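(* Let $L(s)=\sum_I b_II^{-s}$ be a Dirichlet series in the motivic class $\mathfrak M$. Then every partial Dirichlet series $L_{\mathfrak a,\mathfrak w}(s)=\sum_{I\equiv\mathfrak a\pmod{\mathfrak w}}b_II^{-s}$ associated to $L(s)$ is also in the class $\mathfrak M$.
   Context: Setting: $C$ smooth projective geometrically connected curve over $\mathbb F_r$, $\infty$ a closed point of degree $d_\infty$, $A$ the functions regular off $\infty$, $k=\mathrm{Frac}(A)$, $K=k_\infty$ with fixed uniformizer $\pi$, residue field $\mathbb F_\infty$, $\mathbb C_\infty$ the completion of an algebraic closure of $K$. Each $\alpha\in K^\ast$ is uniquely $\zeta_\alpha\pi^{n_\alpha}\langle\alpha\rangle$ ($\zeta_\alpha\in\mathbb F_\infty^\ast$, $\langle\alpha\rangle$ a $1$-unit); $\alpha$ is positive if $\zeta_\alpha=1$. $\mathcal I$ = nonzero fractional ideals of $A$; $\langle\cdot\rangle\colon\mathcal I\to U_1(\mathbb C_\infty)$ is the unique homomorphism with $\langle\lambda A\rangle=\langle\lambda\rangle$ for positive $\lambda$. $\deg_kI$ = degree over $\mathbb F_r$ of the divisor of $I$ on $C\setminus\{\infty\}$. $S_\infty=\mathbb C_\infty^\ast\times\mathbb Z_p$; for $s=(x,y)$, $I^s=x^{\deg_kI}\langle I\rangle^y$. Fix $\pi_\ast^{d_\infty}=\pi$; $I^{s_1}:=\pi_\ast^{-\deg_kI}\langle I\rangle$; $\mathbb V=k(\{I^{s_1}\})\subset\mathbb C_\infty$ (finite over $k$), $\mathcal O_{\mathbb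 V}$ the integral closure of $A$ in $\mathbb V$; the canonical infinite place of $\mathbb V$ is the one given by $\mathbb V\subset\mathbb C_\infty$. $K_1:=K(\{\langle I\rangle: I\in\mathcal I\})$ (finite over $K$) with ring of integers $A_{1,\infty}$ and maximal ideal $M_{1,\infty}$. Motivic class $\mathfrak M$: Dirichlet series $L(s)=\sum_Ib_II^{-s}$ over nonzero ideals $I$ of $A$ such that (1) all $b_I\in A$; (2) there is real $t>0$ with $b_II^{-s}\to0$ as $\deg_kI\to\infty$ for all $(x,y)$ with $|x|_\infty\ge t$; (3) for each integer $j\ge0$ the formal power series $L(\pi_\ast^jx,-j)=\sum_Ib_I(I^{s_1})^jx^{-\deg_kI}$ in $x^{-1}$ is a polynomial in $x^{-1}$ with coefficients in $\mathcal O_{\mathbb V}$ of degree $O(\log j)$ as $j\to\infty$. Partial series: let $W=\{w_1,\dots,w_m\}$ be a finite set of places of $\mathbb V$, at most one of which is the canonical infinite place and the others finite places, $n_1,\dots,n_m$ positive integers, $\mathfrak w=\sum n_iw_i$. For finite $w_i$ let $\mathcal O_{w_i}$ be the local ring of $\mathbb V$ at $w_i$; for $w_i=\infty$ put $\mathcal O_\infty=A_{1,\infty}$. Let $\mathfrak a=\{\alpha_i\in\mathcal O_{w_i}\}$. An ideal $I$ of $A$ satisfies $I\equiv\mathfrak a\pmod{\mathfrak w}$ if $I^{s_1}\equiv\alpha_i\pmod{w_i^{n_i}}$ for all finite $w_i$ and $\langle I\rangle\equiv\alpha_j\pmod{M_{1,\infty}^{n_j}}$ if $w_j$ is the canonical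 infinite place. *)

theory Defs
  imports "HOL-Analysis.Analysis" "HOL-Computational_Algebra.Computational_Algebra"
    "HOL-Library.Landau_Symbols"
begin

text \<open>
  All fields occurring here (the finite constant field, the function field \<open>k\<close>, its completion
  \<open>K\<close>, the field \<open>\<bbbV>\<close>, ...) are subfields of the field \<open>\<complex>\<^sub>\<infinity>\<close>, which is the type \<open>'c\<close>.
\<close>

section \<open>Subfields of a field\<close>

definition is_subfield :: "'c::field set \<Rightarrow> bool" where
  "is_subfield F \<longleftrightarrow> 0 \<in> F \<and> 1 \<in> F \<and>
     (\<forall>x\<in>F. \<forall>y\<in>F. x - y \<in> F \<and> x * y \<in> F) \<and> (\<forall>x\<in>F. inverse x \<in> F)"

definition algebraic_over :: "'c::field set \<Rightarrow> 'c \<Rightarrow> bool" where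
  "algebraic_over F x \<longleftrightarrow> (\<exists>p. p \<noteq> 0 \<and> (\<forall>i. coeff p i \<in> F) \<and> poly p x = 0)"

definition integral_over :: "'c::field set \<Rightarrow> 'c \<Rightarrow> bool" where
  "integral_over R x \<longleftrightarrow> (\<exists>p. lead_coeff p = 1 \<and> (\<forall>i. coeff p i \<in> R) \<and> poly p x = 0)"

definition finite_over :: "'c::field set \<Rightarrow> 'c set \<Rightarrow> bool" where
  "finite_over F L \<longleftrightarrow>
     (\<exists>B. finite B \<and> L = {(\<Sum>b\<in>B. c b * b) | c. \<forall>b\<in>B. c b \<in> F})"

text \<open>A function field in one variable over \<open>F\<close>, with \<open>F\<close> as its exact field of constants.\<close>

definition function_field :: "'c::field set \<Rightarrow> 'c set \<Rightarrow> bool" where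
  "function_field F k \<longleftrightarrow> is_subfield F \<and> is_subfield k \<and> F \<subseteq> k \<and>
     (\<exists>t\<in>k. \<not> algebraic_over F t \<and> finite_over (is_subfield hull (F \<union> {t})) k) \<and>
     (\<forall>x\<in>k. algebraic_over F x \<longrightarrow> x \<in> F)"

text \<open>The dimension of the quotient \<open>M / N\<close> of \<open>F\<close>-vector spaces \<open>N \<subseteq> M\<close>.\<close>

definition quotient_dim :: "'c::field set \<Rightarrow> 'c set \<Rightarrow> 'c set \<Rightarrow> nat" where
  "quotient_dim F M N = (THE n. \<exists>B. finite B \<and> card B = n \<and> B \<subseteq> M \<and>
     (\<forall>x\<in>M. \<exists>!c. c \<in> B \<rightarrow>\<^sub>E F \<and> x - (\<Sum>b\<in>B. c b * b) \<in> N))"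


section \<open>Places\<close>

text \<open>
  A place of a function field \<open>F\<close> is given by its normalized discrete valuation.  The values
  outside of \<open>F - {0}\<close> are fixed to be \<open>0\<close>, so that distinct functions are distinct places.
  (Constants form a finite field, so every valuation is automatically trivial on them.)
\<close>

definition places :: "'c::field set \<Rightarrow> ('c \<Rightarrow> int) set" where
  "places F = {v. (\<forall>x\<in>F - {0}. \<forall>y\<in>F - {0}. v (x * y) = v x + v y) \<and>
                  (\<forall>x\<in>F - {0}. \<forall>y\<in>F - {0}. x + y \<noteq> 0 \<longrightarrow> min (v x) (v y) \<le> v (x + y)) \<and>
                  (\<exists>x\<in>F - {0}. v x = 1) \<and>
                  (\<forall>x. x \<notin> F - {0} \<longrightarrow> v x = 0)}"

text \<open>\<open>place_power F v n\<close> is the \<open>n\<close>-th power of the maximal ideal of the local ring at \<open>v\<close>.\<close>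

definition place_power :: "'c::field set \<Rightarrow> ('c \<Rightarrow> int) \<Rightarrow> nat \<Rightarrow> 'c set" where
  "place_power F v n = {x\<in>F. x = 0 \<or> int n \<le> v x}"

definition local_ring :: "'c::field set \<Rightarrow> ('c \<Rightarrow> int) \<Rightarrow> 'c set" where
  "local_ring F v = {x\<in>F. x = 0 \<or> 0 \<le> v x}"

definition place_degree :: "'c::field set \<Rightarrow> 'c set \<Rightarrow> ('c \<Rightarrow> int) \<Rightarrow> nat" where
  "place_degree F k v = quotient_dim F (local_ring k v) (place_power k v 1)"


section \<open>Products and powers of ideals\<close>

definition ideal_mult :: "'c::field set \<Rightarrow> 'c set \<Rightarrow> 'c set" where
  "ideal_mult I J =
     {(\<Sum>i<n. f i * g i) | (n::nat) f g. \<forall>i<n. f i \<in> I \<and> g i \<in> J}"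

fun ideal_power :: "'c::field set \<Rightarrow> 'c set \<Rightarrow> nat \<Rightarrow> 'c set" where
  "ideal_power R I 0 = R"
| "ideal_power R I (Suc n) = ideal_mult I (ideal_power R I n)"


section \<open>The \<open>p\<close>-adic integers\<close>

text \<open>
  \<open>\<int>\<^sub>p\<close> as the inverse limit of the rings \<open>\<int>/p\<^sup>n\<close>: a \<open>p\<close>-adic integer is the sequence of its
  reduced residues modulo \<open>p\<^sup>n\<close>.
\<close>

definition padic_ints :: "nat \<Rightarrow> (nat \<Rightarrow> int) set" where
  "padic_ints p = {y. \<forall>n. 0 \<le> y n \<and> y n < int p ^ n \<and> y (Suc n) mod int p ^ n = y n}"

definition padic_neg :: "nat \<Rightarrow> (nat \<Rightarrow> int) \<Rightarrow> nat \<Rightarrow> int" where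
  "padic_neg p y = (\<lambda>n. (- y n) mod int p ^ n)"


section \<open>The objects attached to a curve with a point at infinity\<close>

text \<open>
  The data are: the constant field \<open>Fr\<close>, the function field \<open>k\<close>, the place \<open>vinf\<close> of \<open>k\<close>, the
  absolute value \<open>absv\<close> of \<open>\<complex>\<^sub>\<infinity>\<close>, the uniformizer \<open>unif\<close> of \<open>K\<close>, its root \<open>pistar\<close>, and the
  homomorphism \<open>br\<close> from fractional ideals to \<open>1\<close>-units.  What is required of them is stated in
  the locale \<open>goss_setting\<close> below.
\<close>

locale goss_data =
  fixes Fr :: "'c::field set"
    and k :: "'c set"
    and vinf :: "'c \<Rightarrow> int"
    and absv :: "'c \<Rightarrow> real"
    and unif :: 'c
    and pistar :: 'c
    and br :: "'c set \<Rightarrow> 'c"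
begin

definition top_C :: "'c topology" where
  "top_C = Metric_space.mtopology UNIV (\<lambda>x y. absv (x - y))"

definition K :: "'c set" where
  "K = top_C closure_of k"

definition d_inf :: nat where
  "d_inf = place_degree Fr k vinf"

definition A :: "'c set" where
  "A = {x\<in>k. \<forall>v\<in>places k - {vinf}. x \<in> local_ring k v}"

subsection \<open>Positive elements and one-units\<close>

text \<open>
  The residue field of \<open>K\<close>, embedded in \<open>K\<close> as its field of constants (its Teichmueller
  representatives).
\<close>

definition F_inf :: "'c set" where
  "F_inf = {x\<in>K. algebraic_over Fr x}"

definition one_units :: "'c set" where
  "one_units = {u. absv (u - 1) < 1}"

definition decomposition :: "'c \<Rightarrow> 'c \<Rightarrow> int \<Rightarrow> 'c \<Rightarrow> bool" where
  "decomposition x \<zeta> n u \<longleftrightarrow>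
     \<zeta> \<in> F_inf - {0} \<and> u \<in> K \<inter> one_units \<and> x = \<zeta> * unif powi n * u"

definition sgn_inf :: "'c \<Rightarrow> 'c" where
  "sgn_inf x = (THE \<zeta>. \<exists>n u. decomposition x \<zeta> n u)"

definition unit_part :: "'c \<Rightarrow> 'c" where
  "unit_part x = (THE u. \<exists>\<zeta> n. decomposition x \<zeta> n u)"

definition positive :: "'c \<Rightarrow> bool" where
  "positive x \<longleftrightarrow> x \<in> K - {0} \<and> sgn_inf x = 1"

subsection \<open>Ideals and their degrees\<close>

definition fractional_ideals :: "'c set set" where
  "fractional_ideals = {I. I \<subseteq> k \<and> 0 \<in> I \<and> I \<noteq> {0} \<and>
     (\<forall>x\<in>I. \<forall>y\<in>I. x + y \<in> I) \<and> (\<forall>a\<in>A. \<forall>x\<in>I. a * x \<in> I) \<and>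
     (\<exists>a\<in>A - {0}. \<forall>x\<in>I. a * x \<in> A)}"

definition ideals :: "'c set set" where
  "ideals = {I \<in> fractional_ideals. I \<subseteq> A}"

definition ord_ideal :: "('c \<Rightarrow> int) \<Rightarrow> 'c set \<Rightarrow> int" where
  "ord_ideal v I = (INF x\<in>I - {0}. v x)"

definition degk :: "'c set \<Rightarrow> int" where
  "degk I = (\<Sum>v | v \<in> places k - {vinf} \<and> ord_ideal v I \<noteq> 0.
               ord_ideal v I * int (place_degree Fr k v))"

definition one_unit_hom :: "('c set \<Rightarrow> 'c) \<Rightarrow> bool" where
  "one_unit_hom \<phi> \<longleftrightarrow>
     (\<forall>I\<in>fractional_ideals. \<phi> I \<in> one_units) \<and>
     (\<forall>I\<in>fractional_ideals. \<forall>J\<in>fractional_ideals. \<phi> (ideal_mult I J) = \<phi> I * \<phi> J) \<and>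
     (\<forall>x\<in>k - {0}. positive x \<longrightarrow> \<phi> ((*) x ` A) = unit_part x)"

subsection \<open>Exponentiation of ideals\<close>

definition one_unit_power :: "'c \<Rightarrow> (nat \<Rightarrow> int) \<Rightarrow> 'c" where
  "one_unit_power u y = (THE l. limitin top_C (\<lambda>n. u ^ nat (y n)) l sequentially)"

definition S_inf :: "('c \<times> (nat \<Rightarrow> int)) set" where
  "S_inf = (UNIV - {0}) \<times> padic_ints CHAR('c)"

definition S_neg :: "'c \<times> (nat \<Rightarrow> int) \<Rightarrow> 'c \<times> (nat \<Rightarrow> int)" where
  "S_neg s = (inverse (fst s), padic_neg CHAR('c) (snd s))"

definition ideal_exp :: "'c set \<Rightarrow> 'c \<times> (nat \<Rightarrow> int) \<Rightarrow> 'c" where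
  "ideal_exp I s = fst s powi degk I * one_unit_power (br I) (snd s)"

definition ideal_s1 :: "'c set \<Rightarrow> 'c" where
  "ideal_s1 I = pistar powi (- degk I) * br I"

definition \<V> :: "'c set" where
  "\<V> = is_subfield hull (k \<union> ideal_s1 ` fractional_ideals)"

definition O_\<V> :: "'c set" where
  "O_\<V> = {x\<in>\<V>. integral_over A x}"

definition K1 :: "'c set" where
  "K1 = is_subfield hull (K \<union> br ` fractional_ideals)"

definition A1_inf :: "'c set" where
  "A1_inf = {x\<in>K1. absv x \<le> 1}"

definition M1_inf :: "'c set" where
  "M1_inf = {x\<in>K1. absv x < 1}"

subsection \<open>The motivic class\<close>

text \<open>
  The Dirichlet series \<open>\<Sum>\<^sub>I b\<^sub>I I\<^sup>-\<^sup>s\<close> is represented by its coefficient function \<open>b\<close>, of which only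
  the values on \<open>ideals\<close> matter.  The power series \<open>special_series b j\<close> is \<open>L(\<pi>\<^sub>*\<^sup>j x, -j)\<close> in the
  variable \<open>x\<^sup>-\<^sup>1\<close>, terms of equal degree being collected.
\<close>

definition special_series :: "('c set \<Rightarrow> 'c) \<Rightarrow> nat \<Rightarrow> 'c fps" where
  "special_series b j =
     Abs_fps (\<lambda>d. \<Sum>I | I \<in> ideals \<and> degk I = int d. b I * ideal_s1 I ^ j)"

definition motivic :: "('c set \<Rightarrow> 'c) \<Rightarrow> bool" where
  "motivic b \<longleftrightarrow>
     (\<forall>I\<in>ideals. b I \<in> A) \<and>
     (\<exists>t>0. \<forall>s\<in>S_inf. t \<le> absv (fst s) \<longrightarrow>
        (\<forall>\<epsilon>>0. \<exists>N. \<forall>I\<in>ideals. N \<le> degk I \<longrightarrow> absv (b I * ideal_exp I (S_neg s)) < \<epsilon>)) \<and>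
     (\<exists>P :: nat \<Rightarrow> 'c poly.
        (\<forall>j. special_series b j = fps_of_poly (P j) \<and> (\<forall>i. coeff (P j) i \<in> O_\<V>)) \<and>
        (\<lambda>j. real (degree (P j))) \<in> O(\<lambda>j. ln (real j)))"

subsection \<open>Partial series\<close>

text \<open>A place of \<open>\<V>\<close> is finite if it lies over a place of \<open>k\<close> other than \<open>vinf\<close>.\<close>

definition finite_place :: "('c \<Rightarrow> int) \<Rightarrow> bool" where
  "finite_place w \<longleftrightarrow> w \<in> places \<V> \<and>
     (\<exists>v\<in>places k - {vinf}. local_ring \<V> w \<inter> k = local_ring k v)"

definition canonical_place :: "('c \<Rightarrow> int) \<Rightarrow> bool" where
  "canonical_place w \<longleftrightarrow> w \<in> places \<V> \<and> local_ring \<V> w = {x\<in>\<V>. absv x \<le> 1}"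

definition local_ring_at :: "('c \<Rightarrow> int) \<Rightarrow> 'c set" where
  "local_ring_at w = (if canonical_place w then A1_inf else local_ring \<V> w)"

text \<open>
  \<open>I \<equiv> \<aa> mod \<ww>\<close>, where \<open>\<ww>\<close> is the sum of \<open>n w \<cdot> w\<close> over \<open>w \<in> W\<close> and \<open>\<aa>\<close> is the family of the
  \<open>\<alpha> w\<close> for \<open>w \<in> W\<close>.
\<close>

definition ideal_cong ::
    "('c \<Rightarrow> int) set \<Rightarrow> (('c \<Rightarrow> int) \<Rightarrow> nat) \<Rightarrow> (('c \<Rightarrow> int) \<Rightarrow> 'c) \<Rightarrow> 'c set \<Rightarrow> bool" where
  "ideal_cong W n \<alpha> I \<longleftrightarrow> (\<forall>w\<in>W.
     if canonical_place w
     then br I - \<alpha> w \<in> ideal_power A1_inf M1_inf (n w)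
     else ideal_s1 I - \<alpha> w \<in> place_power \<V> w (n w))"

definition partial_series ::
    "('c \<Rightarrow> int) set \<Rightarrow> (('c \<Rightarrow> int) \<Rightarrow> nat) \<Rightarrow> (('c \<Rightarrow> int) \<Rightarrow> 'c) \<Rightarrow>
     ('c set \<Rightarrow> 'c) \<Rightarrow> 'c set \<Rightarrow> 'c" where
  "partial_series W n \<alpha> b = (\<lambda>I. if ideal_cong W n \<alpha> I then b I else 0)"

end


section \<open>The setting\<close>

text \<open>
  A smooth projective geometrically connected curve over the finite field \<open>Fr\<close> is given by its
  function field \<open>k\<close>; its closed points are the places of \<open>k\<close>.  Geometric connectedness means that
  \<open>Fr\<close> is algebraically closed in \<open>k\<close>.  The assumptions \<open>abs_k\<close> to \<open>alg_dense\<close> say that \<open>K\<close>, the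
  closure of \<open>k\<close>, is the completion of \<open>k\<close> at \<open>vinf\<close>, that the elements algebraic over \<open>K\<close> form an
  algebraic closure of \<open>K\<close>, and that \<open>\<complex>\<^sub>\<infinity>\<close> is the completion of the latter.
  Since \<open>absv x = r powr (- d_inf * vinf x)\<close> on \<open>k\<close>, a uniformizer of \<open>K\<close> is an element
  with absolute value \<open>r powr (- d_inf)\<close>.
\<close>

locale goss_setting = goss_data Fr k vinf absv unif pistar br
  for Fr :: "'c::field set" and k vinf absv unif pistar br +
  assumes Fr_finite: "finite Fr"
    and k_function_field: "function_field Fr k"
    and vinf_place: "vinf \<in> places k"
    and abs_nonneg: "\<And>x. 0 \<le> absv x"
    and abs_eq_0: "\<And>x. absv x = 0 \<longleftrightarrow> x = 0"
    and abs_mult: "\<And>x y. absv (x * y) = absv x * absv y"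
    and abs_ultrametric: "\<And>x y. absv (x + y) \<le> max (absv x) (absv y)"
    and abs_k: "\<And>x. x \<in> k - {0} \<Longrightarrow>
      absv x = real (card Fr) powi (- (int d_inf * vinf x))"
    and complete: "Metric_space.mcomplete UNIV (\<lambda>x y. absv (x - y))"
    and alg_closed: "\<And>p. 0 < degree p \<Longrightarrow>
      (\<And>i. algebraic_over K (coeff p i)) \<Longrightarrow>
      \<exists>x. algebraic_over K x \<and> poly p x = 0"
    and alg_dense:
      "top_C closure_of {x. algebraic_over K x} = UNIV"
    and unif_K: "unif \<in> K"
    and unif_abs: "absv unif = real (card Fr) powi (- int d_inf)"
    and pistar: "pistar ^ d_inf = unif"
    and br_hom: "one_unit_hom br"

end

theory Submission
  imports Defs "Jordan_Normal_Form.Char_Poly" "HOL-Real_Asymp.Real_Asymp"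
begin

text \<open>
  For \<open>y\<close> of absolute value at most \<open>1\<close> at a place, \<open>(1 - y\<^sup>E)\<^sup>Q\<close> with \<open>Q\<close> a large power of the
  characteristic is close to \<open>1\<close> or to \<open>0\<close> according to whether \<open>\<bar>y\<bar> < 1\<close> or not, so it replaces the
  indicator function of a residue class. Expanding it, the sum over the ideals of degree \<open>d\<close> in the
  class is congruent, modulo a large power of the place, to a combination of power sums over all
  ideals of degree \<open>d\<close>, which vanish when \<open>d\<close> is large compared with the logarithm of the exponents.
  The restricted sum is integral with controlled size at infinity, so by the product formula it is
  zero. Congruences modulo powers are reached by iteration, and finitely many places one at a time.
  Integrality of the values \<open>I\<close> to the \<open>s\<^sub>1\<close>, and the finite extension containing them, come from
  the finiteness of the class group; it and the product formula are obtained by counting cosets.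
\<close>

section \<open>Subrings, subfields and finite quotients\<close>

text \<open>The restricted sum lies in \<open>\<V>\<close>, which may have several infinite places,
  while its size is known only at the canonical one; so the product formula is not applied to it
  directly. It acts by multiplication on a finite set \<open>S\<close>, with coefficients in
  \<open>A\<close> after clearing a fixed denominator, and if it were nonzero, the constant term of
  a monic relation would be a nonzero element of \<open>A\<close>, for which the product formula of
  \<open>k\<close> is at hand. Both kinds of places fit one argument: with \<open>N\<close> the
  absolute value at the place, the decisive bound on \<open>A - {0}\<close> is
  \<open>1 \<le> N c * absv c\<close>, at infinity simply a square. Since
  \<open>br I = pistar ^ d * ideal_s1 I\<close> in degree \<open>d\<close>, the residue at infinity
  is affine in \<open>ideal_s1 I\<close> too, with coefficients depending on \<open>d\<close>. The
  exponents must balance: \<open>Q\<close> may reach a multiple of \<open>exp (c * d)\<close>, while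
  the error \<open>\<rho> ^ Q\<close> has to beat \<open>exp (const * (1 + d + d * j))\<close>.
  Hence each step shrinks the range of \<open>j\<close> from \<open>exp (c * d)\<close> to
  \<open>exp (c / 3 * d)\<close>. As the constant field is finite, dimensions are counted through
  cardinalities.\<close>

definition is_subring :: "'c::comm_ring_1 set \<Rightarrow> bool" where
  "is_subring R \<longleftrightarrow> 0 \<in> R \<and> 1 \<in> R \<and> (\<forall>x\<in>R. \<forall>y\<in>R. x - y \<in> R \<and> x * y \<in> R)"

definition polys_over :: "'c::comm_ring_1 set \<Rightarrow> 'c poly set" where
  "polys_over R = {p. \<forall>i. coeff p i \<in> R}"

lemma subfield_imp_subring: "is_subfield F \<Longrightarrow> is_subring F"
  by (auto simp: is_subring_def is_subfield_def)

lemma is_subfield_UNIV: "is_subfield UNIV"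
  by (simp add: is_subfield_def)

context
  fixes R :: "'c::comm_ring_1 set"
  assumes R: "is_subring R"
begin

lemma subring_0: "0 \<in> R" and subring_1: "1 \<in> R"
  using R by (auto simp: is_subring_def)

lemma subring_diff: "x \<in> R \<Longrightarrow> y \<in> R \<Longrightarrow> x - y \<in> R"
  using R by (auto simp: is_subring_def)

lemma subring_mult: "x \<in> R \<Longrightarrow> y \<in> R \<Longrightarrow> x * y \<in> R"
  using R by (auto simp: is_subring_def)

lemma subring_uminus: "x \<in> R \<Longrightarrow> - x \<in> R"
  using subring_diff[OF subring_0, of x] by simp

lemma subring_add: "x \<in> R \<Longrightarrow> y \<in> R \<Longrightarrow> x + y \<in> R"
  using subring_diff[of x "- y"] subring_uminus[of y] by simp

lemma subring_sum: "(\<And>i. i \<in> I \<Longrightarrow> f i \<in> R) \<Longrightarrow> sum f I \<in> R"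
  by (induction I rule: infinite_finite_induct) (auto intro: subring_0 subring_add)

lemma subring_prod: "(\<And>i. i \<in> I \<Longrightarrow> f i \<in> R) \<Longrightarrow> prod f I \<in> R"
  by (induction I rule: infinite_finite_induct) (auto intro: subring_1 subring_mult)

lemma subring_power: "x \<in> R \<Longrightarrow> x ^ n \<in> R"
  by (induction n) (auto intro: subring_1 subring_mult)

lemma polys_over_subring: "is_subring (polys_over R)"
  unfolding is_subring_def polys_over_def
  by (auto simp: coeff_mult coeff_1 subring_0 subring_1 intro!: subring_diff subring_sum subring_mult)

lemma poly_in_subring: "p \<in> polys_over R \<Longrightarrow> x \<in> R \<Longrightarrow> poly p x \<in> R"
  unfolding polys_over_def
  by (auto simp: poly_altdef intro!: subring_sum subring_mult subring_power)

lemma pCons_polys_over: "pCons a p \<in> polys_over R \<longleftrightarrow> a \<in> R \<and> p \<in> polys_over R"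
  unfolding polys_over_def by (auto simp: coeff_pCons all_conj_distrib split: nat.splits)

lemma smult_polys_over: "a \<in> R \<Longrightarrow> p \<in> polys_over R \<Longrightarrow> Polynomial.smult a p \<in> polys_over R"
  unfolding polys_over_def by (auto intro: subring_mult)

lemma monom_polys_over: "a \<in> R \<Longrightarrow> Polynomial.monom a n \<in> polys_over R"
  unfolding polys_over_def by (auto simp: subring_0)

end

lemmas subring_closed = subring_0 subring_1 subring_diff subring_mult subring_uminus subring_add
  subring_sum subring_prod subring_power

context
  fixes F :: "'c::field set"
  assumes F: "is_subfield F"
begin

lemma subfield_inverse: "x \<in> F \<Longrightarrow> inverse x \<in> F"
  using F by (auto simp: is_subfield_def)

lemma subfield_divide: "x \<in> F \<Longrightarrow> y \<in> F \<Longrightarrow> x / y \<in> F"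
  using subfield_inverse subring_mult[OF subfield_imp_subring[OF F]] by (simp add: divide_inverse)

lemma subfield_powi: "x \<in> F \<Longrightarrow> x powi n \<in> F"
  using subring_power[OF subfield_imp_subring[OF F]] subfield_inverse
  by (auto simp: power_int_def)

lemmas subfield_closed = subring_closed[OF subfield_imp_subring[OF F]] subfield_inverse
  subfield_divide subfield_powi

end

lemma is_subfield_hull: "is_subfield (is_subfield hull X)"
  by (rule hull_in) (auto simp: is_subfield_def)

section \<open>Subspaces over a subfield and counting of cosets\<close>

definition is_subspace :: "'c::field set \<Rightarrow> 'c set \<Rightarrow> bool" where
  "is_subspace F M \<longleftrightarrow> 0 \<in> M \<and> (\<forall>x\<in>M. \<forall>y\<in>M. x + y \<in> M) \<and> (\<forall>a\<in>F. \<forall>x\<in>M. a * x \<in> M)"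

lemma subspace_0: "is_subspace F M \<Longrightarrow> 0 \<in> M"
  and subspace_add: "is_subspace F M \<Longrightarrow> x \<in> M \<Longrightarrow> y \<in> M \<Longrightarrow> x + y \<in> M"
  and subspace_scale: "is_subspace F M \<Longrightarrow> a \<in> F \<Longrightarrow> x \<in> M \<Longrightarrow> a * x \<in> M"
  by (auto simp: is_subspace_def)

lemma subspace_uminus:
  assumes "is_subring F" "is_subspace F M" "x \<in> M" shows "- x \<in> M"
proof -
  have "-1 \<in> F" using assms(1) subring_uminus subring_1 by blast
  then have "-1 * x \<in> M" using assms subspace_scale by blast
  then show ?thesis by simp
qed

lemma subspace_diff:
  assumes "is_subring F" "is_subspace F M" "x \<in> M" "y \<in> M" shows "x - y \<in> M"
  using subspace_add[OF assms(2,3) subspace_uminus[OF assms(1,2,4)]] by simp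

lemma subspace_sum:
  "is_subspace F M \<Longrightarrow> (\<And>i. i \<in> I \<Longrightarrow> f i \<in> M) \<Longrightarrow> sum f I \<in> M"
  by (induction I rule: infinite_finite_induct) (auto intro: subspace_0 subspace_add)

text \<open>A set of pairwise incongruent elements injects into the quotient by \<open>N\<close>, so
  bounds on the size of such sets play the role of the index, without forming a quotient
  group.\<close>

definition incong :: "'c::ab_group_add set \<Rightarrow> 'c set \<Rightarrow> bool" where
  "incong N Y \<longleftrightarrow> (\<forall>x\<in>Y. \<forall>y\<in>Y. x - y \<in> N \<longrightarrow> x = y)"

text \<open>An incongruent set of greatest size represents every class, for an element outside all
  its classes could be added to it. The bound \<open>C\<close> guarantees that a greatest size
  exists.\<close>

lemma incong_bounded_cover:
  fixes M N :: "'c::ab_group_add set"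
  assumes N: "0 \<in> N" "\<And>x. x \<in> N \<Longrightarrow> - x \<in> N"
    and bd: "\<And>Y. finite Y \<Longrightarrow> Y \<subseteq> M \<Longrightarrow> incong N Y \<Longrightarrow> card Y \<le> C"
  obtains T where "finite T" "T \<subseteq> M" "incong N T" "\<And>x. x \<in> M \<Longrightarrow> \<exists>t\<in>T. x - t \<in> N"
proof -
  let ?Q = "\<lambda>i. \<exists>Y. finite Y \<and> Y \<subseteq> M \<and> incong N Y \<and> card Y = i"
  have "?Q 0" by (intro exI[of _ "{}"]) (auto simp: incong_def)
  moreover have "\<And>i. ?Q i \<Longrightarrow> i \<le> C" using bd by blast
  ultimately obtain m where m: "?Q m" "\<And>i. ?Q i \<Longrightarrow> i \<le> m"
    using Nat.ex_has_greatest_nat[of ?Q 0 C] by blast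
  obtain T where T: "finite T" "T \<subseteq> M" "incong N T" "card T = m" using m(1) by blast
  have "\<exists>t\<in>T. x - t \<in> N" if x: "x \<in> M" for x
  proof (rule ccontr)
    assume n: "\<not> (\<exists>t\<in>T. x - t \<in> N)"
    then have "x \<notin> T" using N(1) by force
    moreover have "t - x \<notin> N" if "t \<in> T" for t
      using N(2)[of "t - x"] n that by auto
    then have "incong N (insert x T)" using T(3) n unfolding incong_def by blast
    then have "?Q (Suc m)" using T x \<open>x \<notin> T\<close> by (intro exI[of _ "insert x T"]) auto
    then show False using m(2) by fastforce
  qed
  then show thesis using that T by blast
qed

text \<open>Pigeonhole: two elements of \<open>Y\<close> attached to the same representative in
  \<open>T\<close> differ by an element of \<open>N\<close>, hence are equal.\<close>

lemma incong_card_le: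
  assumes "is_subring F" "is_subspace F N" "incong N Y" "finite T" "\<And>y. y \<in> Y \<Longrightarrow> \<exists>t\<in>T. y - t \<in> N"
  shows "finite Y \<and> card Y \<le> card T"
proof -
  obtain g where g: "\<And>y. y \<in> Y \<Longrightarrow> g y \<in> T \<and> y - g y \<in> N" using assms(5) by metis
  have "inj_on g Y"
  proof (rule inj_onI)
    fix x y assume "x \<in> Y" "y \<in> Y" "g x = g y"
    then have "(x - g x) - (y - g y) \<in> N"
      using g \<open>x \<in> Y\<close> \<open>y \<in> Y\<close> subspace_diff[OF assms(1,2), of "x - g x" "y - g y"] by blast
    then have "x - y \<in> N" using \<open>g x = g y\<close> by simp
    then show "x = y" using assms(3) \<open>x \<in> Y\<close> \<open>y \<in> Y\<close> by (auto simp: incong_def)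
  qed
  moreover have "g ` Y \<subseteq> T" using g by auto
  ultimately show ?thesis using assms(4) by (meson card_inj_on_le inj_on_finite)
qed

text \<open>The part of \<open>M\<close> congruent to a given \<open>t\<close> modulo
  \<open>H\<close> is contained in a translate of \<open>M \<inter> H\<close>, and
  \<open>card T\<close> such parts exhaust \<open>M\<close>.\<close>

lemma card_cover_le:
  assumes R: "is_subring F" and M: "is_subspace F M" and H: "is_subspace F H" and T: "finite T"
    and cov: "\<And>x. x \<in> M \<Longrightarrow> \<exists>t\<in>T. x - t \<in> H" and fin: "finite (M \<inter> H)"
  shows "finite M \<and> card M \<le> card T * card (M \<inter> H)"
proof -
  define X where "X t = {x\<in>M. x - t \<in> H}" for t
  have X: "finite (X t) \<and> card (X t) \<le> card (M \<inter> H)" for t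
  proof (cases "X t = {}")
    case False
    then obtain x0 where x0: "x0 \<in> X t" by auto
    have "X t \<subseteq> (\<lambda>y. y + x0) ` (M \<inter> H)"
    proof
      fix x assume x: "x \<in> X t"
      then have "x - x0 \<in> M" using x0 subspace_diff[OF R M] by (auto simp: X_def)
      moreover have "(x - t) - (x0 - t) \<in> H"
        using x x0 by (intro subspace_diff[OF R H, of "x - t" "x0 - t"]) (simp_all add: X_def)
      ultimately have "x - x0 \<in> M \<inter> H" by simp
      then show "x \<in> (\<lambda>y. y + x0) ` (M \<inter> H)" by (metis diff_add_cancel image_eqI)
    qed
    then show ?thesis using fin
      by (metis card_image_le card_mono finite_imageI finite_subset le_trans)
  qed simp
  have M: "M = (\<Union>t\<in>T. X t)" using cov by (auto simp: X_def)
  have "card M \<le> (\<Sum>t\<in>T. card (X t))" unfolding M by (rule card_UN_le[OF T])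
  also have "\<dots> \<le> (\<Sum>t\<in>T. card (M \<inter> H))" by (rule sum_mono) (use X in blast)
  finally have c: "card M \<le> card T * card (M \<inter> H)" by simp
  have "finite M" unfolding M using T X by blast
  with c show ?thesis by blast
qed

section \<open>Bases of finite quotients\<close>

definition indep_mod :: "'c::field set \<Rightarrow> 'c set \<Rightarrow> 'c set \<Rightarrow> bool" where
  "indep_mod F N B \<longleftrightarrow> (\<forall>c. (\<forall>b\<in>B. c b \<in> F) \<longrightarrow> (\<Sum>b\<in>B. c b * b) \<in> N \<longrightarrow> (\<forall>b\<in>B. c b = 0))"

definition spans_mod :: "'c::field set \<Rightarrow> 'c set \<Rightarrow> 'c set \<Rightarrow> 'c set \<Rightarrow> bool" where
  "spans_mod F M N B \<longleftrightarrow> (\<forall>x\<in>M. \<exists>c. (\<forall>b\<in>B. c b \<in> F) \<and> x - (\<Sum>b\<in>B. c b * b) \<in> N)"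

lemma spans_modE:
  assumes "spans_mod F M N B" "x \<in> M"
  obtains c where "\<forall>b\<in>B. c b \<in> F" "x - (\<Sum>b\<in>B. c b * b) \<in> N"
  using assms unfolding spans_mod_def by metis

lemma indep_modD:
  "indep_mod F N B \<Longrightarrow> \<forall>b\<in>B. c b \<in> F \<Longrightarrow> (\<Sum>b\<in>B. c b * b) \<in> N \<Longrightarrow> \<forall>b\<in>B. c b = 0"
  unfolding indep_mod_def by simp

locale fin_quotient =
  fixes F M N :: "'c::field set"
  assumes F: "is_subfield F" "finite F" and M: "is_subspace F M" and N: "is_subspace F N"
begin

lemma FR: "is_subring F" using F(1) by (rule subfield_imp_subring)

lemma card_F: "2 \<le> card F"
proof -
  have "card {0::'c, 1} \<le> card F"
    using F FR by (intro card_mono) (auto intro: subring_0 subring_1)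
  then show ?thesis by simp
qed

lemma card_F1: "1 < card F"
  using card_F by simp

text \<open>Take a vector outside the span modulo \<open>N\<close>. A relation with a nonzero
  coefficient at \<open>x\<close> could be divided by this coefficient, which would put
  \<open>x\<close> into the span.\<close>

lemma extend_indep:
  assumes B: "finite B" "B \<subseteq> M" "indep_mod F N B" "\<not> spans_mod F M N B"
  shows "\<exists>x\<in>M - B. indep_mod F N (insert x B)"
proof -
  obtain x where x: "x \<in> M" "\<And>c. (\<forall>b\<in>B. c b \<in> F) \<Longrightarrow> x - (\<Sum>b\<in>B. c b * b) \<notin> N"
    using B(4) unfolding spans_mod_def by blast
  have xB: "x \<notin> B"
  proof
    assume "x \<in> B"
    have "(\<Sum>b\<in>B. (if b = x then 1 else 0) * b) = x"
      using B(1) \<open>x \<in> B\<close> by (simp add: if_distrib[of "\<lambda>u. u * _"] cong: if_cong)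
    then show False
      using x(2)[of "\<lambda>b. if b = x then 1 else 0"] subring_0[OF FR] subring_1[OF FR] subspace_0[OF N]
      by (metis (full_types) diff_self)
  qed
  have "indep_mod F N (insert x B)"
    unfolding indep_mod_def
  proof (intro allI impI)
    fix c assume c: "\<forall>b\<in>insert x B. c b \<in> F" and s: "(\<Sum>b\<in>insert x B. c b * b) \<in> N"
    have s': "c x * x + (\<Sum>b\<in>B. c b * b) \<in> N" using s xB B(1) by simp
    have cx: "c x = 0"
    proof (rule ccontr)
      assume cx: "c x \<noteq> 0"
      have "inverse (c x) * (c x * x + (\<Sum>b\<in>B. c b * b)) \<in> N"
        using subspace_scale[OF N _ s'] c subfield_inverse[OF F(1)] by auto
      moreover have "inverse (c x) * (c x * x + (\<Sum>b\<in>B. c b * b))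
          = x - (\<Sum>b\<in>B. (- inverse (c x) * c b) * b)"
        using cx by (simp add: distrib_left sum_distrib_left sum_negf mult.assoc)
      moreover have "\<forall>b\<in>B. - inverse (c x) * c b \<in> F"
        using c subfield_closed[OF F(1)] by auto
      ultimately show False using x(2)[of "\<lambda>b. - inverse (c x) * c b"] by simp
    qed
    then have "(\<Sum>b\<in>B. c b * b) \<in> N" using s' by simp
    then have "\<forall>b\<in>B. c b = 0" using indep_modD[OF B(3), of c] c by blast
    with cx show "\<forall>b\<in>insert x B. c b = 0" by simp
  qed
  with x(1) xB show ?thesis by blast
qed

lemma incong_card_le_span:
  assumes B: "finite B" "spans_mod F M N B" and Y: "Y \<subseteq> M" "incong N Y"
  shows "finite Y \<and> card Y \<le> card F ^ card B"
proof -
  let ?T = "(\<lambda>c. \<Sum>b\<in>B. c b * b) ` (B \<rightarrow>\<^sub>E F)"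
  have "finite ?T" using B(1) F(2) by (simp add: finite_PiE)
  moreover have "\<exists>t\<in>?T. y - t \<in> N" if "y \<in> Y" for y
  proof -
    have "y \<in> M" using that Y(1) by blast
    obtain c where c: "\<forall>b\<in>B. c b \<in> F" "y - (\<Sum>b\<in>B. c b * b) \<in> N"
      by (rule spans_modE[OF B(2) \<open>y \<in> M\<close>])
    have "(\<Sum>b\<in>B. c b * b) \<in> ?T"
      by (rule image_eqI[of _ _ "restrict c B"]) (use c in auto)
    then show ?thesis using c(2) by blast
  qed
  ultimately have "finite Y \<and> card Y \<le> card ?T" using incong_card_le[OF FR N Y(2)] by blast
  moreover have "card ?T \<le> card (B \<rightarrow>\<^sub>E F)" using B(1) F(2) by (intro card_image_le) (simp add: finite_PiE)
  moreover have "card (B \<rightarrow>\<^sub>E F) = card F ^ card B" using B(1) by (simp add: card_PiE)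
  ultimately show ?thesis by simp
qed

lemma transversal:
  assumes B: "finite B" "B \<subseteq> M" "indep_mod F N B" "spans_mod F M N B"
  obtains T where "finite T" "T \<subseteq> M" "card T = card F ^ card B" "incong N T"
    "\<And>x. x \<in> M \<Longrightarrow> \<exists>t\<in>T. x - t \<in> N"
proof
  let ?s = "\<lambda>c. \<Sum>b\<in>B. c b * b"
  let ?T = "?s ` (B \<rightarrow>\<^sub>E F)"
  have inj: "c = c'" if "c \<in> B \<rightarrow>\<^sub>E F" "c' \<in> B \<rightarrow>\<^sub>E F" "?s c - ?s c' \<in> N" for c c'
  proof -
    have "(\<Sum>b\<in>B. (c b - c' b) * b) \<in> N" using that(3)
      by (simp add: left_diff_distrib sum_subtractf)
    moreover have "\<forall>b\<in>B. c b - c' b \<in> F" using that subring_diff[OF FR] by auto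
    ultimately have "\<forall>b\<in>B. c b - c' b = 0" using B(3) unfolding indep_mod_def
      by (auto dest!: spec[of _ "\<lambda>b. c b - c' b"])
    then show ?thesis using that(1,2) by (intro PiE_ext[of c B _ c']) auto
  qed
  show "finite ?T" using B(1) F(2) by (simp add: finite_PiE)
  show "?T \<subseteq> M" using B(2) by (auto intro!: subspace_sum[OF M] subspace_scale[OF M])
  have "inj_on ?s (B \<rightarrow>\<^sub>E F)" using inj subspace_0[OF N] by (auto intro!: inj_onI)
  then show "card ?T = card F ^ card B" using B(1) by (simp add: card_image card_PiE)
  show "incong N ?T" unfolding incong_def using inj by blast
  show "\<exists>t\<in>?T. x - t \<in> N" if x: "x \<in> M" for x
  proof -
    obtain c where c: "\<forall>b\<in>B. c b \<in> F" "x - ?s c \<in> N"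
      by (rule spans_modE[OF B(4) x])
    have "?s c \<in> ?T" by (rule image_eqI[of _ _ "restrict c B"]) (use c in auto)
    then show ?thesis using c(2) by blast
  qed
qed

text \<open>Vectors are added one at a time. With \<open>i \<le> n\<close> independent vectors the
  span modulo \<open>N\<close> meets at most \<open>card F ^ n\<close> classes, too few for
  \<open>Y\<close>, so another independent vector exists.\<close>

lemma indep_subset_exists:
  assumes Y: "Y \<subseteq> M" "finite Y" "incong N Y" "card F ^ n < card Y"
  shows "\<exists>B. finite B \<and> B \<subseteq> M \<and> indep_mod F N B \<and> card B = Suc n"
proof -
  have "\<exists>B. finite B \<and> B \<subseteq> M \<and> indep_mod F N B \<and> card B = i" if "i \<le> Suc n" for i
    using that
  proof (induction i)
    case 0
    then show ?case by (intro exI[of _ "{}"]) (auto simp: indep_mod_def)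
  next
    case (Suc i)
    then obtain B where B: "finite B" "B \<subseteq> M" "indep_mod F N B" "card B = i" by auto
    have "\<not> spans_mod F M N B"
    proof
      assume "spans_mod F M N B"
      then have "card Y \<le> card F ^ i" using incong_card_le_span[OF B(1) _ Y(1,3)] B(4) by simp
      also have "\<dots> \<le> card F ^ n" using Suc.prems card_F by (intro power_increasing) auto
      finally show False using Y(4) by simp
    qed
    then obtain x where "x \<in> M - B" "indep_mod F N (insert x B)" using extend_indep[OF B(1-3)] by blast
    then show ?case using B by (intro exI[of _ "insert x B"]) auto
  qed
  then show ?thesis by blast
qed

text \<open>This unfolds the condition inside \<open>quotient_dim\<close>: existence of the
  coefficients is spanning, and their uniqueness, read off from the representations of
  \<open>0\<close>, is independence.\<close>

lemma basis_iff:
  assumes "finite B" "B \<subseteq> M"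
  shows "(\<forall>x\<in>M. \<exists>!c. c \<in> B \<rightarrow>\<^sub>E F \<and> x - (\<Sum>b\<in>B. c b * b) \<in> N)
    \<longleftrightarrow> indep_mod F N B \<and> spans_mod F M N B" (is "?l \<longleftrightarrow> ?r")
proof
  assume l: ?l
  have "spans_mod F M N B" unfolding spans_mod_def
  proof
    fix x assume "x \<in> M"
    then obtain c where "c \<in> B \<rightarrow>\<^sub>E F" "x - (\<Sum>b\<in>B. c b * b) \<in> N" using l by blast
    then show "\<exists>c. (\<forall>b\<in>B. c b \<in> F) \<and> x - (\<Sum>b\<in>B. c b * b) \<in> N" by (intro exI[of _ c]) auto
  qed
  moreover have "indep_mod F N B"
    unfolding indep_mod_def
  proof (intro allI impI)
    fix c assume c: "\<forall>b\<in>B. c b \<in> F" "(\<Sum>b\<in>B. c b * b) \<in> N"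
    have "restrict c B \<in> B \<rightarrow>\<^sub>E F" using c by auto
    moreover have "0 - (\<Sum>b\<in>B. restrict c B b * b) \<in> N"
      using subspace_uminus[OF FR N c(2)] by simp
    moreover have "restrict (\<lambda>_. 0) B \<in> B \<rightarrow>\<^sub>E F" "0 - (\<Sum>b\<in>B. restrict (\<lambda>_. 0) B b * b) \<in> N"
      using subring_0[OF FR] subspace_0[OF N] by auto
    ultimately have "restrict c B = restrict (\<lambda>_. 0) B" using l subspace_0[OF M] by blast
    then show "\<forall>b\<in>B. c b = 0" by (metis restrict_apply')
  qed
  ultimately show ?r by blast
next
  assume r: ?r
  show ?l
  proof
    fix x assume "x \<in> M"
    obtain c where c: "\<forall>b\<in>B. c b \<in> F" "x - (\<Sum>b\<in>B. c b * b) \<in> N"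
      by (rule spans_modE[OF conjunct2[OF r] \<open>x \<in> M\<close>])
    show "\<exists>!c. c \<in> B \<rightarrow>\<^sub>E F \<and> x - (\<Sum>b\<in>B. c b * b) \<in> N"
    proof (rule ex1I[of _ "restrict c B"])
      show "restrict c B \<in> B \<rightarrow>\<^sub>E F \<and> x - (\<Sum>b\<in>B. restrict c B b * b) \<in> N" using c by auto
      fix d assume d: "d \<in> B \<rightarrow>\<^sub>E F \<and> x - (\<Sum>b\<in>B. d b * b) \<in> N"
      have eq: "(x - (\<Sum>b\<in>B. c b * b)) - (x - (\<Sum>b\<in>B. d b * b)) = (\<Sum>b\<in>B. (d b - c b) * b)"
        by (simp add: left_diff_distrib sum_subtractf)
      have "(\<Sum>b\<in>B. (d b - c b) * b) \<in> N"
        using subspace_diff[OF FR N c(2) conjunct2[OF d]] unfolding eq .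
      moreover have "\<forall>b\<in>B. d b - c b \<in> F" using c d subring_diff[OF FR] by auto
      ultimately have "\<forall>b\<in>B. d b - c b = 0" using r indep_modD[of F N B "\<lambda>b. d b - c b"] by blast
      then show "d = restrict c B" using d by (intro PiE_ext[of d B "\<lambda>_. F"]) (use c in auto)
    qed
  qed
qed

text \<open>The \<open>THE\<close> in \<open>quotient_dim\<close> is well defined because two bases
  have equal size: the combinations of one are \<open>card F ^ card C\<close> incongruent elements,
  and the other allows at most \<open>card F ^ card B\<close> of them.\<close>

lemma quotient_dim_eq:
  assumes B: "finite B" "B \<subseteq> M" "indep_mod F N B" "spans_mod F M N B"
  shows "quotient_dim F M N = card B"
proof -
  have *: "card C \<le> card B" if B: "finite B" "B \<subseteq> M" "indep_mod F N B" "spans_mod F M N B"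
    and C: "finite C" "C \<subseteq> M" "indep_mod F N C" "spans_mod F M N C" for B C
  proof -
    obtain T where T: "T \<subseteq> M" "card T = card F ^ card C" "incong N T"
      using transversal[OF C] by metis
    have "card F ^ card C \<le> card F ^ card B" using incong_card_le_span[OF B(1,4) T(1,3)] T(2) by simp
    then show ?thesis by (rule power_le_imp_le_exp[OF card_F1])
  qed
  show ?thesis unfolding quotient_dim_def
  proof (rule the_equality)
    show "\<exists>B'. finite B' \<and> card B' = card B \<and> B' \<subseteq> M \<and>
        (\<forall>x\<in>M. \<exists>!c. c \<in> B' \<rightarrow>\<^sub>E F \<and> x - (\<Sum>b\<in>B'. c b * b) \<in> N)"
      by (intro exI[of _ B] conjI B(1,2) refl iffD2[OF basis_iff[OF B(1,2)] conjI[OF B(3,4)]])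
    fix n assume "\<exists>B. finite B \<and> card B = n \<and> B \<subseteq> M \<and>
        (\<forall>x\<in>M. \<exists>!c. c \<in> B \<rightarrow>\<^sub>E F \<and> x - (\<Sum>b\<in>B. c b * b) \<in> N)"
    then obtain C where C: "finite C" "card C = n" "C \<subseteq> M"
        "\<forall>x\<in>M. \<exists>!c. c \<in> C \<rightarrow>\<^sub>E F \<and> x - (\<Sum>b\<in>C. c b * b) \<in> N"
      by (elim exE conjE)
    have C': "indep_mod F N C" "spans_mod F M N C" using iffD1[OF basis_iff[OF C(1,3)] C(4)] by auto
    show "n = card B" using *[OF B C(1,3) C'] *[OF C(1,3) C' B] C(2) by (simp only: le_antisym)
  qed
qed

text \<open>Without a basis the value of \<open>quotient_dim\<close> would be unspecified. The bound
  limits the size of independent sets, and one of greatest size spans by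
  \<open>extend_indep\<close>.\<close>

lemma quotient_dim_transversal:
  assumes bd: "\<And>Y. finite Y \<Longrightarrow> Y \<subseteq> M \<Longrightarrow> incong N Y \<Longrightarrow> card Y \<le> card F ^ n"
  obtains T where "finite T" "T \<subseteq> M" "card T = card F ^ quotient_dim F M N" "incong N T"
    "\<And>x. x \<in> M \<Longrightarrow> \<exists>t\<in>T. x - t \<in> N"
proof -
  have bdB: "card B \<le> n" if B: "finite B" "B \<subseteq> M" "indep_mod F N B" for B
  proof -
    have inj: "c = c'" if "c \<in> B \<rightarrow>\<^sub>E F" "c' \<in> B \<rightarrow>\<^sub>E F" "(\<Sum>b\<in>B. c b * b) - (\<Sum>b\<in>B. c' b * b) \<in> N" for c c'
    proof -
      have "(\<Sum>b\<in>B. (c b - c' b) * b) \<in> N" using that(3)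
        by (simp add: left_diff_distrib sum_subtractf)
      moreover have "\<forall>b\<in>B. c b - c' b \<in> F" using that subring_diff[OF FR] by auto
      ultimately have "\<forall>b\<in>B. c b - c' b = 0" using indep_modD[OF B(3), of "\<lambda>b. c b - c' b"] by blast
      then show ?thesis using that(1,2) by (intro PiE_ext[of c B _ c']) auto
    qed
    let ?T = "(\<lambda>c. \<Sum>b\<in>B. c b * b) ` (B \<rightarrow>\<^sub>E F)"
    have "inj_on (\<lambda>c. \<Sum>b\<in>B. c b * b) (B \<rightarrow>\<^sub>E F)" using inj subspace_0[OF N] by (auto intro!: inj_onI)
    then have "card ?T = card F ^ card B" using B(1) by (simp add: card_image card_PiE)
    moreover have "card ?T \<le> card F ^ n"
    proof (rule bd)
      show "finite ?T" using B(1) F(2) by (simp add: finite_PiE)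
      show "?T \<subseteq> M" using B(2) by (auto intro!: subspace_sum[OF M] subspace_scale[OF M])
      show "incong N ?T" unfolding incong_def using inj by blast
    qed
    ultimately have "card F ^ card B \<le> card F ^ n" by simp
    then show ?thesis by (rule power_le_imp_le_exp[OF card_F1])
  qed
  let ?P = "\<lambda>i. \<exists>B. finite B \<and> B \<subseteq> M \<and> indep_mod F N B \<and> card B = i"
  have "?P 0" by (intro exI[of _ "{}"]) (auto simp: indep_mod_def)
  moreover have "\<And>i. ?P i \<Longrightarrow> i \<le> n" using bdB by blast
  ultimately obtain m where m: "?P m" "\<And>i. ?P i \<Longrightarrow> i \<le> m"
    using Nat.ex_has_greatest_nat[of ?P 0 n] by blast
  obtain B where B: "finite B" "B \<subseteq> M" "indep_mod F N B" "card B = m" using m(1) by blast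
  have sp: "spans_mod F M N B"
  proof (rule ccontr)
    assume "\<not> spans_mod F M N B"
    then obtain x where x: "x \<in> M - B" "indep_mod F N (insert x B)"
      using extend_indep[OF B(1-3)] by blast
    have "?P (Suc m)" using x B by (intro exI[of _ "insert x B"]) auto
    then show False using m(2) by fastforce
  qed
  show thesis using transversal[OF B(1-3) sp] quotient_dim_eq[OF B(1-3) sp] that by metis
qed

end

section \<open>Independence over a rational function field\<close>

text \<open>Polynomials of degree less than \<open>n\<close>. Stating this through the coefficients
  makes \<open>n = 0\<close> give \<open>{0}\<close>, so that the count \<open>card F ^ n\<close>
  has no exception.\<close>

definition bpolys :: "'c::comm_ring_1 set \<Rightarrow> nat \<Rightarrow> 'c poly set" where
  "bpolys F n = {p \<in> polys_over F. \<forall>i\<ge>n. coeff p i = 0}"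

lemma bpolys_mono: "m \<le> n \<Longrightarrow> bpolys F m \<subseteq> bpolys F n"
  by (auto simp: bpolys_def)

lemma polys_over_imp_bpolys: "p \<in> polys_over F \<Longrightarrow> p \<in> bpolys F (Suc (degree p))"
  by (auto simp: bpolys_def intro: coeff_eq_0)

lemma bpolys_Suc:
  assumes "is_subring F"
  shows "bpolys F (Suc n) = (\<lambda>(a, p). pCons a p) ` (F \<times> bpolys F n)"
proof (intro equalityI subsetI)
  fix p assume p: "p \<in> bpolys F (Suc n)"
  obtain a q where [simp]: "p = pCons a q" by (cases p)
  have "coeff q i = 0" if "i \<ge> n" for i
    using p that by (auto simp: bpolys_def dest!: spec[of _ "Suc i"])
  then have "a \<in> F" "q \<in> bpolys F n" using p assms by (auto simp: bpolys_def pCons_polys_over)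
  then show "p \<in> (\<lambda>(a, p). pCons a p) ` (F \<times> bpolys F n)" by auto
qed (use assms in \<open>auto simp: bpolys_def pCons_polys_over coeff_pCons split: nat.splits\<close>)

lemma bpolys_Suc_decomp:
  assumes "p \<in> bpolys F (Suc n)"
  shows "coeff p 0 \<in> F \<and> poly_shift 1 p \<in> bpolys F n \<and> p = pCons (coeff p 0) (poly_shift 1 p)"
proof -
  have "p = pCons (coeff p 0) (poly_shift 1 p)"
    by (rule poly_eqI) (auto simp: coeff_pCons coeff_poly_shift split: nat.splits)
  moreover have "coeff p 0 \<in> F \<and> poly_shift 1 p \<in> bpolys F n"
    using assms by (auto simp: bpolys_def polys_over_def coeff_poly_shift)
  ultimately show ?thesis by blast
qed

lemma card_bpolys:
  assumes "is_subring F" "finite F"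
  shows "finite (bpolys F n) \<and> card (bpolys F n) = card F ^ n"
proof (induction n)
  case 0
  have "bpolys F 0 = {0}" using assms
    by (auto simp: bpolys_def polys_over_def subring_0 intro: poly_eqI)
  then show ?case by simp
next
  case (Suc n)
  have "inj_on (\<lambda>(a, p). pCons a p) (F \<times> bpolys F n)" by (auto simp: inj_on_def)
  then show ?case using Suc assms(2) unfolding bpolys_Suc[OF assms(1)]
    by (simp add: card_image card_cartesian_product)
qed

lemma bpolys_add:
  assumes "is_subring F" "p \<in> bpolys F n" "q \<in> bpolys F n" shows "p + q \<in> bpolys F n"
  using assms subring_add[OF polys_over_subring[OF assms(1)]] by (auto simp: bpolys_def)

text \<open>The second factor is indexed by \<open>Suc n\<close>, that is by degree at most
  \<open>n\<close>, so that multiplication by it raises the strict degree bound by exactly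
  \<open>n\<close>.\<close>

lemma bpolys_mult:
  assumes "is_subring F" "p \<in> bpolys F m" "q \<in> bpolys F (Suc n)" shows "p * q \<in> bpolys F (m + n)"
proof -
  have "coeff (p * q) i = 0" if i: "i \<ge> m + n" for i
    unfolding coeff_mult
  proof (intro sum.neutral ballI)
    fix j assume "j \<in> {..i}"
    show "coeff p j * coeff q (i - j) = 0"
    proof (cases "j < m")
      case True
      then have "i - j \<ge> Suc n" using i by linarith
      then show ?thesis using assms(3) by (simp add: bpolys_def)
    qed (use assms(2) in \<open>simp add: bpolys_def\<close>)
  qed
  then show ?thesis using assms subring_mult[OF polys_over_subring[OF assms(1)]]
    by (auto simp: bpolys_def)
qed

definition ratfuns :: "'c::field set \<Rightarrow> 'c \<Rightarrow> 'c set" where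
  "ratfuns F t = {poly P t / poly Q t | P Q. P \<in> polys_over F \<and> Q \<in> polys_over F \<and> poly Q t \<noteq> 0}"

lemma ratfunsI:
  "P \<in> polys_over F \<Longrightarrow> Q \<in> polys_over F \<Longrightarrow> poly Q t \<noteq> 0 \<Longrightarrow> x = poly P t / poly Q t \<Longrightarrow> x \<in> ratfuns F t"
  unfolding ratfuns_def by blast

lemma ratfuns_subfield:
  assumes "is_subring F" shows "is_subfield (ratfuns F t)"
proof -
  note P = polys_over_subring[OF assms]
  have "x - y \<in> ratfuns F t \<and> x * y \<in> ratfuns F t" if "x \<in> ratfuns F t" "y \<in> ratfuns F t" for x y
  proof -
    obtain P Q P' Q' where *: "x = poly P t / poly Q t" "y = poly P' t / poly Q' t"
      "P \<in> polys_over F" "Q \<in> polys_over F" "P' \<in> polys_over F" "Q' \<in> polys_over F"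
      "poly Q t \<noteq> 0" "poly Q' t \<noteq> 0" using \<open>x \<in> _\<close> \<open>y \<in> _\<close> unfolding ratfuns_def by blast
    have "x - y \<in> ratfuns F t"
      by (rule ratfunsI[of "P * Q' - P' * Q" _ "Q * Q'"])
        (use * in \<open>auto simp: diff_frac_eq intro: subring_diff[OF P] subring_mult[OF P]\<close>)
    moreover have "x * y \<in> ratfuns F t"
      by (rule ratfunsI[of "P * P'" _ "Q * Q'"])
        (use * in \<open>auto intro: subring_mult[OF P]\<close>)
    ultimately show ?thesis by simp
  qed
  moreover have "0 \<in> ratfuns F t" by (rule ratfunsI[of 0 _ 1]) (auto intro: subring_0[OF P] subring_1[OF P])
  moreover have "1 \<in> ratfuns F t" by (rule ratfunsI[of 1 _ 1]) (auto intro: subring_1[OF P])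
  moreover have "inverse x \<in> ratfuns F t" if x: "x \<in> ratfuns F t" for x
  proof -
    obtain P Q where *: "x = poly P t / poly Q t"
      "P \<in> polys_over F" "Q \<in> polys_over F" "poly Q t \<noteq> 0" using x unfolding ratfuns_def by blast
    show ?thesis
    proof (cases "poly P t = 0")
      case True
      then show ?thesis using * \<open>0 \<in> ratfuns F t\<close> by simp
    next
      case False
      then show ?thesis using * by (intro ratfunsI[of Q _ P]) auto
    qed
  qed
  ultimately show ?thesis by (auto simp: is_subfield_def)
qed

lemma hull_subset_ratfuns:
  assumes "is_subring F" shows "is_subfield hull (F \<union> {t}) \<subseteq> ratfuns F t"
proof (rule hull_minimal)
  note P = polys_over_subring[OF assms]
  have "a \<in> ratfuns F t" if "a \<in> F" for a
    by (rule ratfunsI[of "[:a:]" _ 1])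
      (use that in \<open>auto simp: pCons_polys_over[OF assms] intro: subring_0[OF P] subring_1[OF P]\<close>)
  moreover have "t \<in> ratfuns F t"
    by (rule ratfunsI[of "[:0, 1:]" _ 1])
      (auto simp: pCons_polys_over[OF assms] intro: subring_0[OF P] subring_1[OF P]
        subring_0[OF assms] subring_1[OF assms])
  ultimately show "F \<union> {t} \<subseteq> ratfuns F t" by auto
qed (rule ratfuns_subfield[OF assms])

lemma ratfuns_common_denominator:
  assumes F: "is_subring F" and "finite I" "\<And>i. i \<in> I \<Longrightarrow> c i \<in> ratfuns F t"
  shows "\<exists>Q \<delta> P. Q \<in> bpolys F (Suc \<delta>) \<and> poly Q t \<noteq> 0 \<and>
    (\<forall>i\<in>I. P i \<in> bpolys F (Suc \<delta>) \<and> c i = poly (P i) t / poly Q t)"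
  using assms(2,3)
proof (induction I rule: finite_induct)
  case empty
  have "1 \<in> bpolys F (Suc 0)" using subring_1[OF polys_over_subring[OF F]] by (auto simp: bpolys_def)
  then show ?case by (intro exI[of _ 1] exI[of _ 0]) auto
next
  case (insert j I)
  then obtain Q \<delta> P where *: "Q \<in> bpolys F (Suc \<delta>)" "poly Q t \<noteq> 0"
    "\<And>i. i \<in> I \<Longrightarrow> P i \<in> bpolys F (Suc \<delta>) \<and> c i = poly (P i) t / poly Q t" by blast
  have "c j \<in> ratfuns F t" using insert.prems by blast
  then obtain P' Q' where c: "c j = poly P' t / poly Q' t" "P' \<in> polys_over F" "Q' \<in> polys_over F"
    "poly Q' t \<noteq> 0" unfolding ratfuns_def by blast
  define \<epsilon> where "\<epsilon> = degree P' + degree Q'"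
  have P': "P' \<in> bpolys F (Suc \<epsilon>)" and Q': "Q' \<in> bpolys F (Suc \<epsilon>)"
    using polys_over_imp_bpolys[OF c(2)] polys_over_imp_bpolys[OF c(3)]
      bpolys_mono[of "Suc (degree P')" "Suc \<epsilon>" F] bpolys_mono[of "Suc (degree Q')" "Suc \<epsilon>" F]
    by (auto simp: \<epsilon>_def)
  have m: "p * q \<in> bpolys F (Suc (\<delta> + \<epsilon>))" if "p \<in> bpolys F (Suc \<delta>)" "q \<in> bpolys F (Suc \<epsilon>)" for p q
    using bpolys_mult[OF F that] by simp
  let ?P = "\<lambda>i. if i = j then Q * P' else P i * Q'"
  have "\<forall>i\<in>insert j I. ?P i \<in> bpolys F (Suc (\<delta> + \<epsilon>)) \<and> c i = poly (?P i) t / poly (Q * Q') t"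
  proof
    fix i assume "i \<in> insert j I"
    then show "?P i \<in> bpolys F (Suc (\<delta> + \<epsilon>)) \<and> c i = poly (?P i) t / poly (Q * Q') t"
      using *(1,2) *(3)[of i] c(1,4) P' Q' by (cases "i = j") (auto intro: m)
  qed
  then show ?case using m[OF *(1) Q'] *(2) c(4)
    by (intro exI[of _ "Q * Q'"] exI[of _ "\<delta> + \<epsilon>"] exI[of _ ?P]) simp
qed

definition lin_span :: "'c::field set \<Rightarrow> 'c set \<Rightarrow> 'c set" where
  "lin_span K B = {(\<Sum>b\<in>B. c b * b) | c. \<forall>b\<in>B. c b \<in> K}"

lemma lin_spanI: "\<forall>b\<in>B. c b \<in> K \<Longrightarrow> (\<Sum>b\<in>B. c b * b) \<in> lin_span K B"
  unfolding lin_span_def by blast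

lemma lin_spanE:
  assumes "x \<in> lin_span K B"
  obtains c where "\<forall>b\<in>B. c b \<in> K" "x = (\<Sum>b\<in>B. c b * b)"
  using assms unfolding lin_span_def by blast

lemma lin_span_subspace:
  assumes "is_subring K" shows "is_subspace K (lin_span K B)"
  unfolding is_subspace_def
proof (intro conjI ballI)
  show "0 \<in> lin_span K B" using lin_spanI[of B "\<lambda>_. 0" K] subring_0[OF assms] by simp
next
  fix x y assume "x \<in> lin_span K B" "y \<in> lin_span K B"
  obtain c where c: "\<forall>b\<in>B. c b \<in> K" "x = (\<Sum>b\<in>B. c b * b)" by (rule lin_spanE[OF \<open>x \<in> _\<close>])
  obtain d where d: "\<forall>b\<in>B. d b \<in> K" "y = (\<Sum>b\<in>B. d b * b)" by (rule lin_spanE[OF \<open>y \<in> _\<close>])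
  have "x + y = (\<Sum>b\<in>B. (c b + d b) * b)" by (simp add: c d distrib_right sum.distrib)
  then show "x + y \<in> lin_span K B" using lin_spanI[of B "\<lambda>b. c b + d b" K] c d subring_add[OF assms] by simp
next
  fix a x assume "a \<in> K" "x \<in> lin_span K B"
  obtain c where c: "\<forall>b\<in>B. c b \<in> K" "x = (\<Sum>b\<in>B. c b * b)" by (rule lin_spanE[OF \<open>x \<in> _\<close>])
  have "a * x = (\<Sum>b\<in>B. (a * c b) * b)" by (simp add: c sum_distrib_left mult.assoc)
  then show "a * x \<in> lin_span K B" using lin_spanI[of B "\<lambda>b. a * c b" K] c \<open>a \<in> K\<close> subring_mult[OF assms] by simp
qed

lemma lin_span_base:
  assumes "is_subring K" "finite B" "b \<in> B" shows "b \<in> lin_span K B"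
proof -
  have "(\<Sum>b'\<in>B. (if b' = b then 1 else 0) * b') = b"
    using assms(2,3) by (simp add: if_distrib[of "\<lambda>u. u * _"] cong: if_cong)
  moreover have "(\<Sum>b'\<in>B. (if b' = b then 1 else 0) * b') \<in> lin_span K B"
    by (rule lin_spanI) (use subring_0[OF assms(1)] subring_1[OF assms(1)] in auto)
  ultimately show ?thesis by simp
qed

text \<open>Linear independence over the polynomials in \<open>x\<close>, where the coefficients are
  required to vanish as formal polynomials. For transcendental \<open>x\<close> this is independence
  over the rational functions in \<open>x\<close>; for \<open>x\<close> algebraic over
  \<open>F\<close> only the empty set satisfies it.\<close>

definition x_indep :: "'c::field set \<Rightarrow> 'c \<Rightarrow> 'c set \<Rightarrow> bool" where
  "x_indep F x Y \<longleftrightarrow> (\<forall>f. (\<forall>y\<in>Y. f y \<in> polys_over F) \<longrightarrow> (\<Sum>y\<in>Y. poly (f y) x * y) = 0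
     \<longrightarrow> (\<forall>y\<in>Y. f y = 0))"

lemma x_indepD:
  "x_indep F x Y \<Longrightarrow> \<forall>y\<in>Y. f y \<in> polys_over F \<Longrightarrow> (\<Sum>y\<in>Y. poly (f y) x * y) = 0 \<Longrightarrow> \<forall>y\<in>Y. f y = 0"
  unfolding x_indep_def by simp

lemma x_indep_inj:
  assumes "is_subring F" "x_indep F x Y"
  shows "inj_on (\<lambda>f. \<Sum>y\<in>Y. poly (f y) x * y) (Y \<rightarrow>\<^sub>E bpolys F l)"
proof (rule inj_onI)
  fix f g assume f: "f \<in> Y \<rightarrow>\<^sub>E bpolys F l" and g: "g \<in> Y \<rightarrow>\<^sub>E bpolys F l"
    and eq: "(\<Sum>y\<in>Y. poly (f y) x * y) = (\<Sum>y\<in>Y. poly (g y) x * y)"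
  have 0: "(\<Sum>y\<in>Y. poly (f y - g y) x * y) = 0"
    using eq by (simp add: left_diff_distrib sum_subtractf)
  have 1: "\<forall>y\<in>Y. f y - g y \<in> polys_over F"
  proof
    fix y assume "y \<in> Y"
    then have "f y \<in> polys_over F" "g y \<in> polys_over F" using f g by (auto simp: bpolys_def dest!: PiE_mem)
    then show "f y - g y \<in> polys_over F" by (rule subring_diff[OF polys_over_subring[OF assms(1)]])
  qed
  have "\<forall>y\<in>Y. f y - g y = 0" by (rule x_indepD[OF assms(2) 1 0])
  then show "f = g" by (intro PiE_ext[OF f g]) simp
qed

text \<open>
  Writing the \<open>x\<^sup>i y\<close> with \<open>i < l\<close> over a common denominator puts them into a finite box whose size
  grows like \<open>card F ^ (N l)\<close>, while independence makes \<open>card F ^ (l * card Y)\<close> combinations distinct.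
\<close>

lemma x_indep_bounded:
  fixes F :: "'c::field set"
  assumes F: "is_subfield F" "finite F" and B: "finite B"
    and x: "\<And>b. b \<in> B \<Longrightarrow> x * b \<in> lin_span (ratfuns F t) B"
  shows "\<exists>N. \<forall>Y. finite Y \<and> Y \<subseteq> lin_span (ratfuns F t) B \<and> x_indep F x Y \<longrightarrow> card Y \<le> N"
proof -
  note R = subfield_imp_subring[OF F(1)]
  \<comment> \<open>Combinations of \<open>B\<close> whose coefficients have numerators of degree
    less than \<open>h\<close> over the denominator \<open>D\<close>. Such a box has at most
    \<open>card F ^ (h * card B)\<close> elements, whatever \<open>D\<close> is.\<close>
  define box where "box h D = (\<lambda>G. \<Sum>b\<in>B. (poly (G b) t / D) * b) ` (B \<rightarrow>\<^sub>E bpolys F h)" for h D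
  have boxI: "(\<Sum>b\<in>B. (poly (G b) t / D) * b) \<in> box h D" if "\<forall>b\<in>B. G b \<in> bpolys F h" for G h D
    unfolding box_def by (rule image_eqI[of _ _ "restrict G B"]) (use that in auto)
  have box_card: "finite (box h D) \<and> card (box h D) \<le> (card F ^ h) ^ card B" for h D
  proof -
    have "finite (B \<rightarrow>\<^sub>E bpolys F h)" using B card_bpolys[OF R F(2)] by (simp add: finite_PiE)
    moreover from this have "card (box h D) \<le> card (B \<rightarrow>\<^sub>E bpolys F h)" unfolding box_def by (rule card_image_le)
    moreover have "card (B \<rightarrow>\<^sub>E bpolys F h) = (card F ^ h) ^ card B"
      using B card_bpolys[OF R F(2)] by (simp add: card_PiE)
    ultimately show ?thesis by (simp add: box_def)
  qed
  have box_add: "u + w \<in> box h D" if uw: "u \<in> box h D" "w \<in> box h D" for u w h D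
  proof -
    obtain G H where *: "u = (\<Sum>b\<in>B. (poly (G b) t / D) * b)" "w = (\<Sum>b\<in>B. (poly (H b) t / D) * b)"
      "G \<in> B \<rightarrow>\<^sub>E bpolys F h" "H \<in> B \<rightarrow>\<^sub>E bpolys F h" using uw unfolding box_def by blast
    have "u + w = (\<Sum>b\<in>B. (poly (G b + H b) t / D) * b)"
      by (simp add: * add_divide_distrib distrib_right sum.distrib)
    moreover have "\<forall>b\<in>B. G b + H b \<in> bpolys F h" using *(3,4) bpolys_add[OF R] by (auto dest!: PiE_mem)
    ultimately show ?thesis using boxI[of "\<lambda>b. G b + H b" h D] by simp
  qed
  have box_mult: "poly Q t * u \<in> box (h + \<delta>) D" if u: "u \<in> box h D" "Q \<in> bpolys F (Suc \<delta>)" for u h D Q \<delta>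
  proof -
    obtain G where *: "u = (\<Sum>b\<in>B. (poly (G b) t / D) * b)" "G \<in> B \<rightarrow>\<^sub>E bpolys F h"
      using u(1) unfolding box_def by blast
    have "poly Q t * u = (\<Sum>b\<in>B. (poly (G b * Q) t / D) * b)"
      by (simp add: * sum_distrib_left mult_ac)
    moreover have "\<forall>b\<in>B. G b * Q \<in> bpolys F (h + \<delta>)" using *(2) bpolys_mult[OF R _ u(2)] by (auto dest!: PiE_mem)
    ultimately show ?thesis using boxI[of "\<lambda>b. G b * Q" "h + \<delta>" D] by simp
  qed
  have box_denom: "u / q \<in> box h (D * q)" if u: "u \<in> box h D" for u q h D
  proof -
    obtain G where *: "u = (\<Sum>b\<in>B. (poly (G b) t / D) * b)" "G \<in> B \<rightarrow>\<^sub>E bpolys F h"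
      using u(1) unfolding box_def by blast
    have "u / q = (\<Sum>b\<in>B. (poly (G b) t / (D * q)) * b)"
      by (simp add: * sum_divide_distrib)
    moreover have "\<forall>b\<in>B. G b \<in> bpolys F h" using *(2) by (auto dest!: PiE_mem)
    ultimately show ?thesis using boxI[of G h "D * q"] by simp
  qed
  have box_sum: "sum g I \<in> box h D" if "\<And>i. i \<in> I \<Longrightarrow> g i \<in> box h D" for g :: "'c \<Rightarrow> 'c" and I h D
    using that
  proof (induction I rule: infinite_finite_induct)
    case (insert i I)
    then show ?case using box_add by auto
  next
    case empty
    show ?case using boxI[of "\<lambda>_. 0" h D] subring_0[OF polys_over_subring[OF R]] by (simp add: bpolys_def)
  next
    case (infinite I)
    show ?case using boxI[of "\<lambda>_. 0" h D] subring_0[OF polys_over_subring[OF R]] infinite by (simp add: bpolys_def)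
  qed
  have in_box: "\<exists>h Q. poly Q t \<noteq> 0 \<and> Q \<in> bpolys F h \<and> Y \<subseteq> box h (poly Q t)"
    if Y: "finite Y" "Y \<subseteq> lin_span (ratfuns F t) B" for Y
  proof -
    have "\<forall>y\<in>Y. \<exists>c. (\<forall>b\<in>B. c b \<in> ratfuns F t) \<and> y = (\<Sum>b\<in>B. c b * b)"
      using Y(2) unfolding lin_span_def by blast
    then obtain c where c: "\<And>y. y \<in> Y \<Longrightarrow> (\<forall>b\<in>B. c y b \<in> ratfuns F t) \<and> y = (\<Sum>b\<in>B. c y b * b)"
      by metis
    have "\<exists>Q \<delta> P. Q \<in> bpolys F (Suc \<delta>) \<and> poly Q t \<noteq> 0 \<and>
        (\<forall>i\<in>Y \<times> B. P i \<in> bpolys F (Suc \<delta>) \<and> c (fst i) (snd i) = poly (P i) t / poly Q t)"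
      by (rule ratfuns_common_denominator[OF R]) (use Y B c in auto)
    then obtain Q \<delta> P where Q': "Q \<in> bpolys F (Suc \<delta>) \<and> poly Q t \<noteq> 0 \<and>
        (\<forall>i\<in>Y \<times> B. P i \<in> bpolys F (Suc \<delta>) \<and> c (fst i) (snd i) = poly (P i) t / poly Q t)"
      by (elim exE)
    then have Q: "Q \<in> bpolys F (Suc \<delta>)" "poly Q t \<noteq> 0"
      "\<And>i. i \<in> Y \<times> B \<Longrightarrow> P i \<in> bpolys F (Suc \<delta>) \<and> c (fst i) (snd i) = poly (P i) t / poly Q t"
      using conjunct1[OF Q'] conjunct2[OF Q', THEN conjunct1]
        bspec[OF conjunct2[OF Q', THEN conjunct2]] by blast+
    have "y \<in> box (Suc \<delta>) (poly Q t)" if y: "y \<in> Y" for y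
    proof -
      have "y = (\<Sum>b\<in>B. c y b * b)" by (rule conjunct2[OF c[OF y]])
      also have "\<dots> = (\<Sum>b\<in>B. (poly (P (y, b)) t / poly Q t) * b)"
      proof (rule sum.cong)
        fix b assume "b \<in> B"
        then have "c y b = poly (P (y, b)) t / poly Q t" using Q(3)[of "(y, b)"] y by simp
        then show "c y b * b = poly (P (y, b)) t / poly Q t * b" by simp
      qed simp
      also have "\<dots> \<in> box (Suc \<delta>) (poly Q t)"
        by (rule boxI) (use Q(3) y in blast)
      finally show ?thesis .
    qed
    then show ?thesis using Q by blast
  qed
  \<comment> \<open>The products \<open>x * b\<close> are written over one denominator
    \<open>q\<close>. Hence a multiplication by \<open>x\<close> costs at most
    \<open>\<delta>\<close> in the degree of the numerators and one factor \<open>q\<close> in the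
    denominator.\<close>
  obtain hx Q where Q: "poly Q t \<noteq> 0" "Q \<in> bpolys F hx" "(\<lambda>b. x * b) ` B \<subseteq> box hx (poly Q t)"
    using in_box[of "(\<lambda>b. x * b) ` B"] B x by blast
  define q where "q = poly Q t"
  define \<delta> where "\<delta> = hx"
  have Q': "Q \<in> bpolys F (Suc \<delta>)" using Q(2) bpolys_mono[of hx "Suc \<delta>" F] by (auto simp: \<delta>_def)
  have box_q: "u \<in> box (h + \<delta>) (D * q)" if u: "u \<in> box h D" for u h D
  proof -
    have "q * u / q \<in> box (h + \<delta>) (D * q)" unfolding q_def using box_denom[OF box_mult[OF u Q']] .
    then show ?thesis using Q(1) by (simp add: q_def)
  qed
  have box_x: "x * u \<in> box (h + \<delta>) (D * q)" if u: "u \<in> box h D" for u h D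
  proof -
    obtain G where G: "u = (\<Sum>b\<in>B. (poly (G b) t / D) * b)" "G \<in> B \<rightarrow>\<^sub>E bpolys F h"
      using u(1) unfolding box_def by blast
    have "x * u = (\<Sum>b\<in>B. poly (G b) t * (x * b) / D)" by (simp add: G sum_distrib_left mult_ac)
    moreover have "poly (G b) t * (x * b) / D \<in> box (h + \<delta>) (D * q)" if b: "b \<in> B" for b
    proof -
      have "x * b \<in> box hx q" using Q(3) b by (auto simp: q_def)
      moreover have "G b \<in> bpolys F (Suc h)" using G(2) b bpolys_mono[of h "Suc h" F] by (auto dest!: PiE_mem)
      ultimately have "poly (G b) t * (x * b) \<in> box (hx + h) q" by (rule box_mult)
      from box_denom[OF this, of D] show ?thesis by (simp add: \<delta>_def add.commute mult.commute)
    qed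
    ultimately show ?thesis using box_sum[of B "\<lambda>b. poly (G b) t * (x * b) / D"] by simp
  qed
  show ?thesis
  \<comment> \<open>The height \<open>h0\<close> depends on \<open>Y\<close>, but it enters the
    comparison of exponents only as a constant; the part linear in \<open>l\<close> leaves the
    uniform bound \<open>card B * \<delta>\<close>.\<close>
  proof (intro exI[of _ "card B * \<delta>"] allI impI)
    fix Y assume Y: "finite Y \<and> Y \<subseteq> lin_span (ratfuns F t) B \<and> x_indep F x Y"
    obtain h0 Q0 where h0: "Y \<subseteq> box h0 (poly Q0 t)" using in_box[of Y] Y by blast
    define D where "D = poly Q0 t"
    have base: "Y \<subseteq> box (h0 + l * \<delta>) (D * q ^ l)" for l
    proof (induction l)
      case (Suc l)
      then have "Y \<subseteq> box (h0 + l * \<delta> + \<delta>) (D * q ^ l * q)" using box_q by blast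
      then show ?case by (simp add: ac_simps)
    qed (use h0 in \<open>simp add: D_def\<close>)
    have scale: "a * u \<in> box h D" if "a \<in> F" "u \<in> box h D" for a u h D
    proof -
      have "[:a:] \<in> bpolys F (Suc 0)"
        using that(1) subring_0[OF polys_over_subring[OF R]]
        by (auto simp: bpolys_def pCons_polys_over[OF R] coeff_pCons split: nat.splits)
      from box_mult[OF that(2) this] show ?thesis by simp
    qed
    have comb: "(\<Sum>y\<in>Y. poly (f y) x * y) \<in> box (h0 + l * \<delta>) (D * q ^ l)"
      if "\<forall>y\<in>Y. f y \<in> bpolys F l" for f l
      using that
    proof (induction l arbitrary: f)
      case 0
      then have "f y = 0" if "y \<in> Y" for y using that by (auto simp: bpolys_def intro: poly_eqI)
      then have "(\<Sum>y\<in>Y. poly (f y) x * y) = 0" by simp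
      then show ?case using box_sum[of "{}"] by simp
    next
      case (Suc l)
      define a where "a y = coeff (f y) 0" for y
      define p where "p y = poly_shift 1 (f y)" for y
      have ap: "a y \<in> F \<and> p y \<in> bpolys F l \<and> f y = pCons (a y) (p y)" if "y \<in> Y" for y
        unfolding a_def p_def using Suc.prems that by (intro bpolys_Suc_decomp) blast
      have "(\<Sum>y\<in>Y. poly (f y) x * y) = (\<Sum>y\<in>Y. a y * y) + x * (\<Sum>y\<in>Y. poly (p y) x * y)"
        unfolding sum_distrib_left sum.distrib[symmetric] by (rule sum.cong) (auto simp: ap algebra_simps)
      moreover have "(\<Sum>y\<in>Y. a y * y) \<in> box (h0 + Suc l * \<delta>) (D * q ^ Suc l)"
        by (rule box_sum) (use ap base[of "Suc l"] scale in blast)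
      moreover have "x * (\<Sum>y\<in>Y. poly (p y) x * y) \<in> box (h0 + l * \<delta> + \<delta>) (D * q ^ l * q)"
        by (rule box_x[OF Suc.IH]) (use ap in blast)
      ultimately show ?case using box_add by (simp add: ac_simps)
    qed
    \<comment> \<open>Large enough for the part of the exponent that is linear in \<open>l\<close>
      to outweigh \<open>card B * h0\<close>.\<close>
    define l where "l = Suc (card B * h0)"
    let ?s = "\<lambda>f. \<Sum>y\<in>Y. poly (f y) x * y"
    have "?s ` (Y \<rightarrow>\<^sub>E bpolys F l) \<subseteq> box (h0 + l * \<delta>) (D * q ^ l)"
    proof
      fix u assume "u \<in> ?s ` (Y \<rightarrow>\<^sub>E bpolys F l)"
      then obtain f where f: "u = ?s f" "f \<in> Y \<rightarrow>\<^sub>E bpolys F l" by (elim imageE)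
      show "u \<in> box (h0 + l * \<delta>) (D * q ^ l)" unfolding f(1)
        by (rule comb) (use f(2) in \<open>blast dest: PiE_mem\<close>)
    qed
    then have "card (?s ` (Y \<rightarrow>\<^sub>E bpolys F l)) \<le> (card F ^ (h0 + l * \<delta>)) ^ card B"
      using box_card by (meson card_mono le_trans)
    moreover have "card (?s ` (Y \<rightarrow>\<^sub>E bpolys F l)) = (card F ^ l) ^ card Y"
      using x_indep_inj[OF R] Y card_bpolys[OF R F(2)] by (simp add: card_image card_PiE)
    ultimately have "card F ^ (l * card Y) \<le> card F ^ ((h0 + l * \<delta>) * card B)" by (simp add: power_mult)
    moreover have "1 < card F"
    proof -
      have "card {0::'c, 1} \<le> card F"
        using F R by (intro card_mono) (auto intro: subring_0 subring_1)
      then show ?thesis by simp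
    qed
    ultimately have le: "l * card Y \<le> (h0 + l * \<delta>) * card B" using power_le_imp_le_exp by blast
    show "card Y \<le> card B * \<delta>"
    proof (rule ccontr)
      assume "\<not> card Y \<le> card B * \<delta>"
      then have "l * Suc (card B * \<delta>) \<le> l * card Y" by (intro mult_le_mono) auto
      with le have "l * Suc (card B * \<delta>) \<le> (h0 + l * \<delta>) * card B" by (rule order_trans[rotated])
      then have "l \<le> h0 * card B" by (simp add: algebra_simps)
      then show False by (simp add: l_def)
    qed
  qed
qed

text \<open>In a relation with polynomial coefficients the constant terms give a relation modulo
  \<open>x * R\<close>, so they vanish. The rest can be divided by \<open>x\<close>, which lowers
  the degree; the induction is on a common degree bound.\<close>

lemma indep_mod_imp_x_indep:
  fixes F :: "'c::field set"
  assumes F: "is_subfield F" and R: "is_subring R" "F \<subseteq> R" and x: "x \<in> R" "x \<noteq> 0" and B: "B \<subseteq> R"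
    and ind: "indep_mod F ((*) x ` R) B"
  shows "x_indep F x B"
proof -
  note FR = subfield_imp_subring[OF F]
  have main: "\<forall>b\<in>B. f b = 0" if "\<forall>b\<in>B. f b \<in> bpolys F l" "(\<Sum>b\<in>B. poly (f b) x * b) = 0" for f l
    using that
  proof (induction l arbitrary: f)
    case 0
    then show ?case by (auto simp: bpolys_def intro: poly_eqI)
  next
    case (Suc l)
    define a where "a y = coeff (f y) 0" for y
    define p where "p y = poly_shift 1 (f y)" for y
    have ap: "a y \<in> F \<and> p y \<in> bpolys F l \<and> f y = pCons (a y) (p y)" if "y \<in> B" for y
      unfolding a_def p_def using Suc.prems(1) that by (intro bpolys_Suc_decomp) blast
    define s where "s = (\<Sum>y\<in>B. poly (p y) x * y)"
    have "(\<Sum>y\<in>B. poly (f y) x * y) = (\<Sum>y\<in>B. a y * y) + x * s"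
      unfolding s_def sum_distrib_left sum.distrib[symmetric] by (rule sum.cong) (auto simp: ap algebra_simps)
    then have eq: "(\<Sum>y\<in>B. a y * y) = x * (- s)" using Suc.prems(2) by (simp add: eq_neg_iff_add_eq_0)
    have "poly (p y) x * y \<in> R" if "y \<in> B" for y
    proof -
      have "p y \<in> polys_over R" using ap[OF that] R(2) by (auto simp: bpolys_def polys_over_def)
      then show ?thesis using x(1) B that by (intro subring_mult[OF R(1)] poly_in_subring[OF R(1)]) auto
    qed
    then have "- s \<in> R" unfolding s_def by (intro subring_uminus[OF R(1)] subring_sum[OF R(1)])
    then have "(\<Sum>y\<in>B. a y * y) \<in> (*) x ` R" unfolding eq by blast
    then have a0: "\<forall>y\<in>B. a y = 0" using indep_modD[OF ind, of a] ap by blast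
    then have "(\<Sum>y\<in>B. a y * y) = 0" by simp
    then have "s = 0" using eq x(2) by simp
    then have "\<forall>y\<in>B. p y = 0" using Suc.IH[of p] ap unfolding s_def by blast
    then show ?case using a0 ap by simp
  qed
  show ?thesis unfolding x_indep_def
  proof (intro allI impI)
    fix f assume f: "\<forall>y\<in>B. f y \<in> polys_over F" "(\<Sum>y\<in>B. poly (f y) x * y) = 0"
    show "\<forall>y\<in>B. f y = 0"
    proof (cases "finite B")
      case True
      have "f y \<in> bpolys F (Suc (\<Sum>b\<in>B. degree (f b)))" if "y \<in> B" for y
      proof -
        have "degree (f y) \<le> (\<Sum>b\<in>B. degree (f b))" using True that by (meson member_le_sum zero_le)
        then show ?thesis using polys_over_imp_bpolys[of "f y" F] f(1) that
            bpolys_mono[of "Suc (degree (f y))" "Suc (\<Sum>b\<in>B. degree (f b))" F] by auto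
      qed
      then show ?thesis using main f(2) by blast
    next
      case False
      have "\<forall>b\<in>B. (1::'c) = 0"
        by (rule indep_modD[OF ind]) (use False subring_0[OF R(1)] subring_1[OF FR] in auto)
      then have "B = {}" by simp
      then show ?thesis by simp
    qed
  qed
qed

text \<open>Representatives of a basis of the quotient of \<open>R\<close> by \<open>x * R\<close>
  are independent over the polynomials in \<open>x\<close>, so this quotient has dimension at most
  \<open>N\<close> over \<open>F\<close>. Finiteness of the residue fields of places is deduced from
  this.\<close>

lemma incong_multiples_bounded:
  assumes F: "is_subfield F" "finite F" and R: "is_subring R" "F \<subseteq> R" and x: "x \<in> R" "x \<noteq> 0"
    and bd: "\<And>Y. finite Y \<Longrightarrow> Y \<subseteq> R \<Longrightarrow> x_indep F x Y \<Longrightarrow> card Y \<le> N"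
    and Y: "finite Y" "Y \<subseteq> R" "incong ((*) x ` R) Y"
  shows "card Y \<le> card F ^ N"
proof (rule ccontr)
  assume "\<not> card Y \<le> card F ^ N"
  interpret fin_quotient F R "(*) x ` R"
  proof
    show "is_subspace F R" using R subring_add[OF R(1)] subring_mult[OF R(1)] subring_0[OF R(1)]
      by (auto simp: is_subspace_def)
    show "is_subspace F ((*) x ` R)" unfolding is_subspace_def
    proof (intro conjI ballI)
      show "0 \<in> (*) x ` R" using subring_0[OF R(1)] by force
      fix u w assume "u \<in> (*) x ` R" "w \<in> (*) x ` R"
      then obtain u' w' where "u = x * u'" "w = x * w'" "u' \<in> R" "w' \<in> R" by blast
      then show "u + w \<in> (*) x ` R" using subring_add[OF R(1)] by (auto simp: distrib_left[symmetric])
    next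
      fix a u assume "a \<in> F" "u \<in> (*) x ` R"
      then obtain u' where "u = x * u'" "u' \<in> R" by blast
      then have "a * u = x * (a * u')" "a * u' \<in> R" using \<open>a \<in> F\<close> R subring_mult[OF R(1)] by (auto simp: mult_ac)
      then show "a * u \<in> (*) x ` R" by blast
    qed
  qed (use F in auto)
  obtain B where B: "finite B" "B \<subseteq> R" "indep_mod F ((*) x ` R) B" "card B = Suc N"
    using indep_subset_exists[OF Y(2,1,3), of N] \<open>\<not> card Y \<le> card F ^ N\<close> by auto
  have "card B \<le> N" using indep_mod_imp_x_indep[OF F(1) R x B(2,3)] bd B(1,2) by blast
  then show False using B(4) by simp
qed

section \<open>Places\<close>

text \<open>One family for the valuation ring, its ideals and the fractional ideals of negative
  order. The case \<open>x = 0\<close> is separate because a place takes the value \<open>0\<close>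
  there.\<close>

definition val_ge :: "'c::field set \<Rightarrow> ('c \<Rightarrow> int) \<Rightarrow> int \<Rightarrow> 'c set" where
  "val_ge L v n = {x\<in>L. x = 0 \<or> n \<le> v x}"

lemma local_ring_eq: "local_ring L v = val_ge L v 0"
  and place_power_eq: "place_power L v m = val_ge L v (int m)"
  by (auto simp: local_ring_def place_power_def val_ge_def)

locale place =
  fixes L :: "'c::field set" and v :: "'c \<Rightarrow> int"
  assumes L: "is_subfield L" and v: "v \<in> places L"
begin

lemmas L_closed = subfield_closed[OF L]

lemma v_mult: "x \<in> L \<Longrightarrow> y \<in> L \<Longrightarrow> x \<noteq> 0 \<Longrightarrow> y \<noteq> 0 \<Longrightarrow> v (x * y) = v x + v y"
  using v by (auto simp: places_def)

lemma v_add: "x \<in> L \<Longrightarrow> y \<in> L \<Longrightarrow> x \<noteq> 0 \<Longrightarrow> y \<noteq> 0 \<Longrightarrow> x + y \<noteq> 0 \<Longrightarrow> min (v x) (v y) \<le> v (x + y)"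
  using v by (auto simp: places_def)

lemma v_one [simp]: "v 1 = 0"
  using v_mult[of 1 1] L_closed(2) by simp

lemma v_uminus: "v (- x) = v x"
proof (cases "x \<in> L \<and> x \<noteq> 0")
  case True
  have m: "-1 \<in> L" using L_closed(2,5) by blast
  have "v (-1 * -1) = v (-1) + v (-1)" by (rule v_mult) (use m in auto)
  then have "v (-1) = 0" by simp
  moreover have "v (-1 * x) = v (-1) + v x" by (rule v_mult) (use m True in auto)
  ultimately show ?thesis by simp
next
  case False
  then have "\<not> (- x \<in> L \<and> - x \<noteq> 0)" using L_closed(5)[of "-x"] by auto
  then show ?thesis using False v by (auto simp: places_def)
qed

lemma v_inverse: "x \<in> L \<Longrightarrow> x \<noteq> 0 \<Longrightarrow> v (inverse x) = - v x"
  using v_mult[of x "inverse x"] L_closed(10)[of x] by simp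

lemma v_divide: "x \<in> L \<Longrightarrow> y \<in> L \<Longrightarrow> x \<noteq> 0 \<Longrightarrow> y \<noteq> 0 \<Longrightarrow> v (x / y) = v x - v y"
  using v_mult[of x "inverse y"] v_inverse[of y] L_closed(10)[of y] by (simp add: divide_inverse)

lemma v_power: "x \<in> L \<Longrightarrow> x \<noteq> 0 \<Longrightarrow> v (x ^ n) = int n * v x"
proof (induction n)
  case (Suc n)
  then show ?case using v_mult[of x "x ^ n"] L_closed(9)[of x n] by (simp add: algebra_simps)
qed simp

lemma v_powi: "x \<in> L \<Longrightarrow> x \<noteq> 0 \<Longrightarrow> v (x powi n) = n * v x"
  using v_power[of x "nat n"] v_power[of "inverse x" "nat (- n)"] v_inverse[of x] L_closed(10)[of x]
  by (auto simp: power_int_def)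

lemma uniformizer: obtains t where "t \<in> L" "t \<noteq> 0" "v t = 1"
  using v by (auto simp: places_def)

lemma val_ge_subset: "val_ge L v n \<subseteq> L"
  by (auto simp: val_ge_def)

lemma val_ge_mono: "m \<le> n \<Longrightarrow> val_ge L v n \<subseteq> val_ge L v m"
  by (auto simp: val_ge_def)

lemma zero_val_ge: "0 \<in> val_ge L v n"
  by (simp add: val_ge_def L_closed)

lemma val_ge_add: "x \<in> val_ge L v n \<Longrightarrow> y \<in> val_ge L v n \<Longrightarrow> x + y \<in> val_ge L v n"
  using v_add[of x y] by (cases "x = 0 \<or> y = 0 \<or> x + y = 0") (auto simp: val_ge_def L_closed)

lemma val_ge_uminus: "x \<in> val_ge L v n \<Longrightarrow> - x \<in> val_ge L v n"
  by (auto simp: val_ge_def L_closed v_uminus)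

lemma val_ge_diff: "x \<in> val_ge L v n \<Longrightarrow> y \<in> val_ge L v n \<Longrightarrow> x - y \<in> val_ge L v n"
  using val_ge_add[of x n "- y"] val_ge_uminus[of y n] by simp

lemma val_ge_mult: "x \<in> val_ge L v m \<Longrightarrow> y \<in> val_ge L v n \<Longrightarrow> x * y \<in> val_ge L v (m + n)"
  using v_mult[of x y] by (cases "x = 0 \<or> y = 0") (auto simp: val_ge_def L_closed)

lemma val_ge_subring: "is_subring (val_ge L v 0)"
  unfolding is_subring_def using val_ge_diff val_ge_mult[of _ 0 _ 0] zero_val_ge
  by (auto simp: val_ge_def L_closed)

lemma val_ge_multiple: "y \<in> L \<Longrightarrow> y \<noteq> 0 \<Longrightarrow> y * x \<in> val_ge L v (v y + n) \<longleftrightarrow> x \<in> val_ge L v n"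
proof
  assume y: "y \<in> L" "y \<noteq> 0" and yx: "y * x \<in> val_ge L v (v y + n)"
  have "inverse y * (y * x) \<in> val_ge L v (- v y + (v y + n))"
    by (rule val_ge_mult[OF _ yx]) (use y v_inverse[OF y] L_closed in \<open>auto simp: val_ge_def\<close>)
  then show "x \<in> val_ge L v n" using y by (simp add: mult.assoc[symmetric])
qed (use val_ge_mult[of y "v y" x n] in \<open>auto simp: val_ge_def\<close>)

lemma val_ge_multiples: "y \<in> L \<Longrightarrow> y \<noteq> 0 \<Longrightarrow> (*) y ` val_ge L v n = val_ge L v (v y + n)"
proof (intro equalityI subsetI)
  fix x assume y: "y \<in> L" "y \<noteq> 0" and x: "x \<in> val_ge L v (v y + n)"
  have "y * (x / y) \<in> val_ge L v (v y + n)" using x y by simp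
  then have "x / y \<in> val_ge L v n" using val_ge_multiple[OF y] by blast
  then show "x \<in> (*) y ` val_ge L v n" using y by (intro image_eqI[of _ _ "x / y"]) auto
qed (use val_ge_multiple in blast)

text \<open>If the value of the sum were larger than \<open>v x\<close>, subtracting
  \<open>y\<close> would give \<open>x\<close> a larger value than it has.\<close>

lemma v_add_eq:
  assumes "x \<in> L" "x \<noteq> 0" "y \<in> val_ge L v (v x + 1)"
  shows "x + y \<noteq> 0 \<and> v (x + y) = v x"
proof
  show nz: "x + y \<noteq> 0"
  proof
    assume "x + y = 0"
    then have "y = - x" by (metis add_eq_0_iff)
    then show False using assms v_uminus[of x] by (auto simp: val_ge_def)
  qed
  have "x \<in> val_ge L v (v x)" "y \<in> val_ge L v (v x)" using assms by (auto simp: val_ge_def)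
  then have "x + y \<in> val_ge L v (v x)" by (rule val_ge_add)
  then have "v x \<le> v (x + y)" using nz by (auto simp: val_ge_def)
  moreover have "\<not> v x < v (x + y)"
  proof
    assume "v x < v (x + y)"
    then have "x + y \<in> val_ge L v (v x + 1)" using assms L_closed by (auto simp: val_ge_def)
    then have "x + y - y \<in> val_ge L v (v x + 1)" using assms(3) by (rule val_ge_diff)
    then show False using assms by (auto simp: val_ge_def)
  qed
  ultimately show "v (x + y) = v x" by simp
qed

text \<open>Two powers of \<open>a\<close> with different exponents coincide, and the corresponding
  multiples of \<open>v a\<close> agree only for \<open>v a = 0\<close>.\<close>

lemma v_finite_field:
  assumes F: "is_subfield F" "finite F" "F \<subseteq> L" and a: "a \<in> F" "a \<noteq> 0" shows "v a = 0"
proof -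
  have "\<not> inj (\<lambda>n::nat. a ^ n)"
  proof
    assume "inj (\<lambda>n::nat. a ^ n)"
    moreover have "range (\<lambda>n::nat. a ^ n) \<subseteq> F" using subfield_closed(9)[OF F(1)] a by auto
    ultimately show False using F(2) by (meson finite_subset finite_imageD infinite_UNIV_nat)
  qed
  then obtain m n where "m \<noteq> n" "a ^ m = a ^ n" by (auto simp: inj_def)
  then have "int m * v a = int n * v a" using v_power[of a] a F(3) by (metis subsetD)
  then show ?thesis using \<open>m \<noteq> n\<close> by simp
qed

lemma finite_field_val_ge:
  assumes F: "is_subfield F" "finite F" "F \<subseteq> L" and a: "a \<in> F" shows "a \<in> val_ge L v 0"
  using v_finite_field[OF assms] F(3) a by (cases "a = 0") (auto simp: val_ge_def)

lemma val_ge_subspace: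
  assumes F: "is_subfield F" "finite F" "F \<subseteq> L" shows "is_subspace F (val_ge L v n)"
proof -
  have "F \<subseteq> val_ge L v 0" using finite_field_val_ge[OF F] by blast
  then show ?thesis unfolding is_subspace_def
    using zero_val_ge val_ge_add val_ge_mult[of _ 0 _ n] by auto
qed

end

text \<open>
  A maximal subring in which \<open>y\<close> is not invertible is a valuation ring; it is discrete since
  its quotients by principal ideals are finite.
\<close>

lemma place_exists:
  fixes F L :: "'c::field set"
  assumes F: "is_subfield F" "finite F" "F \<subseteq> L" and L: "is_subfield L"
    and y: "y \<in> L" "y \<noteq> 0" "\<And>p. p \<in> polys_over F \<Longrightarrow> y * poly p y \<noteq> 1"
    and bd: "\<And>x. x \<in> L \<Longrightarrow> \<exists>N. \<forall>Y. finite Y \<and> Y \<subseteq> L \<and> x_indep F x Y \<longrightarrow> card Y \<le> N"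
  shows "\<exists>v\<in>places L. 0 < v y"
proof -
  note FR = subfield_imp_subring[OF F(1)]
  note Lc = subfield_closed[OF L]
  note LR = subfield_imp_subring[OF L]
  \<comment> \<open>The competitors for Zorn's lemma: rings between \<open>F\<close> and
    \<open>L\<close> that contain \<open>y\<close> and in which \<open>y\<close> is no unit. The
    third hypothesis on \<open>y\<close> says that \<open>F[y]\<close> is one of them.\<close>
  define \<S> where "\<S> = {R. is_subring R \<and> F \<subseteq> R \<and> R \<subseteq> L \<and> y \<in> R \<and> (\<forall>a\<in>R. y * a \<noteq> 1)}"
  have adjoin: "is_subring ((\<lambda>p. poly p z) ` polys_over R)" "R \<subseteq> (\<lambda>p. poly p z) ` polys_over R"
    "z \<in> (\<lambda>p. poly p z) ` polys_over R" "R \<subseteq> L \<Longrightarrow> z \<in> L \<Longrightarrow> (\<lambda>p. poly p z) ` polys_over R \<subseteq> L"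
    if R: "is_subring R" for R :: "'c set" and z
  proof -
    note P = polys_over_subring[OF R]
    have d: "poly p z - poly q z \<in> (\<lambda>p. poly p z) ` polys_over R"
      "poly p z * poly q z \<in> (\<lambda>p. poly p z) ` polys_over R"
      if "p \<in> polys_over R" "q \<in> polys_over R" for p q
      using subring_diff[OF P that] subring_mult[OF P that]
      by (metis image_eqI poly_diff) (metis image_eqI poly_mult \<open>p * q \<in> polys_over R\<close>)
    have "poly 0 z \<in> (\<lambda>p. poly p z) ` polys_over R" "poly 1 z \<in> (\<lambda>p. poly p z) ` polys_over R"
      using subring_0[OF P] subring_1[OF P] by blast+
    then show "is_subring ((\<lambda>p. poly p z) ` polys_over R)" unfolding is_subring_def using d by auto
    show "R \<subseteq> (\<lambda>p. poly p z) ` polys_over R"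
    proof
      fix a assume "a \<in> R"
      then have "[:a:] \<in> polys_over R" using subring_0[OF P] by (simp add: pCons_polys_over[OF R])
      then show "a \<in> (\<lambda>p. poly p z) ` polys_over R" by (rule rev_image_eqI) simp
    qed
    have "[:0, 1:] \<in> polys_over R"
      using subring_0[OF P] subring_0[OF R] subring_1[OF R] by (simp add: pCons_polys_over[OF R])
    then show "z \<in> (\<lambda>p. poly p z) ` polys_over R" by (rule rev_image_eqI) simp
    show "(\<lambda>p. poly p z) ` polys_over R \<subseteq> L" if "R \<subseteq> L" "z \<in> L"
      using that by (auto intro!: poly_in_subring[OF LR] simp: polys_over_def) blast
  qed
  have "(\<lambda>p. poly p y) ` polys_over F \<in> \<S>"
    unfolding \<S>_def using adjoin[OF FR, of y] F(3) y by auto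
  moreover have "\<Union>\<C> \<in> \<S>" if ne: "\<C> \<noteq> {}" and ch: "subset.chain \<S> \<C>" for \<C>
  proof -
    have sub: "\<C> \<subseteq> \<S>" using ch by (simp add: subset.chain_def)
    have "a - b \<in> \<Union>\<C> \<and> a * b \<in> \<Union>\<C>" if ab: "a \<in> \<Union>\<C>" "b \<in> \<Union>\<C>" for a b
    proof -
      obtain R1 R2 where R12: "R1 \<in> \<C>" "a \<in> R1" "R2 \<in> \<C>" "b \<in> R2" using ab by blast
      then have "R1 \<subseteq> R2 \<or> R2 \<subseteq> R1" using ch by (auto simp: subset.chain_def)
      then obtain R where R: "R \<in> \<C>" "a \<in> R" "b \<in> R" using R12 by blast
      then have "is_subring R" using sub by (auto simp: \<S>_def)
      then show ?thesis using R subring_diff subring_mult by blast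
    qed
    then have "is_subring (\<Union>\<C>)" unfolding is_subring_def
      using ne sub by (auto simp: \<S>_def is_subring_def)
    then show ?thesis using ne sub by (auto simp: \<S>_def) blast
  qed
  ultimately obtain V where V: "V \<in> \<S>" "\<And>R. R \<in> \<S> \<Longrightarrow> V \<subseteq> R \<Longrightarrow> R = V"
    using subset_Zorn_nonempty[of \<S>] by blast
  have OR: "is_subring V" and FO: "F \<subseteq> V" and OL: "V \<subseteq> L" and yO: "y \<in> V"
    and yn: "\<And>a. a \<in> V \<Longrightarrow> y * a \<noteq> 1" using V(1) by (auto simp: \<S>_def)
  note Oc = subring_closed[OF OR]
  \<comment> \<open>Inverting all elements \<open>1 - y * c\<close> gives a ring in which
    \<open>y\<close> is still no unit, so by maximality the inverses belong to \<open>V\<close>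
    already.\<close>
  have unit1: "\<exists>u\<in>V. (1 - y * b) * u = 1" if b: "b \<in> V" for b
  proof -
    have nz: "1 - y * c \<noteq> 0" if "c \<in> V" for c using yn[OF that] by auto
    define V' where "V' = {a / (1 - y * c) | a c. a \<in> V \<and> c \<in> V}"
    have V'I: "a / (1 - y * c) \<in> V'" if "a \<in> V" "c \<in> V" for a c using that by (auto simp: V'_def)
    have prod: "(1 - y * c) * (1 - y * c') = 1 - y * (c + c' - y * c * c')" for c c'
      by (simp add: algebra_simps)
    have "V' \<in> \<S>"
    proof -
      have "u - w \<in> V' \<and> u * w \<in> V'" if "u \<in> V'" "w \<in> V'" for u w
      proof -
        obtain a c a' c' where *: "u = a / (1 - y * c)" "w = a' / (1 - y * c')" "a \<in> V" "c \<in> V"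
          "a' \<in> V" "c' \<in> V" using \<open>u \<in> V'\<close> \<open>w \<in> V'\<close> unfolding V'_def by blast
        have c: "c + c' - y * c * c' \<in> V" using * yO by (intro Oc)
        have "u - w = (a * (1 - y * c') - a' * (1 - y * c)) / ((1 - y * c) * (1 - y * c'))"
          using nz * by (simp add: diff_frac_eq)
        moreover have "a * (1 - y * c') - a' * (1 - y * c) \<in> V" using * yO by (intro Oc)
        ultimately have "u - w \<in> V'" using V'I[OF _ c] by (simp add: prod)
        moreover have "u * w = a * a' / ((1 - y * c) * (1 - y * c'))" by (simp add: *)
        then have "u * w \<in> V'" using V'I[OF _ c, of "a * a'"] * by (simp add: prod Oc)
        ultimately show ?thesis by simp
      qed
      moreover have OO': "V \<subseteq> V'"
      proof
        fix a assume "a \<in> V"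
        then show "a \<in> V'" using V'I[of a 0] Oc(1) by simp
      qed
      moreover have "V' \<subseteq> L"
      proof
        fix u assume "u \<in> V'"
        then obtain a c where "u = a / (1 - y * c)" "a \<in> V" "c \<in> V" unfolding V'_def by blast
        then show "u \<in> L" using OL y(1) by (auto intro!: Lc)
      qed
      moreover have "y * u \<noteq> 1" if "u \<in> V'" for u
      proof
        assume e: "y * u = 1"
        obtain a c where ac: "u = a / (1 - y * c)" "a \<in> V" "c \<in> V" using \<open>u \<in> V'\<close> unfolding V'_def by blast
        then have "y * a = 1 - y * c" using e nz[of c] by (simp add: divide_eq_eq)
        then have "y * (a + c) = 1" by (simp add: algebra_simps)
        then show False using yn[OF Oc(6)[OF ac(2,3)]] by simp
      qed
      ultimately show ?thesis using Oc(1,2) FO yO unfolding \<S>_def is_subring_def by blast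
    qed
    moreover have "V \<subseteq> V'"
    proof
      fix a assume "a \<in> V"
      then show "a \<in> V'" using V'I[of a 0] Oc(1) by simp
    qed
    ultimately have "V' = V" by (rule V(2))
    then have "1 / (1 - y * b) \<in> V" using V'I[OF Oc(2) b] by simp
    then show ?thesis using nz[OF b] by (intro bexI[of _ "1 / (1 - y * b)"]) auto
  qed
  \<comment> \<open>\<open>P z n\<close> says that \<open>y\<close> becomes a unit in the ring
    generated by \<open>V\<close> and \<open>z\<close>, with an inverse of degree at most
    \<open>n\<close> in \<open>z\<close>.\<close>
  define P where "P z n \<longleftrightarrow> (\<exists>p\<in>polys_over V. degree p \<le> n \<and> y * poly p z = 1)" for z n
  have P0: "\<not> P z 0" for z
  proof
    assume "P z 0"
    then obtain p where p: "p \<in> polys_over V" "degree p = 0" "y * poly p z = 1" by (auto simp: P_def)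
    then obtain a where "p = [:a:]" by (meson degree_eq_zeroE)
    then show False using p yn[of a] by (simp add: pCons_polys_over[OF OR])
  qed
  \<comment> \<open>The relation for \<open>1 / z\<close>, multiplied by \<open>z ^ Suc n\<close>,
    expresses \<open>z ^ Suc n\<close> through lower powers, since \<open>1 - y * b\<close> is a
    unit. Substituting this for the leading term shortens the relation for \<open>z\<close>.\<close>
  have reduce: "P z n" if z: "z \<noteq> 0" and p: "P z (Suc n)" and q: "P (1 / z) (Suc m)" and mn: "m \<le> n" for z n m
  proof -
    obtain p where p: "p \<in> polys_over V" "degree p \<le> Suc n" "y * poly p z = 1" using p by (auto simp: P_def)
    obtain q where q: "q \<in> polys_over V" "degree q \<le> Suc m" "y * poly q (1 / z) = 1" using q by (auto simp: P_def)
    obtain b q' where bq: "q = pCons b q'" by (cases q)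
    have b: "b \<in> V" "q' \<in> polys_over V" "degree q' \<le> n"
      using q(1,2) mn by (auto simp: bq pCons_polys_over[OF OR] split: if_splits)
    obtain u where u: "u \<in> V" "(1 - y * b) * u = 1" using unit1[OF b(1)] by blast
    define r where "r = (\<Sum>i\<le>n. Polynomial.monom (coeff q' (n - i)) i)"
    have r: "r \<in> polys_over V" unfolding r_def using b(2)
      by (intro subring_sum[OF polys_over_subring[OF OR]] monom_polys_over[OF OR]) (simp add: polys_over_def)
    have dr: "degree r \<le> n" unfolding r_def by (rule degree_sum_le) (auto intro: order_trans[OF degree_monom_le])
    have "poly q' (1 / z) = (\<Sum>i\<le>n. coeff q' i * (1 / z) ^ i)"
      unfolding poly_altdef by (rule sum.mono_neutral_left) (use b(3) in \<open>auto intro: coeff_eq_0\<close>)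
    then have "z ^ n * poly q' (1 / z) = (\<Sum>i\<le>n. coeff q' i * z ^ (n - i))"
      using z by (simp add: sum_distrib_left power_diff field_simps)
    also have "\<dots> = (\<Sum>i\<le>n. coeff q' (n - i) * z ^ (n - (n - i)))"
      by (rule sum.reindex_bij_witness[of _ "\<lambda>i. n - i" "\<lambda>i. n - i"]) auto
    also have "\<dots> = poly r z" unfolding r_def poly_sum by (intro sum.cong) (auto simp: poly_monom)
    finally have rz: "z ^ n * poly q' (1 / z) = poly r z" .
    have "1 - y * b = y * (1 / z) * poly q' (1 / z)" using q(3) by (simp add: bq algebra_simps)
    moreover have "z ^ Suc n * (y * (1 / z) * poly q' (1 / z)) = y * (z ^ n * poly q' (1 / z))"
      using z by simp
    ultimately have "z ^ Suc n * (1 - y * b) = y * poly r z" using rz by simp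
    then have "z ^ Suc n * ((1 - y * b) * u) = u * y * poly r z" by (simp add: mult_ac)
    then have zn: "z ^ Suc n = u * y * poly r z" using u(2) by simp
    define a where "a = coeff p (Suc n)"
    define p0 where "p0 = p - Polynomial.monom a (Suc n)"
    have a: "a \<in> V" using p(1) by (simp add: a_def polys_over_def)
    have p0: "p0 \<in> polys_over V" unfolding p0_def
      by (intro subring_diff[OF polys_over_subring[OF OR]] p monom_polys_over[OF OR] a)
    have "degree p0 \<le> n"
    proof (rule degree_le, intro allI impI)
      fix i assume "n < i"
      then show "coeff p0 i = 0" using p(2) coeff_eq_0[of p i]
        by (cases "i = Suc n") (auto simp: p0_def a_def)
    qed
    define s where "s = p0 + Polynomial.smult (a * u * y) r"
    have "s \<in> polys_over V" unfolding s_def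
      by (intro subring_add[OF polys_over_subring[OF OR]] p0 smult_polys_over[OF OR] r Oc a u yO)
    moreover have "degree s \<le> n" unfolding s_def
      by (intro degree_add_le \<open>degree p0 \<le> n\<close> order_trans[OF degree_smult_le dr])
    moreover have "poly p z = poly s z"
      unfolding s_def p0_def using zn by (simp add: poly_monom algebra_simps)
    ultimately show ?thesis using p(3) by (auto simp: P_def)
  qed
  have notboth: "\<not> (P z n \<and> P (1 / z) m)" if z: "z \<noteq> 0" for z n m
    using z
  proof (induction "n + m" arbitrary: n m z rule: less_induct)
    case less
    show ?case
    proof
      assume a: "P z n \<and> P (1 / z) m"
      then obtain n' m' where nm: "n = Suc n'" "m = Suc m'" using P0 by (metis not0_implies_Suc)
      show False
      proof (cases "m' \<le> n'")
        case True
        then have "P z n'" using reduce[OF less.prems, of n' m'] a nm by blast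
        then show False using less.hyps[of n' m z] less.prems a nm by simp
      next
        case False
        then have "P (1 / z) m'" using reduce[of "1 / z" m' n'] less.prems a nm by simp
        then show False using less.hyps[of n m' z] less.prems a nm by simp
      qed
    qed
  qed
  \<comment> \<open>If neither \<open>z\<close> nor \<open>1 / z\<close> were in \<open>V\<close>,
    maximality would make \<open>y\<close> a unit after adjoining either of them, and the descent in
    \<open>notboth\<close> excludes this. So \<open>V\<close> is a valuation ring.\<close>
  have val: "z \<in> V \<or> 1 / z \<in> V" if z: "z \<in> L" "z \<noteq> 0" for z
  proof (rule ccontr)
    assume n: "\<not> (z \<in> V \<or> 1 / z \<in> V)"
    have ex: "\<exists>n. P x n" if x: "x \<in> L" "x \<notin> V" for x
    proof -
      let ?R = "(\<lambda>p. poly p x) ` polys_over V"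
      have "?R \<noteq> V" using adjoin(3)[OF OR, of x] x(2) by blast
      then have "?R \<notin> \<S>" using V(2) adjoin(2)[OF OR, of x] by blast
      then have "\<exists>a\<in>?R. y * a = 1"
        unfolding \<S>_def using adjoin[OF OR, of x] OL x(1) FO yO by blast
      then show ?thesis unfolding P_def by blast
    qed
    have "1 / z \<in> L" using z by (intro Lc)
    then show False using ex[of z] ex[of "1 / z"] n z notboth by blast
  qed
  define M where "M = {a\<in>V. a = 0 \<or> 1 / a \<notin> V}"
  have yM: "y \<in> M" using yO yn[of "1 / y"] y(2) by (auto simp: M_def)
  have fin: "\<exists>C. \<forall>Y. finite Y \<and> Y \<subseteq> V \<and> incong ((*) z ` V) Y \<longrightarrow> card Y \<le> C"
    if z: "z \<in> V" "z \<noteq> 0" for z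
  proof -
    obtain N where N: "\<And>Y. finite Y \<and> Y \<subseteq> L \<and> x_indep F z Y \<Longrightarrow> card Y \<le> N"
      using bd[of z] z(1) OL by blast
    have "card Y \<le> card F ^ N" if "finite Y" "Y \<subseteq> V" "incong ((*) z ` V) Y" for Y
      by (rule incong_multiples_bounded[OF F(1,2) OR FO z]) (use N OL that in auto)
    then show ?thesis by blast
  qed
  have mulI: "w \<in> (*) z ` V \<longleftrightarrow> w / z \<in> V" if "z \<noteq> 0" for w z
    using that by (auto intro: image_eqI[of _ _ "w / z"])
  obtain T where T: "finite T" "T \<subseteq> V" "incong ((*) y ` V) T"
    and T_cov: "\<And>x. x \<in> V \<Longrightarrow> \<exists>\<tau>\<in>T. x - \<tau> \<in> (*) y ` V"
  proof -
    obtain C where C: "\<And>Y. finite Y \<and> Y \<subseteq> V \<and> incong ((*) y ` V) Y \<Longrightarrow> card Y \<le> C"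
      using fin[OF yO y(2)] by blast
    have "0 \<in> (*) y ` V" using Oc(1) by force
    moreover have "- x \<in> (*) y ` V" if "x \<in> (*) y ` V" for x
      using that Oc(5) unfolding mulI[OF y(2)] by (simp add: minus_divide_left[symmetric])
    ultimately show thesis using incong_bounded_cover[of "(*) y ` V" V C] C that by metis
  qed
  have cov: "\<exists>\<tau>\<in>T. (x - \<tau>) / y \<in> V" if "x \<in> V" for x
    using T_cov[OF that] unfolding mulI[OF y(2)] .
  define S where "S a = {\<tau>\<in>T. \<tau> / a \<in> V}" for a
  let ?C = "\<lambda>a. a \<in> M \<and> a \<noteq> 0 \<and> y / a \<in> V"
  have "?C y" using yM y(2) Oc(2) by simp
  moreover have "\<And>a. ?C a \<Longrightarrow> card (S a) \<le> card T" using T(1) by (auto simp: S_def intro!: card_mono)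
  \<comment> \<open>Among the nonunits dividing \<open>y\<close>, \<open>t\<close> divides the
    greatest number of representatives of \<open>V\<close> modulo \<open>y\<close>. A nonunit
    \<open>p\<close> not divisible by \<open>t\<close> would divide \<open>t\<close>, hence all
    these representatives, and in addition the representative of \<open>p\<close> itself. So
    \<open>t\<close> generates the maximal ideal.\<close>
  ultimately obtain t where t: "?C t" "\<And>a. ?C a \<Longrightarrow> card (S a) \<le> card (S t)"
    using Lattices_Big.ex_has_greatest_nat[of ?C y "\<lambda>a. card (S a)" "Suc (card T)"] by (metis less_Suc_eq_le)
  have tO: "t \<in> V" and t0: "t \<noteq> 0" and tn: "1 / t \<notin> V" and tL: "t \<in> L" using t(1) OL by (auto simp: M_def)
  have gen: "p / t \<in> V" if p: "p \<in> M" for p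
  proof (rule ccontr)
    assume n: "p / t \<notin> V"
    have p0: "p \<noteq> 0" using n Oc(1) by auto
    have pO: "p \<in> V" using p by (simp add: M_def)
    have tp: "t / p \<in> V"
    proof -
      have "p / t \<in> L" using pO tO OL by (intro Lc) auto
      then show ?thesis using val[of "p / t"] n p0 t0 by simp
    qed
    have yp: "y / p \<in> V" using Oc(4)[OF _ tp, of "y / t"] t(1) t0 by simp
    have sub: "S t \<subseteq> S p"
    proof
      fix \<tau> assume "\<tau> \<in> S t"
      then show "\<tau> \<in> S p" using Oc(4)[OF _ tp, of "\<tau> / t"] t0 by (simp add: S_def)
    qed
    obtain \<tau> where \<tau>: "\<tau> \<in> T" "(p - \<tau>) / y \<in> V" using cov[OF pO] by blast
    have "(p - \<tau>) / p \<in> V" using Oc(4)[OF \<tau>(2) yp] y(2) by simp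
    then have "1 - (p - \<tau>) / p \<in> V" using Oc(2,3) by blast
    then have "\<tau> \<in> S p" using \<tau>(1) p0 by (simp add: S_def diff_divide_distrib)
    moreover have "\<tau> \<notin> S t"
    proof
      assume "\<tau> \<in> S t"
      then have "\<tau> / t \<in> V" by (simp add: S_def)
      moreover have "(p - \<tau>) / t \<in> V" using Oc(4)[OF \<tau>(2), of "y / t"] t(1) y(2) by simp
      ultimately have "\<tau> / t + (p - \<tau>) / t \<in> V" by (rule Oc)
      then show False using n by (simp add: add_divide_distrib[symmetric])
    qed
    ultimately have "card (S t) < card (S p)" using sub T(1)
      by (intro psubset_card_mono) (auto simp: S_def)
    then show False using t(2)[of p] p p0 yp by simp
  qed
  have tpow: "1 / t ^ Suc i \<notin> V" for i
  proof
    assume "1 / t ^ Suc i \<in> V"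
    then have "1 / t ^ Suc i * t ^ i \<in> V" using tO by (intro Oc)
    then show False using tn t0 by simp
  qed
  have unitsub: "1 / (1 - t ^ Suc i) \<in> V" for i
  proof (rule ccontr)
    assume "1 / (1 - t ^ Suc i) \<notin> V"
    moreover have "1 - t ^ Suc i \<in> V" using tO by (intro Oc)
    ultimately have "1 - t ^ Suc i \<in> M" by (simp add: M_def)
    then have "(1 - t ^ Suc i) / t \<in> V" by (rule gen)
    then have "(1 - t ^ Suc i) / t + t ^ i \<in> V" using tO by (intro Oc)
    then show False using tn t0 by (simp add: diff_divide_distrib)
  qed
  \<comment> \<open>As long as \<open>t ^ j\<close> divides \<open>z\<close>, the powers of
    \<open>t\<close> with exponents below \<open>j\<close> are incongruent modulo \<open>z\<close>,
    so \<open>j\<close> is bounded by the number of classes modulo \<open>z\<close>. This makes the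
    valuation discrete.\<close>
  have bound: "\<exists>C. \<forall>j. z / t ^ j \<in> V \<longrightarrow> j \<le> C" if z: "z \<in> V" "z \<noteq> 0" for z
  proof -
    obtain C where C: "\<And>Y. finite Y \<and> Y \<subseteq> V \<and> incong ((*) z ` V) Y \<Longrightarrow> card Y \<le> C"
      using fin[OF z] by blast
    have "j \<le> C" if j: "z / t ^ j \<in> V" for j
    proof -
      have ij: False if ik: "i < k" "k < j" "(t ^ i - t ^ k) / z \<in> V \<or> (t ^ k - t ^ i) / z \<in> V" for i k
      proof -
        obtain l where l: "k = i + Suc l" using less_imp_Suc_add[OF ik(1)] by auto
        have "(t ^ i - t ^ k) / z \<in> V"
        proof (cases "(t ^ i - t ^ k) / z \<in> V")
          case False
          then have "- ((t ^ k - t ^ i) / z) \<in> V" using ik(3) Oc(5) by blast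
          then show ?thesis by (simp add: minus_divide_left)
        qed
        then have "(t ^ i - t ^ k) / z * (1 / (1 - t ^ Suc l)) \<in> V" using unitsub[of l] by (intro Oc)
        moreover have "t ^ i - t ^ k = t ^ i * (1 - t ^ Suc l)" by (simp add: l power_add algebra_simps)
        moreover have "1 - t ^ Suc l \<noteq> 0"
        proof
          assume "1 - t ^ Suc l = 0"
          then have "t * t ^ l = 1" by simp
          then have "1 / t = t ^ l" using t0 by (simp add: field_simps)
          then show False using tn Oc(9)[OF tO, of l] by simp
        qed
        ultimately have "t ^ i / z \<in> V" by simp
        then have "t ^ i / z * (z / t ^ j) \<in> V" using j by (intro Oc)
        then have "t ^ i / t ^ j \<in> V" using z(2) by simp
        moreover obtain d where "j = i + Suc d" using less_imp_Suc_add[OF less_trans[OF ik(1,2)]] by auto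
        ultimately have "1 / t ^ Suc d \<in> V" using t0 by (simp add: power_add)
        then show False using tpow by blast
      qed
      let ?Y = "(\<lambda>i. t ^ i) ` {..<j}"
      have inj: "inj_on (\<lambda>i. t ^ i) {..<j}"
      proof (rule linorder_inj_onI')
        fix i k assume "i \<in> {..<j}" "k \<in> {..<j}" "i < k"
        then show "t ^ i \<noteq> t ^ k" using ij[of i k] Oc(1) by auto
      qed
      have "incong ((*) z ` V) ?Y"
        unfolding incong_def mulI[OF z(2)]
      proof (intro ballI impI)
        fix a b assume "a \<in> ?Y" "b \<in> ?Y" and ab: "(a - b) / z \<in> V"
        then obtain i k where ik: "a = t ^ i" "b = t ^ k" "i < j" "k < j" by auto
        have "i = k" using ij[of i k] ij[of k i] ab ik by (metis linorder_neqE_nat)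
        then show "a = b" using ik by simp
      qed
      moreover have "?Y \<subseteq> V" using Oc(9)[OF tO] by blast
      ultimately have "card ?Y \<le> C" using C[of ?Y] by simp
      then show ?thesis using inj by (simp add: card_image)
    qed
    then show ?thesis by blast
  qed
  define U where "U = {u\<in>V. u \<noteq> 0 \<and> 1 / u \<in> V}"
  have UI: "u * w \<in> U" "1 / u \<in> U" if "u \<in> U" "w \<in> U" for u w
    using that Oc(4)[of u w] Oc(4)[of "1 / u" "1 / w"] by (auto simp: U_def)
  have ex1: "\<exists>n u. u \<in> U \<and> x = t powi n * u" if x: "x \<in> V" "x \<noteq> 0" for x
  proof -
    obtain C where C: "\<And>j. x / t ^ j \<in> V \<Longrightarrow> j \<le> C" using bound[OF x] by blast
    obtain j where j: "x / t ^ j \<in> V" "\<And>i. x / t ^ i \<in> V \<Longrightarrow> i \<le> j"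
      using Nat.ex_has_greatest_nat[of "\<lambda>j. x / t ^ j \<in> V" 0 C] C x(1) by auto
    have "x / t ^ j \<notin> M"
    proof
      assume "x / t ^ j \<in> M"
      then have "x / t ^ Suc j \<in> V" using gen[of "x / t ^ j"] by (simp add: mult.commute)
      then show False using j(2) by fastforce
    qed
    then have "x / t ^ j \<in> U" using j(1) by (auto simp: M_def U_def)
    moreover have "x = t powi (int j) * (x / t ^ j)" using t0 by simp
    ultimately show ?thesis by blast
  qed
  have ex: "\<exists>n u. u \<in> U \<and> x = t powi n * u" if x: "x \<in> L" "x \<noteq> 0" for x
  proof (cases "x \<in> V")
    case False
    then have "1 / x \<in> V" using val x by blast
    then obtain n u where nu: "u \<in> U" "1 / x = t powi n * u" using ex1[of "1 / x"] x by auto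
    have "x = inverse (t powi n * u)" unfolding nu(2)[symmetric] by simp
    then have "x = t powi (- n) * (1 / u)" by (simp add: power_int_minus divide_inverse)
    then show ?thesis using UI(2)[OF nu(1) nu(1)] by blast
  qed (use ex1 x in blast)
  have nonneg: "0 \<le> n" if "t powi n * u \<in> V" "u \<in> U" for n u
  proof (rule ccontr)
    assume "\<not> 0 \<le> n"
    then obtain d where d: "n = - int (Suc d)" by (metis int_cases not_less of_nat_0_le_iff negD linorder_not_le)
    have "t powi n * u * (1 / u) \<in> V" using that(2) by (intro Oc that(1)) (simp add: U_def)
    moreover have "t powi n * u * (1 / u) = t powi n" using that(2) by (simp add: U_def)
    ultimately have "t powi n \<in> V" by (simp only:)
    then have "1 / t ^ Suc d \<in> V" unfolding d power_int_minus power_int_of_nat by (simp add: inverse_eq_divide)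
    then show False using tpow by blast
  qed
  have uniq: "n = m" if "t powi n * u = t powi m * w" "u \<in> U" "w \<in> U" for n m u w
  proof -
    have *: "n \<ge> m" if e: "t powi n * u = t powi m * w" and u: "u \<in> U" "w \<in> U" for n m u w
    proof -
      have "t powi (n - m) * u = w" using e t0 by (simp add: power_int_diff field_simps)
      then show ?thesis using nonneg[of "n - m" u] u by (auto simp: U_def)
    qed
    show ?thesis using *[OF that] *[OF that(1)[symmetric] that(3,2)] by simp
  qed
  define v where "v x = (if x \<in> L - {0} then (THE n. \<exists>u\<in>U. x = t powi n * u) else 0)" for x
  have v_eq: "v x = n" if "x \<in> L" "x = t powi n * u" "u \<in> U" for x n u
  proof -
    have "x \<noteq> 0" using that t0 by (simp add: U_def)
    moreover have "(THE n. \<exists>u\<in>U. x = t powi n * u) = n"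
      by (rule the_equality) (use that uniq in blast)+
    ultimately show ?thesis using that(1) by (simp add: v_def)
  qed
  have v_ge: "n \<le> v x \<longleftrightarrow> x * t powi (- n) \<in> V" if x: "x \<in> L" "x \<noteq> 0" for x n
  proof -
    obtain m u where mu: "u \<in> U" "x = t powi m * u" using ex[OF x] by blast
    have vx: "v x = m" using v_eq[OF x(1) mu(2,1)] .
    have e: "x * t powi (- n) = t powi (m - n) * u" using t0 by (simp add: mu(2) power_int_diff power_int_minus field_simps)
    show ?thesis
    proof
      assume "n \<le> v x"
      then have "t powi (m - n) = t ^ nat (m - n)" using vx by (simp add: power_int_def)
      then show "x * t powi (- n) \<in> V" unfolding e using Oc(9)[OF tO] mu(1) Oc(4) by (simp add: U_def)
    next
      assume "x * t powi (- n) \<in> V"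
      then show "n \<le> v x" using nonneg[of "m - n" u] mu(1) vx unfolding e by simp
    qed
  qed
  have "v \<in> places L" unfolding places_def
  proof (intro CollectI conjI ballI impI allI)
    fix a b assume ab: "a \<in> L - {0}" "b \<in> L - {0}"
    obtain m u where mu: "u \<in> U" "a = t powi m * u" using ex ab by blast
    obtain n w where nw: "w \<in> U" "b = t powi n * w" using ex ab by blast
    have "a * b = t powi (m + n) * (u * w)" using mu(2) nw(2) t0 by (simp add: power_int_add mult_ac)
    then show "v (a * b) = v a + v b"
      using v_eq[of a m u] v_eq[of b n w] v_eq[of "a * b" "m + n" "u * w"] ab mu nw UI(1) Lc(4)[of a b] by auto
    assume s: "a + b \<noteq> 0"
    let ?n = "min (v a) (v b)"
    have "a * t powi (- ?n) \<in> V" "b * t powi (- ?n) \<in> V" using v_ge[of a ?n] v_ge[of b ?n] ab by auto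
    then have "(a + b) * t powi (- ?n) \<in> V" using Oc(6) by (metis distrib_right)
    then show "?n \<le> v (a + b)" using v_ge[of "a + b" ?n] s ab Lc(6)[of a b] by auto
  next
    have "v t = 1" using v_eq[of t 1 1] tL Oc(2) by (auto simp: U_def)
    then show "\<exists>x\<in>L - {0}. v x = 1" using tL t0 by auto
  next
    fix x assume "x \<notin> L - {0}"
    then show "v x = 0" by (auto simp: v_def)
  qed
  moreover have "1 \<le> v y" using v_ge[OF y(1,2), of 1] gen[OF yM] by (simp add: power_int_minus field_simps)
  ultimately show ?thesis by force
qed

section \<open>Weak approximation\<close>

text \<open>Inclusion of the valuation rings gives \<open>w x = v x * w t\<close> for a uniformizer
  \<open>t\<close> of \<open>v\<close>. As \<open>w\<close> takes the value \<open>1\<close>, the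
  integer \<open>w t\<close> divides \<open>1\<close>, and it is nonnegative.\<close>

lemma place_eqI:
  assumes L: "is_subfield L" and v: "v \<in> places L" and w: "w \<in> places L"
    and le: "\<And>x. x \<in> L \<Longrightarrow> x \<noteq> 0 \<Longrightarrow> 0 \<le> v x \<Longrightarrow> 0 \<le> w x"
  shows "v = w"
proof -
  interpret v: place L v using L v by unfold_locales
  interpret w: place L w using L w by unfold_locales
  note Lc = subfield_closed[OF L]
  have zero: "w x = 0" if x: "x \<in> L" "x \<noteq> 0" "v x = 0" for x
    using le[of x] le[of "inverse x"] v.v_inverse[of x] w.v_inverse[of x] x Lc(10)[of x] by simp
  obtain t where t: "t \<in> L" "t \<noteq> 0" "v t = 1" by (rule v.uniformizer)
  have wv: "w x = v x * w t" if x: "x \<in> L" "x \<noteq> 0" for x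
  proof -
    have tp: "t powi v x \<in> L" "t powi v x \<noteq> 0" using t Lc(12) by auto
    have "v (x / t powi v x) = 0" using v.v_divide[OF x(1) tp(1) x(2) tp(2)] v.v_powi[OF t(1,2)] t(3) by simp
    moreover have "x / t powi v x \<in> L" by (rule Lc(11)[OF x(1) tp(1)])
    ultimately have "w (x / t powi v x) = 0" using zero x tp by simp
    then show ?thesis using w.v_divide[OF x(1) tp(1) x(2) tp(2)] w.v_powi[OF t(1,2)] by simp
  qed
  have "0 \<le> w t" using le[of t] t by simp
  obtain s where s: "s \<in> L" "s \<noteq> 0" "w s = 1" by (rule w.uniformizer)
  have "v s * w t = 1" using wv[OF s(1,2)] s(3) by simp
  then have "w t = 1" using \<open>0 \<le> w t\<close> by (metis zmult_eq_1_iff less_eq_int_code(1) zle_iff_zadd zero_le_numeral neg_0_le_iff_le not_one_le_zero)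
  show ?thesis
  proof
    fix x show "v x = w x"
    proof (cases "x \<in> L - {0}")
      case True
      then show ?thesis using wv \<open>w t = 1\<close> by simp
    next
      case False
      then show ?thesis using v w by (simp add: places_def)
    qed
  qed
qed

text \<open>Neither valuation ring contains the other, and the quotient of an element integral only
  at \<open>v\<close> by one integral only at \<open>w\<close> has the required signs.\<close>

lemma place_separate:
  assumes L: "is_subfield L" and v: "v \<in> places L" and w: "w \<in> places L" and "v \<noteq> w"
  shows "\<exists>x\<in>L. x \<noteq> 0 \<and> 0 < v x \<and> w x < 0"
proof -
  interpret v: place L v using L v by unfold_locales
  interpret w: place L w using L w by unfold_locales
  obtain a where a: "a \<in> L" "a \<noteq> 0" "0 \<le> v a" "w a < 0"
    using place_eqI[OF L v w] \<open>v \<noteq> w\<close> by (meson linorder_not_less)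
  obtain b where b: "b \<in> L" "b \<noteq> 0" "0 \<le> w b" "v b < 0"
    using place_eqI[OF L w v] \<open>v \<noteq> w\<close> by (metis linorder_not_less)
  have "a / b \<in> L" "a / b \<noteq> 0" using a b subfield_closed(11)[OF L] by auto
  moreover have "v (a / b) = v a - v b" "w (a / b) = w a - w b"
    using v.v_divide[of a b] w.v_divide[of a b] a b by auto
  ultimately show ?thesis using a b by (intro bexI[of _ "a / b"]) auto
qed

text \<open>If \<open>x\<close> fails at the new place \<open>w\<close>, it is replaced by
  \<open>x + y ^ n\<close>. For large \<open>n\<close> the power dominates wherever \<open>y\<close>
  has a pole, and at the other places of \<open>Z\<close> the pole of \<open>x\<close>
  survives.\<close>

lemma place_separate_finite:
  assumes L: "is_subfield L" and v: "v \<in> places L" and Z: "finite Z" "Z \<subseteq> places L" "v \<notin> Z"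
  shows "\<exists>x\<in>L. x \<noteq> 0 \<and> 0 < v x \<and> (\<forall>w\<in>Z. w x < 0)"
  using Z
proof (induction Z rule: finite_induct)
  case empty
  interpret v: place L v using L v by unfold_locales
  show ?case by (rule v.uniformizer) force
next
  case (insert w Z)
  interpret v: place L v using L v by unfold_locales
  interpret w: place L w using L insert.prems by unfold_locales auto
  note Lc = subfield_closed[OF L]
  obtain x where x: "x \<in> L" "x \<noteq> 0" "0 < v x" "\<And>u. u \<in> Z \<Longrightarrow> u x < 0" using insert by auto
  have "v \<noteq> w" "w \<in> places L" using insert.prems by auto
  then obtain y where y: "y \<in> L" "y \<noteq> 0" "0 < v y" "w y < 0" using place_separate[OF L v] by blast
  show ?case
  proof (cases "w x < 0")
    case True
    then show ?thesis using x by (intro bexI[of _ x]) auto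
  next
    case False
    obtain n :: nat where n: "0 < n" "\<And>u. u \<in> Z \<Longrightarrow> - int n < u x"
    proof
      fix u assume "u \<in> Z"
      then have "nat (- u x) \<le> (\<Sum>u\<in>Z. nat (- u x))" using insert.hyps(1) by (intro member_le_sum) auto
      then have "nat (- u x) < Suc (\<Sum>u\<in>Z. nat (- u x))" by (rule le_imp_less_Suc)
      then show "- int (Suc (\<Sum>u\<in>Z. nat (- u x))) < u x" by linarith
    qed simp
    have yn: "y ^ n \<in> L" "y ^ n \<noteq> 0" using y Lc by auto
    have big: "x + y ^ n \<noteq> 0 \<and> u (x + y ^ n) < 0" if u: "u \<in> places L" "u y < 0" "- int n < u x" for u
    proof -
      interpret u: place L u using L u by unfold_locales
      have e: "u (y ^ n) = int n * u y" using u.v_power[OF y(1,2)] .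
      have "int n * u y \<le> int n * (-1)" using u(2) by (intro mult_left_mono) auto
      then have "u (y ^ n) + 1 \<le> u x" using e u(3) by linarith
      then have "x \<in> val_ge L u (u (y ^ n) + 1)" using x by (simp add: val_ge_def)
      from u.v_add_eq[OF yn this] have "y ^ n + x \<noteq> 0 \<and> u (y ^ n + x) = u (y ^ n)" .
      moreover have "int n * u y < 0" using u(2) n(1) by (simp add: mult_pos_neg)
      ultimately show ?thesis using e by (simp add: add.commute)
    qed
    have w: "x + y ^ n \<noteq> 0 \<and> w (x + y ^ n) < 0"
      using big[of w] w.v y(4) False n(1) by simp
    have "u (x + y ^ n) < 0" if u: "u \<in> Z" for u
    proof -
      have up: "u \<in> places L" using u insert.prems by auto
      interpret u: place L u using L up by unfold_locales
      show ?thesis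
      proof (cases "u y < 0")
        case True
        then show ?thesis using big[OF up True n(2)[OF u]] by simp
      next
        case False
        have "y ^ n \<in> val_ge L u (u x + 1)" using u.v_power[OF y(1,2), of n] False yn x(4)[OF u]
          by (auto simp: val_ge_def intro: order_trans[of _ 0])
        then show ?thesis using u.v_add_eq[OF x(1,2)] x(4)[OF u] by simp
      qed
    qed
    moreover have "0 < v (x + y ^ n)"
    proof -
      have "v (y ^ n) = int n * v y" using v.v_power[OF y(1,2)] .
      then have "0 < v (y ^ n)" using y(3) n(1) by simp
      then show ?thesis using v.v_add[OF x(1) yn(1) x(2) yn(2)] w x(3) by linarith
    qed
    ultimately show ?thesis using w x(1) yn(1) Lc(6) by (intro bexI[of _ "x + y ^ n"]) auto
  qed
qed

text \<open>For \<open>y\<close> vanishing at \<open>v\<close> and with poles on \<open>Z\<close>,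
  the element \<open>1 / (1 + y ^ m)\<close> is close to \<open>1\<close> at \<open>v\<close> and
  close to \<open>0\<close> on \<open>Z\<close>.\<close>

lemma place_indicator:
  assumes L: "is_subfield L" and v: "v \<in> places L" and Z: "finite Z" "Z \<subseteq> places L" "v \<notin> Z"
  shows "\<exists>x\<in>L. x - 1 \<in> val_ge L v (int n) \<and> (\<forall>w\<in>Z. x \<in> val_ge L w (int n))"
proof -
  interpret v: place L v using L v by unfold_locales
  note Lc = subfield_closed[OF L]
  obtain y where y: "y \<in> L" "y \<noteq> 0" "0 < v y" "\<And>w. w \<in> Z \<Longrightarrow> w y < 0"
    using place_separate_finite[OF assms] by blast
  \<comment> \<open>One more than \<open>n\<close>, so that \<open>y ^ m\<close> has positive value
    at \<open>v\<close> even for \<open>n = 0\<close>, and \<open>1 + y ^ m\<close> is a unit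
    there.\<close>
  define m where "m = Suc n"
  have ym: "y ^ m \<in> L" "y ^ m \<noteq> 0" using y Lc by auto
  have vy: "v (y ^ m) = int m * v y" by (rule v.v_power[OF y(1,2)])
  have "int m * 1 \<le> int m * v y" using y(3) by (intro mult_left_mono) auto
  then have vy': "int n + 1 \<le> v (y ^ m)" unfolding vy by (simp only: m_def of_nat_Suc mult_1_right add.commute)
  then have "y ^ m \<in> val_ge L v (v 1 + 1)" using ym by (simp add: val_ge_def)
  then have s: "1 + y ^ m \<noteq> 0" "v (1 + y ^ m) = 0" using v.v_add_eq[of 1 "y ^ m"] Lc(2) by auto
  have sL: "1 + y ^ m \<in> L" using ym Lc by auto
  define x where "x = 1 / (1 + y ^ m)"
  have "x - 1 = - (y ^ m / (1 + y ^ m))" using s(1) by (simp add: x_def field_simps)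
  moreover have "v (y ^ m / (1 + y ^ m)) = v (y ^ m)" using v.v_divide[OF ym(1) sL ym(2) s(1)] s(2) by simp
  then have "y ^ m / (1 + y ^ m) \<in> val_ge L v (int n)" using vy' ym sL Lc(11) by (simp add: val_ge_def)
  ultimately have 1: "x - 1 \<in> val_ge L v (int n)" using v.val_ge_uminus by simp
  have 2: "x \<in> val_ge L w (int n)" if w: "w \<in> Z" for w
  proof -
    have wp: "w \<in> places L" using w Z by auto
    interpret w: place L w using L wp by unfold_locales
    have e: "w (y ^ m) = int m * w y" by (rule w.v_power[OF y(1,2)])
    have "int m * w y \<le> int m * (-1)" using y(4)[OF w] by (intro mult_left_mono) auto
    then have le: "w (y ^ m) \<le> - int n - 1" using e by (simp add: m_def)
    then have "1 \<in> val_ge L w (w (y ^ m) + 1)" using Lc(2) by (simp add: val_ge_def)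
    from w.v_add_eq[OF ym this] have "w (1 + y ^ m) = w (y ^ m)" by (simp add: add.commute)
    then have "w x = - w (y ^ m)" unfolding x_def using w.v_divide[OF Lc(2) sL] s(1) by simp
    then show ?thesis using le sL Lc(2,11) by (simp add: val_ge_def x_def)
  qed
  have "x \<in> L" unfolding x_def using sL Lc by auto
  with 1 2 show ?thesis by blast
qed

text \<open>The prescribed values are combined with weights close to \<open>1\<close> at one place
  and to \<open>0\<close> at the others. The precision \<open>N\<close> of the weights compensates
  the poles of the \<open>\<rho> w\<close>.\<close>

lemma weak_approximation:
  assumes L: "is_subfield L" and Z: "finite Z" "Z \<subseteq> places L" and \<rho>: "\<And>v. v \<in> Z \<Longrightarrow> \<rho> v \<in> L"
  shows "\<exists>y\<in>L. \<forall>v\<in>Z. y - \<rho> v \<in> val_ge L v n"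
proof -
  note Lc = subfield_closed[OF L]
  define N where "N = (\<Sum>v\<in>Z. \<Sum>w\<in>Z. nat (n - v (\<rho> w)))"
  have N: "n \<le> v (\<rho> w) + int N" if "v \<in> Z" "w \<in> Z" for v w
  proof -
    have "nat (n - v (\<rho> w)) \<le> (\<Sum>w\<in>Z. nat (n - v (\<rho> w)))" using Z(1) that by (intro member_le_sum) auto
    also have "\<dots> \<le> N" unfolding N_def using Z(1) that
      by (intro member_le_sum[of v Z "\<lambda>v. \<Sum>w\<in>Z. nat (n - v (\<rho> w))"]) auto
    finally show ?thesis by linarith
  qed
  have "\<forall>v\<in>Z. \<exists>x\<in>L. x - 1 \<in> val_ge L v (int N) \<and> (\<forall>w\<in>Z - {v}. x \<in> val_ge L w (int N))"
    using Z by (intro ballI place_indicator[OF L]) auto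
  then obtain x where x: "\<And>v. v \<in> Z \<Longrightarrow> x v \<in> L \<and> x v - 1 \<in> val_ge L v (int N) \<and> (\<forall>w\<in>Z - {v}. x v \<in> val_ge L w (int N))"
    by metis
  define y where "y = (\<Sum>w\<in>Z. \<rho> w * x w)"
  have "y \<in> L" unfolding y_def using x \<rho> by (intro Lc) auto
  moreover have "y - \<rho> v \<in> val_ge L v n" if v: "v \<in> Z" for v
  proof -
    have vp: "v \<in> places L" using v Z by auto
    interpret v: place L v using L vp by unfold_locales
    have self: "\<rho> w \<in> val_ge L v (v (\<rho> w))" if "w \<in> Z" for w using \<rho> that by (simp add: val_ge_def)
    have "y - \<rho> v = \<rho> v * (x v - 1) + (\<Sum>w\<in>Z - {v}. \<rho> w * x w)"
      unfolding y_def using Z(1) v by (simp add: sum.remove algebra_simps)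
    moreover have "\<rho> v * (x v - 1) \<in> val_ge L v n"
      using v.val_ge_mult[OF self[OF v], of "x v - 1" "int N"] x[OF v] N[OF v v] v.val_ge_mono by blast
    moreover have "\<rho> w * x w \<in> val_ge L v n" if w: "w \<in> Z - {v}" for w
      using v.val_ge_mult[OF self, of w "x w" "int N"] x[of w] N[OF v, of w] v.val_ge_mono w v by blast
    then have "(\<Sum>w\<in>Z - {v}. \<rho> w * x w) \<in> val_ge L v n"
      by (intro subspace_sum[of "{0, 1}"]) (auto simp: is_subspace_def v.zero_val_ge v.val_ge_add)
    ultimately show ?thesis using v.val_ge_add by simp
  qed
  ultimately show ?thesis by blast
qed

section \<open>The product formula and Riemann's inequality\<close>

locale ffield =
  fixes F k :: "'c::field set"
  assumes F_finite: "finite F" and ff: "function_field F k"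
begin

lemma F_subfield: "is_subfield F" and k_subfield: "is_subfield k" and F_subset: "F \<subseteq> k"
  and F_exact: "x \<in> k \<Longrightarrow> algebraic_over F x \<Longrightarrow> x \<in> F"
  using ff by (auto simp: function_field_def)

lemmas F_subring = subfield_imp_subring[OF F_subfield]
lemmas k_subring = subfield_imp_subring[OF k_subfield]
lemmas k_closed = subfield_closed[OF k_subfield]

lemma card_F: "2 \<le> card F"
proof -
  have "card {0::'c, 1} \<le> card F"
    using F_finite F_subring by (intro card_mono) (auto intro: subring_0 subring_1)
  then show ?thesis by simp
qed

lemma F_power_le_iff: "card F ^ m \<le> card F ^ n \<longleftrightarrow> m \<le> n"
  using card_F by (intro power_increasing_iff) simp

lemma placeI: "v \<in> places k \<Longrightarrow> place k v"
  using k_subfield by unfold_locales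

lemma k_span: obtains t B where "finite B" "B \<subseteq> k" "k \<subseteq> lin_span (ratfuns F t) B"
proof -
  obtain t where t: "t \<in> k" "finite_over (is_subfield hull (F \<union> {t})) k"
    using ff by (auto simp: function_field_def)
  let ?H = "is_subfield hull (F \<union> {t})"
  obtain B where B: "finite B" "k = lin_span ?H B"
    using t(2) unfolding finite_over_def lin_span_def by blast
  have "B \<subseteq> k" unfolding B(2) using lin_span_base[OF subfield_imp_subring[OF is_subfield_hull] B(1)] by blast
  moreover have "k \<subseteq> lin_span (ratfuns F t) B"
  proof
    fix x assume "x \<in> k"
    then have "x \<in> lin_span ?H B" using B(2) by simp
    then obtain c where "\<forall>b\<in>B. c b \<in> ?H" "x = (\<Sum>b\<in>B. c b * b)" by (rule lin_spanE)
    then show "x \<in> lin_span (ratfuns F t) B"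
      using hull_subset_ratfuns[OF F_subring, of t] by (auto intro!: lin_spanI)
  qed
  ultimately show thesis using that B(1) by blast
qed

lemma k_indep_bounded: "x \<in> k \<Longrightarrow> \<exists>N. \<forall>Y. finite Y \<and> Y \<subseteq> k \<and> x_indep F x Y \<longrightarrow> card Y \<le> N"
proof -
  assume x: "x \<in> k"
  obtain t B where B: "finite B" "B \<subseteq> k" "k \<subseteq> lin_span (ratfuns F t) B" by (rule k_span)
  have "x * b \<in> lin_span (ratfuns F t) B" if "b \<in> B" for b
    using that B x k_closed(4)[of x b] by blast
  from x_indep_bounded[OF F_subfield F_finite B(1) this] obtain N where
    "\<forall>Y. finite Y \<and> Y \<subseteq> lin_span (ratfuns F t) B \<and> x_indep F x Y \<longrightarrow> card Y \<le> N" by blast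
  then show ?thesis using B(3) by (intro exI[of _ N]) blast
qed

text \<open>For transcendental \<open>x\<close> this is the degree of \<open>k\<close> over the
  field generated by \<open>F\<close> and \<open>x\<close>, and for constants it is
  \<open>0\<close>. As the greatest size of an independent set it can be compared directly with
  cardinalities.\<close>

definition dimx :: "'c \<Rightarrow> nat" where
  "dimx x = (GREATEST n. \<exists>Y. finite Y \<and> Y \<subseteq> k \<and> x_indep F x Y \<and> card Y = n)"

lemma
  assumes "x \<in> k"
  shows dimx_ge: "finite Y \<Longrightarrow> Y \<subseteq> k \<Longrightarrow> x_indep F x Y \<Longrightarrow> card Y \<le> dimx x"
    and dimx_attained: "\<exists>Y. finite Y \<and> Y \<subseteq> k \<and> x_indep F x Y \<and> card Y = dimx x"
proof -
  let ?P = "\<lambda>n. \<exists>Y. finite Y \<and> Y \<subseteq> k \<and> x_indep F x Y \<and> card Y = n"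
  obtain N where N: "\<forall>Y. finite Y \<and> Y \<subseteq> k \<and> x_indep F x Y \<longrightarrow> card Y \<le> N"
    using k_indep_bounded[OF assms] by blast
  have bd: "\<And>n. ?P n \<Longrightarrow> n \<le> N" using N by blast
  have P0: "?P 0" by (intro exI[of _ "{}"]) (auto simp: x_indep_def)
  show "finite Y \<Longrightarrow> Y \<subseteq> k \<Longrightarrow> x_indep F x Y \<Longrightarrow> card Y \<le> dimx x"
    unfolding dimx_def by (rule Greatest_le_nat[of ?P _ N]) (use bd in blast)+
  show "?P (dimx x)" unfolding dimx_def by (rule GreatestI_nat[of ?P, OF P0 bd])
qed

abbreviation deg :: "('c \<Rightarrow> int) \<Rightarrow> nat" where
  "deg v \<equiv> place_degree F k v"

text \<open>The residue field is finite because \<open>incong_multiples_bounded\<close> applies to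
  the valuation ring and a uniformizer; hence \<open>place_degree\<close> is a genuine
  dimension.\<close>

lemma residue_transversal:
  assumes v: "v \<in> places k"
  obtains T where "finite T" "T \<subseteq> val_ge k v 0" "card T = card F ^ deg v" "incong (val_ge k v 1) T"
    "\<And>x. x \<in> val_ge k v 0 \<Longrightarrow> \<exists>t\<in>T. x - t \<in> val_ge k v 1"
proof -
  interpret v: place k v by (rule placeI[OF v])
  obtain x where x: "x \<in> k" "x \<noteq> 0" "v x = 1" by (rule v.uniformizer)
  have sub: "is_subspace F (val_ge k v n)" for n by (rule v.val_ge_subspace[OF F_subfield F_finite F_subset])
  interpret fin_quotient F "val_ge k v 0" "val_ge k v 1"
    by unfold_locales (use F_subfield F_finite sub v.val_ge_mono in auto)
  have "F \<subseteq> val_ge k v 0" using v.finite_field_val_ge[OF F_subfield F_finite F_subset] by blast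
  have bd: "card Y \<le> card F ^ dimx x" if Y: "finite Y" "Y \<subseteq> val_ge k v 0" "incong (val_ge k v 1) Y" for Y
  proof (rule incong_multiples_bounded[OF F_subfield F_finite v.val_ge_subring \<open>F \<subseteq> val_ge k v 0\<close> _ x(2) _ Y(1,2)])
    show "x \<in> val_ge k v 0" using x by (simp add: val_ge_def)
    show "incong ((*) x ` val_ge k v 0) Y" using Y(3) v.val_ge_multiples[OF x(1,2), of 0] x(3) by simp
    show "card Y' \<le> dimx x" if "finite Y'" "Y' \<subseteq> val_ge k v 0" "x_indep F x Y'" for Y'
      using dimx_ge[OF x(1)] that v.val_ge_subset by blast
  qed
  have d: "deg v = quotient_dim F (val_ge k v 0) (val_ge k v 1)"
    by (simp add: place_degree_def local_ring_eq place_power_eq)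
  show thesis
    by (rule quotient_dim_transversal[of "dimx x"]) (use bd that in \<open>auto simp: d\<close>)
qed

lemma deg_pos: "v \<in> places k \<Longrightarrow> 0 < deg v"
proof (rule ccontr)
  assume v: "v \<in> places k" and "\<not> 0 < deg v"
  interpret v: place k v by (rule placeI[OF v])
  obtain T where T: "card T = card F ^ deg v" "\<And>x. x \<in> val_ge k v 0 \<Longrightarrow> \<exists>t\<in>T. x - t \<in> val_ge k v 1"
    using residue_transversal[OF v] by metis
  have "card T = 1" using T(1) \<open>\<not> 0 < deg v\<close> by simp
  then obtain t where t: "T = {t}" by (meson card_1_singletonE)
  have "1 - t \<in> val_ge k v 1" "0 - t \<in> val_ge k v 1"
    using T(2)[of 1] T(2)[of 0] t k_closed(1,2) by (auto simp: val_ge_def)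
  then have "(1 - t) - (0 - t) \<in> val_ge k v 1" by (rule v.val_ge_diff)
  then show False by (simp add: val_ge_def)
qed

text \<open>Expansions with \<open>n\<close> digits from a residue system, in powers of a
  uniformizer.\<close>

lemma power_incong_exists:
  assumes v: "v \<in> places k"
  shows "\<exists>T. finite T \<and> T \<subseteq> val_ge k v 0 \<and> card T = card F ^ (n * deg v) \<and> incong (val_ge k v (int n)) T"
proof (induction n)
  case 0
  have "0 \<in> val_ge k v 0" by (simp add: val_ge_def k_closed)
  then show ?case by (intro exI[of _ "{0}"]) (auto simp: incong_def)
next
  case (Suc n)
  interpret v: place k v by (rule placeI[OF v])
  obtain x where x: "x \<in> k" "x \<noteq> 0" "v x = 1" by (rule v.uniformizer)
  have xn: "x ^ n \<in> k" "x ^ n \<noteq> 0" "v (x ^ n) = int n" using x k_closed(9) v.v_power[OF x(1,2)] by auto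
  obtain T where T: "finite T" "T \<subseteq> val_ge k v 0" "card T = card F ^ (n * deg v)" "incong (val_ge k v (int n)) T"
    using Suc by blast
  obtain S where S: "finite S" "S \<subseteq> val_ge k v 0" "card S = card F ^ deg v" "incong (val_ge k v 1) S"
    using residue_transversal[OF v] by metis
  let ?f = "\<lambda>(a, b). a + x ^ n * b"
  have xb: "x ^ n * b \<in> val_ge k v (int n)" if "b \<in> val_ge k v 0" for b
    using v.val_ge_multiple[OF xn(1,2), of b 0] that xn(3) by simp
  have key: "a = a' \<and> b = b'"
    if "a \<in> T" "a' \<in> T" "b \<in> S" "b' \<in> S" "(a + x ^ n * b) - (a' + x ^ n * b') \<in> val_ge k v (int (Suc n))" for a a' b b'
  proof -
    have b: "b \<in> val_ge k v 0" "b' \<in> val_ge k v 0" using that S by auto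
    have "x ^ n * b - x ^ n * b' \<in> val_ge k v (int n)" using xb b v.val_ge_diff by blast
    moreover have "(a + x ^ n * b) - (a' + x ^ n * b') \<in> val_ge k v (int n)"
      using that(5) v.val_ge_mono[of "int n" "int (Suc n)"] by auto
    ultimately have "((a + x ^ n * b) - (a' + x ^ n * b')) - (x ^ n * b - x ^ n * b') \<in> val_ge k v (int n)"
      using v.val_ge_diff by blast
    then have "a - a' \<in> val_ge k v (int n)" by (simp add: algebra_simps)
    then have a: "a = a'" using T(4) that by (auto simp: incong_def)
    then have "x ^ n * (b - b') \<in> val_ge k v (v (x ^ n) + 1)" using that(5) xn(3) by (simp add: algebra_simps)
    then have "b - b' \<in> val_ge k v 1" using v.val_ge_multiple[OF xn(1,2)] by blast
    then show ?thesis using a S(4) that by (auto simp: incong_def)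
  qed
  have inj: "inj_on ?f (T \<times> S)"
    using key v.zero_val_ge by (auto intro!: inj_onI)
  have "finite (?f ` (T \<times> S))" using T S by auto
  moreover have "?f ` (T \<times> S) \<subseteq> val_ge k v 0"
  proof clarsimp
    fix a b assume "a \<in> T" "b \<in> S"
    then have "a \<in> val_ge k v 0" "x ^ n * b \<in> val_ge k v 0"
      using T(2) S(2) xb v.val_ge_mono[of 0 "int n"] by auto
    then show "a + x ^ n * b \<in> val_ge k v 0" by (rule v.val_ge_add)
  qed
  moreover have "card (?f ` (T \<times> S)) = card F ^ (Suc n * deg v)"
    using inj T S by (simp add: card_image card_cartesian_product power_add)
  moreover have "incong (val_ge k v (int (Suc n))) (?f ` (T \<times> S))"
    unfolding incong_def using key by auto
  ultimately show ?case by blast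
qed

text \<open>By weak approximation the ring \<open>R\<close> of functions regular on \<open>Z\<close>
  realizes all families of residues of order \<open>v x\<close> at the places of \<open>Z\<close>.
  Different families stay incongruent modulo \<open>x * R\<close>, and that quotient has at most
  \<open>card F ^ dimx x\<close> elements.\<close>

lemma zeros_degree_le:
  assumes x: "x \<in> k" "x \<noteq> 0" and Z: "finite Z" "Z \<subseteq> places k" "\<And>v. v \<in> Z \<Longrightarrow> 0 < v x"
  shows "(\<Sum>v\<in>Z. nat (v x) * deg v) \<le> dimx x"
proof -
  define R where "R = {y\<in>k. \<forall>v\<in>Z. y \<in> val_ge k v 0}"
  have pl: "place k v" if "v \<in> Z" for v using placeI that Z by blast
  have R: "is_subring R"
    unfolding is_subring_def R_def
    using k_closed subring_closed[OF place.val_ge_subring[OF pl]] by auto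
  have FR: "F \<subseteq> R"
  proof
    fix a assume a: "a \<in> F"
    have "a \<in> val_ge k v 0" if "v \<in> Z" for v
      using place.finite_field_val_ge[OF pl[OF that] F_subfield F_finite F_subset a] .
    then show "a \<in> R" using a F_subset by (auto simp: R_def)
  qed
  have xR: "x \<in> R" using x Z(3) by (fastforce simp: R_def val_ge_def)
  have "\<forall>v\<in>Z. \<exists>T. finite T \<and> T \<subseteq> val_ge k v 0 \<and> card T = card F ^ (nat (v x) * deg v) \<and> incong (val_ge k v (int (nat (v x)))) T"
    using power_incong_exists Z(2) by blast
  then obtain T where T: "\<And>v. v \<in> Z \<Longrightarrow> finite (T v) \<and> T v \<subseteq> val_ge k v 0 \<and>
      card (T v) = card F ^ (nat (v x) * deg v) \<and> incong (val_ge k v (int (nat (v x)))) (T v)" by metis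
  have T1: "T v \<subseteq> k" if "v \<in> Z" for v using T[OF that] by (auto simp: val_ge_def)
  define n where "n = (\<Sum>v\<in>Z. nat (v x))"
  have "\<exists>y\<in>k. \<forall>v\<in>Z. y - \<rho> v \<in> val_ge k v (int n)" if "\<rho> \<in> Pi\<^sub>E Z T" for \<rho>
    using T1 that by (intro weak_approximation[OF k_subfield Z(1,2)]) (auto dest: PiE_mem)
  then obtain y where y: "\<And>\<rho>. \<rho> \<in> Pi\<^sub>E Z T \<Longrightarrow> y \<rho> \<in> k \<and> (\<forall>v\<in>Z. y \<rho> - \<rho> v \<in> val_ge k v (int n))"
    by metis
  have yv: "y \<rho> - \<rho> v \<in> val_ge k v (v x)" if "\<rho> \<in> Pi\<^sub>E Z T" "v \<in> Z" for \<rho> v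
  proof -
    have "nat (v x) \<le> n" unfolding n_def using Z(1) that(2) by (intro member_le_sum) auto
    then have "v x \<le> int n" by linarith
    then show ?thesis using y[OF that(1)] that(2) place.val_ge_mono[OF pl[OF that(2)]] by blast
  qed
  have yR: "y \<rho> \<in> R" if \<rho>: "\<rho> \<in> Pi\<^sub>E Z T" for \<rho>
  proof -
    have "y \<rho> \<in> val_ge k v 0" if v: "v \<in> Z" for v
    proof -
      have "y \<rho> - \<rho> v \<in> val_ge k v 0"
        using yv[OF \<rho> v] place.val_ge_mono[OF pl[OF v], of 0 "v x"] Z(3)[OF v] by auto
      moreover have "\<rho> v \<in> val_ge k v 0" using T[OF v] \<rho> v by (auto dest: PiE_mem)
      ultimately have "y \<rho> - \<rho> v + \<rho> v \<in> val_ge k v 0" by (rule place.val_ge_add[OF pl[OF v]])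
      then show ?thesis by simp
    qed
    then show ?thesis using y[OF \<rho>] by (simp add: R_def)
  qed
  have key: "\<rho> = \<sigma>" if \<rho>: "\<rho> \<in> Pi\<^sub>E Z T" and \<sigma>: "\<sigma> \<in> Pi\<^sub>E Z T" and d: "y \<rho> - y \<sigma> \<in> (*) x ` R" for \<rho> \<sigma>
  proof (rule PiE_ext[OF \<rho> \<sigma>])
    fix v assume v: "v \<in> Z"
    interpret v: place k v by (rule pl[OF v])
    have "y \<rho> - y \<sigma> \<in> val_ge k v (v x)"
      using d v.val_ge_multiples[OF x, of 0] v by (auto simp: R_def)
    moreover have "(y \<rho> - \<rho> v) - (y \<sigma> - \<sigma> v) \<in> val_ge k v (v x)"
      using yv[OF \<rho> v] yv[OF \<sigma> v] by (rule v.val_ge_diff)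
    ultimately have "(y \<rho> - y \<sigma>) - ((y \<rho> - \<rho> v) - (y \<sigma> - \<sigma> v)) \<in> val_ge k v (v x)" by (rule v.val_ge_diff)
    then have "\<rho> v - \<sigma> v \<in> val_ge k v (int (nat (v x)))" using Z(3)[OF v] by (simp add: algebra_simps)
    moreover have "\<rho> v \<in> T v" "\<sigma> v \<in> T v" using \<rho> \<sigma> v by (auto dest: PiE_mem)
    moreover have "incong (val_ge k v (int (nat (v x)))) (T v)" using T[OF v] by simp
    ultimately show "\<rho> v = \<sigma> v" unfolding incong_def by blast
  qed
  have inj: "inj_on y (Pi\<^sub>E Z T)"
  proof (rule inj_onI)
    fix \<rho> \<sigma> assume "\<rho> \<in> Pi\<^sub>E Z T" "\<sigma> \<in> Pi\<^sub>E Z T" "y \<rho> = y \<sigma>"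
    moreover have "0 \<in> (*) x ` R" using subring_0[OF R] by force
    ultimately show "\<rho> = \<sigma>" using key by simp
  qed
  have "card (y ` Pi\<^sub>E Z T) \<le> card F ^ dimx x"
  proof (rule incong_multiples_bounded[OF F_subfield F_finite R FR xR x(2)])
    show "card Y \<le> dimx x" if "finite Y" "Y \<subseteq> R" "x_indep F x Y" for Y
      using dimx_ge[OF x(1)] that by (auto simp: R_def)
    show "finite (y ` Pi\<^sub>E Z T)" using Z(1) T by (intro finite_imageI finite_PiE) auto
    show "y ` Pi\<^sub>E Z T \<subseteq> R" using yR by blast
    show "incong ((*) x ` R) (y ` Pi\<^sub>E Z T)" unfolding incong_def using key by blast
  qed
  moreover have "card (y ` Pi\<^sub>E Z T) = card F ^ (\<Sum>v\<in>Z. nat (v x) * deg v)"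
    using inj T Z(1) by (simp add: card_image card_PiE power_sum)
  ultimately show ?thesis by (simp add: F_power_le_iff)
qed

lemma finite_zeros:
  assumes x: "x \<in> k" "x \<noteq> 0" shows "finite {v\<in>places k. 0 < v x}"
proof (rule ccontr)
  assume "infinite {v\<in>places k. 0 < v x}"
  then obtain Z where Z: "Z \<subseteq> {v\<in>places k. 0 < v x}" "finite Z" "card Z = Suc (dimx x)"
    by (meson infinite_arbitrarily_large)
  have "card Z \<le> (\<Sum>v\<in>Z. nat (v x) * deg v)"
  proof -
    have "(\<Sum>v\<in>Z. 1) \<le> (\<Sum>v\<in>Z. nat (v x) * deg v)"
    proof (rule sum_mono)
      fix v assume "v \<in> Z"
      then show "1 \<le> nat (v x) * deg v" using deg_pos[of v] Z(1) by auto
    qed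
    then show ?thesis by simp
  qed
  then show False using zeros_degree_le[OF x, of Z] Z by auto
qed

lemma finite_poles:
  assumes x: "x \<in> k" shows "finite {v\<in>places k. v x < 0}"
proof (cases "x = 0")
  case True
  then have "{v\<in>places k. v x < 0} = {}" by (auto simp: places_def)
  then show ?thesis by (simp only: finite.emptyI)
next
  case False
  have "finite {v\<in>places k. 0 < v (inverse x)}" using x False k_closed by (intro finite_zeros) auto
  moreover have "{v\<in>places k. 0 < v (inverse x)} = {v\<in>places k. v x < 0}"
    by (intro Collect_cong conj_cong refl) (simp add: place.v_inverse[OF placeI x False])
  ultimately show ?thesis by simp
qed

section \<open>Riemann-Roch spaces and their cardinalities\<close>

definition rr_space :: "(('c \<Rightarrow> int) \<Rightarrow> int) \<Rightarrow> 'c set" where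
  "rr_space D = {x\<in>k. \<forall>v\<in>places k. x \<in> val_ge k v (- D v)}"

lemma rr_space_subspace: "is_subspace F (rr_space D)"
  unfolding is_subspace_def rr_space_def
  using k_closed F_subset
    subspace_0[OF place.val_ge_subspace[OF placeI F_subfield F_finite F_subset]]
    subspace_add[OF place.val_ge_subspace[OF placeI F_subfield F_finite F_subset]]
    subspace_scale[OF place.val_ge_subspace[OF placeI F_subfield F_finite F_subset]]
  by auto

lemma rr_space_mono:
  assumes "\<And>v. v \<in> places k \<Longrightarrow> D v \<le> D' v" shows "rr_space D \<subseteq> rr_space D'"
proof
  fix y assume y: "y \<in> rr_space D"
  have "y \<in> val_ge k v (- D' v)" if v: "v \<in> places k" for v
    using place.val_ge_mono[OF placeI[OF v], of "- D' v" "- D v"] assms[OF v] y v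
    by (auto simp: rr_space_def)
  then show "y \<in> rr_space D'" using y by (simp add: rr_space_def)
qed

text \<open>After division by the power \<open>s\<close> of a uniformizer the elements of the larger
  space are integral at \<open>w\<close>, and their residues there determine them modulo the smaller
  space.\<close>

lemma card_rr_space_step:
  assumes w: "w \<in> places k" and fin: "finite (rr_space D)"
  shows "finite (rr_space (\<lambda>v. D v + (if v = w then 1 else 0))) \<and>
    card (rr_space (\<lambda>v. D v + (if v = w then 1 else 0))) \<le> card F ^ deg w * card (rr_space D)"
proof -
  let ?D = "\<lambda>v. D v + (if v = w then 1 else 0)"
  interpret w: place k w by (rule placeI[OF w])
  obtain x where x: "x \<in> k" "x \<noteq> 0" "w x = 1" by (rule w.uniformizer)
  obtain T where T: "finite T" "T \<subseteq> val_ge k w 0" "card T = card F ^ deg w"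
    "\<And>x. x \<in> val_ge k w 0 \<Longrightarrow> \<exists>t\<in>T. x - t \<in> val_ge k w 1"
    using residue_transversal[OF w] by metis
  define s where "s = x powi (- D w - 1)"
  have s: "s \<in> k" "s \<noteq> 0" "w s = - D w - 1"
    using x k_closed(12) w.v_powi[OF x(1,2)] by (auto simp: s_def)
  have eq: "rr_space ?D \<inter> val_ge k w (- D w) = rr_space D"
  proof (intro equalityI subsetI)
    fix y assume y: "y \<in> rr_space ?D \<inter> val_ge k w (- D w)"
    have "y \<in> val_ge k v (- D v)" if "v \<in> places k" for v
      using y that by (cases "v = w") (auto simp: rr_space_def)
    then show "y \<in> rr_space D" using y by (auto simp: rr_space_def)
  next
    fix y assume y: "y \<in> rr_space D"
    have "rr_space D \<subseteq> rr_space ?D" by (rule rr_space_mono) auto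
    moreover have "y \<in> val_ge k w (- D w)" using y w by (simp add: rr_space_def)
    ultimately show "y \<in> rr_space ?D \<inter> val_ge k w (- D w)" using y by blast
  qed
  have "finite (rr_space ?D) \<and> card (rr_space ?D) \<le> card ((*) s ` T) * card (rr_space ?D \<inter> val_ge k w (- D w))"
  proof (rule card_cover_le[OF F_subring rr_space_subspace w.val_ge_subspace[OF F_subfield F_finite F_subset]])
    show "finite ((*) s ` T)" using T by simp
    show "finite (rr_space ?D \<inter> val_ge k w (- D w))" using fin eq by simp
    fix y assume "y \<in> rr_space ?D"
    then have "y \<in> val_ge k w (w s + 0)" using w s(3) by (auto simp: rr_space_def)
    then obtain u where u: "u \<in> val_ge k w 0" "y = s * u"
      using w.val_ge_multiples[OF s(1,2), of 0] by blast
    obtain t where t: "t \<in> T" "u - t \<in> val_ge k w 1" using T(4)[OF u(1)] by blast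
    have "s * (u - t) \<in> val_ge k w (w s + 1)" using w.val_ge_multiple[OF s(1,2)] t(2) by blast
    then have "y - s * t \<in> val_ge k w (- D w)" using s(3) u(2) by (simp add: right_diff_distrib)
    then show "\<exists>t\<in>(*) s ` T. y - t \<in> val_ge k w (- D w)" using t(1) by blast
  qed
  moreover have "card ((*) s ` T) = card F ^ deg w" using s(2) T(3) by (simp add: card_image inj_on_def)
  ultimately show ?thesis using eq by simp
qed

lemma le_mult_trans: "(x::nat) \<le> a * y \<Longrightarrow> y \<le> b * z \<Longrightarrow> x \<le> a * b * z"
  unfolding mult.assoc by (rule order_trans[OF _ mult_le_mono2])

lemma card_rr_space_add:
  assumes Z: "finite Z" "Z \<subseteq> places k" and fin: "finite (rr_space D)"
  shows "finite (rr_space (\<lambda>v. D v + (if v \<in> Z then int (E v) else 0))) \<and>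
    card (rr_space (\<lambda>v. D v + (if v \<in> Z then int (E v) else 0)))
      \<le> card F ^ (\<Sum>v\<in>Z. E v * deg v) * card (rr_space D)"
  using Z
proof (induction Z rule: finite_induct)
  case empty
  then show ?case using fin by simp
next
  case (insert w Z)
  define D' where "D' = (\<lambda>v. D v + (if v \<in> Z then int (E v) else 0))"
  have w: "w \<in> places k" using insert.prems by simp
  have IH: "finite (rr_space D')" "card (rr_space D') \<le> card F ^ (\<Sum>v\<in>Z. E v * deg v) * card (rr_space D)"
    using insert by (auto simp: D'_def)
  let ?D = "\<lambda>n v. D' v + (if v = w then int n else 0)"
  have "finite (rr_space (?D n)) \<and> card (rr_space (?D n)) \<le> card F ^ (n * deg w) * card (rr_space D')" for n
  proof (induction n)
    case 0
    have "?D 0 = D'" by (rule ext) simp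
    then show ?case using IH(1) by (simp only: mult_0 power_0 mult_1_left order_refl simp_thms)
  next
    case (Suc n)
    have e: "(\<lambda>v. ?D n v + (if v = w then 1 else 0)) = ?D (Suc n)" by (rule ext) simp
    have "finite (rr_space (?D (Suc n))) \<and> card (rr_space (?D (Suc n))) \<le> card F ^ deg w * card (rr_space (?D n))"
      using card_rr_space_step[OF w conjunct1[OF Suc]] unfolding e .
    moreover from this have "card (rr_space (?D (Suc n))) \<le> card F ^ deg w * card F ^ (n * deg w) * card (rr_space D')"
      by (rule le_mult_trans[OF conjunct2 conjunct2[OF Suc]])
    ultimately show ?case by (simp only: power_add mult_Suc)
  qed
  then have *: "finite (rr_space (?D (E w))) \<and> card (rr_space (?D (E w))) \<le> card F ^ (E w * deg w) * card (rr_space D')" .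
  have e: "?D (E w) = (\<lambda>v. D v + (if v \<in> insert w Z then int (E v) else 0))"
    by (rule ext) (use insert.hyps in \<open>auto simp: D'_def\<close>)
  have "card (rr_space (?D (E w))) \<le> card F ^ (E w * deg w) * card F ^ (\<Sum>v\<in>Z. E v * deg v) * card (rr_space D)"
    by (rule le_mult_trans[OF conjunct2[OF *] IH(2)])
  with * show ?case unfolding e sum.insert[OF insert.hyps] power_add by blast
qed

text \<open>An element with a zero is not algebraic over \<open>F\<close>, for \<open>F\<close> is
  the exact field of constants and constants have value \<open>0\<close>. Hence
  \<open>inverse z\<close> is no unit in the ring it generates over \<open>F\<close>, and
  \<open>place_exists\<close> supplies a place where it vanishes.\<close>

lemma negative_has_pole:
  assumes z: "z \<in> k" "z \<noteq> 0" and w: "w \<in> places k" "0 < w z"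
  shows "\<exists>v\<in>places k. v z < 0"
proof -
  have iz: "inverse z \<in> k" "inverse z \<noteq> 0" using z k_closed by auto
  have "inverse z * poly p (inverse z) \<noteq> 1" if p: "p \<in> polys_over F" for p
  proof
    assume e: "inverse z * poly p (inverse z) = 1"
    let ?q = "pCons (-1) p"
    have "?q \<in> polys_over F" using p subring_uminus[OF F_subring subring_1[OF F_subring]]
      by (simp add: pCons_polys_over[OF F_subring])
    then have "algebraic_over F (inverse z)" unfolding algebraic_over_def
      using e by (intro exI[of _ ?q]) (auto simp: polys_over_def)
    then have "inverse z \<in> F" using F_exact iz by blast
    then have "w (inverse z) = 0"
      using place.v_finite_field[OF placeI[OF w(1)] F_subfield F_finite F_subset] iz by blast
    then show False using place.v_inverse[OF placeI[OF w(1)] z] w(2) by simp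
  qed
  then obtain v where v: "v \<in> places k" "0 < v (inverse z)"
    using place_exists[OF F_subfield F_finite F_subset k_subfield iz _ k_indep_bounded] by blast
  then show ?thesis using place.v_inverse[OF placeI[OF v(1)] z] by auto
qed

lemma rr_space_negative:
  assumes "w \<in> places k" shows "rr_space (\<lambda>v. if v = w then -1 else 0) = {0}"
proof (intro equalityI subsetI)
  fix z assume z: "z \<in> rr_space (\<lambda>v. if v = w then -1 else 0)"
  show "z \<in> {0}"
  proof (rule ccontr)
    assume "z \<notin> {0}"
    then have "z \<in> k" "z \<noteq> 0" "0 < w z" using z assms by (auto simp: rr_space_def val_ge_def)
    then obtain v where v: "v \<in> places k" "v z < 0" using negative_has_pole assms by blast
    then have "v \<noteq> w" using \<open>0 < w z\<close> by auto
    then show False using z v \<open>z \<noteq> 0\<close> by (auto simp: rr_space_def val_ge_def)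
  qed
next
  fix z :: 'c assume "z \<in> {0}"
  then show "z \<in> rr_space (\<lambda>v. if v = w then -1 else 0)"
    using subspace_0[OF rr_space_subspace] by simp
qed

text \<open>The count starts from the coefficient \<open>-1\<close> at the single place
  \<open>w\<close>, whose space is zero, and adds one place at a time. The extra
  \<open>deg w\<close> in the exponent is the cost of returning to the divisor
  \<open>0\<close>.\<close>

lemma card_rr_space_le:
  assumes w: "w \<in> places k" and Z: "finite Z" "Z \<subseteq> places k"
  shows "finite (rr_space (\<lambda>v. if v \<in> Z then int (E v) else 0)) \<and>
    card (rr_space (\<lambda>v. if v \<in> Z then int (E v) else 0)) \<le> card F ^ ((\<Sum>v\<in>Z. E v * deg v) + deg w)"
proof -
  let ?D = "\<lambda>v. if v = w then -1 else (0::int)"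
  have D0: "finite (rr_space ?D)" "card (rr_space ?D) = 1" using rr_space_negative[OF w] by auto
  have e: "(\<lambda>v. ?D v + (if v = w then 1 else 0)) = (\<lambda>v. 0)" by (rule ext) simp
  have 0: "finite (rr_space (\<lambda>v. 0))" "card (rr_space (\<lambda>v. 0)) \<le> card F ^ deg w"
    using card_rr_space_step[OF w D0(1)] D0(2) unfolding e by auto
  have "finite (rr_space (\<lambda>v. 0 + (if v \<in> Z then int (E v) else 0))) \<and>
      card (rr_space (\<lambda>v. 0 + (if v \<in> Z then int (E v) else 0))) \<le> card F ^ (\<Sum>v\<in>Z. E v * deg v) * card (rr_space (\<lambda>v. 0))"
    by (rule card_rr_space_add[OF Z 0(1)])
  then have "finite (rr_space (\<lambda>v. if v \<in> Z then int (E v) else 0)) \<and>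
      card (rr_space (\<lambda>v. if v \<in> Z then int (E v) else 0)) \<le> card F ^ (\<Sum>v\<in>Z. E v * deg v) * card (rr_space (\<lambda>v. 0))"
    by (simp only: add_0)
  with mult_le_mono2[OF 0(2), of "card F ^ (\<Sum>v\<in>Z. E v * deg v)"] show ?thesis
    unfolding power_add by (blast intro: order_trans)
qed

text \<open>Combinations of an independent set \<open>Y\<close> of \<open>dimx x\<close> elements
  with polynomials in \<open>x\<close> of degree less than \<open>l\<close> are distinct. Their
  poles are at most \<open>l\<close> times those of \<open>x\<close> plus a divisor \<open>C\<close>
  that comes from \<open>Y\<close> and does not depend on \<open>l\<close>.\<close>

lemma rr_space_lower:
  assumes x: "x \<in> k" and w: "w \<in> places k"
  obtains Z C where "finite Z" "Z \<subseteq> places k" "{v\<in>places k. v x < 0} \<subseteq> Z"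
    "\<And>l. card F ^ (l * dimx x) \<le> card (rr_space (\<lambda>v. if v \<in> Z then int (l * nat (- v x) + C v) else 0))"
proof -
  obtain Y where Y: "finite Y" "Y \<subseteq> k" "x_indep F x Y" "card Y = dimx x" using dimx_attained[OF x] by blast
  define Z where "Z = {v\<in>places k. v x < 0} \<union> (\<Union>y\<in>Y. {v\<in>places k. v y < 0})"
  define C where "C v = (\<Sum>y\<in>Y. nat (- v y))" for v :: "'c \<Rightarrow> int"
  have Z: "finite Z" "Z \<subseteq> places k" "{v\<in>places k. v x < 0} \<subseteq> Z"
    using finite_poles x Y by (auto simp: Z_def)
  have "card F ^ (l * dimx x) \<le> card (rr_space (\<lambda>v. if v \<in> Z then int (l * nat (- v x) + C v) else 0))" (is "_ \<le> card ?R") for l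
  proof -
    let ?s = "\<lambda>f. \<Sum>y\<in>Y. poly (f y) x * y"
    have "?s f \<in> ?R" if f: "f \<in> Y \<rightarrow>\<^sub>E bpolys F l" for f
    proof -
      have fy: "f y \<in> bpolys F l" if "y \<in> Y" for y using f that by (rule PiE_mem)
      have "poly (f y) x * y \<in> ?R" if y: "y \<in> Y" for y
      proof -
        have fk: "f y \<in> polys_over k" using fy[OF y] F_subset by (auto simp: bpolys_def polys_over_def)
        have "poly (f y) x * y \<in> val_ge k v (- (if v \<in> Z then int (l * nat (- v x) + C v) else 0))" if v: "v \<in> places k" for v
        proof -
          interpret v: place k v by (rule placeI[OF v])
          have p1: "poly (f y) x \<in> val_ge k v (- int (l * nat (- v x)))"
            unfolding poly_altdef
          proof (rule subspace_sum[OF v.val_ge_subspace[OF F_subfield F_finite F_subset]])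
            fix i assume "i \<in> {..degree (f y)}"
            show "coeff (f y) i * x ^ i \<in> val_ge k v (- int (l * nat (- v x)))"
            proof (cases "i < l \<and> x \<noteq> 0")
              case True
              have "int i * v x \<ge> - int (l * nat (- v x))"
              proof (cases "v x \<ge> 0")
                case False
                then have "int i * (- v x) \<le> int l * (- v x)" using True by (intro mult_right_mono) auto
                then show ?thesis using False by simp
              qed simp
              then have "x ^ i \<in> val_ge k v (- int (l * nat (- v x)))"
                using x True v.v_power[OF x, of i] k_closed(9) by (auto simp: val_ge_def)
              moreover have "coeff (f y) i \<in> F" using fy[OF y] by (auto simp: bpolys_def polys_over_def)
              ultimately show ?thesis
                by (intro subspace_scale[OF v.val_ge_subspace[OF F_subfield F_finite F_subset]])
            next
              case False
              then have "coeff (f y) i = 0 \<or> x = 0" using fy[OF y] by (auto simp: bpolys_def)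
              then show ?thesis
              proof
                assume "x = 0"
                have "coeff (f y) i \<in> F" "x ^ i \<in> F" using \<open>x = 0\<close> fy[OF y] subring_0[OF F_subring] subring_1[OF F_subring]
                  by (cases i; auto simp: bpolys_def polys_over_def)+
                then have "coeff (f y) i * x ^ i \<in> F" using subring_mult[OF F_subring] by blast
                then have "coeff (f y) i * x ^ i \<in> val_ge k v 0"
                  by (rule v.finite_field_val_ge[OF F_subfield F_finite F_subset])
                then show ?thesis using v.val_ge_mono[of "- int (l * nat (- v x))" 0] by auto
              qed (simp add: v.zero_val_ge)
            qed
          qed
          have "y \<in> val_ge k v (- int (C v))"
          proof -
            have "nat (- v y) \<le> C v" unfolding C_def using Y(1) y by (intro member_le_sum) auto
            then show ?thesis using Y(2) y by (auto simp: val_ge_def)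
          qed
          from v.val_ge_mult[OF p1 this]
          have m: "poly (f y) x * y \<in> val_ge k v (- int (l * nat (- v x) + C v))" by simp
          show ?thesis
          proof (cases "v \<in> Z")
            case False
            then have "\<not> v x < 0" "\<And>y. y \<in> Y \<Longrightarrow> \<not> v y < 0" using v by (auto simp: Z_def)
            moreover from this have "C v = 0" unfolding C_def by (intro sum.neutral ballI) (meson linorder_not_less nat_0_iff neg_le_0_iff_le)
            ultimately have z: "l * nat (- v x) + C v = 0" by simp
            show ?thesis using m False unfolding z by simp
          qed (use m in simp)
        qed
        moreover have "poly (f y) x * y \<in> k"
          using poly_in_subring[OF k_subring fk x] Y(2) y k_closed(4) by blast
        ultimately show ?thesis by (simp add: rr_space_def)
      qed
      then show ?thesis by (intro subspace_sum[OF rr_space_subspace])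
    qed
    then have sub: "?s ` (Y \<rightarrow>\<^sub>E bpolys F l) \<subseteq> ?R" by (intro image_subsetI)
    have "finite ?R" using card_rr_space_le[OF w Z(1,2), of "\<lambda>v. l * nat (- v x) + C v"] by (rule conjunct1)
    then have "card (?s ` (Y \<rightarrow>\<^sub>E bpolys F l)) \<le> card ?R" using sub by (intro card_mono)
    moreover have "card (?s ` (Y \<rightarrow>\<^sub>E bpolys F l)) = card F ^ (l * dimx x)"
      using x_indep_inj[OF F_subring Y(3)] Y(1,4) card_bpolys[OF F_subring F_finite]
      by (simp add: card_image card_PiE power_mult)
    ultimately show ?thesis by simp
  qed
  then show thesis using that Z by blast
qed

lemma sum_poles:
  assumes "finite Z" "Z \<subseteq> places k" "{v\<in>places k. v x < 0} \<subseteq> Z"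
  shows "(\<Sum>v\<in>Z. nat (- v x) * deg v) = (\<Sum>v | v \<in> places k \<and> v x < 0. nat (- v x) * deg v)"
  using assms by (intro sum.mono_neutral_right) auto

text \<open>The same spaces are counted from below and from above: for every \<open>l\<close>,
  \<open>l * dimx x\<close> is at most \<open>l\<close> times the degree of the poles plus a
  constant.\<close>

lemma poles_degree_ge:
  assumes x: "x \<in> k" and w: "w \<in> places k"
  shows "dimx x \<le> (\<Sum>v | v \<in> places k \<and> v x < 0. nat (- v x) * deg v)"
proof (rule ccontr)
  let ?d = "\<Sum>v | v \<in> places k \<and> v x < 0. nat (- v x) * deg v"
  assume n: "\<not> dimx x \<le> ?d"
  obtain Z C where Z: "finite Z" "Z \<subseteq> places k" "{v\<in>places k. v x < 0} \<subseteq> Z" and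
    C: "\<And>l. card F ^ (l * dimx x) \<le> card (rr_space (\<lambda>v. if v \<in> Z then int (l * nat (- v x) + C v) else 0))"
    using rr_space_lower[OF x w] by blast
  define c where "c = (\<Sum>v\<in>Z. C v * deg v) + deg w"
  have s: "(\<Sum>v\<in>Z. (l * nat (- v x) + C v) * deg v) = l * ?d + (\<Sum>v\<in>Z. C v * deg v)" for l
    unfolding sum_poles[OF Z, symmetric] by (simp add: distrib_right sum.distrib sum_distrib_left mult.assoc)
  have "card F ^ (l * dimx x) \<le> card F ^ (l * ?d + c)" for l
    using C[of l] card_rr_space_le[OF w Z(1,2), of "\<lambda>v. l * nat (- v x) + C v"]
    unfolding s c_def by (simp add: add.assoc)
  then have le: "l * dimx x \<le> l * ?d + c" for l by (simp add: F_power_le_iff)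
  have "Suc c * Suc ?d \<le> Suc c * dimx x" using n by (intro mult_le_mono2) simp
  then show False using le[of "Suc c"] by simp
qed

text \<open>The zeros count at most \<open>dimx x\<close> and the poles at least
  \<open>dimx x\<close>. Applying both bounds also to \<open>inverse x\<close>, where zeros and
  poles are exchanged, closes the chain of inequalities.\<close>

lemma zeros_eq_poles:
  assumes x: "x \<in> k" "x \<noteq> 0"
  shows "(\<Sum>v | v \<in> places k \<and> 0 < v x. nat (v x) * deg v) = (\<Sum>v | v \<in> places k \<and> v x < 0. nat (- v x) * deg v)"
    and "w \<in> places k \<Longrightarrow> dimx x = (\<Sum>v | v \<in> places k \<and> v x < 0. nat (- v x) * deg v)"
proof -
  let ?z = "\<lambda>x. \<Sum>v | v \<in> places k \<and> 0 < v x. nat (v x) * deg v"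
  let ?p = "\<lambda>x. \<Sum>v | v \<in> places k \<and> v x < 0. nat (- v x) * deg v"
  have ix: "inverse x \<in> k" "inverse x \<noteq> 0" using x k_closed by auto
  have zi: "?z (inverse x) = ?p x"
    by (intro sum.cong Collect_cong conj_cong refl) (simp_all add: place.v_inverse[OF placeI x])
  have pi: "?p (inverse x) = ?z x"
    by (intro sum.cong Collect_cong conj_cong refl) (simp_all add: place.v_inverse[OF placeI x])
  have z: "?z x \<le> dimx x" if "x \<in> k" "x \<noteq> 0" for x
    by (rule zeros_degree_le[OF that finite_zeros[OF that]]) auto
  have "?z x = ?p x \<and> dimx x = ?p x" if w: "w \<in> places k" for w
  proof -
    have "?p x \<le> ?z x" using order_trans[OF z[OF ix] poles_degree_ge[OF ix(1) w]] unfolding zi pi .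
    then have "?p x \<le> dimx x" using z[OF x] by (rule order_trans)
    then have d: "dimx x = ?p x" using poles_degree_ge[OF x(1) w] by (rule le_antisym[rotated])
    moreover have "?z x = ?p x" using z[OF x] \<open>?p x \<le> ?z x\<close> unfolding d by (rule le_antisym)
    ultimately show ?thesis by (rule conjI[rotated])
  qed
  then show "w \<in> places k \<Longrightarrow> dimx x = ?p x" by blast
  show "?z x = ?p x"
  proof (cases "places k = {}")
    case False
    then show ?thesis using \<open>\<And>w. w \<in> places k \<Longrightarrow> ?z x = ?p x \<and> dimx x = ?p x\<close> by blast
  qed simp
qed

theorem product_formula:
  assumes x: "x \<in> k" "x \<noteq> 0" and Z: "finite Z" "Z \<subseteq> places k" "{v\<in>places k. v x \<noteq> 0} \<subseteq> Z"
  shows "(\<Sum>v\<in>Z. v x * int (deg v)) = 0"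
proof -
  let ?p = "{v\<in>places k. v x < 0}" and ?z = "{v\<in>places k. 0 < v x}"
  have "(\<Sum>v\<in>Z. v x * int (deg v)) = (\<Sum>v\<in>?z \<union> ?p. v x * int (deg v))"
    using Z by (intro sum.mono_neutral_right) auto
  also have "\<dots> = (\<Sum>v\<in>?z. v x * int (deg v)) + (\<Sum>v\<in>?p. v x * int (deg v))"
    using finite_zeros[OF x] finite_poles[OF x(1)] by (intro sum.union_disjoint) auto
  also have "(\<Sum>v\<in>?z. v x * int (deg v)) = int (\<Sum>v\<in>?z. nat (v x) * deg v)"
    unfolding of_nat_sum by (rule sum.cong) auto
  also have "(\<Sum>v\<in>?p. v x * int (deg v)) = - int (\<Sum>v\<in>?p. nat (- v x) * deg v)"
    unfolding of_nat_sum sum_negf[symmetric] by (rule sum.cong) auto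
  finally show ?thesis using zeros_eq_poles(1)[OF x] by simp
qed

text \<open>The divisors \<open>B l\<close> are multiples of the poles of one function, and for them
  the dimension is known up to \<open>\<gamma>\<close>. For large \<open>l\<close> the divisor
  \<open>m * w\<close> is linearly equivalent to one below \<open>B l\<close>, and enlarging the
  latter to \<open>B l\<close> multiplies the cardinality by no more than the degrees allow.\<close>

theorem riemann_inequality:
  assumes w: "w \<in> places k"
  obtains \<gamma> where
    "\<And>m. card F ^ (m * deg w) \<le> card F ^ \<gamma> * card (rr_space (\<lambda>v. if v = w then int m else 0))"
proof -
  interpret w: place k w by (rule placeI[OF w])
  obtain x where x: "x \<in> k" "x \<noteq> 0" "w x = 1" by (rule w.uniformizer)
  define n where "n = dimx x"
  have n_eq: "n = (\<Sum>v | v \<in> places k \<and> v x < 0. nat (- v x) * deg v)"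
    unfolding n_def by (rule zeros_eq_poles(2)[OF x(1,2) w])
  have n1: "1 \<le> n"
  proof -
    have "nat (w x) * deg w \<le> dimx x" using zeros_degree_le[OF x(1,2), of "{w}"] w x(3) by simp
    then show ?thesis using deg_pos[OF w] x(3) by (simp add: n_def)
  qed
  obtain Z C where Z: "finite Z" "Z \<subseteq> places k" "{v\<in>places k. v x < 0} \<subseteq> Z" and
    C: "\<And>l. card F ^ (l * n) \<le> card (rr_space (\<lambda>v. if v \<in> Z then int (l * nat (- v x) + C v) else 0))"
    using rr_space_lower[OF x(1) w] unfolding n_def by blast
  define \<gamma> where "\<gamma> = (\<Sum>v\<in>Z. C v * deg v)"
  define B where "B l = (\<lambda>v. if v \<in> Z then int (l * nat (- v x)) else 0)" for l
  have finB: "finite (rr_space (B l))" for l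
    using card_rr_space_le[OF w Z(1,2), of "\<lambda>v. l * nat (- v x)"] unfolding B_def by (rule conjunct1)
  have lB: "card F ^ (l * n) \<le> card F ^ \<gamma> * card (rr_space (B l))" for l
  proof -
    have "(\<lambda>v. B l v + (if v \<in> Z then int (C v) else 0)) = (\<lambda>v. if v \<in> Z then int (l * nat (- v x) + C v) else 0)"
      by (rule ext) (simp add: B_def)
    then show ?thesis using card_rr_space_add[OF Z(1,2) finB[of l], of C] C[of l] by (simp add: \<gamma>_def)
  qed
  have fin: "finite (rr_space D)" if "\<And>v. v \<in> places k \<Longrightarrow> D v \<le> B l v" for D l
    using rr_space_mono[of D "B l"] that finB[of l] by (meson finite_subset)
  have "card F ^ (m * deg w) \<le> card F ^ \<gamma> * card (rr_space (\<lambda>v. if v = w then int m else 0))" for m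
  proof -
    \<comment> \<open>So large that the space of \<open>B l - m * w\<close> must contain a nonzero
      \<open>z\<close>.\<close>
    define l where "l = \<gamma> + m * deg w + 1"
    have ln: "l \<le> l * n" using n1 by simp
    define D where "D v = B l v - (if v = w then int m else 0)" for v
    have e: "(\<lambda>v. D v + (if v \<in> {w} then int m else 0)) = B l" by (rule ext) (simp add: D_def)
    have finD: "finite (rr_space D)" by (rule fin[of _ l]) (auto simp: D_def)
    have "card (rr_space (B l)) \<le> card F ^ (m * deg w) * card (rr_space D)"
      using card_rr_space_add[of "{w}" D "\<lambda>_. m", OF _ _ finD] w unfolding e by simp
    from le_mult_trans[OF lB[of l] this]
    have "card F ^ (l * n) \<le> card F ^ (\<gamma> + m * deg w) * card (rr_space D)" by (simp only: power_add)
    moreover have "card F ^ (\<gamma> + m * deg w) < card F ^ (l * n)"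
      using card_F ln by (intro power_strict_increasing) (auto simp: l_def)
    ultimately have "card (rr_space D) \<noteq> 0 \<and> card (rr_space D) \<noteq> 1" by (metis less_le_not_le mult.right_neutral mult_0_right not_less_zero le_zero_eq)
    then obtain z where z: "z \<in> rr_space D" "z \<noteq> 0"
      using subspace_0[OF rr_space_subspace, of D] by (metis card_1_singleton_iff is_singletonI' is_singleton_altdef empty_iff)
    have zk: "z \<in> k" using z by (simp add: rr_space_def)
    have vz: "- D v \<le> v z" if "v \<in> places k" for v using z that by (auto simp: rr_space_def val_ge_def)
    \<comment> \<open>The divisor \<open>m * w\<close> shifted by the divisor of \<open>z\<close>:
      linearly equivalent to \<open>m * w\<close>, and at most \<open>B l\<close> by the choice of
      \<open>z\<close>.\<close>
    define D' where "D' v = (if v = w then int m else 0) - v z" for v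
    define E where "E v = nat (B l v - D' v)" for v
    have DE: "D' v + int (E v) = B l v" if "v \<in> places k" for v
      using vz[OF that] by (auto simp: D'_def E_def D_def)
    define Z' where "Z' = Z \<union> {w} \<union> {v\<in>places k. v z < 0} \<union> {v\<in>places k. 0 < v z}"
    have Z': "finite Z'" "Z' \<subseteq> places k" using Z w finite_poles[OF zk] finite_zeros[OF zk z(2)] by (auto simp: Z'_def)
    have E0: "E v = 0" if "v \<in> places k" "v \<notin> Z'" for v using that by (auto simp: E_def D'_def B_def Z'_def)
    have finD': "finite (rr_space D')" by (rule fin[of _ l]) (use DE in fastforce)
    have "rr_space (\<lambda>v. D' v + (if v \<in> Z' then int (E v) else 0)) = rr_space (B l)"
    proof -
      have "D' v + (if v \<in> Z' then int (E v) else 0) = B l v" if "v \<in> places k" for v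
        using DE[OF that] E0[OF that] by auto
      then show ?thesis by (auto simp: rr_space_def)
    qed
    then have up: "card (rr_space (B l)) \<le> card F ^ (\<Sum>v\<in>Z'. E v * deg v) * card (rr_space D')"
      using card_rr_space_add[OF Z' finD', of E] by simp
    \<comment> \<open>The degree of \<open>B l - D'\<close>, to which the divisor of
      \<open>z\<close> contributes nothing by the product formula.\<close>
    have "int (\<Sum>v\<in>Z'. E v * deg v) = (\<Sum>v\<in>Z'. (B l v - (if v = w then int m else 0) + v z) * int (deg v))"
      unfolding of_nat_sum
    proof (rule sum.cong)
      fix v assume "v \<in> Z'"
      then have "int (E v) = B l v - (if v = w then int m else 0) + v z" using DE[of v] Z' by (auto simp: D'_def)
      then show "int (E v * deg v) = (B l v - (if v = w then int m else 0) + v z) * int (deg v)" by simp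
    qed simp
    also have "\<dots> = (\<Sum>v\<in>Z'. B l v * int (deg v)) - (\<Sum>v\<in>Z'. (if v = w then int m else 0) * int (deg v)) + (\<Sum>v\<in>Z'. v z * int (deg v))"
      by (simp add: distrib_right left_diff_distrib sum.distrib sum_subtractf)
    also have "(\<Sum>v\<in>Z'. v z * int (deg v)) = 0"
      by (rule product_formula[OF zk z(2) Z']) (auto simp: Z'_def)
    also have "(\<Sum>v\<in>Z'. (if v = w then int m else 0) * int (deg v)) = int m * int (deg w)"
      using Z'(1) by (simp add: Z'_def if_distrib[of "\<lambda>u. u * _"] cong: if_cong)
    also have "(\<Sum>v\<in>Z'. B l v * int (deg v)) = (\<Sum>v\<in>Z. B l v * int (deg v))"
      using Z'(1) by (intro sum.mono_neutral_right) (auto simp: Z'_def B_def)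
    also have "\<dots> = int (\<Sum>v\<in>Z. l * nat (- v x) * deg v)"
      unfolding of_nat_sum by (rule sum.cong) (auto simp: B_def)
    also have "(\<Sum>v\<in>Z. l * nat (- v x) * deg v) = l * n"
      unfolding n_eq sum_poles[OF Z, symmetric] by (simp add: sum_distrib_left mult.assoc)
    finally have s: "(\<Sum>v\<in>Z'. E v * deg v) + m * deg w = l * n" by (simp only: flip: of_nat_mult)
    have "card (rr_space D') = card (rr_space (\<lambda>v. if v = w then int m else 0))"
    proof -
      have "rr_space D' = (*) z ` rr_space (\<lambda>v. if v = w then int m else 0)"
      proof (intro equalityI subsetI)
        fix u assume u: "u \<in> rr_space D'"
        have "u / z \<in> val_ge k v (- (if v = w then int m else 0))" if v: "v \<in> places k" for v
        proof -
          interpret v: place k v by (rule placeI[OF v])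
          have "z * (u / z) \<in> val_ge k v (v z + (- (if v = w then int m else 0)))"
            using u v z(2) by (auto simp: rr_space_def D'_def)
          then show ?thesis using v.val_ge_multiple[OF zk z(2)] by blast
        qed
        then have "u / z \<in> rr_space (\<lambda>v. if v = w then int m else 0)"
          using u zk k_closed(11) by (auto simp: rr_space_def)
        then show "u \<in> (*) z ` rr_space (\<lambda>v. if v = w then int m else 0)"
          using z(2) by (intro image_eqI[of _ _ "u / z"]) auto
      next
        fix u assume "u \<in> (*) z ` rr_space (\<lambda>v. if v = w then int m else 0)"
        then obtain u' where u': "u = z * u'" "u' \<in> rr_space (\<lambda>v. if v = w then int m else 0)" by blast
        have "u \<in> val_ge k v (- D' v)" if v: "v \<in> places k" for v
        proof -
          interpret v: place k v by (rule placeI[OF v])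
          have "z * u' \<in> val_ge k v (v z + (- (if v = w then int m else 0)))"
            using u'(2) v v.val_ge_multiple[OF zk z(2)] unfolding rr_space_def by blast
          then show ?thesis using u'(1) by (auto simp: D'_def)
        qed
        then show "u \<in> rr_space D'" using u' zk k_closed(4) by (auto simp: rr_space_def)
      qed
      then show ?thesis using z(2) by (simp add: card_image inj_on_def)
    qed
    then have "card F ^ (l * n) \<le> card F ^ \<gamma> * (card F ^ (\<Sum>v\<in>Z'. E v * deg v) * card (rr_space (\<lambda>v. if v = w then int m else 0)))"
      using le_mult_trans[OF lB[of l] up] by (simp only: mult.assoc)
    then have "card F ^ (\<Sum>v\<in>Z'. E v * deg v) * card F ^ (m * deg w)
      \<le> card F ^ (\<Sum>v\<in>Z'. E v * deg v) * (card F ^ \<gamma> * card (rr_space (\<lambda>v. if v = w then int m else 0)))"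
      unfolding s[symmetric] power_add by (simp add: mult_ac)
    moreover have "0 < card F ^ (\<Sum>v\<in>Z'. E v * deg v)" using card_F by simp
    ultimately show ?thesis by (simp only: mult_le_cancel1)
  qed
  then show thesis using that by blast
qed

end

section \<open>Monic relations from multiplication matrices\<close>

text \<open>
  The coefficients of the characteristic polynomial of multiplication by \<open>x\<close> are controlled by a
  filtration \<open>R\<close>, so that integrality and size of the coefficients are obtained at once.
\<close>

lemma mult_char_poly:
  fixes x :: "'c::field"
  assumes S: "finite S" "s0 \<in> S" "s0 \<noteq> 0"
    and c: "\<And>s. s \<in> S \<Longrightarrow> x * s = (\<Sum>s'\<in>S. c s s' * s')"
    and R0: "\<And>a. 0 \<in> R a" and Rd: "\<And>a u w. u \<in> R a \<Longrightarrow> w \<in> R a \<Longrightarrow> u - w \<in> R a"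
    and Rm: "\<And>a b u w. u \<in> R a \<Longrightarrow> w \<in> R b \<Longrightarrow> u * w \<in> R (a + b)"
    and R1: "1 \<in> R 0" "1 \<in> R 1" and Rc: "\<And>s s'. s \<in> S \<Longrightarrow> s' \<in> S \<Longrightarrow> c s s' \<in> R (1::nat)"
  shows "\<exists>p. lead_coeff p = 1 \<and> degree p = card S \<and> poly p x = 0 \<and> (\<forall>i. coeff p i \<in> R (card S))"
proof -
  define m where "m = card S"
  obtain f where f: "bij_betw f {..<m} S" using S(1) ex_bij_betw_nat_finite[of S]
    by (auto simp: m_def lessThan_atLeast0)
  define B where "B = mat m m (\<lambda>(i, j). c (f i) (f j))"
  have B: "B \<in> carrier_mat m m" by (simp add: B_def)
  define p where "p = char_poly B"
  have "degree p = m \<and> coeff p m = 1" unfolding p_def by (rule degree_monic_char_poly[OF B])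
  then have p: "degree p = m" "lead_coeff p = 1" by auto
  have fS: "f i \<in> S" if "i < m" for i using f that by (auto simp: bij_betw_def)
  have "eigenvector B (vec m f) x"
    unfolding eigenvector_def
  proof (intro conjI)
    show "vec m f \<in> carrier_vec (dim_row B)" using B by simp
    obtain i where i: "i < m" "f i = s0" using f S(2) by (auto simp: bij_betw_def)
    show "vec m f \<noteq> 0\<^sub>v (dim_row B)"
    proof
      assume "vec m f = 0\<^sub>v (dim_row B)"
      then have "vec m f $ i = 0\<^sub>v m $ i" using B by simp
      then show False using i S(3) by simp
    qed
    show "B *\<^sub>v vec m f = x \<cdot>\<^sub>v vec m f"
    proof (rule eq_vecI)
      fix i assume "i < dim_vec (x \<cdot>\<^sub>v vec m f)"
      then have i: "i < m" by simp
      have "(B *\<^sub>v vec m f) $ i = (\<Sum>j = 0..<m. c (f i) (f j) * f j)"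
        using i by (simp add: B_def scalar_prod_def)
      also have "\<dots> = (\<Sum>s'\<in>S. c (f i) s' * s')"
        using sum.reindex_bij_betw[OF f, of "\<lambda>s'. c (f i) s' * s'"] by (simp add: lessThan_atLeast0)
      also have "\<dots> = x * f i" by (rule c[OF fS[OF i], symmetric])
      finally show "(B *\<^sub>v vec m f) $ i = (x \<cdot>\<^sub>v vec m f) $ i" using i by simp
    qed (simp add: B_def)
  qed
  then have root: "poly p x = 0"
    using eigenvalue_root_char_poly[OF B, of x] by (auto simp: eigenvalue_def p_def)
  define P where "P a = {q. \<forall>i. coeff q i \<in> R a}" for a
  have Pd: "u - w \<in> P a" if "u \<in> P a" "w \<in> P a" for u w a using that Rd by (simp add: P_def)
  have P0: "0 \<in> P a" for a using R0 by (simp add: P_def)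
  have Pu: "- u \<in> P a" if "u \<in> P a" for u a using Pd[OF P0 that] by simp
  have Pa: "u + w \<in> P a" if "u \<in> P a" "w \<in> P a" for u w a using Pd[OF that(1) Pu[OF that(2)]] by simp
  have Ru: "- u \<in> R a" if "u \<in> R a" for u a using Rd[OF R0 that] by simp
  have Ra: "u + w \<in> R a" if "u \<in> R a" "w \<in> R a" for u w a using Rd[OF that(1) Ru[OF that(2)]] by simp
  have Rs: "sum g I \<in> R a" if "\<And>i. i \<in> I \<Longrightarrow> g i \<in> R a" for g :: "nat \<Rightarrow> 'c" and I a
    using that by (induction I rule: infinite_finite_induct) (auto intro: R0 Ra)
  have Pm: "u * w \<in> P (a + b)" if "u \<in> P a" "w \<in> P b" for u w a b
    using that by (auto simp: P_def coeff_mult intro!: Rs Rm)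
  have Ps: "sum g I \<in> P a" if "\<And>i. i \<in> I \<Longrightarrow> g i \<in> P a" for g :: "(nat \<Rightarrow> nat) \<Rightarrow> 'c poly" and I a
    using that by (induction I rule: infinite_finite_induct) (auto intro: P0 Pa)
  have P1: "1 \<in> P 0" using R0 R1 by (auto simp: P_def coeff_1)
  have entry: "char_poly_matrix B $$ (i, j) \<in> P 1" if "i < m" "j < m" for i j
  proof -
    have cR: "- c (f i) (f j) \<in> R 1" by (intro Ru Rc fS that)
    have "char_poly_matrix B $$ (i, j) = (if i = j then [:- c (f i) (f j), 1:] else [:- c (f i) (f j):])"
      using that B by (auto simp: char_poly_matrix_def B_def)
    also have "\<dots> \<in> P 1" using cR R0 R1 by (auto simp: P_def coeff_pCons split: nat.splits)
    finally show ?thesis .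
  qed
  have sgn: "signof \<pi> * u \<in> P a" if "u \<in> P a" for \<pi> u a
    using that Pu by (auto simp: sign_def)
  have prod: "(\<Prod>i = 0..<n. g i) \<in> P n" if "\<And>i. i < n \<Longrightarrow> g i \<in> P 1" for n and g :: "nat \<Rightarrow> 'c poly"
    using that
  proof (induction n)
    case (Suc n)
    then have "(\<Prod>i = 0..<n. g i) * g n \<in> P (n + 1)" by (intro Pm) auto
    then show ?case by simp
  qed (use P1 in simp)
  have "p = (\<Sum>\<pi> | \<pi> permutes {0..<m}. signof \<pi> * (\<Prod>i = 0..<m. char_poly_matrix B $$ (i, \<pi> i)))"
    unfolding p_def char_poly_def by (rule det_def'[OF char_poly_matrix_closed[OF B]])
  also have "\<dots> \<in> P m"
  proof (intro Ps sgn prod entry)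
    fix \<pi> i assume "\<pi> \<in> {\<pi>. \<pi> permutes {0..<m}}" "i < m"
    then show "\<pi> i < m" using permutes_in_image[of \<pi> "{0..<m}" i] by simp
  qed
  finally have "\<forall>i. coeff p i \<in> R m" by (simp add: P_def)
  then show ?thesis using p root unfolding m_def by blast
qed

lemma lin_span_mult_closed:
  assumes R: "is_subring R" and x: "\<And>s. s \<in> S \<Longrightarrow> x * s \<in> lin_span R S" and u: "u \<in> lin_span R S"
  shows "x * u \<in> lin_span R S"
proof -
  obtain c where c: "\<forall>b\<in>S. c b \<in> R" "u = (\<Sum>b\<in>S. c b * b)" by (rule lin_spanE[OF u])
  have "x * u = (\<Sum>b\<in>S. c b * (x * b))" by (simp add: c sum_distrib_left mult_ac)
  also have "\<dots> \<in> lin_span R S"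
  proof (rule subspace_sum[OF lin_span_subspace[OF R]])
    fix b assume "b \<in> S"
    then show "c b * (x * b) \<in> lin_span R S"
      using c(1) x by (intro subspace_scale[OF lin_span_subspace[OF R], of "c b"]) auto
  qed
  finally show ?thesis .
qed

text \<open>With a constant filtration \<open>mult_char_poly\<close> is the Cayley-Hamilton argument
  for integrality.\<close>

lemma monic_relation:
  assumes R: "is_subring R" and S: "finite S" "s0 \<in> S" "s0 \<noteq> 0"
    and x: "\<And>s. s \<in> S \<Longrightarrow> x * s \<in> lin_span R S"
  shows "\<exists>p. lead_coeff p = 1 \<and> degree p = card S \<and> p \<in> polys_over R \<and> poly p x = 0"
proof -
  have "\<forall>s\<in>S. \<exists>c. (\<forall>b\<in>S. c b \<in> R) \<and> x * s = (\<Sum>b\<in>S. c b * b)"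
    using x unfolding lin_span_def by blast
  then obtain c where c: "\<And>s. s \<in> S \<Longrightarrow> (\<forall>b\<in>S. c s b \<in> R) \<and> x * s = (\<Sum>b\<in>S. c s b * b)" by metis
  have "\<exists>p. lead_coeff p = 1 \<and> degree p = card S \<and> poly p x = 0 \<and> (\<forall>i. coeff p i \<in> R)"
    by (rule mult_char_poly[OF S, of x c "\<lambda>_. R"])
      (use c subring_closed(1-4)[OF R] in auto)
  then show ?thesis by (auto simp: polys_over_def)
qed

text \<open>Multiplication by \<open>x\<close> and by \<open>y\<close> preserves the span of the
  products \<open>x ^ i * y ^ j\<close> with exponents below the two degrees, hence so do
  \<open>x - y\<close> and \<open>x * y\<close>.\<close>

lemma integral_over_subring:
  assumes R: "is_subring R" shows "is_subring {x. integral_over R x}"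
proof -
  have const: "integral_over R a" if "a \<in> R" for a
    unfolding integral_over_def using that subring_closed[OF R]
    by (intro exI[of _ "[:- a, 1:]"]) (auto simp: coeff_pCons split: nat.splits)
  have "integral_over R (x - y) \<and> integral_over R (x * y)" if xy: "integral_over R x" "integral_over R y" for x y
  proof -
    obtain p where p: "lead_coeff p = 1" "\<forall>i. coeff p i \<in> R" "poly p x = 0"
      using xy by (auto simp: integral_over_def)
    obtain q where q: "lead_coeff q = 1" "\<forall>i. coeff q i \<in> R" "poly q y = 0"
      using xy by (auto simp: integral_over_def)
    define n m where "n = degree p" "m = degree q"
    have "0 < degree r" if "lead_coeff r = 1" "poly r z = 0" for r :: "'a poly" and z
    proof (rule ccontr)
      assume "\<not> 0 < degree r"
      then have "degree r = 0" by simp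
      then obtain a where "r = [:a:]" by (rule degree_eq_zeroE)
      then show False using that by simp
    qed
    then have nm: "0 < n" "0 < m" unfolding n_m_def using p(1,3) q(1,3) by blast+
    define S where "S = (\<lambda>(i, j). x ^ i * y ^ j) ` ({..<n} \<times> {..<m})"
    have S: "finite S" "1 \<in> S" using nm by (auto simp: S_def intro!: image_eqI[of _ _ "(0, 0)"])
    note sp = lin_span_subspace[OF R]
    have red: "z ^ d = - (\<Sum>i<d. coeff r i * z ^ i)"
      if "lead_coeff r = 1" "poly r z = 0" "d = degree r" for r :: "'a poly" and z d
    proof -
      have "poly r z = (\<Sum>i<Suc d. coeff r i * z ^ i)"
        unfolding poly_altdef that(3) lessThan_Suc_atMost ..
      moreover have "coeff r d = 1" using that(1,3) by simp
      ultimately have "poly r z = (\<Sum>i<d. coeff r i * z ^ i) + z ^ d" by simp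
      then show ?thesis using that(2) by (simp add: eq_neg_iff_add_eq_0 add.commute)
    qed
    have base: "x ^ i * y ^ j \<in> lin_span R S" if "i < n" "j < m" for i j
    proof (rule lin_span_base[OF R S(1)])
      show "x ^ i * y ^ j \<in> S" unfolding S_def using that by (intro image_eqI[of _ _ "(i, j)"]) auto
    qed
    have sc: "a * (u * w) \<in> lin_span R S" if "a \<in> R" "u * w \<in> lin_span R S" for a u w
      by (rule subspace_scale[OF sp that])
    have xS: "x * s \<in> lin_span R S" if s: "s \<in> S" for s
    proof -
      obtain i j where ij: "s = x ^ i * y ^ j" "i < n" "j < m" using s by (auto simp: S_def)
      show ?thesis
      proof (cases "Suc i = n")
        case True
        have "x * s = x ^ n * y ^ j" using ij(1) True[symmetric] by (simp add: mult.assoc)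
        also have "\<dots> = - (\<Sum>i<n. coeff p i * (x ^ i * y ^ j))"
          unfolding red[OF p(1,3) n_m_def(1)] by (simp add: sum_distrib_right mult.assoc)
        also have "\<dots> \<in> lin_span R S"
          using p(2) ij(3) base by (intro subspace_uminus[OF R sp] subspace_sum[OF sp] sc) auto
        finally show ?thesis .
      next
        case False
        then have "x ^ Suc i * y ^ j \<in> lin_span R S" using ij by (intro base) auto
        then show ?thesis using ij(1) by (simp add: mult.assoc)
      qed
    qed
    have yS: "y * s \<in> lin_span R S" if s: "s \<in> S" for s
    proof -
      obtain i j where ij: "s = x ^ i * y ^ j" "i < n" "j < m" using s by (auto simp: S_def)
      show ?thesis
      proof (cases "Suc j = m")
        case True
        have "y * s = x ^ i * y ^ m" using ij(1) True[symmetric] by (simp add: mult_ac)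
        also have "\<dots> = - (\<Sum>j<m. coeff q j * (x ^ i * y ^ j))"
          unfolding red[OF q(1,3) n_m_def(2)] by (simp add: sum_distrib_left mult_ac)
        also have "\<dots> \<in> lin_span R S"
          using q(2) ij(2) base by (intro subspace_uminus[OF R sp] subspace_sum[OF sp] sc) auto
        finally show ?thesis .
      next
        case False
        then have "x ^ i * y ^ Suc j \<in> lin_span R S" using ij by (intro base) auto
        then show ?thesis using ij(1) by (simp add: mult_ac)
      qed
    qed
    have "(x - y) * s \<in> lin_span R S" if "s \<in> S" for s
      using subspace_diff[OF R sp xS[OF that] yS[OF that]] by (simp add: left_diff_distrib)
    moreover have "(x * y) * s \<in> lin_span R S" if "s \<in> S" for s
      using lin_span_mult_closed[OF R xS yS[OF that]] by (simp add: mult.assoc)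
    ultimately show ?thesis
      using monic_relation[OF R S] by (simp add: integral_over_def polys_over_def) (metis one_neq_zero)
  qed
  then show ?thesis using const subring_closed(1,2)[OF R] by (auto simp: is_subring_def)
qed

lemma integral_over_base:
  assumes R: "is_subring R" "a \<in> R" shows "integral_over R a"
  unfolding integral_over_def using assms subring_closed[OF R(1)]
  by (intro exI[of _ "[:- a, 1:]"]) (auto simp: coeff_pCons split: nat.splits)

lemma integral_over_root:
  assumes R: "is_subring R" and x: "x ^ n \<in> R" "0 < n" shows "integral_over R x"
proof -
  let ?p = "Polynomial.monom 1 n - [:x ^ n:]"
  have d: "degree ?p = n"
  proof (rule antisym)
    show "degree ?p \<le> n" by (rule degree_diff_le) (auto simp: degree_monom_le)
    show "n \<le> degree ?p" using x(2) by (intro le_degree) (auto simp: coeff_pCons split: nat.splits)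
  qed
  have "lead_coeff ?p = 1" unfolding d using x(2) by (auto simp: coeff_pCons split: nat.splits)
  moreover have "\<forall>i. coeff ?p i \<in> R" using x subring_closed[OF R] by (auto simp: coeff_pCons split: nat.splits)
  moreover have "poly ?p x = 0" by (simp add: poly_monom)
  ultimately show ?thesis unfolding integral_over_def by blast
qed

text \<open>Factors of the variable are split off, which is harmless since
  \<open>x \<noteq> 0\<close>. The coefficients are only shifted, so every bound or membership known
  for those of \<open>p\<close> passes to \<open>q\<close>.\<close>

lemma nonzero_constant_relation:
  fixes x :: "'c::field"
  assumes "lead_coeff p = 1" "poly p x = 0" "x \<noteq> 0"
  obtains q where "lead_coeff q = 1" "poly q x = 0" "coeff q 0 \<noteq> 0" "degree q \<le> degree p"
    "\<And>i. \<exists>j. coeff q i = coeff p j"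
  using assms
proof (induction "degree p" arbitrary: p thesis rule: less_induct)
  case less
  show ?case
  proof (cases "coeff p 0 = 0")
    case True
    obtain q where q: "p = pCons 0 q" using True by (cases p) auto
    have q0: "q \<noteq> 0" using less.prems(2) q by auto
    have "lead_coeff q = 1" "poly q x = 0" "degree q < degree p"
      using less.prems q q0 by auto
    from less.hyps[OF this(3) _ this(1,2) less.prems(4)] obtain q' where
      q': "lead_coeff q' = 1" "poly q' x = 0" "coeff q' 0 \<noteq> 0" "degree q' \<le> degree q"
        "\<And>i. \<exists>j. coeff q' i = coeff q j" by blast
    show ?thesis
    proof (rule less.prems(1)[OF q'(1-3)])
      show "degree q' \<le> degree p" using q'(4) \<open>degree q < degree p\<close> by simp
      fix i show "\<exists>j. coeff q' i = coeff p j" using q'(5)[of i] q by (metis coeff_pCons_Suc)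
    qed
  next
    case False
    then show ?thesis using less.prems by blast
  qed
qed

text \<open>A relation for \<open>x\<close> with nonzero constant term exhibits
  \<open>inverse x\<close> as a polynomial in \<open>x\<close> over \<open>K\<close>, so closure
  under multiplication yields inverses.\<close>

lemma lin_span_subfield:
  fixes K :: "'c::field set"
  assumes K: "is_subfield K" and S: "finite S" "1 \<in> lin_span K S"
    and SS: "\<And>s s'. s \<in> S \<Longrightarrow> s' \<in> S \<Longrightarrow> s * s' \<in> lin_span K S"
  shows "is_subfield (lin_span K S)"
proof -
  note R = subfield_imp_subring[OF K]
  note sp = lin_span_subspace[OF R]
  have mult: "u * w \<in> lin_span K S" if "u \<in> lin_span K S" "w \<in> lin_span K S" for u w
  proof -
    have "s * u \<in> lin_span K S" if "s \<in> S" for s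
      by (rule lin_span_mult_closed[OF R SS[OF that] \<open>u \<in> _\<close>])
    then show ?thesis using lin_span_mult_closed[OF R _ \<open>w \<in> _\<close>, of u] by (simp add: mult.commute)
  qed
  have ring: "is_subring (lin_span K S)"
    unfolding is_subring_def using mult subspace_diff[OF R sp] subspace_0[OF sp] S(2) by blast
  obtain s0 where s0: "s0 \<in> S" "s0 \<noteq> 0"
  proof (rule ccontr)
    assume "\<not> thesis"
    then have "\<forall>s\<in>S. s = 0" using that by blast
    then have "lin_span K S \<subseteq> {0}" by (auto simp: lin_span_def intro!: sum.neutral)
    then show False using S(2) by auto
  qed
  have "inverse x \<in> lin_span K S" if x: "x \<in> lin_span K S" for x
  proof (cases "x = 0")
    case False
    have "x * s \<in> lin_span K S" if "s \<in> S" for s using mult[OF x lin_span_base[OF R S(1) that]] .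
    from monic_relation[OF R S(1) s0 this] obtain p where
      p: "lead_coeff p = 1" "p \<in> polys_over K" "poly p x = 0" by blast
    from nonzero_constant_relation[OF p(1,3) False] obtain q where
      q: "poly q x = 0" "coeff q 0 \<noteq> 0" "\<And>i. \<exists>j. coeff q i = coeff p j" by metis
    obtain c q' where cq: "q = pCons c q'" by (cases q)
    have qK: "q \<in> polys_over K" using p(2) q(3) by (auto simp: polys_over_def) metis
    then have c: "c \<in> K" "q' \<in> polys_over K" "c \<noteq> 0" using q(2) by (auto simp: cq pCons_polys_over[OF R])
    have "K \<subseteq> lin_span K S" using subspace_scale[OF sp _ S(2)] by (metis mult.right_neutral subsetI)
    then have "poly q' x \<in> lin_span K S"
      using c(2) by (intro poly_in_subring[OF ring _ x]) (auto simp: polys_over_def)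
    moreover have "inverse x = (- inverse c) * poly q' x"
    proof -
      have "c + x * poly q' x = 0" using q(1) by (simp add: cq)
      then have e: "x * poly q' x = - c" by (simp add: eq_neg_iff_add_eq_0 add.commute)
      have "x * ((- inverse c) * poly q' x) = (- inverse c) * (x * poly q' x)" by (simp only: mult.left_commute)
      also have "\<dots> = 1" unfolding e using c(3) by simp
      finally show ?thesis by (rule inverse_unique)
    qed
    moreover have "- inverse c \<in> K" using c(1) subfield_closed[OF K] by auto
    ultimately show ?thesis by (metis subspace_scale[OF sp])
  qed (use subspace_0[OF sp] in simp)
  then show ?thesis using ring unfolding is_subfield_def is_subring_def by blast
qed

section \<open>Ultrametric absolute values\<close>

text \<open>Horner's scheme with a reduction by \<open>q\<close> in each step keeps the degree below
  that of \<open>q\<close>, and there are finitely many such polynomials over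
  \<open>F\<close>.\<close>

lemma finite_adjoin_algebraic:
  fixes F :: "'c::field set"
  assumes F: "is_subfield F" "finite F" and z: "algebraic_over F z"
  shows "finite ((\<lambda>p. poly p z) ` polys_over F)"
proof -
  note R = subfield_imp_subring[OF F(1)]
  obtain q where q: "q \<noteq> 0" "q \<in> polys_over F" "poly q z = 0"
    using z by (auto simp: algebraic_over_def polys_over_def)
  define n where "n = degree q"
  let ?S = "(\<lambda>p. poly p z) ` bpolys F n"
  have S: "z * u + a \<in> ?S" if u: "u \<in> ?S" and a: "a \<in> F" for u a
  proof -
    obtain p where p: "p \<in> bpolys F n" "u = poly p z" using u by blast
    define c where "c = coeff (pCons a p) n / lead_coeff q"
    define r where "r = pCons a p - Polynomial.smult c q"
    have ap: "pCons a p \<in> polys_over F" using p a by (simp add: pCons_polys_over[OF R] bpolys_def)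
    then have c: "c \<in> F" unfolding c_def using q(2)
      by (intro subfield_closed[OF F(1)]) (auto simp: polys_over_def)
    have "r \<in> polys_over F" unfolding r_def
      by (intro subring_diff[OF polys_over_subring[OF R]] ap smult_polys_over[OF R] c q)
    moreover have "coeff r i = 0" if "i \<ge> n" for i
    proof (cases "i = n")
      case True
      then show ?thesis using q(1) by (simp add: r_def c_def n_def)
    next
      case False
      then have i: "i > n" using that by simp
      then have "coeff q i = 0" unfolding n_def by (rule coeff_eq_0)
      moreover have "coeff (pCons a p) i = 0" using p(1) i by (cases i) (auto simp: bpolys_def)
      ultimately show ?thesis by (simp add: r_def)
    qed
    ultimately have "r \<in> bpolys F n" by (simp add: bpolys_def)
    moreover have "poly r z = z * u + a" using q(3) p(2) by (simp add: r_def add.commute)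
    ultimately show ?thesis by (metis image_eqI)
  qed
  have "poly p z \<in> ?S" if "p \<in> polys_over F" for p
    using that
  proof (induction p)
    case 0
    have "0 \<in> bpolys F n" using subring_0[OF polys_over_subring[OF R]] by (simp add: bpolys_def)
    then show ?case by blast
  next
    case (pCons a p)
    then show ?case using S[of "poly p z" a] by (simp add: pCons_polys_over[OF R] add.commute)
  qed
  then have "(\<lambda>p. poly p z) ` polys_over F \<subseteq> ?S" by blast
  then show ?thesis using card_bpolys[OF R F(2), of n] by (meson finite_imageI finite_subset)
qed

text \<open>Apart from nonnegativity the axioms concern the subfield \<open>L\<close> only. This
  covers both \<open>absv\<close> on the whole type and the absolute value of a place of
  \<open>\<V>\<close>, which carries no information outside \<open>\<V>\<close>.\<close>

locale nonarch =
  fixes L :: "'c::field set" and N :: "'c \<Rightarrow> real"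
  assumes L: "is_subfield L"
    and N_nonneg: "\<And>x. 0 \<le> N x"
    and N_eq_0: "\<And>x. x \<in> L \<Longrightarrow> N x = 0 \<longleftrightarrow> x = 0"
    and N_mult: "\<And>x y. x \<in> L \<Longrightarrow> y \<in> L \<Longrightarrow> N (x * y) = N x * N y"
    and N_add: "\<And>x y. x \<in> L \<Longrightarrow> y \<in> L \<Longrightarrow> N (x + y) \<le> max (N x) (N y)"
begin

lemmas L_closed = subfield_closed[OF L]

lemma N_0 [simp]: "N 0 = 0"
  using N_eq_0[of 0] L_closed(1) by simp

lemma N_1 [simp]: "N 1 = 1"
  using N_mult[of 1 1] N_eq_0[of 1] L_closed(2) by simp

lemma N_power: "x \<in> L \<Longrightarrow> N (x ^ n) = N x ^ n"
  by (induction n) (auto simp: N_mult L_closed)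

lemma N_uminus: "x \<in> L \<Longrightarrow> N (- x) = N x"
proof -
  assume x: "x \<in> L"
  have m: "-1 \<in> L" using L_closed(2,5) by blast
  have "N (-1) ^ 2 = 1" using N_mult[OF m m] by (simp add: power2_eq_square)
  then have "N (-1) = 1" using N_nonneg[of "-1"] by (simp add: power2_eq_1_iff)
  then show ?thesis using N_mult[OF m x] by simp
qed

lemma N_diff: "x \<in> L \<Longrightarrow> y \<in> L \<Longrightarrow> N (x - y) \<le> max (N x) (N y)"
  using N_add[of x "- y"] N_uminus[of y] L_closed(5)[of y] by simp

lemma N_inverse: "x \<in> L \<Longrightarrow> N (inverse x) = inverse (N x)"
proof (cases "x = 0")
  case False
  assume x: "x \<in> L"
  then have "N x * N (inverse x) = 1" using N_mult[of x "inverse x"] L_closed(10) False by simp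
  then show ?thesis by (metis inverse_unique)
qed simp

lemma N_divide: "x \<in> L \<Longrightarrow> y \<in> L \<Longrightarrow> N (x / y) = N x / N y"
  using N_mult[of x "inverse y"] N_inverse[of y] L_closed(10)[of y] by (simp add: divide_inverse)

lemma N_powi: "x \<in> L \<Longrightarrow> N (x powi n) = N x powi n"
  using N_power N_inverse[of x] L_closed(10)[of x] by (auto simp: power_int_def)

lemma N_sum: "(\<And>i. i \<in> I \<Longrightarrow> f i \<in> L \<and> N (f i) \<le> c) \<Longrightarrow> 0 \<le> c \<Longrightarrow> N (sum f I) \<le> c"
proof (induction I rule: infinite_finite_induct)
  case (insert i I)
  have "sum f I \<in> L" using insert.prems by (intro L_closed(7)) auto
  then have "N (f i + sum f I) \<le> max (N (f i)) (N (sum f I))" using insert.prems by (intro N_add) auto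
  moreover have "N (f i) \<le> c" "N (sum f I) \<le> c" using insert by auto
  ultimately show ?case using insert.hyps by simp
qed auto

lemma N_add_lt: "x \<in> L \<Longrightarrow> y \<in> L \<Longrightarrow> N y < N x \<Longrightarrow> N (x + y) = N x"
proof (rule antisym)
  assume xy: "x \<in> L" "y \<in> L" "N y < N x"
  show "N (x + y) \<le> N x" using N_add[OF xy(1,2)] xy(3) by simp
  have "N (x + y - y) \<le> max (N (x + y)) (N y)" using xy by (intro N_diff) (auto intro: L_closed)
  then show "N x \<le> N (x + y)" using xy(3) by simp
qed

lemma N_one_plus: "x \<in> L \<Longrightarrow> N x < 1 \<Longrightarrow> N (1 + x) = 1"
  using N_add_lt[of 1 x] L_closed(2) by simp

text \<open>The powers of \<open>poly p z\<close> stay in a finite set and therefore repeat, which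
  is possible only for absolute value \<open>1\<close>.\<close>

lemma finite_order_abs:
  assumes F: "is_subfield F" "finite F" "F \<subseteq> L" and z: "z \<in> L" "z \<noteq> 0" "algebraic_over F z"
    and p: "p \<in> polys_over F" "poly p z \<noteq> 0"
  shows "N (poly p z) = 1"
proof -
  note R = subfield_imp_subring[OF F(1)]
  let ?y = "poly p z"
  have y: "?y \<in> L"
    using p(1) F(3) by (intro poly_in_subring[OF subfield_imp_subring[OF L] _ z(1)]) (auto simp: polys_over_def)
  have "(\<lambda>n::nat. ?y ^ n) ` UNIV \<subseteq> (\<lambda>p. poly p z) ` polys_over F"
  proof (rule image_subsetI)
    fix n :: nat
    have "poly (p ^ n) z \<in> (\<lambda>p. poly p z) ` polys_over F"
      by (intro imageI subring_power[OF polys_over_subring[OF R]] p)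
    then show "?y ^ n \<in> (\<lambda>p. poly p z) ` polys_over F" by simp
  qed
  then have "finite (range (\<lambda>n::nat. ?y ^ n))" using finite_adjoin_algebraic[OF F(1,2) z(3)] finite_subset by blast
  then have "\<not> inj (\<lambda>n::nat. ?y ^ n)" using finite_imageD infinite_UNIV_nat by blast
  then obtain m n where mn: "m \<noteq> n" "?y ^ m = ?y ^ n" by (auto simp: inj_def)
  have pos: "0 < N ?y" using N_eq_0[OF y] N_nonneg[of ?y] p(2) by linarith
  have eq: "N ?y ^ m = N ?y ^ n" using mn(2) N_power[OF y] by metis
  show ?thesis
  proof (rule ccontr)
    assume "N ?y \<noteq> 1"
    then have "m = n" using eq pos power_inject_exp'[of "N ?y" m n] by simp
    then show False using mn(1) by simp
  qed
qed

text \<open>Among the \<open>C + 1\<close> powers of \<open>u\<close> with exponents up to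
  \<open>C\<close> two are congruent, so \<open>u\<close> raised to the difference of the exponents
  is congruent to \<open>1\<close>. All such differences divide \<open>fact C\<close>, which makes
  the exponent uniform in \<open>u\<close>.\<close>

lemma unit_power_one:
  assumes bd: "\<And>Y. finite Y \<Longrightarrow> Y \<subseteq> L \<Longrightarrow> (\<And>y. y \<in> Y \<Longrightarrow> N y \<le> 1) \<Longrightarrow>
      (\<And>y y'. y \<in> Y \<Longrightarrow> y' \<in> Y \<Longrightarrow> N (y - y') < 1 \<Longrightarrow> y = y') \<Longrightarrow> card Y \<le> C"
    and u: "u \<in> L" "N u = 1"
  shows "N (u ^ fact C - 1) < 1"
proof -
  have one: "N (w ^ n - 1) < 1" if "w \<in> L" "N (w - 1) < 1" for w n
  proof (induction n)
    case (Suc n)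
    have "N w = 1" using N_one_plus[of "w - 1"] that L_closed(2,3) by simp
    have "N (w * (w ^ n - 1) + (w - 1)) \<le> max (N (w * (w ^ n - 1))) (N (w - 1))"
      using that by (intro N_add) (auto intro!: L_closed)
    also have "\<dots> < 1" using Suc that \<open>N w = 1\<close> N_mult[of w "w ^ n - 1"] by (simp add: L_closed)
    finally show ?case by (simp add: algebra_simps)
  qed simp
  have uL: "u ^ i \<in> L" for i using u by (intro L_closed)
  have "\<exists>i j. i < j \<and> j \<le> C \<and> N (u ^ j - u ^ i) < 1"
  proof (rule ccontr)
    assume n: "\<nexists>i j. i < j \<and> j \<le> C \<and> N (u ^ j - u ^ i) < 1"
    have ne: "\<not> N (u ^ i - u ^ j) < 1" if "i \<noteq> j" "i \<le> C" "j \<le> C" for i j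
      using n that N_uminus[of "u ^ i - u ^ j"] uL L_closed(3) by (metis linorder_neqE_nat minus_diff_eq)
    have inj: "inj_on (\<lambda>i. u ^ i) {..C}"
    proof (rule inj_onI, rule ccontr)
      fix i j assume "i \<in> {..C}" "j \<in> {..C}" "u ^ i = u ^ j" "i \<noteq> j"
      then show False using ne[of i j] by simp
    qed
    have "card ((\<lambda>i. u ^ i) ` {..C}) \<le> C"
    proof (rule bd)
      fix y y' assume "y \<in> (\<lambda>i. u ^ i) ` {..C}" "y' \<in> (\<lambda>i. u ^ i) ` {..C}" and d: "N (y - y') < 1"
      then obtain i j where "y = u ^ i" "y' = u ^ j" "i \<le> C" "j \<le> C" by auto
      then show "y = y'" using ne[of i j] d by auto
    qed (use uL u in \<open>auto simp: N_power\<close>)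
    then show False using inj by (simp add: card_image)
  qed
  then obtain i j where ij: "i < j" "j \<le> C" "N (u ^ j - u ^ i) < 1" by blast
  have "u ^ j - u ^ i = u ^ i * (u ^ (j - i) - 1)" using ij(1) by (simp add: right_diff_distrib power_add[symmetric])
  then have "N (u ^ (j - i) - 1) < 1"
    using ij(3) N_mult[of "u ^ i" "u ^ (j - i) - 1"] uL u by (simp add: N_power L_closed)
  moreover have "(j - i) dvd fact C" using ij by (intro dvd_fact) auto
  then obtain d where "fact C = (j - i) * d" by (auto simp: dvd_def)
  ultimately show ?thesis using one[OF uL, of "j - i" d] by (simp add: power_mult)
qed

end

text \<open>Digit expansion in the form of a covering: starting at order \<open>a\<close>, each
  further digit costs a factor \<open>card F ^ deg v\<close>.\<close>

lemma (in ffield) val_ge_cover: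
  assumes v: "v \<in> places k"
  shows "\<exists>T. finite T \<and> card T \<le> card F ^ (n * deg v) \<and>
    (\<forall>x\<in>val_ge k v a. \<exists>t\<in>T. x - t \<in> val_ge k v (a + int n))"
proof (induction n)
  case 0
  show ?case by (intro exI[of _ "{0}"]) auto
next
  case (Suc n)
  interpret v: place k v by (rule placeI[OF v])
  obtain x where x: "x \<in> k" "x \<noteq> 0" "v x = 1" by (rule v.uniformizer)
  define s where "s = x powi (a + int n)"
  have s: "s \<in> k" "s \<noteq> 0" "v s = a + int n"
    using x k_closed(12) v.v_powi[OF x(1,2)] by (auto simp: s_def)
  obtain T where T: "finite T" "card T \<le> card F ^ (n * deg v)"
    "\<And>x. x \<in> val_ge k v a \<Longrightarrow> \<exists>t\<in>T. x - t \<in> val_ge k v (a + int n)" using Suc by blast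
  obtain S where S: "finite S" "card S = card F ^ deg v"
    "\<And>x. x \<in> val_ge k v 0 \<Longrightarrow> \<exists>t\<in>S. x - t \<in> val_ge k v 1" using residue_transversal[OF v] by metis
  let ?T = "(\<lambda>(t, u). t + s * u) ` (T \<times> S)"
  have "card ?T \<le> card (T \<times> S)" using T S by (intro card_image_le) auto
  also have "\<dots> \<le> card F ^ (n * deg v) * card F ^ deg v" using T(2) S(2) by (simp add: card_cartesian_product)
  finally have "card ?T \<le> card F ^ (Suc n * deg v)" by (simp add: power_add mult.commute)
  moreover have "\<exists>t\<in>?T. y - t \<in> val_ge k v (a + int (Suc n))" if y: "y \<in> val_ge k v a" for y
  proof -
    obtain t where t: "t \<in> T" "y - t \<in> val_ge k v (v s + 0)" using T(3)[OF y] s(3) by auto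
    then obtain w where w: "w \<in> val_ge k v 0" "y - t = s * w" using v.val_ge_multiples[OF s(1,2), of 0] by blast
    obtain u where u: "u \<in> S" "w - u \<in> val_ge k v 1" using S(3)[OF w(1)] by blast
    have "s * (w - u) \<in> val_ge k v (v s + 1)" using v.val_ge_multiple[OF s(1,2)] u(2) by blast
    moreover have "y - (t + s * u) = s * (w - u)" using w(2) by (simp add: algebra_simps)
    ultimately have "y - (t + s * u) \<in> val_ge k v (a + int (Suc n))" using s(3) by (simp add: algebra_simps)
    then show ?thesis using t(1) u(1) by (intro bexI[of _ "t + s * u"]) auto
  qed
  moreover have "finite ?T" using T S by auto
  ultimately show ?case by blast
qed

section \<open>The ring \<open>A\<close> and its ideal classes\<close>

sublocale goss_setting \<subseteq> ffield Fr k
  by unfold_locales (rule Fr_finite k_function_field)+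

sublocale goss_setting \<subseteq> abs: nonarch UNIV absv
  by unfold_locales (auto simp: is_subfield_UNIV abs_nonneg abs_eq_0 abs_mult abs_ultrametric)

sublocale goss_setting \<subseteq> vinf: place k vinf
  using vinf_place by (rule placeI)

context goss_setting
begin

lemma d_inf_eq: "d_inf = deg vinf"
  by (simp add: d_inf_def)

lemma d_inf_pos: "0 < d_inf"
  using deg_pos[OF vinf_place] by (simp add: d_inf_eq)

lemma A_def': "A = {x\<in>k. \<forall>v\<in>places k - {vinf}. x \<in> val_ge k v 0}"
  by (simp add: A_def local_ring_eq)

lemma A_subset: "A \<subseteq> k"
  by (auto simp: A_def)

lemma A_subring: "is_subring A"
  unfolding is_subring_def A_def'
  using k_closed subring_closed[OF place.val_ge_subring[OF placeI]] by auto

lemmas A_closed = subring_closed[OF A_subring]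

text \<open>A zero at infinity would force a pole somewhere, and elements of \<open>A\<close> have
  no poles elsewhere.\<close>

lemma A_vinf_le: "x \<in> A \<Longrightarrow> x \<noteq> 0 \<Longrightarrow> vinf x \<le> 0"
proof (rule ccontr)
  assume x: "x \<in> A" "x \<noteq> 0" "\<not> vinf x \<le> 0"
  then obtain v where v: "v \<in> places k" "v x < 0" using negative_has_pole[of x vinf] vinf_place A_subset by auto
  then have "v \<noteq> vinf" using x(3) by auto
  then have "x \<in> val_ge k v 0" using x(1) v(1) by (auto simp: A_def')
  then show False using x(2) v(2) by (auto simp: val_ge_def)
qed

definition A_le :: "nat \<Rightarrow> 'c set" where
  "A_le m = A \<inter> val_ge k vinf (- int m)"

lemma A_le_eq: "A_le m = rr_space (\<lambda>v. if v = vinf then int m else 0)"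
proof (intro equalityI subsetI)
  fix x assume x: "x \<in> A_le m"
  have "x \<in> val_ge k v (- (if v = vinf then int m else 0))" if "v \<in> places k" for v
    using x that by (cases "v = vinf") (auto simp: A_le_def A_def')
  then show "x \<in> rr_space (\<lambda>v. if v = vinf then int m else 0)"
    using x A_subset by (auto simp: rr_space_def A_le_def)
next
  fix x assume x: "x \<in> rr_space (\<lambda>v. if v = vinf then int m else 0)"
  then have v: "x \<in> val_ge k v (- (if v = vinf then int m else 0))" if "v \<in> places k" for v
    using that by (simp add: rr_space_def)
  have "x \<in> val_ge k v 0" if "v \<in> places k - {vinf}" for v using v[of v] that by simp
  then show "x \<in> A_le m" using x v[OF vinf_place] by (simp add: A_le_def A_def' rr_space_def)
qed

lemma finite_A_le: "finite (A_le m)"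
proof -
  have "(\<lambda>v. if v = vinf then int m else 0) = (\<lambda>v. if v \<in> {vinf} then int m else 0)" by auto
  then show ?thesis unfolding A_le_eq
    using card_rr_space_le[OF vinf_place, of "{vinf}" "\<lambda>_. m"] vinf_place by simp
qed

lemma card_A_le_lower: "\<exists>\<gamma>. \<forall>m. card Fr ^ (m * d_inf) \<le> card Fr ^ \<gamma> * card (A_le m)"
  unfolding A_le_eq d_inf_eq using riemann_inequality[OF vinf_place] by blast

text \<open>By Riemann's inequality the sets \<open>A_le m\<close> grow without bound, which is
  impossible if all elements of \<open>A\<close> are regular at infinity.\<close>

lemma nonconstant_exists: "\<exists>t\<in>A. t \<noteq> 0 \<and> vinf t < 0"
proof (rule ccontr)
  assume n: "\<not> ?thesis"
  have A0: "A_le m = A_le 0" for m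
    unfolding A_le_def using n by (auto simp: val_ge_def A_def)
  obtain \<gamma> where \<gamma>: "\<And>m. card Fr ^ (m * d_inf) \<le> card Fr ^ \<gamma> * card (A_le m)" using card_A_le_lower by blast
  define c where "c = card (A_le 0)"
  have "c < 2 ^ c" by (rule less_exp)
  also have "\<dots> \<le> card Fr ^ c" using card_F by (intro power_mono) auto
  finally have "card Fr ^ \<gamma> * c < card Fr ^ \<gamma> * card Fr ^ c" using card_F by simp
  also have "\<dots> \<le> card Fr ^ ((\<gamma> + c) * d_inf)"
    using card_F d_inf_pos unfolding power_add[symmetric] by (intro power_increasing) auto
  finally show False using \<gamma>[of "\<gamma> + c"] A0[of "\<gamma> + c"] by (simp add: c_def)
qed

text \<open>The denominator is a nonzero function that vanishes to sufficient order at the poles of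
  \<open>x\<close> and has poles only at infinity. Riemann's inequality provides it once
  \<open>m\<close> exceeds the number \<open>s\<close> of these conditions by enough.\<close>

lemma denominator_exists:
  assumes x: "x \<in> k" shows "\<exists>b\<in>A. b \<noteq> 0 \<and> b * x \<in> A"
proof -
  define Z where "Z = {v\<in>places k. v x < 0}"
  have Z: "finite Z" "Z \<subseteq> places k" using finite_poles[OF x] by (auto simp: Z_def)
  define E where "E v = nat (- v x)" for v
  define s where "s = (\<Sum>v\<in>Z. E v * deg v)"
  obtain \<gamma> where \<gamma>: "\<And>m. card Fr ^ (m * d_inf) \<le> card Fr ^ \<gamma> * card (A_le m)" using card_A_le_lower by blast
  define m where "m = Suc (\<gamma> + s)"
  define D where "D v = (if v = vinf then int m else 0) - (if v \<in> Z then int (E v) else 0)" for v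
  have e: "(\<lambda>v. D v + (if v \<in> Z then int (E v) else 0)) = (\<lambda>v. if v = vinf then int m else 0)"
    by (rule ext) (simp add: D_def)
  have fin: "finite (rr_space D)"
    by (rule finite_subset[OF rr_space_mono, of _ "\<lambda>v. if v = vinf then int m else 0"])
      (auto simp: D_def finite_A_le A_le_eq[symmetric])
  have "card (A_le m) \<le> card Fr ^ s * card (rr_space D)"
    using card_rr_space_add[OF Z fin, of E] unfolding e A_le_eq s_def by blast
  from le_mult_trans[OF \<gamma>[of m] this]
  have le: "card Fr ^ (m * d_inf) \<le> card Fr ^ (\<gamma> + s) * card (rr_space D)" by (simp add: power_add)
  have "card Fr ^ (\<gamma> + s) < card Fr ^ m" using card_F by (intro power_strict_increasing) (auto simp: m_def)
  also have "\<dots> \<le> card Fr ^ (m * d_inf)" using card_F d_inf_pos by (intro power_increasing) auto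
  finally have lt: "card Fr ^ (\<gamma> + s) < card Fr ^ (m * d_inf)" .
  have "rr_space D \<noteq> {0}"
  proof
    assume "rr_space D = {0}"
    then have "card (rr_space D) = 1" by simp
    then show False using le lt by simp
  qed
  then obtain b where b: "b \<in> rr_space D" "b \<noteq> 0" using subspace_0[OF rr_space_subspace, of D] by blast
  have bk: "b \<in> k" using b by (simp add: rr_space_def)
  have bD: "b \<in> val_ge k v (- D v)" if "v \<in> places k" for v using b that by (simp add: rr_space_def)
  have "b \<in> val_ge k v 0 \<and> b * x \<in> val_ge k v 0" if v: "v \<in> places k" "v \<noteq> vinf" for v
  proof -
    interpret v: place k v by (rule placeI[OF v(1)])
    have D: "0 \<le> - D v" "0 \<le> - D v + v x" using v by (auto simp: D_def Z_def E_def)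
    have "b \<in> val_ge k v 0" using v.val_ge_mono[OF D(1)] bD[OF v(1)] by blast
    moreover have "x \<in> val_ge k v (v x)" using x by (simp add: val_ge_def)
    from v.val_ge_mult[OF bD[OF v(1)] this] have "b * x \<in> val_ge k v 0"
      using v.val_ge_mono[OF D(2)] by blast
    ultimately show ?thesis by simp
  qed
  then show ?thesis using b bk x k_closed(4) by (intro bexI[of _ b]) (auto simp: A_def')
qed

section \<open>Fractional ideals as lattices at infinity\<close>

lemma fracD:
  assumes "I \<in> fractional_ideals"
  shows "I \<subseteq> k" "0 \<in> I" "\<exists>x\<in>I. x \<noteq> 0" "\<And>x y. x \<in> I \<Longrightarrow> y \<in> I \<Longrightarrow> x + y \<in> I"
    "\<And>a x. a \<in> A \<Longrightarrow> x \<in> I \<Longrightarrow> a * x \<in> I" "\<exists>a\<in>A. a \<noteq> 0 \<and> (\<forall>x\<in>I. a * x \<in> A)"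
  using assms unfolding fractional_ideals_def by auto

lemma fracI:
  assumes "I \<subseteq> k" "0 \<in> I" "x \<in> I" "x \<noteq> 0" "\<And>x y. x \<in> I \<Longrightarrow> y \<in> I \<Longrightarrow> x + y \<in> I"
    "\<And>a x. a \<in> A \<Longrightarrow> x \<in> I \<Longrightarrow> a * x \<in> I" "a \<in> A" "a \<noteq> 0" "\<And>x. x \<in> I \<Longrightarrow> a * x \<in> A"
  shows "I \<in> fractional_ideals"
  unfolding fractional_ideals_def using assms by (intro CollectI conjI ballI bexI[of _ a]) auto

lemma frac_subspace: "I \<in> fractional_ideals \<Longrightarrow> is_subspace A I"
  using fracD[of I] by (simp add: is_subspace_def)

lemma A_frac: "A \<in> fractional_ideals"
  using A_subset A_closed by (intro fracI[of A 1 1]) auto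

lemma scale_frac:
  assumes I: "I \<in> fractional_ideals" and l: "l \<in> k" "l \<noteq> 0" shows "(*) l ` I \<in> fractional_ideals"
proof -
  obtain x where x: "x \<in> I" "x \<noteq> 0" using fracD(3)[OF I] by blast
  obtain a where a: "a \<in> A" "a \<noteq> 0" "\<And>x. x \<in> I \<Longrightarrow> a * x \<in> A" using fracD(6)[OF I] by blast
  obtain b where b: "b \<in> A" "b \<noteq> 0" "b * l \<in> A" using denominator_exists[OF l(1)] by blast
  show ?thesis
  proof (rule fracI[of _ "l * x" "a * b"])
    show "(*) l ` I \<subseteq> k" using fracD(1)[OF I] l k_closed(4) by blast
    show "0 \<in> (*) l ` I" using fracD(2)[OF I] by force
    show "l * x \<in> (*) l ` I" "l * x \<noteq> 0" "a * b \<noteq> 0" "a * b \<in> A" using x l a b A_closed(4) by auto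
    fix u w assume "u \<in> (*) l ` I" "w \<in> (*) l ` I"
    then obtain u' w' where "u = l * u'" "w = l * w'" "u' \<in> I" "w' \<in> I" by blast
    then show "u + w \<in> (*) l ` I" using fracD(4)[OF I, of u' w'] by (auto simp: distrib_left[symmetric])
  next
    fix c u assume c: "c \<in> A" "u \<in> (*) l ` I"
    then obtain u' where u: "u = l * u'" "u' \<in> I" by blast
    have "c * u = l * (c * u')" using u by (simp add: mult_ac)
    then show "c * u \<in> (*) l ` I" using fracD(5)[OF I c(1) u(2)] by blast
  next
    fix u assume "u \<in> (*) l ` I"
    then obtain u' where u: "u = l * u'" "u' \<in> I" by blast
    have "a * b * u = (a * u') * (b * l)" using u by (simp add: mult_ac)
    then show "a * b * u \<in> A" using a(3)[OF u(2)] b(3) A_closed(4) by metis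
  qed
qed

lemma frac_vinf_bounded:
  assumes I: "I \<in> fractional_ideals" shows "\<exists>e::nat. \<forall>x\<in>I. x \<noteq> 0 \<longrightarrow> vinf x \<le> int e"
proof -
  obtain a where a: "a \<in> A" "a \<noteq> 0" "\<And>x. x \<in> I \<Longrightarrow> a * x \<in> A" using fracD(6)[OF I] by blast
  have "vinf x \<le> int (nat (- vinf a))" if x: "x \<in> I" "x \<noteq> 0" for x
  proof -
    have "vinf (a * x) \<le> 0" using a x by (intro A_vinf_le) auto
    moreover have "vinf (a * x) = vinf a + vinf x"
      using a x fracD(1)[OF I] A_subset by (intro vinf.v_mult) auto
    ultimately show ?thesis by linarith
  qed
  then show ?thesis by blast
qed

text \<open>Sums of elements of \<open>R\<close> and of \<open>A_le m\<close> lie in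
  \<open>J\<close> and stay distinct modulo order \<open>e + 1\<close> at infinity, since
  \<open>J\<close> has no nonzero element of that order. Counting classes bounds the number of these
  sums, and the dependence on \<open>m\<close> cancels against the growth of
  \<open>A_le m\<close>.\<close>

lemma lattice_index_bounded:
  "\<exists>C. \<forall>J e R. J \<in> fractional_ideals \<and> A \<subseteq> J \<and> (\<forall>x\<in>J. x \<noteq> 0 \<longrightarrow> vinf x \<le> int e) \<and>
    finite R \<and> R \<subseteq> J \<and> incong A R \<longrightarrow> card R \<le> C e"
proof -
  obtain \<gamma> where \<gamma>: "\<And>m. card Fr ^ (m * d_inf) \<le> card Fr ^ \<gamma> * card (A_le m)" using card_A_le_lower by blast
  have bound: "card R \<le> card Fr ^ (\<gamma> + Suc e * d_inf)"
    if J: "J \<in> fractional_ideals" "A \<subseteq> J" and e: "\<And>x. x \<in> J \<Longrightarrow> x \<noteq> 0 \<Longrightarrow> vinf x \<le> int e"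
      and R: "finite R" "R \<subseteq> J" "incong A R" for J e R
  proof -
    note sp = frac_subspace[OF J(1)]
    define m where "m = (\<Sum>x\<in>R. nat (- vinf x))"
    have Rm: "x \<in> val_ge k vinf (- int m)" if x: "x \<in> R" for x
    proof -
      have "nat (- vinf x) \<le> m" unfolding m_def using R(1) x by (intro member_le_sum) auto
      then have "- int m \<le> vinf x" by linarith
      then show ?thesis using x R(2) fracD(1)[OF J(1)] by (auto simp: val_ge_def)
    qed
    let ?f = "\<lambda>(\<rho>, a). \<rho> + a"
    define X where "X = ?f ` (R \<times> A_le m)"
    have inj: "inj_on ?f (R \<times> A_le m)"
    proof (rule inj_onI, clarify)
      fix \<rho> a \<rho>' a' assume *: "\<rho> \<in> R" "a \<in> A_le m" "\<rho>' \<in> R" "a' \<in> A_le m" "\<rho> + a = \<rho>' + a'"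
      have "\<rho> - \<rho>' = a' - a" using *(5) by (simp add: algebra_simps)
      then have "\<rho> - \<rho>' \<in> A" using * A_closed(3)[of a' a] by (simp add: A_le_def)
      then have "\<rho> = \<rho>'" using R(3) * by (auto simp: incong_def)
      then show "\<rho> = \<rho>' \<and> a = a'" using *(5) by simp
    qed
    have XJ: "x \<in> J \<and> x \<in> val_ge k vinf (- int m)" if x: "x \<in> X" for x
    proof -
      obtain \<rho> a where ra: "x = \<rho> + a" "\<rho> \<in> R" "a \<in> A_le m" using x by (auto simp: X_def)
      have "\<rho> + a \<in> J" using ra R(2) J(2) by (intro fracD(4)[OF J(1)]) (auto simp: A_le_def)
      moreover have "\<rho> + a \<in> val_ge k vinf (- int m)"
        using ra Rm by (intro vinf.val_ge_add) (auto simp: A_le_def)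
      ultimately show ?thesis using ra(1) by simp
    qed
    obtain T where T: "finite T" "card T \<le> card Fr ^ ((m + Suc e) * deg vinf)"
      "\<forall>x\<in>val_ge k vinf (- int m). \<exists>t\<in>T. x - t \<in> val_ge k vinf (- int m + int (m + Suc e))"
      using val_ge_cover[OF vinf_place] by blast
    have inc: "incong (val_ge k vinf (int (Suc e))) X"
      unfolding incong_def
    proof (intro ballI impI)
      fix x y assume xy: "x \<in> X" "y \<in> X" "x - y \<in> val_ge k vinf (int (Suc e))"
      then have "x - y \<in> J" using XJ subspace_diff[OF A_subring sp] by blast
      then show "x = y" using e[of "x - y"] xy(3) by (cases "x = y") (auto simp: val_ge_def)
    qed
    have "card X \<le> card T"
      using incong_card_le[OF F_subring vinf.val_ge_subspace[OF F_subfield F_finite F_subset] inc T(1)] T(3) XJ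
      by fastforce
    moreover have "card X = card R * card (A_le m)"
      unfolding X_def using inj by (simp add: card_image card_cartesian_product)
    ultimately have "card R * card (A_le m) \<le> card Fr ^ ((m + Suc e) * d_inf)" using T(2) by (simp add: d_inf_eq)
    then have le: "card Fr ^ \<gamma> * (card R * card (A_le m)) \<le> card Fr ^ \<gamma> * card Fr ^ ((m + Suc e) * d_inf)"
      by (rule mult_le_mono2)
    have "card R * card Fr ^ (m * d_inf) \<le> card R * (card Fr ^ \<gamma> * card (A_le m))"
      by (rule mult_le_mono2[OF \<gamma>])
    also have "\<dots> = card Fr ^ \<gamma> * (card R * card (A_le m))" by (simp only: mult.left_commute)
    also have "\<dots> \<le> card Fr ^ \<gamma> * card Fr ^ ((m + Suc e) * d_inf)" by (rule le)
    also have "\<dots> = card Fr ^ (\<gamma> + Suc e * d_inf) * card Fr ^ (m * d_inf)"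
      by (simp add: power_add[symmetric] algebra_simps)
    finally show ?thesis using card_F by simp
  qed
  show ?thesis
  proof (intro exI[of _ "\<lambda>e. card Fr ^ (\<gamma> + Suc e * d_inf)"] allI impI)
    fix J e R assume "J \<in> fractional_ideals \<and> A \<subseteq> J \<and> (\<forall>x\<in>J. x \<noteq> 0 \<longrightarrow> vinf x \<le> int e) \<and>
      finite R \<and> R \<subseteq> J \<and> incong A R"
    then show "card R \<le> card Fr ^ (\<gamma> + Suc e * d_inf)" by (intro bound[of J]) auto
  qed
qed

text \<open>
  Scaling by an element of maximal \<open>vinf\<close> makes a fractional ideal contain \<open>A\<close> with bounded
  index, and then a fixed \<open>D\<close> multiplies it into \<open>A\<close>.
\<close>

theorem finitely_many_classes:
  "\<exists>\<J> D. finite \<J> \<and> \<J> \<subseteq> fractional_ideals \<and> D \<in> A - {0} \<and> (\<forall>J\<in>\<J>. 1 \<in> J \<and> (\<forall>x\<in>J. D * x \<in> A)) \<and>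
    (\<forall>I\<in>fractional_ideals. \<exists>l\<in>k - {0}. \<exists>J\<in>\<J>. I = (*) l ` J)"
proof -
  obtain C where C0: "\<forall>J e R. J \<in> fractional_ideals \<and> A \<subseteq> J \<and> (\<forall>x\<in>J. x \<noteq> 0 \<longrightarrow> vinf x \<le> int e) \<and>
    finite R \<and> R \<subseteq> J \<and> incong A R \<longrightarrow> card R \<le> C e" using lattice_index_bounded by (elim exE)
  have C: "card R \<le> C e" if "J \<in> fractional_ideals" "A \<subseteq> J" "\<And>x. x \<in> J \<Longrightarrow> x \<noteq> 0 \<Longrightarrow> vinf x \<le> int e"
    "finite R" "R \<subseteq> J" "incong A R" for J e R
    using C0[rule_format, of J e R] that by simp
  obtain t where t: "t \<in> A" "t \<noteq> 0" "vinf t < 0" using nonconstant_exists by blast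
  have tk: "t \<in> k" using t A_subset by auto
  define c where "c = C 0"
  define Q where "Q = {(i, j). i < j \<and> j \<le> c}"
  have Q: "finite Q" by (rule finite_subset[of _ "{..c} \<times> {..c}"]) (auto simp: Q_def)
  \<comment> \<open>Among the \<open>c + 1\<close> multiples of an element of a normalized
    \<open>J\<close> by powers of \<open>t\<close>, two agree modulo \<open>A\<close>. The product
    over all pairs of exponents therefore multiplies every such \<open>J\<close> into
    \<open>A\<close> at once.\<close>
  define D where "D = (\<Prod>(i, j)\<in>Q. t ^ i - t ^ j)"
  have ti: "t ^ i \<noteq> t ^ j" if "i < j" for i j
  proof
    assume "t ^ i = t ^ j"
    then have "int i * vinf t = int j * vinf t" using vinf.v_power[OF tk t(2)] by metis
    then show False using that t(3) by simp
  qed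
  have tA: "(case q of (i, j) \<Rightarrow> t ^ i - t ^ j) \<in> A" for q
    using A_closed(3)[OF A_closed(9)[OF t(1)] A_closed(9)[OF t(1)]] by (simp add: split_def)
  have D: "D \<in> A" "D \<noteq> 0"
  proof -
    show "D \<in> A" unfolding D_def by (rule A_closed(8)[OF tA])
    have "t ^ i \<noteq> t ^ j" if "(i, j) \<in> Q" for i j using ti[of i j] that by (simp add: Q_def)
    then show "D \<noteq> 0" unfolding D_def prod_zero_iff[OF Q] by auto
  qed
  define \<J> where "\<J> = {J\<in>fractional_ideals. 1 \<in> J \<and> (\<forall>x\<in>J. D * x \<in> A)}"
  have AJ: "A \<subseteq> J" if "J \<in> \<J>" for J
    using fracD(5)[of J _ 1] that by (auto simp: \<J>_def)
  have classes: "\<exists>l\<in>k - {0}. \<exists>J\<in>\<J>. I = (*) l ` J" if I: "I \<in> fractional_ideals" for I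
  proof -
    obtain e where e: "\<And>x. x \<in> I \<Longrightarrow> x \<noteq> 0 \<Longrightarrow> vinf x \<le> int e" using frac_vinf_bounded[OF I] by blast
    obtain x0 where x0: "x0 \<in> I" "x0 \<noteq> 0" using fracD(3)[OF I] by blast
    let ?P = "\<lambda>n. \<exists>x\<in>I. x \<noteq> 0 \<and> vinf x = int e - int n"
    have P0: "?P (nat (int e - vinf x0))" using x0 e[OF x0] by (intro bexI[of _ x0]) auto
    define n where "n = (LEAST n. ?P n)"
    have n: "n \<le> m" if "?P m" for m unfolding n_def using that by (rule Least_le)
    have "?P n" unfolding n_def by (rule LeastI[of ?P, OF P0])
    then obtain l where l: "l \<in> I" "l \<noteq> 0" "vinf l = int e - int n" by blast
    have max: "vinf x \<le> vinf l" if "x \<in> I" "x \<noteq> 0" for x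
    proof -
      have "?P (nat (int e - vinf x))" using that e[OF that] by (intro bexI[of _ x]) auto
      then have "n \<le> nat (int e - vinf x)" by (rule n)
      then show ?thesis using l(3) e[OF that] by linarith
    qed
    have lk: "l \<in> k" using l fracD(1)[OF I] by blast
    define J where "J = (*) (inverse l) ` I"
    have J: "J \<in> fractional_ideals" unfolding J_def using lk l(2) k_closed(10) by (intro scale_frac[OF I]) auto
    have IJ: "I = (*) l ` J" unfolding J_def image_image using l(2) by (simp add: mult.assoc[symmetric])
    have J1: "1 \<in> J" unfolding J_def using l by (intro image_eqI[of _ _ l]) auto
    have AJ: "A \<subseteq> J" using fracD(5)[OF J _ J1] by auto
    have Je: "vinf x \<le> int 0" if x: "x \<in> J" "x \<noteq> 0" for x
    proof -
      obtain y where y: "x = inverse l * y" "y \<in> I" using x by (auto simp: J_def)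
      then have "y \<noteq> 0" "y \<in> k" using x fracD(1)[OF I] by auto
      then show ?thesis using max[of y] y vinf.v_mult[of "inverse l" y] vinf.v_inverse[OF lk l(2)] lk l(2) k_closed(10)
        by simp
    qed
    have "D * y \<in> A" if y: "y \<in> J" for y
    proof -
      have tiy: "t ^ i * y \<in> J" for i using fracD(5)[OF J _ y] A_closed(9)[OF t(1)] by blast
      have "\<exists>i j. i < j \<and> j \<le> c \<and> (t ^ i - t ^ j) * y \<in> A"
      proof (rule ccontr)
        assume n: "\<not> ?thesis"
        have ne: "i = j" if ij: "i \<le> c" "j \<le> c" "t ^ i * y - t ^ j * y \<in> A" for i j
        proof (rule ccontr)
          assume "i \<noteq> j"
          moreover have "(t ^ i - t ^ j) * y \<in> A" using ij(3) by (simp add: left_diff_distrib)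
          moreover have "(t ^ j - t ^ i) * y \<in> A" using A_closed(5)[OF ij(3)] by (simp add: left_diff_distrib)
          ultimately show False using n ij by (metis linorder_neqE_nat)
        qed
        let ?Y = "(\<lambda>i. t ^ i * y) ` {..c}"
        have inj: "inj_on (\<lambda>i. t ^ i * y) {..c}"
          using ne A_closed(1) by (intro inj_onI) auto
        have "card ?Y \<le> C 0"
        proof (rule C[OF J AJ])
          show "vinf x \<le> int 0" if "x \<in> J" "x \<noteq> 0" for x using Je[OF that] .
          show "incong A ?Y" unfolding incong_def using ne by auto
        qed (use tiy in auto)
        then show False using inj by (simp add: card_image c_def)
      qed
      then obtain i j where ij: "(i, j) \<in> Q" "(t ^ i - t ^ j) * y \<in> A" by (auto simp: Q_def)
      have "D = (t ^ i - t ^ j) * (\<Prod>(i, j)\<in>Q - {(i, j)}. t ^ i - t ^ j)"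
        unfolding D_def using Q ij(1) by (simp add: prod.remove)
      then have Dy: "D * y = ((t ^ i - t ^ j) * y) * (\<Prod>(i, j)\<in>Q - {(i, j)}. t ^ i - t ^ j)" by (simp add: mult_ac)
      show ?thesis unfolding Dy by (rule A_closed(4)[OF ij(2) A_closed(8)[OF tA]])
    qed
    then have "J \<in> \<J>" using J J1 by (simp add: \<J>_def)
    then show ?thesis using IJ lk l(2) by blast
  qed
  \<comment> \<open>All members of \<open>\<J>\<close> lie between \<open>A\<close> and
    \<open>M\<close>, and \<open>A\<close> has finite index in \<open>M\<close>; so \<open>J\<close>
    is determined by its intersection with a finite system \<open>T\<close> of
    representatives.\<close>
  define M where "M = (*) (inverse D) ` A"
  have Dk: "D \<in> k" using D A_subset by auto
  have M: "M \<in> fractional_ideals" unfolding M_def using D Dk k_closed(10) by (intro scale_frac[OF A_frac]) auto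
  have AM: "A \<subseteq> M"
  proof
    fix a assume "a \<in> A"
    then have "D * a \<in> A" "a = inverse D * (D * a)" using D A_closed(4) by auto
    then show "a \<in> M" unfolding M_def by blast
  qed
  obtain e where e: "\<And>x. x \<in> M \<Longrightarrow> x \<noteq> 0 \<Longrightarrow> vinf x \<le> int e" using frac_vinf_bounded[OF M] by blast
  obtain T where T: "finite T" "T \<subseteq> M" "\<And>x. x \<in> M \<Longrightarrow> \<exists>s\<in>T. x - s \<in> A"
    using incong_bounded_cover[of A M "C e"] C[OF M AM e] A_closed(1,5) by metis
  have "inj_on (\<lambda>J. J \<inter> T) \<J>"
  proof (rule inj_onI)
    fix J J' assume J: "J \<in> \<J>" "J' \<in> \<J>" "J \<inter> T = J' \<inter> T"
    have "J \<subseteq> J'" if J: "J \<in> \<J>" "J' \<in> \<J>" "J \<inter> T = J' \<inter> T" for J J'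
    proof
      fix x assume x: "x \<in> J"
      have "D * x \<in> A" "x = inverse D * (D * x)" using J(1) x D by (auto simp: \<J>_def)
      then have "x \<in> M" unfolding M_def by blast
      then obtain s where s: "s \<in> T" "x - s \<in> A" using T(3) by blast
      have JJ: "J \<in> fractional_ideals" "J' \<in> fractional_ideals" using J by (auto simp: \<J>_def)
      have "x - s \<in> J" using s(2) AJ[OF J(1)] by blast
      then have "x - (x - s) \<in> J" by (rule subspace_diff[OF A_subring frac_subspace[OF JJ(1)] x])
      then have "s \<in> J'" using s(1) J(3) by auto
      then have "s + (x - s) \<in> J'" using s(2) AJ[OF J(2)] by (intro fracD(4)[OF JJ(2)]) auto
      then show "x \<in> J'" by simp
    qed
    then show "J = J'" using J by blast
  qed
  moreover have "(\<lambda>J. J \<inter> T) ` \<J> \<subseteq> Pow T" by auto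
  ultimately have "finite \<J>" using T(1) by (meson finite_Pow_iff finite_imageD finite_subset)
  moreover have "\<J> \<subseteq> fractional_ideals" "\<forall>J\<in>\<J>. 1 \<in> J \<and> (\<forall>x\<in>J. D * x \<in> A)" by (auto simp: \<J>_def)
  ultimately show ?thesis using D classes by (intro exI[of _ \<J>] exI[of _ D]) simp
qed

end

section \<open>Degrees and exponentiation of ideals\<close>

lemma ideal_multI: "x \<in> I \<Longrightarrow> y \<in> J \<Longrightarrow> x * y \<in> ideal_mult I J"
  unfolding ideal_mult_def by (intro CollectI exI[of _ "1::nat"] exI[of _ "\<lambda>_. x"] exI[of _ "\<lambda>_. y"]) simp

lemma zero_in_ideal_mult: "0 \<in> ideal_mult I J"
  unfolding ideal_mult_def by (intro CollectI exI[of _ "0::nat"]) simp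

lemma ideal_mult_add:
  assumes "u \<in> ideal_mult I J" "w \<in> ideal_mult I J" shows "u + w \<in> ideal_mult I J"
proof -
  obtain n :: nat and f g where u: "u = (\<Sum>i<n. f i * g i)" "\<forall>i<n. f i \<in> I \<and> g i \<in> J"
    using assms(1) unfolding ideal_mult_def by blast
  obtain m :: nat and f' g' where w: "w = (\<Sum>i<m. f' i * g' i)" "\<forall>i<m. f' i \<in> I \<and> g' i \<in> J"
    using assms(2) unfolding ideal_mult_def by blast
  let ?f = "\<lambda>i. if i < n then f i else f' (i - n)" and ?g = "\<lambda>i. if i < n then g i else g' (i - n)"
  have "(\<Sum>i<n + m. ?f i * ?g i) = (\<Sum>i<n. ?f i * ?g i) + (\<Sum>i<m. ?f (i + n) * ?g (i + n))"
    by (induction m) (auto simp: add.commute[of n])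
  also have "\<dots> = u + w" by (simp add: u(1) w(1))
  finally have "u + w = (\<Sum>i<n + m. ?f i * ?g i)" by simp
  moreover have "\<forall>i<n + m. ?f i \<in> I \<and> ?g i \<in> J" using u(2) w(2) by auto
  ultimately show ?thesis unfolding ideal_mult_def
    by (intro CollectI exI[of _ "n + m"] exI[of _ ?f] exI[of _ ?g] conjI)
qed

lemma ideal_mult_subset:
  assumes "0 \<in> M" "\<And>x y. x \<in> M \<Longrightarrow> y \<in> M \<Longrightarrow> x + y \<in> M" "\<And>x y. x \<in> I \<Longrightarrow> y \<in> J \<Longrightarrow> x * y \<in> M"
  shows "ideal_mult I J \<subseteq> M"
proof
  fix u assume "u \<in> ideal_mult I J"
  then obtain n :: nat and f g where u: "u = (\<Sum>i<n. f i * g i)" "\<forall>i<n. f i \<in> I \<and> g i \<in> J"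
    unfolding ideal_mult_def by blast
  have "(\<Sum>i<m. f i * g i) \<in> M" if "m \<le> n" for m
    using that by (induction m) (use assms u(2) in auto)
  then show "u \<in> M" using u(1) by simp
qed

context goss_setting
begin

lemma ideal_mult_frac:
  assumes I: "I \<in> fractional_ideals" and J: "J \<in> fractional_ideals"
  shows "ideal_mult I J \<in> fractional_ideals"
proof -
  obtain x where x: "x \<in> I" "x \<noteq> 0" using fracD(3)[OF I] by blast
  obtain y where y: "y \<in> J" "y \<noteq> 0" using fracD(3)[OF J] by blast
  obtain a where a: "a \<in> A" "a \<noteq> 0" "\<And>x. x \<in> I \<Longrightarrow> a * x \<in> A" using fracD(6)[OF I] by blast
  obtain b where b: "b \<in> A" "b \<noteq> 0" "\<And>x. x \<in> J \<Longrightarrow> b * x \<in> A" using fracD(6)[OF J] by blast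
  show ?thesis
  proof (rule fracI[of _ "x * y" "a * b"])
    show "ideal_mult I J \<subseteq> k"
      using fracD(1)[OF I] fracD(1)[OF J] by (intro ideal_mult_subset) (auto intro: k_closed)
    show "x * y \<in> ideal_mult I J" using x y by (intro ideal_multI)
    show "x * y \<noteq> 0" "a * b \<noteq> 0" "a * b \<in> A" using x y a b A_closed(4) by auto
  next
    fix c u assume c: "c \<in> A" and u: "u \<in> ideal_mult I J"
    have "ideal_mult I J \<subseteq> {u. c * u \<in> ideal_mult I J}"
    proof (rule ideal_mult_subset)
      fix x y assume "x \<in> I" "y \<in> J"
      then show "x * y \<in> {u. c * u \<in> ideal_mult I J}"
        using ideal_multI[of "c * x" I y J] fracD(5)[OF I c] by (simp add: mult.assoc)
    qed (auto simp: zero_in_ideal_mult distrib_left intro: ideal_mult_add)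
    then show "c * u \<in> ideal_mult I J" using u by blast
  next
    fix u assume u: "u \<in> ideal_mult I J"
    have "ideal_mult I J \<subseteq> {u. a * b * u \<in> A}"
    proof (rule ideal_mult_subset)
      fix x y assume "x \<in> I" "y \<in> J"
      then have "(a * x) * (b * y) \<in> A" using a b A_closed(4) by blast
      then show "x * y \<in> {u. a * b * u \<in> A}" by (simp add: mult_ac)
    qed (auto simp: distrib_left intro: A_closed)
    then show "a * b * u \<in> A" using u by blast
  qed (auto intro: zero_in_ideal_mult ideal_mult_add)
qed

lemma ideal_mult_principal:
  assumes J: "J \<in> fractional_ideals" shows "ideal_mult ((*) l ` A) J = (*) l ` J"
proof (intro equalityI ideal_mult_subset)
  show "0 \<in> (*) l ` J" using fracD(2)[OF J] by force
  fix x y assume "x \<in> (*) l ` J" "y \<in> (*) l ` J"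
  then obtain x' y' where "x = l * x'" "y = l * y'" "x' \<in> J" "y' \<in> J" by blast
  then show "x + y \<in> (*) l ` J" using fracD(4)[OF J, of x' y'] by (auto simp: distrib_left[symmetric])
next
  fix x y assume "x \<in> (*) l ` A" and y: "y \<in> J"
  then obtain a where a: "x = l * a" "a \<in> A" by blast
  have "x * y = l * (a * y)" using a by simp
  then show "x * y \<in> (*) l ` J" using fracD(5)[OF J a(2) y] by blast
next
  show "(*) l ` J \<subseteq> ideal_mult ((*) l ` A) J"
  proof
    fix x assume "x \<in> (*) l ` J"
    then obtain y where y: "x = l * y" "y \<in> J" by blast
    have "l \<in> (*) l ` A" using A_closed(2) by force
    then show "x \<in> ideal_mult ((*) l ` A) J" using ideal_multI[OF \<open>l \<in> _\<close> y(2)] y(1) by simp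
  qed
qed

lemma ideal_power_frac: "I \<in> fractional_ideals \<Longrightarrow> ideal_power A I n \<in> fractional_ideals"
  by (induction n) (auto intro: A_frac ideal_mult_frac)

lemma ideal_power_principal: "l \<in> k \<Longrightarrow> l \<noteq> 0 \<Longrightarrow> ideal_power A ((*) l ` A) n = (*) (l ^ n) ` A"
proof (induction n)
  case (Suc n)
  have "(*) (l ^ n) ` A \<in> fractional_ideals" using Suc.prems k_closed(9) by (intro scale_frac[OF A_frac]) auto
  then have "ideal_mult ((*) l ` A) ((*) (l ^ n) ` A) = (*) l ` (*) (l ^ n) ` A"
    by (rule ideal_mult_principal)
  moreover have "(*) l ` (*) (l ^ n) ` A = (*) (l ^ Suc n) ` A" by (simp add: image_image mult.assoc)
  ultimately show ?case by (simp only: ideal_power.simps Suc.IH[OF Suc.prems])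
qed simp

lemma ideal_mult_subset_right:
  assumes I: "I \<subseteq> A" and J: "J \<in> fractional_ideals" shows "ideal_mult I J \<subseteq> J"
  using fracD[OF J] I by (intro ideal_mult_subset) auto

lemma ideal_power_subset: "I \<subseteq> A \<Longrightarrow> I \<in> fractional_ideals \<Longrightarrow> ideal_power A I n \<subseteq> A"
proof (induction n)
  case (Suc n)
  then show ?case using ideal_mult_subset_right[OF Suc.prems(1) ideal_power_frac[OF Suc.prems(2), of n]] by simp
qed simp

text \<open>\<open>ord_ideal\<close> is an infimum of integers, which has the intended meaning once
  it is attained. A denominator of \<open>I\<close> bounds the values from below.\<close>

lemma ord_attained:
  assumes I: "I \<in> fractional_ideals" and v: "v \<in> places k - {vinf}"
  obtains x where "x \<in> I" "x \<noteq> 0" "ord_ideal v I = v x" "\<And>y. y \<in> I \<Longrightarrow> y \<noteq> 0 \<Longrightarrow> v x \<le> v y"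
proof -
  interpret v: place k v using v by (intro placeI) auto
  obtain a where a: "a \<in> A" "a \<noteq> 0" "\<And>x. x \<in> I \<Longrightarrow> a * x \<in> A" using fracD(6)[OF I] by blast
  have lb: "0 \<le> v a + v y" if "y \<in> I" "y \<noteq> 0" for y
  proof -
    have "a * y \<in> val_ge k v 0" using a(3)[OF that(1)] v by (auto simp: A_def')
    moreover have "a \<in> k" "y \<in> k" using a(1) that(1) A_subset fracD(1)[OF I] by auto
    ultimately show ?thesis using v.v_mult[of a y] a(2) that(2) by (auto simp: val_ge_def)
  qed
  obtain x0 where x0: "x0 \<in> I" "x0 \<noteq> 0" using fracD(3)[OF I] by blast
  let ?P = "\<lambda>n. \<exists>x\<in>I. x \<noteq> 0 \<and> v a + v x = int n"
  have P0: "?P (nat (v a + v x0))" using x0 lb[OF x0] by (intro bexI[of _ x0]) auto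
  define n where "n = (LEAST n. ?P n)"
  have n: "n \<le> m" if "?P m" for m unfolding n_def using that by (rule Least_le)
  have "?P n" unfolding n_def by (rule LeastI[of ?P, OF P0])
  then obtain x where x: "x \<in> I" "x \<noteq> 0" "v a + v x = int n" by blast
  have min: "v x \<le> v y" if y: "y \<in> I" "y \<noteq> 0" for y
  proof -
    have "?P (nat (v a + v y))" using y lb[OF y] by (intro bexI[of _ y]) auto
    then have "n \<le> nat (v a + v y)" by (rule n)
    then show ?thesis using x(3) lb[OF y] by linarith
  qed
  have "ord_ideal v I = v x" unfolding ord_ideal_def using x min by (intro cInf_eq_minimum) auto
  then show thesis using that x min by blast
qed

lemma ord_mult:
  assumes I: "I \<in> fractional_ideals" and J: "J \<in> fractional_ideals" and v: "v \<in> places k - {vinf}"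
  shows "ord_ideal v (ideal_mult I J) = ord_ideal v I + ord_ideal v J"
proof -
  interpret v: place k v using v by (intro placeI) auto
  obtain x where x: "x \<in> I" "x \<noteq> 0" "ord_ideal v I = v x" "\<And>y. y \<in> I \<Longrightarrow> y \<noteq> 0 \<Longrightarrow> v x \<le> v y"
    by (rule ord_attained[OF I v]) blast
  obtain y where y: "y \<in> J" "y \<noteq> 0" "ord_ideal v J = v y" "\<And>z. z \<in> J \<Longrightarrow> z \<noteq> 0 \<Longrightarrow> v y \<le> v z"
    by (rule ord_attained[OF J v]) blast
  have xy: "x * y \<in> ideal_mult I J" "x * y \<noteq> 0" using x y ideal_multI by auto
  have vxy: "v (x * y) = v x + v y" using x y fracD(1)[OF I] fracD(1)[OF J] by (intro v.v_mult) auto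
  have "ideal_mult I J \<subseteq> val_ge k v (v x + v y)"
  proof (rule ideal_mult_subset)
    fix u w assume "u \<in> I" "w \<in> J"
    then have "u \<in> val_ge k v (v x)" "w \<in> val_ge k v (v y)"
      using x(4)[of u] y(4)[of w] fracD(1)[OF I] fracD(1)[OF J] by (auto simp: val_ge_def)
    then show "u * w \<in> val_ge k v (v x + v y)" by (rule v.val_ge_mult)
  qed (auto intro: v.zero_val_ge v.val_ge_add)
  then have min: "v (x * y) \<le> v z" if "z \<in> ideal_mult I J" "z \<noteq> 0" for z
    using that vxy by (auto simp: val_ge_def)
  have "ord_ideal v (ideal_mult I J) = v (x * y)"
    unfolding ord_ideal_def using xy min by (intro cInf_eq_minimum) auto
  then show ?thesis using vxy x(3) y(3) by simp
qed

lemma ord_principal: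
  assumes l: "l \<in> k" "l \<noteq> 0" and v: "v \<in> places k - {vinf}" shows "ord_ideal v ((*) l ` A) = v l"
proof -
  interpret v: place k v using v by (intro placeI) auto
  have min: "v l \<le> v y" if y: "y \<in> (*) l ` A" "y \<noteq> 0" for y
  proof -
    obtain a where a: "y = l * a" "a \<in> A" using y by blast
    then have "a \<in> val_ge k v 0" using v by (auto simp: A_def')
    then show ?thesis using a y v.v_mult[OF l(1), of a] l by (auto simp: val_ge_def)
  qed
  have "l \<in> (*) l ` A" using A_closed(2) by force
  then show ?thesis unfolding ord_ideal_def using l min by (intro cInf_eq_minimum) auto
qed

lemma finite_support: "x \<in> k \<Longrightarrow> x \<noteq> 0 \<Longrightarrow> finite {v\<in>places k. v x \<noteq> 0}"
  by (rule finite_subset[of _ "{v\<in>places k. 0 < v x} \<union> {v\<in>places k. v x < 0}"])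
    (auto simp: finite_zeros finite_poles)

text \<open>At a place where a denominator of \<open>I\<close> and some nonzero element of
  \<open>I\<close> are both units, the order is \<open>0\<close>; all but finitely many places are
  of this kind.\<close>

lemma finite_ord_support:
  assumes I: "I \<in> fractional_ideals" shows "finite {v\<in>places k - {vinf}. ord_ideal v I \<noteq> 0}"
proof -
  obtain a where a: "a \<in> A" "a \<noteq> 0" "\<And>x. x \<in> I \<Longrightarrow> a * x \<in> A" using fracD(6)[OF I] by blast
  obtain x0 where x0: "x0 \<in> I" "x0 \<noteq> 0" using fracD(3)[OF I] by blast
  have k: "a \<in> k" "x0 \<in> k" using a x0 A_subset fracD(1)[OF I] by auto
  have "{v\<in>places k - {vinf}. ord_ideal v I \<noteq> 0} \<subseteq> {v\<in>places k. v a \<noteq> 0} \<union> {v\<in>places k. v x0 \<noteq> 0}"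
  proof (rule subsetI, rule ccontr)
    fix v assume v0: "v \<in> {v\<in>places k - {vinf}. ord_ideal v I \<noteq> 0}"
      and n: "v \<notin> {v\<in>places k. v a \<noteq> 0} \<union> {v\<in>places k. v x0 \<noteq> 0}"
    then have v: "v \<in> places k" "v \<noteq> vinf" "ord_ideal v I \<noteq> 0" and 0: "v x0 = 0" "v a = 0" by auto
    interpret v: place k v using v by (intro placeI)
    obtain x where x: "x \<in> I" "x \<noteq> 0" "ord_ideal v I = v x" "\<And>y. y \<in> I \<Longrightarrow> y \<noteq> 0 \<Longrightarrow> v x \<le> v y"
      using ord_attained[OF I, of v] v by blast
    have "v x < 0" using x(3) x(4)[OF x0] v(3) 0 by simp
    moreover have "a * x \<in> val_ge k v 0" using a(3)[OF x(1)] v by (auto simp: A_def')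
    then have "0 \<le> v a + v x" using v.v_mult[of a x] k a(2) x(1,2) fracD(1)[OF I] by (auto simp: val_ge_def)
    ultimately show False using 0(2) by linarith
  qed
  then show ?thesis using finite_support k a(2) x0(2) by (meson finite_UnI finite_subset)
qed

lemma degk_eq:
  assumes "finite Z" "Z \<subseteq> places k - {vinf}" "{v\<in>places k - {vinf}. ord_ideal v I \<noteq> 0} \<subseteq> Z"
  shows "degk I = (\<Sum>v\<in>Z. ord_ideal v I * int (deg v))"
  unfolding degk_def using assms by (intro sum.mono_neutral_left) auto

lemma degk_mult:
  assumes I: "I \<in> fractional_ideals" and J: "J \<in> fractional_ideals"
  shows "degk (ideal_mult I J) = degk I + degk J"
proof -
  let ?Z = "{v\<in>places k - {vinf}. ord_ideal v I \<noteq> 0} \<union> {v\<in>places k - {vinf}. ord_ideal v J \<noteq> 0}"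
  have Z: "finite ?Z" "?Z \<subseteq> places k - {vinf}" using finite_ord_support I J by auto
  have "degk (ideal_mult I J) = (\<Sum>v\<in>?Z. ord_ideal v (ideal_mult I J) * int (deg v))"
    using ord_mult[OF I J] by (intro degk_eq Z) auto
  also have "\<dots> = (\<Sum>v\<in>?Z. ord_ideal v I * int (deg v) + ord_ideal v J * int (deg v))"
    using ord_mult[OF I J] by (intro sum.cong) (auto simp: distrib_right)
  also have "\<dots> = degk I + degk J"
    unfolding sum.distrib using degk_eq[OF Z, of I] degk_eq[OF Z, of J] by simp
  finally show ?thesis .
qed

text \<open>By the product formula the finite part of the divisor of \<open>l\<close> has the
  opposite degree of its part at infinity.\<close>

lemma degk_principal:
  assumes l: "l \<in> k" "l \<noteq> 0" shows "degk ((*) l ` A) = - (int d_inf * vinf l)"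
proof -
  let ?Z = "{v\<in>places k. v l \<noteq> 0} - {vinf}"
  have Z: "finite ?Z" "?Z \<subseteq> places k - {vinf}" using finite_support[OF l] by auto
  have "degk ((*) l ` A) = (\<Sum>v\<in>?Z. ord_ideal v ((*) l ` A) * int (deg v))"
    using ord_principal[OF l] by (intro degk_eq Z) auto
  also have "\<dots> = (\<Sum>v\<in>?Z. v l * int (deg v))" using ord_principal[OF l] by (intro sum.cong) auto
  also have "\<dots> + vinf l * int (deg vinf) = (\<Sum>v\<in>insert vinf ?Z. v l * int (deg v))"
    by (subst sum.insert) (use Z(1) in auto)
  also have "\<dots> = 0" using Z vinf_place by (intro product_formula[OF l]) auto
  finally show ?thesis by (simp add: d_inf_eq eq_neg_iff_add_eq_0 mult.commute)
qed

section \<open>Size and multiplicativity of the values at ideals\<close>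

lemma br_mult: "I \<in> fractional_ideals \<Longrightarrow> J \<in> fractional_ideals \<Longrightarrow> br (ideal_mult I J) = br I * br J"
  and br_one_unit: "I \<in> fractional_ideals \<Longrightarrow> absv (br I - 1) < 1"
  and br_principal: "x \<in> k \<Longrightarrow> x \<noteq> 0 \<Longrightarrow> positive x \<Longrightarrow> br ((*) x ` A) = unit_part x"
  using br_hom unfolding one_unit_hom_def one_units_def by auto

lemma abs_br: "I \<in> fractional_ideals \<Longrightarrow> absv (br I) = 1"
  using abs.N_one_plus[of "br I - 1"] br_one_unit by simp

lemma br_nonzero: "I \<in> fractional_ideals \<Longrightarrow> br I \<noteq> 0"
  using abs_br by fastforce

lemma r_gt_1: "1 < real (card Fr)"
  using card_F by simp

lemma abs_pistar: "absv pistar = inverse (real (card Fr))"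
proof -
  have "absv pistar ^ d_inf = absv unif" using pistar abs.N_power[of pistar d_inf] by simp
  also have "\<dots> = inverse (real (card Fr)) ^ d_inf" unfolding unif_abs by (simp add: power_int_minus power_inverse)
  finally have e: "absv pistar ^ d_inf = inverse (real (card Fr)) ^ d_inf" .
  show ?thesis by (rule power_eq_imp_eq_base[OF e abs_nonneg _ d_inf_pos]) simp
qed

lemma pistar_nonzero: "pistar \<noteq> 0"
  using abs_pistar r_gt_1 abs.N_0 by auto

lemma unif_nonzero: "unif \<noteq> 0"
  using pistar pistar_nonzero by auto

lemma ideal_s1_nonzero: "I \<in> fractional_ideals \<Longrightarrow> ideal_s1 I \<noteq> 0"
  using br_nonzero pistar_nonzero by (simp add: ideal_s1_def)

lemma ideal_s1_mult:
  "I \<in> fractional_ideals \<Longrightarrow> J \<in> fractional_ideals \<Longrightarrow> ideal_s1 (ideal_mult I J) = ideal_s1 I * ideal_s1 J"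
  using pistar_nonzero by (simp add: ideal_s1_def degk_mult br_mult power_int_diff power_int_minus field_simps power_int_add)

lemma ideal_s1_A: "ideal_s1 A = 1"
proof -
  have "ideal_mult A A = A" using ideal_mult_principal[OF A_frac, of 1] by simp
  then have "ideal_s1 A * ideal_s1 A = ideal_s1 A" using ideal_s1_mult[OF A_frac A_frac] by simp
  then show ?thesis using ideal_s1_nonzero[OF A_frac] by simp
qed

lemma ideal_s1_power: "I \<in> fractional_ideals \<Longrightarrow> ideal_s1 (ideal_power A I n) = ideal_s1 I ^ n"
  by (induction n) (auto simp: ideal_s1_A ideal_s1_mult ideal_power_frac)

lemma abs_ideal_s1: "I \<in> fractional_ideals \<Longrightarrow> absv (ideal_s1 I) = real (card Fr) powi degk I"
proof -
  assume I: "I \<in> fractional_ideals"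
  have "absv (ideal_s1 I) = absv (pistar powi (- degk I)) * absv (br I)"
    unfolding ideal_s1_def by (rule abs_mult)
  also have "\<dots> = inverse (real (card Fr)) powi (- degk I)"
    by (simp only: abs.N_powi[OF UNIV_I] abs_pistar abs_br[OF I] mult_1_right)
  also have "\<dots> = real (card Fr) powi degk I" by (simp add: power_int_inverse power_int_minus)
  finally show ?thesis .
qed

section \<open>The completion at infinity\<close>

lemma abs_metric: "Metric_space UNIV (\<lambda>x y. absv (x - y))"
proof
  show "absv (x - y) = absv (y - x)" for x y using abs.N_uminus[of "x - y"] by simp
  show "absv (x - z) \<le> absv (x - y) + absv (y - z)" for x y z
    using abs.N_add[of "x - y" "y - z"] abs_nonneg[of "x - y"] abs_nonneg[of "y - z"] by simp
qed (auto simp: abs_nonneg abs_eq_0)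

lemma K_iff: "x \<in> K \<longleftrightarrow> (\<forall>e>0. \<exists>y\<in>k. absv (x - y) < e)"
proof -
  interpret M: Metric_space UNIV "\<lambda>x y. absv (x - y)" by (rule abs_metric)
  show ?thesis unfolding K_def top_C_def M.metric_closure_of by (auto simp: M.in_mball)
qed

lemma K_approx: "x \<in> K \<Longrightarrow> 0 < e \<Longrightarrow> \<exists>y\<in>k. absv (x - y) < e"
  by (simp add: K_iff)

lemma k_subset_K: "k \<subseteq> K"
  using K_iff by fastforce

lemma K_approx_abs:
  assumes "x \<in> K" "x \<noteq> 0" "0 < e" shows "\<exists>y\<in>k. absv (x - y) < e \<and> absv y = absv x \<and> y \<noteq> 0"
proof -
  have "0 < absv x" using abs_nonneg[of x] abs_eq_0[of x] assms(2) by linarith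
  then obtain y where y: "y \<in> k" "absv (x - y) < min e (absv x)" using K_approx[OF assms(1), of "min e (absv x)"] assms(3) by auto
  have "absv (x + - (x - y)) = absv x"
    by (rule abs.N_add_lt) (use y abs.N_uminus[of "x - y"] in auto)
  then have "absv y = absv x" by simp
  then show ?thesis using y \<open>0 < absv x\<close> by (intro bexI[of _ y]) auto
qed

lemma K_subfield: "is_subfield K"
  unfolding is_subfield_def
proof (intro conjI ballI)
  show "0 \<in> K" "1 \<in> K" using k_subset_K k_closed(1,2) by auto
  fix x y assume xy: "x \<in> K" "y \<in> K"
  show "x - y \<in> K" unfolding K_iff
  proof (intro allI impI)
    fix e :: real assume e: "0 < e"
    obtain x' where x': "x' \<in> k" "absv (x - x') < e" using K_approx[OF xy(1) e] by blast
    obtain y' where y': "y' \<in> k" "absv (y - y') < e" using K_approx[OF xy(2) e] by blast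
    have "absv ((x - x') - (y - y')) < e" using abs.N_diff[of "x - x'" "y - y'"] x' y' by simp
    then show "\<exists>z\<in>k. absv (x - y - z) < e" using x' y' k_closed(3)
      by (intro bexI[of _ "x' - y'"]) (auto simp: algebra_simps)
  qed
  show "x * y \<in> K" unfolding K_iff
  proof (intro allI impI)
    fix e :: real assume e: "0 < e"
    obtain y' where y': "y' \<in> k" "absv (y - y') < e / (absv x + 1)"
      using K_approx[OF xy(2), of "e / (absv x + 1)"] e abs_nonneg[of x] by (auto simp: divide_pos_pos add_nonneg_pos)
    obtain x' where x': "x' \<in> k" "absv (x - x') < e / (absv y' + 1)"
      using K_approx[OF xy(1), of "e / (absv y' + 1)"] e abs_nonneg[of y'] by (auto simp: divide_pos_pos add_nonneg_pos)
    have small: "a * b < e" if "0 \<le> a" "0 \<le> b" "b < e / (a + 1)" for a b :: real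
    proof -
      have "(a + 1) * b < e" using that by (simp add: field_simps)
      then show ?thesis using that by (simp add: distrib_right)
    qed
    have "absv (x * (y - y')) < e" using small[OF abs_nonneg abs_nonneg y'(2)] by (simp add: abs_mult)
    moreover have "absv (y' * (x - x')) < e" using small[OF abs_nonneg abs_nonneg x'(2)] by (simp add: abs_mult)
    ultimately have "absv (x * (y - y') + y' * (x - x')) < e"
      using abs.N_add[of "x * (y - y')" "y' * (x - x')"] by simp
    then show "\<exists>z\<in>k. absv (x * y - z) < e" using x' y' k_closed(4)
      by (intro bexI[of _ "x' * y'"]) (auto simp: algebra_simps)
  qed
next
  fix x assume x: "x \<in> K"
  show "inverse x \<in> K"
  proof (cases "x = 0")
    case False
    show ?thesis unfolding K_iff
    proof (intro allI impI)
      fix e :: real assume e: "0 < e"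
      have p: "0 < absv x" using abs_nonneg[of x] abs_eq_0[of x] False by linarith
      obtain y where y: "y \<in> k" "absv (x - y) < e * (absv x * absv x)" "absv y = absv x" "y \<noteq> 0"
        using K_approx_abs[OF x False, of "e * (absv x * absv x)"] e p by auto
      have "inverse x - inverse y = - ((x - y) / (x * y))" using False y(4) by (simp add: field_simps)
      then have "absv (inverse x - inverse y) = absv ((x - y) / (x * y))" using abs.N_uminus[of "(x - y) / (x * y)"] by simp
      also have "\<dots> = absv (x - y) / (absv x * absv x)" using y(3) by (simp add: abs.N_divide abs_mult)
      also have "\<dots> < e" using y(2) p by (simp add: divide_less_eq)
      finally show "\<exists>z\<in>k. absv (inverse x - z) < e" using y(1) k_closed(10) by (intro bexI[of _ "inverse y"]) auto
    qed
  qed (use x in simp)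
qed

lemmas K_closed = subfield_closed[OF K_subfield]

lemma abs_le_1_iff: "x \<in> k \<Longrightarrow> absv x \<le> 1 \<longleftrightarrow> x \<in> val_ge k vinf 0"
  and abs_lt_1_iff: "x \<in> k \<Longrightarrow> absv x < 1 \<longleftrightarrow> x \<in> val_ge k vinf 1"
proof -
  assume x: "x \<in> k"
  have *: "(absv x \<le> 1 \<longleftrightarrow> 0 \<le> vinf x) \<and> (absv x < 1 \<longleftrightarrow> 1 \<le> vinf x)" if "x \<noteq> 0"
  proof -
    define n where "n = int d_inf * vinf x"
    have e: "absv x = real (card Fr) powi (- n)" using abs_k[of x] x that by (simp add: n_def)
    have s: "0 < n \<longleftrightarrow> 0 < vinf x" "n < 0 \<longleftrightarrow> vinf x < 0" using d_inf_pos by (auto simp: n_def zero_less_mult_iff mult_less_0_iff)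
    consider "0 < n" | "n = 0" | "n < 0" by linarith
    then show ?thesis
    proof cases
      case 1
      have "1 < real (card Fr) ^ nat n" using r_gt_1 1 by (intro one_less_power) auto
      moreover have "real (card Fr) powi n = real (card Fr) ^ nat n" using 1 by (simp add: power_int_def)
      ultimately have "absv x < 1" unfolding e power_int_minus inverse_less_1_iff by simp
      then show ?thesis using s 1 by auto
    next
      case 2
      then show ?thesis using s e by auto
    next
      case 3
      have "1 < real (card Fr) ^ nat (- n)" using r_gt_1 3 by (intro one_less_power) auto
      then have "1 < absv x" unfolding e using 3 by (simp add: power_int_def)
      then show ?thesis using s 3 by auto
    qed
  qed
  show "absv x \<le> 1 \<longleftrightarrow> x \<in> val_ge k vinf 0" "absv x < 1 \<longleftrightarrow> x \<in> val_ge k vinf 1"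
    using * x by (cases "x = 0"; auto simp: val_ge_def)+
qed

lemma abs_A_ge_1: "x \<in> A \<Longrightarrow> x \<noteq> 0 \<Longrightarrow> 1 \<le> absv x"
  using abs_lt_1_iff[of x] A_vinf_le[of x] A_subset by (force simp: val_ge_def)

text \<open>Since \<open>k\<close> is dense in \<open>K\<close>, the residue classes at infinity are
  already represented in \<open>k\<close>.\<close>

lemma K_residue_cover:
  obtains T where "finite T" "T \<subseteq> k" "T \<noteq> {}" "\<And>t. t \<in> T \<Longrightarrow> absv t \<le> 1"
    "\<And>x. x \<in> K \<Longrightarrow> absv x \<le> 1 \<Longrightarrow> \<exists>t\<in>T. absv (x - t) < 1"
proof -
  obtain T where T: "finite T" "T \<subseteq> val_ge k vinf 0"
    "\<And>x. x \<in> val_ge k vinf 0 \<Longrightarrow> \<exists>t\<in>T. x - t \<in> val_ge k vinf 1" using residue_transversal[OF vinf_place] by metis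
  have Tk: "T \<subseteq> k" using T(2) by (auto simp: val_ge_def)
  have cov: "\<exists>t\<in>T. absv (x - t) < 1" if x: "x \<in> K" "absv x \<le> 1" for x
  proof -
    obtain y where y: "y \<in> k" "absv (x - y) < 1" using K_approx[OF x(1), of 1] by auto
    have "absv (x - (x - y)) \<le> max (absv x) (absv (x - y))" by (rule abs.N_diff) auto
    then have "absv y \<le> 1" using x y by simp
    then obtain t where t: "t \<in> T" "y - t \<in> val_ge k vinf 1" using T(3) abs_le_1_iff[OF y(1)] by blast
    have "y - t \<in> k" using y(1) t(1) Tk k_closed(3) by blast
    then have "absv (y - t) < 1" using abs_lt_1_iff t(2) by blast
    then have "absv ((x - y) + (y - t)) < 1" using abs.N_add[of "x - y" "y - t"] y(2) by simp
    then show ?thesis using t(1) by auto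
  qed
  show thesis
  proof (rule that[OF T(1) Tk _ _ cov])
    show "T \<noteq> {}" using cov[of 0] K_closed(1) by auto
    show "absv t \<le> 1" if "t \<in> T" for t using abs_le_1_iff[of t] that T(2) Tk by blast
  qed
qed

lemma K_unit_power: "\<exists>E>0. \<forall>u\<in>K. absv u = 1 \<longrightarrow> absv (u ^ E - 1) < 1"
proof -
  interpret KK: nonarch K absv
    by unfold_locales (auto simp: K_subfield abs_nonneg abs_eq_0 abs_mult abs_ultrametric)
  obtain T where T: "finite T" "\<And>x. x \<in> K \<Longrightarrow> absv x \<le> 1 \<Longrightarrow> \<exists>t\<in>T. absv (x - t) < 1"
    using K_residue_cover by metis
  have bd: "card Y \<le> card T" if Y: "finite Y" "Y \<subseteq> K" "\<And>y. y \<in> Y \<Longrightarrow> absv y \<le> 1"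
    "\<And>y y'. y \<in> Y \<Longrightarrow> y' \<in> Y \<Longrightarrow> absv (y - y') < 1 \<Longrightarrow> y = y'" for Y
  proof -
    have "\<forall>y\<in>Y. \<exists>t\<in>T. absv (y - t) < 1" using T(2) Y(2,3) by blast
    then obtain g where g: "\<And>y. y \<in> Y \<Longrightarrow> g y \<in> T \<and> absv (y - g y) < 1" by metis
    have "inj_on g Y"
    proof (rule inj_onI)
      fix y y' assume yy: "y \<in> Y" "y' \<in> Y" "g y = g y'"
      have "absv ((y - g y) - (y' - g y')) < 1"
        using abs.N_diff[of "y - g y" "y' - g y'"] conjunct2[OF g[OF yy(1)]] conjunct2[OF g[OF yy(2)]] by simp
      then show "y = y'" using Y(4)[OF yy(1,2)] yy(3) by simp
    qed
    then show ?thesis using g T(1) by (intro card_inj_on_le[of g]) auto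
  qed
  show ?thesis
    by (intro exI[of _ "fact (card T)"] conjI ballI impI) (auto intro: KK.unit_power_one[OF bd])
qed

text \<open>Absolute values give \<open>n = m\<close>. Then \<open>z - 1\<close> has absolute value
  less than \<open>1\<close>, whereas a nonzero polynomial expression over \<open>Fr\<close> in the
  algebraic element \<open>z\<close> has absolute value \<open>1\<close>. The sign \<open>1\<close>
  of the first decomposition is the one required by \<open>positive\<close>.\<close>

lemma decomposition_unique:
  assumes d: "decomposition x 1 n u" and d': "decomposition x z m w"
  shows "z = 1 \<and> u = w"
proof -
  have u: "absv (u - 1) < 1" "x = unif powi n * u" and w: "absv (w - 1) < 1" "x = z * unif powi m * w"
    and z: "z \<in> K" "algebraic_over Fr z" "z \<noteq> 0"
    using d d' by (auto simp: decomposition_def one_units_def F_inf_def)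
  have au: "absv u = 1" and aw: "absv w = 1" using abs.N_one_plus[of "u - 1"] abs.N_one_plus[of "w - 1"] u w by auto
  have "[:0, 1:] \<in> polys_over Fr" "[:-1, 1:] \<in> polys_over Fr"
    using subring_closed[OF F_subring] subring_0[OF polys_over_subring[OF F_subring]]
    by (auto simp: pCons_polys_over[OF F_subring])
  note fo = abs.finite_order_abs[OF F_subfield F_finite _ _ z(3,2) this(1), simplified]
    abs.finite_order_abs[OF F_subfield F_finite _ _ z(3,2) this(2), simplified]
  have az: "absv z = 1" using fo(1) z(3) by simp
  have "absv unif powi n = absv unif powi m"
    using u(2) w(2) au aw az by (metis abs.N_mult abs.N_powi iso_tuple_UNIV_I mult.right_neutral mult_1)
  moreover have "0 < absv unif" "absv unif < 1"
  proof -
    have "absv unif = inverse (real (card Fr) ^ d_inf)" unfolding unif_abs by (simp add: power_int_minus)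
    moreover have "1 < real (card Fr) ^ d_inf" using r_gt_1 d_inf_pos by (intro one_less_power) auto
    ultimately show "0 < absv unif" "absv unif < 1" using card_F by (auto simp: inverse_less_1_iff)
  qed
  ultimately have "n = m" by (metis power_int_strict_decreasing linorder_neqE less_irrefl)
  then have uw: "u = z * w" using u(2) w(2) unif_nonzero by simp
  have w0: "w \<noteq> 0" using aw by auto
  have "(z - 1) * w = (u - 1) - (w - 1)" using uw by (simp add: algebra_simps)
  then have "absv ((z - 1) * w) < 1" using abs.N_diff[of "u - 1" "w - 1"] u(1) w(1) by simp
  then have "absv (z - 1) < 1" using aw by (simp add: abs_mult)
  then have "z = 1" using fo(2) by (cases "z = 1") auto
  then show ?thesis using uw by simp
qed

text \<open>The exponent \<open>E\<close> turns the unit part of \<open>l\<close> into a one-unit,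
  so \<open>l ^ E\<close> is positive and \<open>br\<close> is known on it. Thus
  \<open>ideal_s1\<close> of a principal ideal agrees with the generator up to a root of
  unity.\<close>

lemma ideal_s1_principal_power:
  "\<exists>E>0. \<forall>l\<in>k. l \<noteq> 0 \<longrightarrow> ideal_s1 ((*) l ` A) ^ E = l ^ E"
proof -
  obtain E where E: "0 < E" "\<And>u. u \<in> K \<Longrightarrow> absv u = 1 \<Longrightarrow> absv (u ^ E - 1) < 1" using K_unit_power by blast
  have "ideal_s1 ((*) l ` A) ^ E = l ^ E" if l: "l \<in> k" "l \<noteq> 0" for l
  proof -
    have lK: "l \<in> K" using l k_subset_K by auto
    define c where "c = l / unif powi vinf l"
    have c: "c \<in> K" unfolding c_def by (intro K_closed lK unif_K)
    have "absv c = 1"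
    proof -
      have "absv l = real (card Fr) powi (- (int d_inf * vinf l))" using abs_k l by simp
      also have "\<dots> = absv unif powi vinf l" unfolding unif_abs by (simp flip: power_int_mult)
      finally show ?thesis unfolding c_def using unif_nonzero abs_eq_0[of unif]
        by (simp add: abs.N_divide abs.N_powi)
    qed
    then have c1: "absv (c ^ E - 1) < 1" using E(2) c by blast
    define n where "n = vinf l * int E"
    have lE: "l ^ E = unif powi n * c ^ E"
      unfolding c_def n_def using unif_nonzero by (simp add: power_divide power_int_mult)
    have dec: "decomposition (l ^ E) 1 n (c ^ E)"
      unfolding decomposition_def one_units_def F_inf_def
    proof (intro conjI)
      have "[:-1, 1:] \<in> polys_over Fr"
        using subring_closed[OF F_subring] subring_0[OF polys_over_subring[OF F_subring]]
        by (auto simp: pCons_polys_over[OF F_subring])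
      then have "algebraic_over Fr 1" unfolding algebraic_over_def
        by (intro exI[of _ "[:-1, 1:]"]) (auto simp: polys_over_def)
      then show "1 \<in> {x\<in>K. algebraic_over Fr x} - {0}" using K_closed(2) by simp
      show "c ^ E \<in> K \<inter> {u. absv (u - 1) < 1}" using c c1 K_closed(9) by simp
    qed (use lE in simp)
    have "sgn_inf (l ^ E) = 1" unfolding sgn_inf_def
      by (rule the_equality) (use dec decomposition_unique[OF dec] in blast)+
    then have pos: "positive (l ^ E)" unfolding positive_def using lK l(2) K_closed(9) by auto
    have up: "unit_part (l ^ E) = c ^ E" unfolding unit_part_def
      by (rule the_equality) (use dec decomposition_unique[OF dec] in blast)+
    have lEk: "l ^ E \<in> k" "l ^ E \<noteq> 0" using l k_closed(9) by auto
    have "ideal_s1 ((*) l ` A) ^ E = ideal_s1 ((*) (l ^ E) ` A)"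
      using ideal_s1_power[OF scale_frac[OF A_frac l], of E] ideal_power_principal[OF l, of E] by simp
    also have "\<dots> = pistar powi (int d_inf * vinf (l ^ E)) * c ^ E"
      unfolding ideal_s1_def degk_principal[OF lEk] br_principal[OF lEk pos] up by simp
    also have "pistar powi (int d_inf * vinf (l ^ E)) = unif powi n"
      unfolding vinf.v_power[OF l] n_def
      by (simp only: power_int_mult[of pistar "int d_inf"] power_int_of_nat pistar) (simp only: mult.commute)
    finally show ?thesis using lE by simp
  qed
  then show ?thesis using E(1) by blast
qed

section \<open>A finite set spanning the values of exponentiation\<close>

text \<open>Up to factors from \<open>k\<close> the set \<open>S\<close> is closed under
  multiplication and contains all values of \<open>ideal_s1\<close>. The last clause describes
  multiplication by \<open>ideal_s1 I\<close> as a matrix with one entry in each row and with a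
  common denominator \<open>D\<close>, uniformly in the ideal \<open>I\<close>.\<close>

definition spanning :: "'c set \<Rightarrow> 'c \<Rightarrow> bool" where
  "spanning S D \<longleftrightarrow> finite S \<and> S \<noteq> {} \<and> 0 \<notin> S \<and> D \<in> A - {0} \<and>
    (\<forall>I\<in>fractional_ideals. \<exists>\<mu>\<in>k - {0}. \<exists>s\<in>S. ideal_s1 I = \<mu> * s) \<and>
    (\<forall>s\<in>S. \<forall>s'\<in>S. \<exists>\<mu>\<in>k - {0}. \<exists>s''\<in>S. s * s' = \<mu> * s'') \<and>
    (\<forall>I\<in>ideals. \<forall>s\<in>S. \<exists>\<mu>\<in>k - {0}. \<exists>s'\<in>S. ideal_s1 I * s = \<mu> * s' \<and> D * \<mu> \<in> A)"

lemma spanningD: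
  assumes "spanning S D"
  shows "finite S" "S \<noteq> {}" "0 \<notin> S" "D \<in> A" "D \<noteq> 0"
    "\<And>I. I \<in> fractional_ideals \<Longrightarrow> \<exists>\<mu>\<in>k - {0}. \<exists>s\<in>S. ideal_s1 I = \<mu> * s"
    "\<And>s s'. s \<in> S \<Longrightarrow> s' \<in> S \<Longrightarrow> \<exists>\<mu>\<in>k - {0}. \<exists>s''\<in>S. s * s' = \<mu> * s''"
    "\<And>I s. I \<in> ideals \<Longrightarrow> s \<in> S \<Longrightarrow> \<exists>\<mu>\<in>k - {0}. \<exists>s'\<in>S. ideal_s1 I * s = \<mu> * s' \<and> D * \<mu> \<in> A"
  using assms unfolding spanning_def by auto

text \<open>Up to roots of unity and factors from \<open>k\<close>, the value
  \<open>ideal_s1 I\<close> depends on the class of \<open>I\<close> only. So \<open>S\<close>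
  consists of the \<open>z * ideal_s1 J\<close> with \<open>z\<close> a root of unity and
  \<open>J\<close> among finitely many representatives.\<close>

lemma spanning_exists: "\<exists>S D. spanning S D"
proof -
  obtain E where E: "0 < E" "\<And>l. l \<in> k \<Longrightarrow> l \<noteq> 0 \<Longrightarrow> ideal_s1 ((*) l ` A) ^ E = l ^ E"
    using ideal_s1_principal_power by blast
  obtain \<J> D where J0: "finite \<J> \<and> \<J> \<subseteq> fractional_ideals \<and> D \<in> A - {0} \<and> (\<forall>J\<in>\<J>. 1 \<in> J \<and> (\<forall>x\<in>J. D * x \<in> A)) \<and>
    (\<forall>I\<in>fractional_ideals. \<exists>l\<in>k - {0}. \<exists>J\<in>\<J>. I = (*) l ` J)" using finitely_many_classes by (elim exE)
  have J: "finite \<J>" "\<J> \<subseteq> fractional_ideals" "\<And>J. J \<in> \<J> \<Longrightarrow> 1 \<in> J" "D \<in> A" "D \<noteq> 0"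
    "\<And>J x. J \<in> \<J> \<Longrightarrow> x \<in> J \<Longrightarrow> D * x \<in> A"
    using J0 by simp_all
  have cls: "\<exists>l\<in>k - {0}. \<exists>J\<in>\<J>. I = (*) l ` J" if "I \<in> fractional_ideals" for I
    using J0 that by (elim conjE) (erule bspec)
  define Z where "Z = {z::'c. z ^ E = 1}"
  have Z: "finite Z"
  proof -
    have "Polynomial.monom 1 E - 1 \<noteq> (0 :: 'c poly)"
      using E(1) by (auto dest!: arg_cong[of _ _ "\<lambda>p. coeff p E"])
    then have "finite {z. poly (Polynomial.monom 1 E - 1) z = (0::'c)}" by (rule poly_roots_finite)
    then show ?thesis by (simp add: Z_def poly_monom)
  qed
  have Z0: "z \<noteq> 0" "absv z = 1" if "z \<in> Z" for z
  proof -
    show "z \<noteq> 0" using that E(1) by (auto simp: Z_def power_0_left)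
    have "absv z ^ E = 1" using that abs.N_power[of z E] by (simp add: Z_def)
    then have e: "absv z ^ E = 1 ^ E" by simp
    show "absv z = 1" by (rule power_eq_imp_eq_base[OF e abs_nonneg _ E(1)]) simp
  qed
  define S where "S = (\<lambda>(z, J). z * ideal_s1 J) ` (Z \<times> \<J>)"
  have S: "finite S" using Z J(1) by (simp add: S_def)
  have SI: "z * ideal_s1 J \<in> S" if "z \<in> Z" "J \<in> \<J>" for z J using that by (auto simp: S_def)
  have prin: "\<exists>z\<in>Z. ideal_s1 ((*) l ` J) = l * (z * ideal_s1 J)"
    if l: "l \<in> k - {0}" and J': "J \<in> fractional_ideals" for l J
  proof -
    have "ideal_s1 ((*) l ` J) = ideal_s1 (ideal_mult ((*) l ` A) J)" using ideal_mult_principal[OF J'] by simp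
    also have "\<dots> = ideal_s1 ((*) l ` A) * ideal_s1 J" using l J' by (intro ideal_s1_mult scale_frac A_frac) auto
    also have "\<dots> = l * ((ideal_s1 ((*) l ` A) / l) * ideal_s1 J)" using l by simp
    finally show ?thesis using E(2)[of l] l by (intro bexI[of _ "ideal_s1 ((*) l ` A) / l"]) (auto simp: Z_def power_divide)
  qed
  have ZZ: "z * w \<in> Z" if "z \<in> Z" "w \<in> Z" for z w using that by (simp add: Z_def power_mult_distrib)
  have main: "\<exists>\<mu>\<in>k - {0}. \<exists>J\<in>\<J>. \<exists>z\<in>Z. ideal_s1 I = \<mu> * (z * ideal_s1 J) \<and> I = (*) \<mu> ` J"
    if I: "I \<in> fractional_ideals" for I
  proof -
    obtain l J where lJ: "l \<in> k - {0}" "J \<in> \<J>" "I = (*) l ` J" using cls[OF I] by blast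
    then show ?thesis using prin[OF lJ(1), of J] J(2) by blast
  qed
  have S2: "\<exists>\<mu>\<in>k - {0}. \<exists>s'\<in>S. ideal_s1 I * s = \<mu> * s' \<and> (I \<subseteq> A \<longrightarrow> D * \<mu> \<in> A)"
    if I: "I \<in> fractional_ideals" and s: "s \<in> S" for I s
  proof -
    obtain z J' where zJ: "s = z * ideal_s1 J'" "z \<in> Z" "J' \<in> \<J>" using s by (auto simp: S_def)
    have J': "J' \<in> fractional_ideals" using zJ J(2) by auto
    obtain \<mu> J'' w where mu: "\<mu> \<in> k - {0}" "J'' \<in> \<J>" "w \<in> Z" "ideal_s1 (ideal_mult I J') = \<mu> * (w * ideal_s1 J'')"
      "ideal_mult I J' = (*) \<mu> ` J''" using main[OF ideal_mult_frac[OF I J']] by blast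
    have "ideal_s1 I * s = \<mu> * ((z * w) * ideal_s1 J'')"
      using mu(4) ideal_s1_mult[OF I J'] zJ(1) by (simp add: mult_ac)
    moreover have "D * \<mu> \<in> A" if "I \<subseteq> A"
    proof -
      \<comment> \<open>Because the representatives contain \<open>1\<close>, the factor
        \<open>\<mu>\<close> itself lies in the product ideal, hence in \<open>J'\<close>, and
        \<open>D\<close> multiplies \<open>J'\<close> into \<open>A\<close>.\<close>
      have "\<mu> * 1 \<in> ideal_mult I J'" unfolding mu(5) using J(3)[OF mu(2)] by blast
      then have "\<mu> \<in> J'" using ideal_mult_subset_right[OF that J'] by auto
      then show ?thesis using J(6)[OF zJ(3)] by blast
    qed
    ultimately show ?thesis using mu(1) SI[OF ZZ[OF zJ(2) mu(3)] mu(2)] by blast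
  qed
  show ?thesis
    unfolding spanning_def
  proof (intro exI[of _ S] exI[of _ D] conjI ballI)
    show "finite S" by (rule S)
    obtain \<mu> J'' w where "J'' \<in> \<J>" "w \<in> Z" using main[OF A_frac] by blast
    then show "S \<noteq> {}" using SI by blast
    show "0 \<notin> S" using Z0 ideal_s1_nonzero J(2) by (auto simp: S_def)
    show "D \<in> A - {0}" using J by simp
    show "\<exists>\<mu>\<in>k - {0}. \<exists>s\<in>S. ideal_s1 I = \<mu> * s" if "I \<in> fractional_ideals" for I
      using main[OF that] SI by blast
    show "\<exists>\<mu>\<in>k - {0}. \<exists>s''\<in>S. s * s' = \<mu> * s''" if s: "s \<in> S" "s' \<in> S" for s s'
    proof -
      obtain z J' where zJ: "s = z * ideal_s1 J'" "z \<in> Z" "J' \<in> \<J>" using s by (auto simp: S_def)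
      have J': "J' \<in> fractional_ideals" using zJ J(2) by auto
      obtain \<mu> t where mu: "\<mu> \<in> k - {0}" "t \<in> S" "ideal_s1 J' * s' = \<mu> * t" using S2[OF J' s(2)] by blast
      obtain w J'' where wJ: "t = w * ideal_s1 J''" "w \<in> Z" "J'' \<in> \<J>" using mu(2) by (auto simp: S_def)
      have "s * s' = z * (\<mu> * t)" using zJ(1) mu(3) by (simp add: mult_ac)
      also have "\<dots> = \<mu> * ((z * w) * ideal_s1 J'')" using wJ(1) by (simp add: mult_ac)
      finally show ?thesis using mu(1) SI[OF ZZ[OF zJ(2) wJ(2)] wJ(3)] by blast
    qed
    show "\<exists>\<mu>\<in>k - {0}. \<exists>s'\<in>S. ideal_s1 I * s = \<mu> * s' \<and> D * \<mu> \<in> A" if "I \<in> ideals" "s \<in> S" for I s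
      using S2[of I s] that by (auto simp: ideals_def)
  qed
qed

text \<open>Two powers of \<open>I\<close>, with exponents \<open>a < b\<close>, are in the same
  class and differ by a factor \<open>m\<close>. Multiplication by \<open>m\<close> maps the smaller
  power into itself, and the common denominator of all \<open>m ^ n * x\<close> forces
  \<open>m\<close> into \<open>A\<close>. Comparing values shows that some power of
  \<open>ideal_s1 I\<close> equals \<open>m ^ E\<close>.\<close>

lemma ideal_s1_power_in_A:
  assumes I: "I \<in> ideals" shows "\<exists>n>0. ideal_s1 I ^ n \<in> A"
proof -
  obtain E where E: "0 < E" "\<And>l. l \<in> k \<Longrightarrow> l \<noteq> 0 \<Longrightarrow> ideal_s1 ((*) l ` A) ^ E = l ^ E"
    using ideal_s1_principal_power by blast
  obtain \<J> where J: "finite \<J>" "\<J> \<subseteq> fractional_ideals"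
    "\<forall>I\<in>fractional_ideals. \<exists>l\<in>k - {0}. \<exists>J\<in>\<J>. I = (*) l ` J"
    using finitely_many_classes by (elim exE conjE)
  have If: "I \<in> fractional_ideals" "I \<subseteq> A" using I by (auto simp: ideals_def)
  let ?P = "\<lambda>n. ideal_power A I n"
  have P: "?P n \<in> fractional_ideals" for n by (rule ideal_power_frac[OF If(1)])
  have "\<forall>n. \<exists>p. fst p \<in> k - {0} \<and> snd p \<in> \<J> \<and> ?P n = (*) (fst p) ` snd p"
  proof
    fix n
    obtain l J' where "l \<in> k - {0}" "J' \<in> \<J>" "?P n = (*) l ` J'" using bspec[OF J(3) P[of n]] by blast
    then show "\<exists>p. fst p \<in> k - {0} \<and> snd p \<in> \<J> \<and> ?P n = (*) (fst p) ` snd p"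
      by (intro exI[of _ "(l, J')"]) simp
  qed
  from choice[OF this] obtain p where
    p: "\<forall>n. fst (p n) \<in> k - {0} \<and> snd (p n) \<in> \<J> \<and> ?P n = (*) (fst (p n)) ` snd (p n)" by (elim exE)
  define l where "l n = fst (p n)" for n
  define j where "j n = snd (p n)" for n
  have lj: "l n \<in> k - {0} \<and> j n \<in> \<J> \<and> ?P n = (*) (l n) ` j n" for n
    unfolding l_def j_def by (rule spec[OF p])
  have "\<not> inj j"
  proof
    assume "inj j"
    moreover have "range j \<subseteq> \<J>" using lj by blast
    ultimately show False using J(1) by (meson finite_imageD finite_subset infinite_UNIV_nat)
  qed
  then obtain a b where ab: "a < b" "j a = j b" unfolding inj_def by (metis linorder_neqE_nat)
  define m where "m = l b / l a"
  have m: "m \<in> k" "m \<noteq> 0" using lj[of a] lj[of b] by (auto simp: m_def k_closed)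
  have Pb: "?P b = (*) m ` ?P a"
    using lj[of a] lj[of b] ab(2) by (simp add: m_def image_image mult.assoc[symmetric])
  have "?P (a + d) \<subseteq> ?P a" for d
  proof (induction d)
    case (Suc d)
    then show ?case using ideal_mult_subset_right[OF If(2) P[of "a + d"]] by auto
  qed simp
  from this[of "b - a"] have sub: "?P b \<subseteq> ?P a" using ab(1) by simp
  have step: "m * x \<in> ?P a" if "x \<in> ?P a" for x using that Pb sub by blast
  obtain x where x: "x \<in> ?P a" "x \<noteq> 0" using fracD(3)[OF P] by blast
  have xk: "x \<in> k" using x fracD(1)[OF P] by blast
  have mn: "m ^ n * x \<in> ?P a" for n by (induction n) (use x step in \<open>auto simp: mult.assoc\<close>)
  have mA: "m \<in> A"
    unfolding A_def'
  proof (intro CollectI conjI ballI)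
    fix v assume v: "v \<in> places k - {vinf}"
    interpret v: place k v using v by (intro placeI) auto
    obtain c where c: "c \<in> A" "c \<noteq> 0" "\<And>y. y \<in> ?P a \<Longrightarrow> c * y \<in> A" using fracD(6)[OF P] by blast
    have ck: "c \<in> k" using c A_subset by auto
    have "0 \<le> v c + (int n * v m + v x)" for n
    proof -
      have "c * (m ^ n * x) \<in> val_ge k v 0" using c(3)[OF mn] v by (auto simp: A_def')
      moreover have "v (c * (m ^ n * x)) = v c + (int n * v m + v x)"
        using v.v_mult[of c "m ^ n * x"] v.v_mult[of "m ^ n" x] v.v_power[OF m] ck c(2) xk x(2) m k_closed by simp
      ultimately show ?thesis using c(2) x(2) m(2) by (auto simp: val_ge_def)
    qed
    \<comment> \<open>If \<open>v m\<close> were negative, this exponent would already contradict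
      the integrality just shown.\<close>
    from this[of "nat (v c + v x + 1)"] have "0 \<le> v m"
    proof (rule contrapos_pp)
      assume "\<not> 0 \<le> v m"
      then have "int (nat (v c + v x + 1)) * v m \<le> int (nat (v c + v x + 1)) * (-1)" by (intro mult_left_mono) auto
      then show "\<not> 0 \<le> v c + (int (nat (v c + v x + 1)) * v m + v x)" by linarith
    qed
    then show "m \<in> val_ge k v 0" using m by (simp add: val_ge_def)
  qed (rule m)
  have "ideal_s1 I ^ b = ideal_s1 ((*) m ` ?P a)" using ideal_s1_power[OF If(1), of b] Pb by simp
  also have "\<dots> = ideal_s1 (ideal_mult ((*) m ` A) (?P a))" using ideal_mult_principal[OF P] by simp
  also have "\<dots> = ideal_s1 ((*) m ` A) * ideal_s1 I ^ a"
    using ideal_s1_mult[OF scale_frac[OF A_frac m] P] ideal_s1_power[OF If(1)] by simp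
  finally have "ideal_s1 I ^ (b - a) = ideal_s1 ((*) m ` A)"
    using ab(1) ideal_s1_nonzero[OF If(1)] by (simp add: power_diff)
  then have "ideal_s1 I ^ ((b - a) * E) = m ^ E" using E(2)[OF m] by (simp add: power_mult)
  moreover have "m ^ E \<in> A" using mA by (rule A_closed(9))
  ultimately show ?thesis using ab(1) E(1) by (intro exI[of _ "(b - a) * E"]) auto
qed

section \<open>The field of values and its integers\<close>

lemma V_subfield: "is_subfield \<V>"
  unfolding \<V>_def by (rule is_subfield_hull)

lemmas V_closed = subfield_closed[OF V_subfield]

lemma k_subset_V: "k \<subseteq> \<V>" and ideal_s1_V: "I \<in> fractional_ideals \<Longrightarrow> ideal_s1 I \<in> \<V>"
  unfolding \<V>_def by (auto intro: hull_inc)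

lemma O_V_subring: "is_subring O_\<V>"
  using integral_over_subring[OF A_subring] subfield_imp_subring[OF V_subfield]
  unfolding O_\<V>_def is_subring_def by blast

lemma A_subset_O_V: "A \<subseteq> O_\<V>"
  using integral_over_base[OF A_subring] A_subset k_subset_V by (auto simp: O_\<V>_def)

lemma ideal_s1_O_V: "I \<in> ideals \<Longrightarrow> ideal_s1 I \<in> O_\<V>"
  using ideal_s1_power_in_A[of I] integral_over_root[OF A_subring, of "ideal_s1 I"] ideal_s1_V[of I]
  by (auto simp: O_\<V>_def ideals_def)

lemma V_subset_span:
  assumes S: "finite S" "\<And>I. I \<in> fractional_ideals \<Longrightarrow> \<exists>\<mu>\<in>k - {0}. \<exists>s\<in>S. ideal_s1 I = \<mu> * s"
    "\<And>s s'. s \<in> S \<Longrightarrow> s' \<in> S \<Longrightarrow> \<exists>\<mu>\<in>k - {0}. \<exists>s''\<in>S. s * s' = \<mu> * s''"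
  shows "\<V> \<subseteq> lin_span k S"
proof -
  have sp: "\<mu> * s \<in> lin_span k S" if "\<mu> \<in> k" "s \<in> S" for \<mu> s
    by (rule subspace_scale[OF lin_span_subspace[OF k_subring] that(1) lin_span_base[OF k_subring S(1) that(2)]])
  have one: "1 \<in> lin_span k S"
  proof -
    obtain \<mu> s where "\<mu> \<in> k - {0}" "s \<in> S" "ideal_s1 A = \<mu> * s" using S(2)[OF A_frac] by blast
    then show ?thesis using sp[of \<mu> s] ideal_s1_A by simp
  qed
  have "is_subfield (lin_span k S)"
    by (rule lin_span_subfield[OF k_subfield S(1) one]) (use S(3) sp in fastforce)
  moreover have "k \<subseteq> lin_span k S"
    using subspace_scale[OF lin_span_subspace[OF k_subring] _ one] by force
  moreover have "ideal_s1 ` fractional_ideals \<subseteq> lin_span k S" using S(2) sp by fastforce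
  ultimately show ?thesis unfolding \<V>_def by (intro hull_minimal) auto
qed

end

section \<open>Restriction of a series by an indicator polynomial\<close>

lemma power_between:
  fixes X :: real and p :: nat
  assumes "2 \<le> p" "1 \<le> X" shows "\<exists>e. real (p ^ e) \<le> X \<and> X < real p * real (p ^ e)"
proof -
  let ?P = "\<lambda>e. real (p ^ e) \<le> X"
  have bd: "e \<le> nat \<lceil>X\<rceil>" if "?P e" for e
  proof -
    have "real e < 2 ^ e" by simp
    also have "\<dots> \<le> real (p ^ e)" using assms(1) by (simp add: power_mono)
    also note that
    finally have "real e \<le> X" by simp
    then show ?thesis by linarith
  qed
  have "?P 0" using assms(2) by simp
  then obtain e where e: "?P e" "\<And>i. ?P i \<Longrightarrow> i \<le> e"
    using Nat.ex_has_greatest_nat[of ?P 0 "nat \<lceil>X\<rceil>"] bd by blast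
  have "\<not> ?P (Suc e)" using e(2)[of "Suc e"] by auto
  then show ?thesis using e(1) by auto
qed

text \<open>The terms on the left bound the logarithm of the accumulated constants, the last one
  accounting for \<open>d * j\<close> with \<open>j\<close> up to
  \<open>exp (c / 3 * d)\<close>.\<close>

lemma growth_comparison:
  fixes c C K :: real
  assumes "0 < c" "0 < K"
  shows "eventually (\<lambda>d::nat. C * (1 + real d + real d * exp (c / 3 * real d)) < K * exp (c * real d)) sequentially"
proof -
  have "((\<lambda>x::real. C * (1 + x + x * exp (c / 3 * x)) / exp (c * x)) \<longlongrightarrow> 0) at_top"
    using assms(1) by real_asymp
  then have "eventually (\<lambda>x::real. C * (1 + x + x * exp (c / 3 * x)) / exp (c * x) < K) at_top"
    using assms(2) by (rule order_tendstoD)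
  then have "eventually (\<lambda>x::real. C * (1 + x + x * exp (c / 3 * x)) < K * exp (c * x)) at_top"
    by eventually_elim (simp add: divide_less_eq)
  then show ?thesis by (rule eventually_compose_filterlim) (rule filterlim_real_sequentially)
qed

context goss_setting
begin

text \<open>The natural numbers map into the finite field \<open>Fr\<close>, so two of them coincide
  there and the characteristic is positive.\<close>

lemma CHAR_prime: "prime CHAR('c)"
proof -
  have "\<not> inj (of_nat :: nat \<Rightarrow> 'c)"
  proof
    assume "inj (of_nat :: nat \<Rightarrow> 'c)"
    moreover have "of_nat n \<in> Fr" for n
      by (induction n) (auto intro: subring_0[OF F_subring] subring_1[OF F_subring] subring_add[OF F_subring])
    then have "range (of_nat :: nat \<Rightarrow> 'c) \<subseteq> Fr" by blast
    ultimately show False using Fr_finite by (meson finite_imageD finite_subset infinite_UNIV_nat)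
  qed
  then obtain m n :: nat where mn: "m < n" "(of_nat m :: 'c) = of_nat n"
    unfolding inj_def by (metis linorder_neqE_nat)
  have "(of_nat (n - m) :: 'c) = 0" using mn by (simp add: of_nat_diff)
  then have "CHAR('c) dvd n - m" by (simp add: of_nat_eq_0_iff_char_dvd)
  then have "0 < CHAR('c)" using mn(1) by (auto intro: Nat.gr0I)
  then show ?thesis by (rule prime_CHAR_semidom)
qed

lemma ideals_fractional: "I \<in> ideals \<Longrightarrow> I \<in> fractional_ideals"
  by (auto simp: ideals_def)

lemma ideal_power_ideals: "I \<in> ideals \<Longrightarrow> ideal_power A I n \<in> ideals"
  using ideal_power_frac ideal_power_subset by (auto simp: ideals_def)

section \<open>The motivic class in terms of decay and of vanishing power sums\<close>

definition dsum :: "('c set \<Rightarrow> 'c) \<Rightarrow> nat \<Rightarrow> nat \<Rightarrow> 'c" where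
  "dsum b j d = (\<Sum>I | I \<in> ideals \<and> degk I = int d. b I * ideal_s1 I ^ j)"

definition decaying :: "('c set \<Rightarrow> 'c) \<Rightarrow> bool" where
  "decaying b \<longleftrightarrow> (\<exists>t>0. \<forall>s\<in>S_inf. t \<le> absv (fst s) \<longrightarrow>
        (\<forall>\<epsilon>>0. \<exists>N. \<forall>I\<in>ideals. N \<le> degk I \<longrightarrow> absv (b I * ideal_exp I (S_neg s)) < \<epsilon>))"

text \<open>The logarithmic degree bound, solved for \<open>j\<close>.\<close>

definition vanishing :: "('c set \<Rightarrow> 'c) \<Rightarrow> bool" where
  "vanishing b \<longleftrightarrow> (\<exists>c>0. \<exists>d0. \<forall>d\<ge>d0. \<forall>j. real j \<le> exp (c * real d) \<longrightarrow> dsum b j d = 0)"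

lemma special_series_nth: "fps_nth (special_series b j) d = dsum b j d"
  by (simp add: special_series_def dsum_def)

lemma dsum_O_V: "(\<And>I. I \<in> ideals \<Longrightarrow> b I \<in> A) \<Longrightarrow> dsum b j d \<in> O_\<V>"
  unfolding dsum_def using A_subset_O_V ideal_s1_O_V
  by (intro subring_sum[OF O_V_subring] subring_mult[OF O_V_subring] subring_power[OF O_V_subring]) auto

lemma motivic_imp_vanishing:
  assumes "motivic b" shows "vanishing b"
proof -
  obtain P :: "nat \<Rightarrow> 'c poly" where P: "\<And>j. special_series b j = fps_of_poly (P j)"
    "(\<lambda>j. real (degree (P j))) \<in> O(\<lambda>j. ln (real j))" using assms unfolding motivic_def by blast
  have co: "dsum b j d = coeff (P j) d" for j d using P(1)[of j] special_series_nth[of b j d] by simp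
  obtain C where C: "0 < C" "eventually (\<lambda>j. norm (real (degree (P j))) \<le> C * norm (ln (real j))) sequentially"
    using P(2) by (elim landau_o.bigE)
  obtain j0 where j0: "\<And>j. j \<ge> j0 \<Longrightarrow> real (degree (P j)) \<le> C * \<bar>ln (real j)\<bar>"
    using C(2) by (auto simp: eventually_sequentially)
  \<comment> \<open>The \<open>O\<close> bound holds only for large \<open>j\<close>; the finitely
    many other degrees are absorbed into \<open>d0\<close>. Taking at least \<open>1\<close> keeps
    \<open>ln j\<close> nonnegative beyond \<open>j1\<close>.\<close>
  define j1 where "j1 = max j0 1"
  define d0 where "d0 = Suc (\<Sum>j<j1. degree (P j))"
  \<comment> \<open>The constant \<open>1 / (2 * C)\<close> makes the degree bound
    \<open>C * ln j\<close> at most \<open>d / 2\<close>, which is strictly below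
    \<open>d\<close>.\<close>
  have "dsum b j d = 0" if d: "d0 \<le> d" and j: "real j \<le> exp (1 / (2 * C) * real d)" for d j
  proof -
    have "degree (P j) < d"
    proof (cases "j < j1")
      case True
      then have "degree (P j) \<le> (\<Sum>j<j1. degree (P j))" by (intro member_le_sum) auto
      then show ?thesis using d by (simp add: d0_def)
    next
      case False
      then have j': "j0 \<le> j" "1 \<le> j" by (auto simp: j1_def)
      have "ln (real j) \<le> ln (exp (1 / (2 * C) * real d))" using j j'(2) by (subst ln_le_cancel_iff) auto
      then have "ln (real j) \<le> 1 / (2 * C) * real d" by simp
      then have "C * ln (real j) \<le> C * (1 / (2 * C) * real d)" using C(1) by (intro mult_left_mono) auto
      also have "\<dots> = real d / 2" using C(1) by simp
      finally have "C * \<bar>ln (real j)\<bar> \<le> real d / 2" using j'(2) by simp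
      then have "real (degree (P j)) \<le> real d / 2" using j0[OF j'(1)] by simp
      then show ?thesis using d by (simp add: d0_def)
    qed
    then show ?thesis unfolding co by (rule coeff_eq_0)
  qed
  then show ?thesis unfolding vanishing_def using C(1) by (intro exI[of _ "1 / (2 * C)"] conjI exI[of _ d0]) auto
qed

lemma motivicI:
  assumes A: "\<And>I. I \<in> ideals \<Longrightarrow> b I \<in> A" and dec: "decaying b" and van: "vanishing b" shows "motivic b"
proof -
  obtain c d0 where c: "0 < c" "\<And>d j. d0 \<le> d \<Longrightarrow> real j \<le> exp (c * real d) \<Longrightarrow> dsum b j d = 0"
    using van unfolding vanishing_def by blast
  \<comment> \<open>Beyond \<open>M j\<close> the degree \<open>d\<close> exceeds both
    \<open>d0\<close> and \<open>ln j / c\<close>, which is the range where \<open>vanishing\<close>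
    applies.\<close>
  define M where "M j = d0 + nat \<lceil>ln (real j) / c\<rceil>" for j
  define P where "P j = (\<Sum>d\<le>M j. Polynomial.monom (dsum b j d) d)" for j
  have zero: "dsum b j d = 0" if "M j < d" for j d
  proof (rule c(2))
    show "d0 \<le> d" using that by (simp add: M_def)
    have "ln (real j) / c \<le> real d" using that unfolding M_def by linarith
    then have "ln (real j) \<le> c * real d" using c(1) by (simp add: field_simps)
    then show "real j \<le> exp (c * real d)"
      using exp_le_cancel_iff[of "ln (real j)" "c * real d"] by (cases "j = 0") auto
  qed
  have co: "coeff (P j) d = dsum b j d" for j d
    using zero[of j d] by (auto simp: P_def coeff_sum)
  have "special_series b j = fps_of_poly (P j)" for j
    by (rule fps_ext) (simp add: special_series_nth co)
  moreover have "coeff (P j) i \<in> O_\<V>" for j i unfolding co by (rule dsum_O_V[OF A])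
  moreover have "(\<lambda>j. real (degree (P j))) \<in> O(\<lambda>j. ln (real j))"
  proof (rule landau_o.bigI)
    show "0 < real d0 + 1 + 1 / c" using c(1) by (simp add: add_pos_nonneg add_nonneg_pos)
    \<comment> \<open>From \<open>j = 3\<close> on \<open>ln j\<close> is at least \<open>1\<close>,
      so additive constants are absorbed into a multiple of it.\<close>
    have "real (degree (P j)) \<le> (real d0 + 1 + 1 / c) * ln (real j)" if j: "j \<ge> 3" for j
    proof -
      have "exp (1::real) \<le> 3" by (rule exp_le)
      then have l: "1 \<le> ln (real j)" using j by (subst ln_ge_iff) auto
      have "degree (P j) \<le> M j" unfolding P_def by (rule degree_sum_le) (auto intro: order_trans[OF degree_monom_le])
      then have "real (degree (P j)) \<le> real (M j)" by simp
      also have "0 \<le> ln (real j) / c" using l c(1) by simp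
      then have "real (M j) \<le> real d0 + 1 + ln (real j) / c" unfolding M_def by linarith
      also have "\<dots> \<le> (real d0 + 1) * ln (real j) + ln (real j) / c"
        using mult_left_mono[OF l, of "real d0 + 1"] by simp
      finally show ?thesis by (simp add: algebra_simps)
    qed
    then show "eventually (\<lambda>j. norm (real (degree (P j))) \<le> (real d0 + 1 + 1 / c) * norm (ln (real j))) sequentially"
      unfolding eventually_sequentially by (intro exI[of _ 3]) auto
  qed
  ultimately show ?thesis unfolding motivic_def using A dec unfolding decaying_def by blast
qed

lemma motivic_iff: "motivic b \<longleftrightarrow> (\<forall>I\<in>ideals. b I \<in> A) \<and> decaying b \<and> vanishing b"
proof
  assume "motivic b"
  then show "(\<forall>I\<in>ideals. b I \<in> A) \<and> decaying b \<and> vanishing b"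
    using motivic_imp_vanishing[of b] unfolding motivic_def decaying_def by blast
qed (intro motivicI, auto)

section \<open>Bounds on coefficients and the restriction step\<close>

lemma one_unit_power_0: "one_unit_power u (\<lambda>_. 0) = 1"
proof -
  interpret M: Metric_space UNIV "\<lambda>x y. absv (x - y)" by (rule abs_metric)
  have lim: "limitin top_C (\<lambda>n. u ^ nat 0) 1 sequentially" by (simp add: top_C_def)
  show ?thesis unfolding one_unit_power_def
  proof (rule the_equality, rule lim)
    fix l assume "limitin top_C (\<lambda>n. u ^ nat 0) l sequentially"
    then show "l = 1" using lim unfolding top_C_def by (rule M.limitin_metric_unique) simp
  qed
qed

text \<open>The decay condition is tested at the single point \<open>(x, 0)\<close> with
  \<open>x\<close> an element of \<open>A\<close> beyond the threshold \<open>t\<close>. There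
  \<open>ideal_exp\<close> is a pure power of \<open>x\<close>, and \<open>\<tau>\<close> is
  \<open>absv x\<close>.\<close>

lemma coefficient_bound:
  assumes "decaying b"
  shows "\<exists>\<tau>\<ge>1. \<exists>d0. \<forall>d\<ge>d0. \<forall>I\<in>ideals. degk I = int d \<longrightarrow> absv (b I) \<le> \<tau> ^ d"
proof -
  obtain t where t: "0 < t" "\<And>s. s \<in> S_inf \<Longrightarrow> t \<le> absv (fst s) \<Longrightarrow>
        (\<forall>\<epsilon>>0. \<exists>N. \<forall>I\<in>ideals. N \<le> degk I \<longrightarrow> absv (b I * ideal_exp I (S_neg s)) < \<epsilon>)"
    using assms unfolding decaying_def by blast
  obtain a where a: "a \<in> A" "a \<noteq> 0" "vinf a < 0" using nonconstant_exists by blast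
  have "1 < absv a" using abs_le_1_iff[of a] a A_subset by (force simp: val_ge_def)
  then obtain n where n: "t < absv a ^ n" using real_arch_pow by blast
  define x where "x = a ^ n"
  have x: "x \<noteq> 0" "t \<le> absv x" "1 \<le> absv x"
    using a n \<open>1 < absv a\<close> by (auto simp: x_def abs.N_power)
  define s where "s = (x, \<lambda>_::nat. 0::int)"
  have s: "s \<in> S_inf" using x CHAR_prime prime_gt_0_nat by (auto simp: s_def S_inf_def padic_ints_def)
  have "t \<le> absv (fst s)" using x(2) by (simp add: s_def)
  from spec[OF t(2)[OF s this], of 1] obtain N where
    N: "\<And>I. I \<in> ideals \<Longrightarrow> N \<le> degk I \<Longrightarrow> absv (b I * ideal_exp I (S_neg s)) < 1" by auto
  have "absv (b I) \<le> absv x ^ d" if I: "I \<in> ideals" "degk I = int d" "nat N \<le> d" for I d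
  proof -
    have "ideal_exp I (S_neg s) = inverse x ^ d"
      unfolding ideal_exp_def S_neg_def s_def padic_neg_def using I(2) by (simp add: one_unit_power_0)
    then have "absv (b I) * inverse (absv x) ^ d < 1"
      using N[of I] I by (simp add: abs_mult abs.N_power abs.N_inverse)
    then have "absv (b I) / absv x ^ d < 1" by (simp add: field_simps)
    then show ?thesis using x(3) by (simp add: divide_less_eq)
  qed
  then show ?thesis using x(3) by (intro exI[of _ "absv x"] conjI exI[of _ "nat N"]) auto
qed

text \<open>
  A small element \<open>x\<close> of the span vanishes: the constant term of a monic relation for it would be
  a nonzero element of \<open>A\<close> violating \<open>1 \<le> N c * absv c\<close>.
\<close>

lemma small_element_zero:
  assumes N: "nonarch L N" and VL: "\<V> \<subseteq> L"
    and lower: "\<And>c. c \<in> A \<Longrightarrow> c \<noteq> 0 \<Longrightarrow> 1 \<le> N c * absv c"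
    and upper: "\<And>c. c \<in> A \<Longrightarrow> N c \<le> max 1 (absv c)"
    and S: "finite S" "S \<noteq> {}" "0 \<notin> S"
    and x: "x \<in> \<V>" "\<And>s. s \<in> S \<Longrightarrow> x * s = (\<Sum>s'\<in>S. c s s' * s')"
    and c: "\<And>s s'. s \<in> S \<Longrightarrow> s' \<in> S \<Longrightarrow> c s s' \<in> A \<and> absv (c s s') \<le> \<Theta>"
    and \<Theta>: "1 \<le> \<Theta>" and Nx: "N x \<le> \<Theta> * \<delta>" and \<delta>: "0 \<le> \<delta>" "\<delta> \<le> 1" "\<Theta> ^ (3 * card S + 1) * \<delta> < 1"
  shows "x = 0"
proof (rule ccontr)
  assume x0: "x \<noteq> 0"
  interpret N: nonarch L N by (rule N)
  define m where "m = card S"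
  obtain s0 where s0: "s0 \<in> S" "s0 \<noteq> 0" using S by auto
  \<comment> \<open>Elements of \<open>A\<close> graded by size: a product of \<open>a\<close>
    matrix entries lies in level \<open>a\<close>, so the coefficients of the characteristic
    polynomial have size at most \<open>\<Theta> ^ m\<close>.\<close>
  define R where "R a = {u\<in>A. absv u \<le> \<Theta> ^ a}" for a :: nat
  have "\<exists>p. lead_coeff p = 1 \<and> degree p = card S \<and> poly p x = 0 \<and> (\<forall>i. coeff p i \<in> R (card S))"
  proof (rule mult_char_poly[OF S(1) s0 x(2)])
    show "0 \<in> R a" for a using A_closed(1) \<Theta> by (simp add: R_def)
    show "u - w \<in> R a" if "u \<in> R a" "w \<in> R a" for a u w
      using that A_closed(3)[of u w] abs.N_diff[of u w] by (auto simp: R_def)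
    show "u * w \<in> R (a + b)" if "u \<in> R a" "w \<in> R b" for a b u w
      using that A_closed(4)[of u w] \<Theta> abs_nonneg by (auto simp: R_def abs_mult power_add intro!: mult_mono)
    show "1 \<in> R 0" "1 \<in> R 1" using A_closed(2) \<Theta> by (auto simp: R_def)
    show "c s s' \<in> R 1" if "s \<in> S" "s' \<in> S" for s s' using c[OF that] by (simp add: R_def)
  qed
  then obtain p where p: "lead_coeff p = 1" "degree p = m" "poly p x = 0" "\<And>i. coeff p i \<in> R m"
    unfolding m_def by blast
  obtain q where q: "poly q x = 0" "coeff q 0 \<noteq> 0" "degree q \<le> m" "\<And>i. \<exists>j. coeff q i = coeff p j"
    by (rule nonzero_constant_relation[OF p(1,3) x0]) (use p(2) in blast)
  have qR: "coeff q i \<in> A" "absv (coeff q i) \<le> \<Theta> ^ m" for i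
    using q(4)[of i] p(4) by (auto simp: R_def)
  obtain a q' where aq: "q = pCons a q'" by (cases q)
  have a: "a \<in> A" "a \<noteq> 0" "absv a \<le> \<Theta> ^ m" using qR[of 0] q(2) by (auto simp: aq)
  have xL: "x \<in> L" using x(1) VL by auto
  have AL: "A \<subseteq> L" using A_subset k_subset_V VL by auto
  have Tm: "1 \<le> \<Theta> ^ i" for i using \<Theta> by (rule one_le_power)
  have "\<Theta> * \<delta> \<le> \<Theta> * 1" using \<delta>(2) \<Theta> by (intro mult_left_mono) auto
  then have Nx1: "N x \<le> \<Theta>" using Nx by linarith
  have q': "coeff q' i \<in> L" "N (coeff q' i) \<le> \<Theta> ^ m" for i
  proof -
    have e: "coeff q' i = coeff q (Suc i)" by (simp add: aq)
    show "coeff q' i \<in> L" unfolding e using qR(1) AL by blast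
    show "N (coeff q' i) \<le> \<Theta> ^ m" unfolding e using upper[OF qR(1), of "Suc i"] qR(2)[of "Suc i"] Tm[of m] by simp
  qed
  have dq: "degree q' \<le> m" using q(3) by (simp add: aq split: if_splits)
  have pL: "poly q' x \<in> L" unfolding poly_altdef using q'(1) xL by (intro N.L_closed) auto
  have "N (poly q' x) \<le> \<Theta> ^ (2 * m)"
    unfolding poly_altdef
  proof (rule N.N_sum)
    fix i assume "i \<in> {..degree q'}"
    then have i: "i \<le> m" using dq by simp
    have xi: "x ^ i \<in> L" using xL by (rule N.L_closed)
    have "N (coeff q' i * x ^ i) = N (coeff q' i) * N x ^ i"
      using N.N_mult[OF q'(1) xi] N.N_power[OF xL] by simp
    also have "\<dots> \<le> \<Theta> ^ m * \<Theta> ^ i"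
      using q'(2) Nx1 N.N_nonneg \<Theta> by (intro mult_mono power_mono) auto
    also have "\<dots> \<le> \<Theta> ^ m * \<Theta> ^ m" using i \<Theta> by (intro mult_left_mono power_increasing) auto
    finally show "coeff q' i * x ^ i \<in> L \<and> N (coeff q' i * x ^ i) \<le> \<Theta> ^ (2 * m)"
      using N.L_closed(4)[OF q'(1) xi] by (simp add: mult_2 power_add)
  qed (use \<Theta> in simp)
  moreover have "a = - (x * poly q' x)" using q(1) by (simp add: aq eq_neg_iff_add_eq_0)
  then have "N a = N x * N (poly q' x)"
    using N.N_uminus[of "x * poly q' x"] N.N_mult[OF xL pL] N.L_closed(4)[OF xL pL] by simp
  ultimately have "N a \<le> (\<Theta> * \<delta>) * \<Theta> ^ (2 * m)"
    using Nx N.N_nonneg \<Theta> \<delta>(1) by (auto intro!: mult_mono)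
  then have "N a * absv a \<le> ((\<Theta> * \<delta>) * \<Theta> ^ (2 * m)) * \<Theta> ^ m"
    using a(3) abs_nonneg \<Theta> \<delta>(1) by (intro mult_mono) auto
  \<comment> \<open>The exponent \<open>3 * m + 1\<close> collects one factor
    \<open>\<Theta>\<close> from \<open>N x\<close>, the power \<open>2 * m\<close> from the
    cofactor \<open>poly q' x\<close>, and \<open>m\<close> from the size of \<open>a\<close> at
    infinity.\<close>
  also have "\<dots> = \<Theta> ^ (3 * m + 1) * \<delta>" by (simp add: power_add[symmetric] mult_ac flip: power_Suc)
  also have "\<dots> < 1" using \<delta>(3) by (simp add: m_def)
  finally show False using lower[OF a(1,2)] by simp
qed

text \<open>
  The polynomial \<open>(1 - y\<^sup>E)\<^sup>Q\<close> with \<open>Q\<close> a power of the characteristic is \<open>N\<close>-adically close to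
  the indicator function of \<open>N y < 1\<close>, and it turns the restricted sum into a combination of
  unrestricted ones, which vanish.
\<close>

theorem vanishing_restrict:
  assumes N: "nonarch L N" and VL: "\<V> \<subseteq> L"
    and lower: "\<And>c. c \<in> A \<Longrightarrow> c \<noteq> 0 \<Longrightarrow> 1 \<le> N c * absv c"
    and upper: "\<And>c. c \<in> A \<Longrightarrow> N c \<le> max 1 (absv c)"
    and Ns1: "\<And>I. I \<in> ideals \<Longrightarrow> N (ideal_s1 I) \<le> max 1 (absv (ideal_s1 I))"
    and y: "\<And>I d. I \<in> ideals \<Longrightarrow> degk I = int d \<Longrightarrow> y I = u d * ideal_s1 I + w d"
    and E: "0 < E" and \<rho>: "0 < \<rho>" "\<rho> < 1"
    and yN: "\<And>I. I \<in> ideals \<Longrightarrow> b I \<noteq> 0 \<Longrightarrow> y I \<in> L \<and> N (y I) \<le> 1 \<and>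
      (N (y I) < 1 \<longrightarrow> N (y I) \<le> \<rho>) \<and> (N (y I) = 1 \<longrightarrow> N (y I ^ E - 1) \<le> \<rho>)"
    and bA: "\<And>I. I \<in> ideals \<Longrightarrow> b I \<in> A" and dec: "decaying b" and van: "vanishing b"
  shows "vanishing (\<lambda>I. if N (y I) < 1 then b I else 0)"
proof -
  interpret N: nonarch L N by (rule N)
  define b' where "b' = (\<lambda>I. if N (y I) < 1 then b I else 0)"
  have AL: "A \<subseteq> L" using A_subset k_subset_V VL by auto
  obtain S D where SD: "spanning S D" using spanning_exists by blast
  note S = spanningD[OF SD]
  define m where "m = card S"
  obtain \<tau> d1 where \<tau>: "1 \<le> \<tau>" "\<And>d I. d1 \<le> d \<Longrightarrow> I \<in> ideals \<Longrightarrow> degk I = int d \<Longrightarrow> absv (b I) \<le> \<tau> ^ d"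
    using coefficient_bound[OF dec] by blast
  obtain c d0 where c: "0 < c" "\<And>d j. d0 \<le> d \<Longrightarrow> real j \<le> exp (c * real d) \<Longrightarrow> dsum b j d = 0"
    using van unfolding vanishing_def by blast
  define r where "r = real (card Fr)"
  have r: "1 \<le> r" using r_gt_1 by (simp add: r_def)
  \<comment> \<open>An upper bound for the ratios of sizes within \<open>S\<close>; it bounds
    \<open>\<mu>\<close> in \<open>ideal_s1 I ^ j * s = \<mu> * s'\<close>, where the size of
    \<open>ideal_s1 I\<close> is known.\<close>
  define \<kappa> where "\<kappa> = 1 + (\<Sum>s\<in>S. \<Sum>s'\<in>S. absv s / absv s')"
  have \<kappa>: "absv s / absv s' \<le> \<kappa>" if "s \<in> S" "s' \<in> S" for s s'
  proof -
    have "absv s / absv s' \<le> (\<Sum>s'\<in>S. absv s / absv s')"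
      using S(1) that by (intro member_le_sum[of s' S "\<lambda>s'. absv s / absv s'"]) (auto simp: abs_nonneg)
    also have "\<dots> \<le> (\<Sum>s\<in>S. \<Sum>s'\<in>S. absv s / absv s')"
      using S(1) that by (intro member_le_sum[of s S "\<lambda>s. \<Sum>s'\<in>S. absv s / absv s'"]) (auto simp: abs_nonneg intro!: sum_nonneg)
    finally show ?thesis by (simp add: \<kappa>_def)
  qed
  have \<kappa>1: "1 \<le> \<kappa>" unfolding \<kappa>_def by (simp add: sum_nonneg abs_nonneg)
  define \<beta> where "\<beta> = absv D * \<kappa>"
  have D1: "1 \<le> absv D" using abs_A_ge_1 S(4,5) by simp
  have \<beta>: "1 \<le> \<beta>" using mult_mono[OF D1 \<kappa>1] D1 by (simp add: \<beta>_def)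
  have s1: "absv (ideal_s1 I) = r ^ d" if "I \<in> ideals" "degk I = int d" for I d
    using abs_ideal_s1[OF ideals_fractional[OF that(1)]] that(2) by (simp add: r_def)
  \<comment> \<open>The claim for fixed \<open>d\<close> and \<open>j\<close>. The two conditions on
    \<open>e\<close> pull in opposite directions: the power of the characteristic must be small
    enough for the power sums to vanish and large enough to make the error negligible.\<close>
  have single: "dsum b' j d = 0"
    if d: "d0 \<le> d" "d1 \<le> d" and jQ: "real (j + E * CHAR('c) ^ e) \<le> exp (c * real d)"
      and small: "(\<beta> * \<tau> ^ d * r ^ (d * j)) ^ (3 * m + 1) * \<rho> ^ (CHAR('c) ^ e) < 1" for d j e
  proof (cases "finite {I. I \<in> ideals \<and> degk I = int d}")
    case fin: True
    define \<Omega> where "\<Omega> = {I. I \<in> ideals \<and> degk I = int d}"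
    have \<Omega>: "finite \<Omega>" "\<And>I. I \<in> \<Omega> \<Longrightarrow> I \<in> ideals \<and> degk I = int d" using fin by (auto simp: \<Omega>_def)
    define Q where "Q = CHAR('c) ^ e"
    \<comment> \<open>In degree \<open>d\<close> the element \<open>y I\<close> is one and the same
      affine function of \<open>ideal_s1 I\<close>, so the approximate indicator is a single
      polynomial in \<open>ideal_s1 I\<close>, independent of \<open>I\<close>.\<close>
    define f where "f = (1 - [:w d, u d:] ^ E) ^ Q"
    have fx: "poly f (ideal_s1 I) = (1 - y I ^ E) ^ Q" if "I \<in> \<Omega>" for I
      unfolding f_def using y[of I d] \<Omega>(2)[OF that] by (simp add: algebra_simps)
    have df: "degree f \<le> E * Q"
    proof -
      have "degree ([:w d, u d:] ^ E) \<le> degree [:w d, u d:] * E" by (rule degree_power_le)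
      also have "\<dots> \<le> E" by simp
      finally have "degree (1 - [:w d, u d:] ^ E) \<le> E" by (intro degree_diff_le) auto
      then have "degree (1 - [:w d, u d:] ^ E) * Q \<le> E * Q" by simp
      then show ?thesis unfolding f_def using degree_power_le order_trans by blast
    qed
    have "(\<Sum>I\<in>\<Omega>. b I * ideal_s1 I ^ j * poly f (ideal_s1 I)) = (\<Sum>i\<le>degree f. coeff f i * dsum b (i + j) d)"
    proof -
      have "(\<Sum>I\<in>\<Omega>. b I * ideal_s1 I ^ j * poly f (ideal_s1 I))
          = (\<Sum>I\<in>\<Omega>. \<Sum>i\<le>degree f. coeff f i * (b I * ideal_s1 I ^ (i + j)))"
        unfolding poly_altdef sum_distrib_left by (intro sum.cong refl) (simp add: power_add mult_ac)
      also have "\<dots> = (\<Sum>i\<le>degree f. coeff f i * dsum b (i + j) d)"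
        unfolding dsum_def \<Omega>_def[symmetric] sum_distrib_left by (rule sum.swap)
      finally show ?thesis .
    qed
    also have "\<dots> = 0"
    proof (intro sum.neutral ballI)
      fix i assume "i \<in> {..degree f}"
      then have "i + j \<le> j + E * Q" using df by simp
      then have "real (i + j) \<le> exp (c * real d)" using jQ unfolding Q_def by (meson of_nat_mono order_trans)
      then show "coeff f i * dsum b (i + j) d = 0" using c(2)[OF d(1)] by simp
    qed
    finally have vanish: "(\<Sum>I\<in>\<Omega>. b I * ideal_s1 I ^ j * poly f (ideal_s1 I)) = 0" .
    define T where "T = dsum b' j d"
    \<comment> \<open>Subtracting the vanishing combination of power sums leaves only the error of
      the approximate indicator.\<close>
    have T_eq: "T = (\<Sum>I\<in>\<Omega>. (b' I - b I * (1 - y I ^ E) ^ Q) * ideal_s1 I ^ j)"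
    proof -
      have "(\<Sum>I\<in>\<Omega>. (b' I - b I * (1 - y I ^ E) ^ Q) * ideal_s1 I ^ j)
          = (\<Sum>I\<in>\<Omega>. b' I * ideal_s1 I ^ j) - (\<Sum>I\<in>\<Omega>. b I * ideal_s1 I ^ j * poly f (ideal_s1 I))"
        unfolding sum_subtractf[symmetric] by (intro sum.cong refl) (simp add: fx algebra_simps)
      then show ?thesis unfolding vanish by (simp add: T_def dsum_def \<Omega>_def)
    qed
    have Q0: "0 < Q" using CHAR_prime prime_gt_0_nat by (simp add: Q_def)
    have NT: "N T \<le> \<tau> ^ d * r ^ (d * j) * \<rho> ^ Q"
      unfolding T_eq
    proof (rule N.N_sum)
      fix I assume I: "I \<in> \<Omega>"
      have I': "I \<in> ideals" "degk I = int d" using \<Omega>(2)[OF I] by auto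
      have sL: "ideal_s1 I \<in> L" using ideal_s1_V[OF ideals_fractional[OF I'(1)]] VL by blast
      have Nsj: "N (ideal_s1 I ^ j) \<le> r ^ (d * j)"
      proof -
        have "N (ideal_s1 I) \<le> r ^ d" using Ns1[OF I'(1)] s1[OF I'] one_le_power[OF r, of d] by simp
        then show ?thesis using N.N_power[OF sL] N.N_nonneg by (simp add: power_mult power_mono)
      qed
      have key: "b' I - b I * (1 - y I ^ E) ^ Q \<in> L \<and> N (b' I - b I * (1 - y I ^ E) ^ Q) \<le> \<tau> ^ d * \<rho> ^ Q"
      proof (cases "b I = 0")
        case True
        then show ?thesis using \<tau>(1) \<rho>(1) N.L_closed(1) by (simp add: b'_def)
      next
        case False
        note yI = yN[OF I'(1) False]
        have bL: "b I \<in> L" using bA[OF I'(1)] AL by blast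
        have Nb: "N (b I) \<le> \<tau> ^ d"
          using upper[OF bA[OF I'(1)]] \<tau>(2)[OF d(2) I'] one_le_power[OF \<tau>(1), of d] by simp
        have yL: "y I ^ E \<in> L" using yI by (intro N.L_closed) auto
        obtain g where g: "g \<in> L" "N g \<le> \<rho> ^ Q" "b' I - b I * (1 - y I ^ E) ^ Q = b I * g"
        proof (cases "N (y I) < 1")
          case True
          \<comment> \<open>\<open>Q\<close> is a power of the characteristic, so raising to the
            power \<open>Q\<close> is additive.\<close>
          have f: "(1 - y I ^ E) ^ Q = 1 - (y I ^ E) ^ Q"
          proof -
            have "((1 - y I ^ E) + y I ^ E) ^ Q = (1 - y I ^ E) ^ Q + (y I ^ E) ^ Q"
              unfolding Q_def by (rule freshmans_dream'[OF CHAR_prime refl])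
            then show ?thesis by (simp add: algebra_simps)
          qed
          have "b' I - b I * (1 - y I ^ E) ^ Q = b I * (y I ^ E) ^ Q"
            unfolding f using True by (simp add: b'_def algebra_simps)
          moreover have "N ((y I ^ E) ^ Q) \<le> \<rho> ^ Q"
          proof -
            have "N (y I) ^ E \<le> N (y I) ^ 1" using E yI N.N_nonneg by (intro power_decreasing) auto
            then have "N (y I) ^ E \<le> \<rho>" using yI True by simp
            then have "(N (y I) ^ E) ^ Q \<le> \<rho> ^ Q" using N.N_nonneg by (intro power_mono) auto
            then show ?thesis using N.N_power[OF yL] N.N_power[of "y I" E] yI by simp
          qed
          moreover have "(y I ^ E) ^ Q \<in> L" using yL by (rule N.L_closed)
          ultimately show thesis using that by blast
        next
          case False
          then have "N (y I) = 1" using yI by simp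
          then have "N (1 - y I ^ E) \<le> \<rho>"
            using yI N.N_uminus[of "y I ^ E - 1"] N.L_closed(3)[OF yL N.L_closed(2)] by simp
          then have "N ((1 - y I ^ E) ^ Q) \<le> \<rho> ^ Q"
            using N.N_power[of "1 - y I ^ E"] N.L_closed(3)[OF N.L_closed(2) yL] N.N_nonneg by (simp add: power_mono)
          moreover have gL: "(1 - y I ^ E) ^ Q \<in> L" by (intro N.L_closed(9) N.L_closed(3) N.L_closed(2) yL)
          moreover have "b' I - b I * (1 - y I ^ E) ^ Q = b I * (- ((1 - y I ^ E) ^ Q))"
            using False by (simp add: b'_def)
          ultimately show thesis using that[of "- ((1 - y I ^ E) ^ Q)"] N.N_uminus[OF gL] N.L_closed(5)[OF gL] by simp
        qed
        show ?thesis unfolding g(3)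
          using N.N_mult[OF bL g(1)] N.L_closed(4)[OF bL g(1)] Nb g(2) N.N_nonneg \<tau>(1) by (simp add: mult_mono)
      qed
      have sjL: "ideal_s1 I ^ j \<in> L" using sL by (rule N.L_closed)
      have "N ((b' I - b I * (1 - y I ^ E) ^ Q) * ideal_s1 I ^ j) \<le> (\<tau> ^ d * \<rho> ^ Q) * r ^ (d * j)"
        using N.N_mult[OF conjunct1[OF key] sjL] key Nsj N.N_nonneg \<tau>(1) \<rho>(1) by (simp add: mult_mono)
      then show "(b' I - b I * (1 - y I ^ E) ^ Q) * ideal_s1 I ^ j \<in> L \<and>
          N ((b' I - b I * (1 - y I ^ E) ^ Q) * ideal_s1 I ^ j) \<le> \<tau> ^ d * r ^ (d * j) * \<rho> ^ Q"
        using N.L_closed(4)[OF conjunct1[OF key] sjL] by (simp add: mult_ac)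
    qed (use \<tau>(1) r \<rho>(1) in simp)
    define \<Theta> where "\<Theta> = \<beta> * \<tau> ^ d * r ^ (d * j)"
    have tr: "1 \<le> \<tau> ^ d" "1 \<le> r ^ (d * j)" using \<tau>(1) r by (auto intro: one_le_power)
    have \<Theta>1: "1 \<le> \<Theta>" unfolding \<Theta>_def using \<beta> tr by (metis mult_ge1_I)
    have ex: "\<exists>\<mu> s'. s' \<in> S \<and> ideal_s1 I ^ j * s = \<mu> * s' \<and> D * \<mu> \<in> A \<and> absv \<mu> \<le> r ^ (d * j) * \<kappa>"
      if I: "I \<in> \<Omega>" and s: "s \<in> S" for I s
    proof -
      have I': "I \<in> ideals" "degk I = int d" using \<Omega>(2)[OF I] by auto
      obtain \<mu> s' where mu: "\<mu> \<in> k - {0}" "s' \<in> S" "ideal_s1 (ideal_power A I j) * s = \<mu> * s'" "D * \<mu> \<in> A"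
        using S(8)[OF ideal_power_ideals[OF I'(1), of j] s] by blast
      have e: "ideal_s1 I ^ j * s = \<mu> * s'" using mu(3) ideal_s1_power[OF ideals_fractional[OF I'(1)]] by simp
      have s'0: "s' \<noteq> 0" using mu(2) S(3) by auto
      have "absv (ideal_s1 I) ^ j * absv s = absv \<mu> * absv s'"
        using arg_cong[OF e, of absv] by (simp add: abs_mult abs.N_power)
      then have "absv \<mu> = r ^ (d * j) * (absv s / absv s')" using s1[OF I'] s'0 abs_eq_0[of s'] by (simp add: field_simps power_mult)
      also have "\<dots> \<le> r ^ (d * j) * \<kappa>" using \<kappa>[OF s mu(2)] r by (intro mult_left_mono) auto
      finally show ?thesis using mu e by blast
    qed
    then have "\<forall>q\<in>\<Omega> \<times> S. \<exists>z. snd z \<in> S \<and> ideal_s1 (fst q) ^ j * snd q = fst z * snd z \<and> D * fst z \<in> A \<and> absv (fst z) \<le> r ^ (d * j) * \<kappa>"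
      by fastforce
    from bchoice[OF this] obtain h where h: "\<forall>q\<in>\<Omega> \<times> S. snd (h q) \<in> S \<and> ideal_s1 (fst q) ^ j * snd q = fst (h q) * snd (h q) \<and>
        D * fst (h q) \<in> A \<and> absv (fst (h q)) \<le> r ^ (d * j) * \<kappa>" by (elim exE)
    have h': "snd (h (I, s)) \<in> S" "ideal_s1 I ^ j * s = fst (h (I, s)) * snd (h (I, s))" "D * fst (h (I, s)) \<in> A"
      "absv (fst (h (I, s))) \<le> r ^ (d * j) * \<kappa>" if "I \<in> \<Omega>" "s \<in> S" for I s
      using bspec[OF h, of "(I, s)"] that by auto
    \<comment> \<open>The matrix of multiplication by \<open>D * T\<close> on \<open>S\<close>: each
      ideal contributes one entry to row \<open>s\<close>, in the column of the element of
      \<open>S\<close> to which it carries \<open>s\<close>.\<close>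
    define cf where "cf s s' = (\<Sum>I\<in>\<Omega>. if snd (h (I, s)) = s' then b' I * (D * fst (h (I, s))) else 0)" for s s'
    have "D * T = 0"
    proof (rule small_element_zero[OF N VL lower upper S(1,2,3)])
      show "D * T \<in> \<V>"
        unfolding T_def dsum_def using S(4) A_subset k_subset_V bA ideal_s1_V ideals_fractional V_closed(1)
        by (intro V_closed) (auto simp: b'_def)
      show "D * T * s = (\<Sum>s'\<in>S. cf s s' * s')" if s: "s \<in> S" for s
      proof -
        have "(\<Sum>s'\<in>S. cf s s' * s') = (\<Sum>I\<in>\<Omega>. \<Sum>s'\<in>S. (if snd (h (I, s)) = s' then b' I * (D * fst (h (I, s))) else 0) * s')"
          unfolding cf_def sum_distrib_right by (rule sum.swap)
        also have "\<dots> = (\<Sum>I\<in>\<Omega>. b' I * (D * fst (h (I, s))) * snd (h (I, s)))"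
          using S(1) h'(1)[OF _ s] by (intro sum.cong refl) (simp add: if_distrib[of "\<lambda>u. u * _"] cong: if_cong)
        also have "\<dots> = (\<Sum>I\<in>\<Omega>. D * (b' I * ideal_s1 I ^ j) * s)"
        proof (intro sum.cong refl)
          fix I assume I: "I \<in> \<Omega>"
          have "b' I * (D * fst (h (I, s))) * snd (h (I, s)) = b' I * D * (fst (h (I, s)) * snd (h (I, s)))"
            by (simp only: mult.assoc)
          also have "\<dots> = b' I * D * (ideal_s1 I ^ j * s)" by (simp only: h'(2)[OF I s])
          also have "\<dots> = D * (b' I * ideal_s1 I ^ j) * s" by (simp only: mult_ac)
          finally show "b' I * (D * fst (h (I, s))) * snd (h (I, s)) = D * (b' I * ideal_s1 I ^ j) * s" .
        qed
        also have "\<dots> = D * T * s" unfolding T_def dsum_def \<Omega>_def by (simp add: sum_distrib_left sum_distrib_right)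
        finally show ?thesis by simp
      qed
      show "cf s s' \<in> A \<and> absv (cf s s') \<le> \<Theta>" if s: "s \<in> S" "s' \<in> S" for s s'
      proof
        have b'A: "b' I \<in> A" if "I \<in> \<Omega>" for I using bA \<Omega>(2)[OF that] A_closed(1) by (simp add: b'_def)
        show "cf s s' \<in> A" unfolding cf_def
        proof (rule A_closed(7))
          fix I assume I: "I \<in> \<Omega>"
          show "(if snd (h (I, s)) = s' then b' I * (D * fst (h (I, s))) else 0) \<in> A"
            using A_closed(4)[OF b'A[OF I] h'(3)[OF I s(1)]] A_closed(1) by simp
        qed
        show "absv (cf s s') \<le> \<Theta>" unfolding cf_def
        proof (rule abs.N_sum)
          fix I assume I: "I \<in> \<Omega>"
          have b'b: "absv (b' I) \<le> \<tau> ^ d" using \<tau>(2)[OF d(2), of I] \<Omega>(2)[OF I] \<tau>(1) by (simp add: b'_def)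
          have "absv (b' I * (D * fst (h (I, s)))) = absv (b' I) * (absv D * absv (fst (h (I, s))))" by (simp add: abs_mult)
          also have "\<dots> \<le> \<tau> ^ d * (absv D * (r ^ (d * j) * \<kappa>))"
            using b'b h'(4)[OF I s(1)] abs_nonneg \<tau>(1) by (intro mult_mono mult_left_mono) auto
          also have "\<dots> = \<Theta>" by (simp add: \<Theta>_def \<beta>_def mult_ac)
          finally show "(if snd (h (I, s)) = s' then b' I * (D * fst (h (I, s))) else 0) \<in> UNIV \<and>
              absv (if snd (h (I, s)) = s' then b' I * (D * fst (h (I, s))) else 0) \<le> \<Theta>" using \<Theta>1 by simp
        qed (use \<Theta>1 in simp)
      qed
      show "1 \<le> \<Theta>" by (rule \<Theta>1)
      show "N (D * T) \<le> \<Theta> * \<rho> ^ Q"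
      proof -
        have DL: "D \<in> L" using S(4) AL by auto
        have TL: "T \<in> L"
          using dsum_O_V[of b' j d] bA A_closed(1) VL by (auto simp: T_def b'_def O_\<V>_def)
        have "N (D * T) = N D * N T" by (rule N.N_mult[OF DL TL])
        also have "\<dots> \<le> absv D * (\<tau> ^ d * r ^ (d * j) * \<rho> ^ Q)"
          using upper[OF S(4)] D1 NT N.N_nonneg by (intro mult_mono) auto
        also have "\<dots> \<le> absv D * \<kappa> * (\<tau> ^ d * r ^ (d * j) * \<rho> ^ Q)"
          using \<kappa>1 D1 tr \<rho>(1) by (intro mult_right_mono) auto
        finally show ?thesis by (simp add: \<Theta>_def \<beta>_def mult_ac)
      qed
      show "0 \<le> \<rho> ^ Q" "\<rho> ^ Q \<le> 1" using \<rho> by (auto simp: power_le_one)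
      show "\<Theta> ^ (3 * card S + 1) * \<rho> ^ Q < 1" using small by (simp add: \<Theta>_def Q_def m_def)
    qed
    then show ?thesis using S(5) by (simp add: T_def)
  next
    case False
    \<comment> \<open>A sum over an infinite set is \<open>0\<close> by convention.\<close>
    then show ?thesis unfolding dsum_def by (rule sum.infinite)
  qed
  define \<nu> where "\<nu> = - ln \<rho>"
  have \<nu>: "0 < \<nu>" using \<rho> by (simp add: \<nu>_def)
  define p where "p = CHAR('c)"
  have p: "2 \<le> p" unfolding p_def using CHAR_prime by (rule prime_ge_2_nat)
  \<comment> \<open>Chosen so that \<open>C * (1 + d + d * exp (c / 3 * d))\<close> bounds the
    logarithm of the size factor in \<open>single\<close>.\<close>
  define C where "C = real (3 * m + 1) * (ln \<beta> + ln \<tau> + ln r)"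
  \<comment> \<open>The rate at which \<open>\<rho> ^ Q\<close> decays. A factor \<open>p\<close> is
    lost because \<open>Q\<close> must be a power of \<open>p\<close>, and \<open>2 * E\<close>
    because \<open>E * Q\<close> may use up only half of the range \<open>exp (c * d)\<close>, the
    other half being reserved for \<open>j\<close>.\<close>
  define K where "K = \<nu> / (2 * real E * real p)"
  have K: "0 < K" using \<nu> E p by (simp add: K_def)
  have ev: "eventually (\<lambda>d::nat. C * (1 + real d + real d * exp (c / 3 * real d)) < K * exp (c * real d) \<and>
      2 * real E * (1 + real d + real d * exp (c / 3 * real d)) < 1 * exp (c * real d) \<and> d0 \<le> d \<and> d1 \<le> d \<and> 1 \<le> d) sequentially"
    by (intro eventually_conj growth_comparison[OF c(1) K] growth_comparison[OF c(1), of 1] eventually_ge_at_top) simp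
  then obtain d2 where d2: "\<And>d. d2 \<le> d \<Longrightarrow> C * (1 + real d + real d * exp (c / 3 * real d)) < K * exp (c * real d) \<and>
      2 * real E * (1 + real d + real d * exp (c / 3 * real d)) < 1 * exp (c * real d) \<and> d0 \<le> d \<and> d1 \<le> d \<and> 1 \<le> d"
    unfolding eventually_sequentially by blast
  have "dsum b' j d = 0" if d: "d2 \<le> d" and j: "real j \<le> exp (c / 3 * real d)" for d j
  proof -
    let ?X = "exp (c * real d) / (2 * real E)"
    let ?g = "1 + real d + real d * exp (c / 3 * real d)"
    have big: "?g < ?X" using d2[OF d] E by (simp add: field_simps)
    have d1': "1 \<le> real d" using d2[OF d] by simp
    have "exp (c / 3 * real d) \<le> real d * exp (c / 3 * real d)" using d1' by simp
    then have jX: "real j \<le> ?g" using j d1' by linarith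
    have "0 \<le> real d * exp (c / 3 * real d)" by simp
    then have g1: "1 \<le> ?g" "real d \<le> ?g" using d1' by linarith+
    then have "1 \<le> ?X" using big by linarith
    then obtain e where e: "real (p ^ e) \<le> ?X" "?X < real p * real (p ^ e)" using power_between[OF p] by blast
    have "real E * real (p ^ e) \<le> exp (c * real d) / 2" using e(1) E by (simp add: field_simps)
    moreover have "real j \<le> exp (c * real d) / 2"
    proof -
      have "?X \<le> exp (c * real d) / 2" using E by (simp add: field_simps)
      then show ?thesis using jX big by linarith
    qed
    ultimately have jQ: "real (j + E * p ^ e) \<le> exp (c * real d)" by simp
    have "(\<beta> * \<tau> ^ d * r ^ (d * j)) ^ (3 * m + 1) * \<rho> ^ (p ^ e) < 1"
    proof -
      have pos: "0 < \<beta>" "0 < \<tau>" "0 < r" using \<beta> \<tau>(1) r by auto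
      let ?Y = "(\<beta> * \<tau> ^ d * r ^ (d * j)) ^ (3 * m + 1) * \<rho> ^ (p ^ e)"
      have Y: "0 < ?Y" using pos \<rho>(1) by simp
      have l: "0 \<le> ln \<beta>" "0 \<le> ln \<tau>" "0 \<le> ln r" using \<beta> \<tau>(1) r by auto
      have "ln ?Y = real (3 * m + 1) * (ln \<beta> + real d * ln \<tau> + real (d * j) * ln r) - real (p ^ e) * \<nu>"
        using pos \<rho>(1) by (simp add: ln_mult ln_realpow \<nu>_def algebra_simps)
      also have "real (3 * m + 1) * (ln \<beta> + real d * ln \<tau> + real (d * j) * ln r) \<le> C * ?g"
      proof -
        have "real (d * j) \<le> real d * exp (c / 3 * real d)" using j by (simp add: mult_left_mono)
        then have "real (d * j) \<le> ?g" using d1' by linarith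
        note g = g1 this
        have "ln \<beta> + real d * ln \<tau> + real (d * j) * ln r \<le> ?g * ln \<beta> + ?g * ln \<tau> + ?g * ln r"
          using mult_right_mono[OF g(1) l(1)] mult_right_mono[OF g(2) l(2)] mult_right_mono[OF g(3) l(3)] by linarith
        then have "real (3 * m + 1) * (ln \<beta> + real d * ln \<tau> + real (d * j) * ln r)
            \<le> real (3 * m + 1) * (?g * ln \<beta> + ?g * ln \<tau> + ?g * ln r)" by (rule mult_left_mono) simp
        also have "\<dots> = C * ?g" by (simp add: C_def algebra_simps)
        finally show ?thesis .
      qed
      also have "C * ?g < K * exp (c * real d)" using d2[OF d] by blast
      also have "K * exp (c * real d) = \<nu> / real p * ?X" using E by (simp add: K_def)
      also have "\<dots> \<le> \<nu> / real p * (real p * real (p ^ e))" using e(2) \<nu> p by (intro mult_left_mono) auto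
      also have "\<dots> = real (p ^ e) * \<nu>" using p by simp
      finally have "ln ?Y < 0" by simp
      then show ?thesis using Y by simp
    qed
    then show ?thesis using single[of d j e] d2[OF d] jQ unfolding p_def by blast
  qed
  then show ?thesis unfolding vanishing_def b'_def[symmetric]
    using c(1) by (intro exI[of _ "c / 3"] conjI exI[of _ d2]) auto
qed

end

section \<open>The canonical infinite place\<close>

text \<open>The constant factor \<open>C\<close> disappears in high powers: if \<open>N\<close>
  exceeded \<open>Q\<close>, Bernoulli's inequality would make \<open>(N / Q) ^ l\<close> larger
  than \<open>C\<close>, already for \<open>l = Q * C\<close>.\<close>

lemma geometric_bound:
  fixes N Q C :: nat
  assumes le: "\<And>l. N ^ l \<le> Q ^ l * C" and Q: "0 < Q" shows "N \<le> Q"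
proof (rule ccontr)
  assume "\<not> N \<le> Q"
  then have N: "Q + 1 \<le> N" by simp
  define l where "l = Q * C"
  have q: "0 < real Q" using Q by simp
  have "1 + real l * (1 / real Q) \<le> (1 + 1 / real Q) ^ l" by (rule Bernoulli_inequality) (use q in \<open>simp add: order_trans[of _ 0]\<close>)
  then have "(1 + real C) * real Q ^ l \<le> (1 + 1 / real Q) ^ l * real Q ^ l"
    using q by (intro mult_right_mono) (simp_all add: l_def)
  also have "\<dots> = (real Q + 1) ^ l" using q by (simp add: power_mult_distrib[symmetric] distrib_right)
  also have "\<dots> \<le> real N ^ l" using N by (intro power_mono) auto
  also have "\<dots> \<le> real Q ^ l * real C" using le[of l] by (metis of_nat_le_iff of_nat_mult of_nat_power)
  finally have "real Q ^ l \<le> 0" by (simp add: algebra_simps)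
  then show False using q by (simp add: not_less[symmetric])
qed

context goss_setting
begin

lemma abs_unif: "0 < absv unif" "absv unif < 1"
proof -
  have "absv unif = inverse (real (card Fr) ^ d_inf)" unfolding unif_abs by (simp add: power_int_minus)
  moreover have "1 < real (card Fr) ^ d_inf" using r_gt_1 d_inf_pos by (intro one_less_power) auto
  ultimately show "0 < absv unif" "absv unif < 1" using card_F by (auto simp: inverse_less_1_iff)
qed

text \<open>Nonzero elements of \<open>K\<close> have the same absolute values as elements of
  \<open>k\<close>, and these are integral powers of \<open>absv unif\<close>.\<close>

lemma K_abs_lt_1: assumes x: "x \<in> K" "absv x < 1" shows "absv x \<le> absv unif"
proof (cases "x = 0")
  case False
  obtain y where y: "y \<in> k" "absv y = absv x" "y \<noteq> 0" using K_approx_abs[OF x(1) False, of 1] by auto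
  have "1 \<le> vinf y" using abs_lt_1_iff[OF y(1)] x(2) y by (auto simp: val_ge_def)
  then have "int d_inf * 1 \<le> int d_inf * vinf y" by (intro mult_left_mono) auto
  then have "real (card Fr) powi (- (int d_inf * vinf y)) \<le> real (card Fr) powi (- int d_inf)"
    using r_gt_1 by (intro power_int_increasing) auto
  then show ?thesis using abs_k[of y] y unif_abs by simp
qed (use abs_nonneg in simp)

text \<open>Expansion in powers of \<open>unif\<close> with digits from a finite system of
  residues.\<close>

lemma K_cover:
  "\<exists>q>0. \<forall>n. \<exists>T. finite T \<and> T \<subseteq> K \<and> card T \<le> q ^ n \<and>
    (\<forall>c\<in>K. absv c \<le> 1 \<longrightarrow> (\<exists>t\<in>T. absv (c - t) \<le> absv unif ^ n))"
proof -
  obtain T0 where T0: "finite T0" "T0 \<subseteq> k" "T0 \<noteq> {}" "\<And>t. t \<in> T0 \<Longrightarrow> absv t \<le> 1"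
    "\<And>x. x \<in> K \<Longrightarrow> absv x \<le> 1 \<Longrightarrow> \<exists>t\<in>T0. absv (x - t) < 1" using K_residue_cover by metis
  have T0K: "T0 \<subseteq> K" using T0(2) k_subset_K by auto
  have "\<exists>T. finite T \<and> T \<subseteq> K \<and> card T \<le> card T0 ^ n \<and>
    (\<forall>c\<in>K. absv c \<le> 1 \<longrightarrow> (\<exists>t\<in>T. absv (c - t) \<le> absv unif ^ n))" for n
  proof (induction n)
    case 0
    show ?case by (intro exI[of _ "{0}"]) (auto simp: K_closed)
  next
    case (Suc n)
    then obtain T where T: "finite T" "T \<subseteq> K" "card T \<le> card T0 ^ n"
      "\<And>c. c \<in> K \<Longrightarrow> absv c \<le> 1 \<Longrightarrow> \<exists>t\<in>T. absv (c - t) \<le> absv unif ^ n" by blast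
    let ?T = "(\<lambda>(t, t'). t + unif ^ n * t') ` (T \<times> T0)"
    have un: "unif ^ n \<in> K" "unif ^ n \<noteq> 0" using unif_K unif_nonzero K_closed(9) by auto
    have "card ?T \<le> card (T \<times> T0)" using T T0 by (intro card_image_le) auto
    also have "\<dots> \<le> card T0 ^ Suc n" using T(3) by (simp add: card_cartesian_product mult.commute)
    finally have "card ?T \<le> card T0 ^ Suc n" .
    moreover have "\<exists>t\<in>?T. absv (c - t) \<le> absv unif ^ Suc n" if c: "c \<in> K" "absv c \<le> 1" for c
    proof -
      obtain t where t: "t \<in> T" "absv (c - t) \<le> absv unif ^ n" using T(4)[OF c] by blast
      define z where "z = (c - t) / unif ^ n"
      have "t \<in> K" using t(1) T(2) by blast
      then have z: "z \<in> K" unfolding z_def by (rule K_closed(11)[OF K_closed(3)[OF c(1)] un(1)])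
      have "absv z \<le> 1" using t(2) abs_unif(1) by (simp add: z_def abs.N_divide abs.N_power)
      then obtain t' where t': "t' \<in> T0" "absv (z - t') < 1" using T0(5)[OF z] by blast
      have "z - t' \<in> K" using z t'(1) T0K K_closed(3) by blast
      then have le: "absv (z - t') \<le> absv unif" using K_abs_lt_1 t'(2) by blast
      have "c - (t + unif ^ n * t') = unif ^ n * (z - t')" using un(2) by (simp add: z_def field_simps)
      then have "absv (c - (t + unif ^ n * t')) = absv unif ^ n * absv (z - t')" by (simp add: abs_mult abs.N_power)
      also have "\<dots> \<le> absv unif ^ n * absv unif" using le abs_nonneg by (intro mult_left_mono) auto
      finally have "absv (c - (t + unif ^ n * t')) \<le> absv unif ^ Suc n" by (simp add: mult.commute)
      then show ?thesis using t(1) t'(1) by (intro bexI[of _ "t + unif ^ n * t'"]) auto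
    qed
    moreover have "?T \<subseteq> K"
    proof (clarsimp)
      fix t t' assume "t \<in> T" "t' \<in> T0"
      then have "t \<in> K" "t' \<in> K" using T(2) T0K by auto
      then show "t + unif ^ n * t' \<in> K" using K_closed(6)[OF _ K_closed(4)[OF un(1)]] by simp
    qed
    moreover have "finite ?T" using T T0 by auto
    ultimately show ?case by blast
  qed
  moreover have "0 < card T0" using T0 by (simp add: card_gt_0_iff)
  ultimately show ?thesis by (intro exI[of _ "card T0"] conjI allI)
qed

text \<open>
  The sums of \<open>unif\<^sup>j y\<^sub>j\<close> with \<open>j < l\<close> are pairwise at distance more than \<open>absv unif ^ l\<close>, but
  they lie in a fixed lattice, which is covered by \<open>C * q ^ (card S * l)\<close> balls of this radius.
\<close>

lemma span_separated_bounded: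
  assumes S: "finite S"
  shows "\<exists>Q. \<forall>Y. finite Y \<and> Y \<subseteq> lin_span K S \<and> (\<forall>y\<in>Y. absv y \<le> 1) \<and>
    (\<forall>y\<in>Y. \<forall>y'\<in>Y. absv (y - y') \<le> absv unif \<longrightarrow> y = y') \<longrightarrow> card Y \<le> Q"
proof -
  obtain q :: nat where q: "0 < q" "\<forall>n. \<exists>T. finite T \<and> T \<subseteq> K \<and> card T \<le> q ^ n \<and>
    (\<forall>c\<in>K. absv c \<le> 1 \<longrightarrow> (\<exists>t\<in>T. absv (c - t) \<le> absv unif ^ n))" using K_cover by (elim exE conjE)
  let ?\<epsilon> = "absv unif"
  have pw: "\<exists>n. ?\<epsilon> ^ n * x \<le> 1" for x :: real
  proof -
    have "0 < 1 / (\<bar>x\<bar> + 1)" by (simp add: add_nonneg_pos)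
    then obtain n where "?\<epsilon> ^ n < 1 / (\<bar>x\<bar> + 1)" using real_arch_pow_inv abs_unif(2) by blast
    then have "?\<epsilon> ^ n * (\<bar>x\<bar> + 1) < 1" by (simp add: field_simps add_pos_nonneg)
    moreover have "?\<epsilon> ^ n * x \<le> ?\<epsilon> ^ n * (\<bar>x\<bar> + 1)" using abs_unif(1) by (intro mult_left_mono) auto
    ultimately show ?thesis by (intro exI[of _ n]) simp
  qed
  obtain b where b: "?\<epsilon> ^ b * (\<Sum>s\<in>S. absv s) \<le> 1" using pw by blast
  have bs: "?\<epsilon> ^ b * absv s \<le> 1" if "s \<in> S" for s
  proof -
    have "absv s \<le> (\<Sum>s\<in>S. absv s)" using S that abs_nonneg by (intro member_le_sum) auto
    then have "?\<epsilon> ^ b * absv s \<le> ?\<epsilon> ^ b * (\<Sum>s\<in>S. absv s)" using abs_unif(1) by (intro mult_left_mono) auto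
    then show ?thesis using b by simp
  qed
  have bd: "card Y \<le> q ^ card S"
    if Y: "finite Y" "Y \<subseteq> lin_span K S" "\<And>y. y \<in> Y \<Longrightarrow> absv y \<le> 1"
      "\<And>y y'. y \<in> Y \<Longrightarrow> y' \<in> Y \<Longrightarrow> absv (y - y') \<le> ?\<epsilon> \<Longrightarrow> y = y'" for Y
  proof -
    have "\<forall>y\<in>Y. \<exists>c. (\<forall>s\<in>S. c s \<in> K) \<and> y = (\<Sum>s\<in>S. c s * s)"
      using Y(2) unfolding lin_span_def by blast
    from bchoice[OF this] obtain c where c: "\<forall>y\<in>Y. (\<forall>s\<in>S. c y s \<in> K) \<and> y = (\<Sum>s\<in>S. c y s * s)" by (elim exE)
    have cK: "c y s \<in> K" if "y \<in> Y" "s \<in> S" for y s using c that by blast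
    have cy: "(\<Sum>s\<in>S. c y s * s) = y" if "y \<in> Y" for y using bspec[OF c that] by (elim conjE) (rule sym)
    \<comment> \<open>The powers \<open>b\<close> and \<open>a\<close> of \<open>unif\<close>
      compensate the size of the generators and of the coordinates of \<open>Y\<close>. Only
      \<open>a\<close> depends on \<open>Y\<close>, and neither of them depends on
      \<open>l\<close>.\<close>
    obtain a where a: "?\<epsilon> ^ a * (\<Sum>y\<in>Y. \<Sum>s\<in>S. absv (c y s)) \<le> 1" using pw by blast
    have ac: "absv (unif ^ a * c y s) \<le> 1" if "y \<in> Y" "s \<in> S" for y s
    proof -
      have "absv (c y s) \<le> (\<Sum>s\<in>S. absv (c y s))" using S that abs_nonneg by (intro member_le_sum[of s S "\<lambda>s. absv (c y s)"]) auto
      also have "\<dots> \<le> (\<Sum>y\<in>Y. \<Sum>s\<in>S. absv (c y s))"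
        using Y(1) that abs_nonneg by (intro member_le_sum[of y Y "\<lambda>y. \<Sum>s\<in>S. absv (c y s)"]) (auto intro: sum_nonneg)
      finally have "?\<epsilon> ^ a * absv (c y s) \<le> ?\<epsilon> ^ a * (\<Sum>y\<in>Y. \<Sum>s\<in>S. absv (c y s))"
        using abs_unif(1) by (intro mult_left_mono) auto
      then show ?thesis using a by (simp add: abs_mult abs.N_power)
    qed
    have "card Y ^ l \<le> (q ^ card S) ^ l * q ^ ((a + b) * card S)" for l
    proof -
      \<comment> \<open>The precision of the coordinates: \<open>l\<close> digits for the
        separation, and \<open>a + b\<close> more to make up for the two scalings.\<close>
      define n where "n = a + b + l"
      obtain T where T: "finite T" "T \<subseteq> K" "card T \<le> q ^ n"
        "\<forall>c\<in>K. absv c \<le> 1 \<longrightarrow> (\<exists>t\<in>T. absv (c - t) \<le> ?\<epsilon> ^ n)" using spec[OF q(2), of n] by (elim exE conjE)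
      define z where "z f = (\<Sum>j<l. unif ^ j * f j)" for f
      \<comment> \<open>These are the coordinates of \<open>unif ^ a * z f\<close>, integral by the
        choice of \<open>a\<close>, and \<open>tz f\<close> collects their approximations in the
        finite set \<open>T\<close>. The family \<open>f\<close> is recovered from
        \<open>tz f\<close>, which gives the count.\<close>
      define cz where "cz f s = unif ^ a * (\<Sum>j<l. unif ^ j * c (f j) s)" for f s
      define tz where "tz f = (\<lambda>s\<in>S. SOME t. t \<in> T \<and> absv (cz f s - t) \<le> ?\<epsilon> ^ n)" for f
      have tz: "tz f s \<in> T \<and> absv (cz f s - tz f s) \<le> ?\<epsilon> ^ n" if f: "f \<in> {..<l} \<rightarrow>\<^sub>E Y" and s: "s \<in> S" for f s
      proof -
        have fj: "f j \<in> Y" if "j < l" for j using f that by auto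
        have "cz f s \<in> K" unfolding cz_def using fj cK[OF _ s] unif_K by (intro K_closed) auto
        moreover have "absv (cz f s) \<le> 1"
          unfolding cz_def sum_distrib_left
        proof (rule abs.N_sum)
          fix j assume j: "j \<in> {..<l}"
          have "unif ^ a * (unif ^ j * c (f j) s) = unif ^ j * (unif ^ a * c (f j) s)" by (simp add: mult_ac)
          note eq = this
          have "absv (unif ^ j * (unif ^ a * c (f j) s)) \<le> 1 * 1"
            unfolding abs_mult[of "unif ^ j"] using ac[OF fj s] j abs_unif abs_nonneg
            by (intro mult_mono) (auto simp: abs.N_power power_le_one)
          then show "unif ^ a * (unif ^ j * c (f j) s) \<in> UNIV \<and> absv (unif ^ a * (unif ^ j * c (f j) s)) \<le> 1"
            unfolding eq mult_1_right by (intro conjI UNIV_I)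
        qed simp
        ultimately have "\<exists>t. t \<in> T \<and> absv (cz f s - t) \<le> ?\<epsilon> ^ n" using T(4) by blast
        from someI_ex[OF this] show ?thesis using s by (simp add: tz_def)
      qed
      have zc: "unif ^ a * z f = (\<Sum>s\<in>S. cz f s * s)" if f: "f \<in> {..<l} \<rightarrow>\<^sub>E Y" for f
      proof -
        have fj: "f j \<in> Y" if "j < l" for j using f that by auto
        have "(\<Sum>s\<in>S. cz f s * s) = unif ^ a * (\<Sum>s\<in>S. \<Sum>j<l. unif ^ j * (c (f j) s * s))"
          unfolding cz_def sum_distrib_left sum_distrib_right by (intro sum.cong refl) (simp add: mult_ac)
        also have "(\<Sum>s\<in>S. \<Sum>j<l. unif ^ j * (c (f j) s * s)) = (\<Sum>j<l. \<Sum>s\<in>S. unif ^ j * (c (f j) s * s))" by (rule sum.swap)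
        also have "\<dots> = z f" unfolding z_def by (intro sum.cong refl) (simp add: sum_distrib_left[symmetric] cy fj)
        finally show ?thesis by simp
      qed
      have close: "absv (z f - z g) \<le> ?\<epsilon> ^ l"
        if f: "f \<in> {..<l} \<rightarrow>\<^sub>E Y" and g: "g \<in> {..<l} \<rightarrow>\<^sub>E Y" and e: "tz f = tz g" for f g
      proof -
        have "absv ((cz f s - cz g s) * s) \<le> ?\<epsilon> ^ (a + l)" if s: "s \<in> S" for s
        proof -
          have "absv ((cz f s - tz f s) - (cz g s - tz g s)) \<le> ?\<epsilon> ^ n"
            using abs.N_diff[of "cz f s - tz f s" "cz g s - tz g s"] conjunct2[OF tz[OF f s]] conjunct2[OF tz[OF g s]] by simp
          then have "absv (cz f s - cz g s) \<le> ?\<epsilon> ^ n" by (simp add: e)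
          then have "absv (cz f s - cz g s) * absv s \<le> ?\<epsilon> ^ n * absv s" using abs_nonneg by (intro mult_right_mono)
          also have "\<dots> = ?\<epsilon> ^ (a + l) * (?\<epsilon> ^ b * absv s)" by (simp add: n_def power_add mult_ac)
          also have "\<dots> \<le> ?\<epsilon> ^ (a + l) * 1" using bs[OF s] abs_unif(1) by (intro mult_left_mono) auto
          finally show ?thesis by (simp add: abs_mult)
        qed
        then have "absv (\<Sum>s\<in>S. (cz f s - cz g s) * s) \<le> ?\<epsilon> ^ (a + l)"
          using abs_unif(1) by (intro abs.N_sum) auto
        moreover have "(\<Sum>s\<in>S. (cz f s - cz g s) * s) = unif ^ a * (z f - z g)"
          using zc[OF f] zc[OF g] by (simp add: left_diff_distrib right_diff_distrib sum_subtractf)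
        ultimately have "?\<epsilon> ^ a * absv (z f - z g) \<le> ?\<epsilon> ^ a * ?\<epsilon> ^ l" by (simp add: abs_mult abs.N_power power_add)
        then show ?thesis using abs_unif(1) by simp
      qed
      \<comment> \<open>At the first index \<open>i\<close> where \<open>f\<close> and
        \<open>g\<close> differ, the term would exceed \<open>absv unif ^ Suc i\<close>, while the
        later terms and the whole difference do not.\<close>
      have sep: "f = g" if f: "f \<in> {..<l} \<rightarrow>\<^sub>E Y" and g: "g \<in> {..<l} \<rightarrow>\<^sub>E Y" and d: "absv (z f - z g) \<le> ?\<epsilon> ^ l" for f g
      proof (rule PiE_ext[OF f g])
        have "\<forall>j<i. f j = g j" if "i \<le> l" for i
          using that
        proof (induction i)
          case (Suc i)
          then have eq: "\<And>j. j < i \<Longrightarrow> f j = g j" and i: "i < l" by auto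
          have fg: "f j \<in> Y" "g j \<in> Y" if "j < l" for j using f g that by auto
          define R where "R = (\<Sum>j\<in>{Suc i..<l}. unif ^ j * (f j - g j))"
          have "z f - z g = (\<Sum>j<l. unif ^ j * (f j - g j))"
            by (simp add: z_def right_diff_distrib sum_subtractf)
          also have "\<dots> = (\<Sum>j\<in>{i..<l}. unif ^ j * (f j - g j))"
            using eq by (intro sum.mono_neutral_right) auto
          also have "\<dots> = unif ^ i * (f i - g i) + R" unfolding R_def using i by (simp add: sum.atLeast_Suc_lessThan)
          finally have zz: "unif ^ i * (f i - g i) = (z f - z g) - R" by simp
          have "absv R \<le> ?\<epsilon> ^ Suc i" unfolding R_def
          proof (rule abs.N_sum)
            fix j assume j: "j \<in> {Suc i..<l}"
            have "absv (f j - g j) \<le> 1" using abs.N_diff[of "f j" "g j"] Y(3)[OF fg(1)[of j]] Y(3)[OF fg(2)[of j]] j by simp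
            then have "?\<epsilon> ^ j * absv (f j - g j) \<le> ?\<epsilon> ^ j * 1" using abs_unif(1) by (intro mult_left_mono) auto
            also have "\<dots> \<le> ?\<epsilon> ^ Suc i" using abs_unif j unfolding mult_1_right by (intro power_decreasing) auto
            finally show "unif ^ j * (f j - g j) \<in> UNIV \<and> absv (unif ^ j * (f j - g j)) \<le> ?\<epsilon> ^ Suc i"
              by (simp add: abs_mult abs.N_power)
          qed (use abs_unif(1) in simp)
          moreover have "?\<epsilon> ^ l \<le> ?\<epsilon> ^ Suc i" using abs_unif i by (intro power_decreasing) auto
          ultimately have "absv (unif ^ i * (f i - g i)) \<le> ?\<epsilon> ^ Suc i"
            unfolding zz using abs.N_diff[of "z f - z g" R] d by simp
          then have "absv (f i - g i) \<le> ?\<epsilon>" using abs_unif(1) by (simp add: abs_mult abs.N_power mult.commute)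
          then have "f i = g i" using Y(4) fg[OF i] by blast
          then show ?case using eq by (auto simp: less_Suc_eq)
        qed simp
        then show "f j = g j" if "j \<in> {..<l}" for j using that by auto
      qed
      have "inj_on tz ({..<l} \<rightarrow>\<^sub>E Y)" using sep close by (auto intro!: inj_onI)
      moreover have "tz ` ({..<l} \<rightarrow>\<^sub>E Y) \<subseteq> S \<rightarrow>\<^sub>E T"
      proof (rule image_subsetI)
        fix f assume "f \<in> {..<l} \<rightarrow>\<^sub>E Y"
        then show "tz f \<in> S \<rightarrow>\<^sub>E T" using tz by (intro PiE_I) (auto simp: tz_def)
      qed
      ultimately have "card ({..<l} \<rightarrow>\<^sub>E Y) \<le> card (S \<rightarrow>\<^sub>E T)"
        using S T(1) by (intro card_inj_on_le[of tz]) (auto intro: finite_PiE)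
      then have "card Y ^ l \<le> card T ^ card S" using S by (simp add: card_PiE)
      also have "\<dots> \<le> (q ^ n) ^ card S" using T(3) by (intro power_mono) auto
      also have "\<dots> = (q ^ card S) ^ l * q ^ ((a + b) * card S)"
        by (simp add: n_def power_add[symmetric] power_mult[symmetric] algebra_simps)
      finally show ?thesis .
    qed
    \<comment> \<open>The factor with exponent \<open>(a + b) * card S\<close> does not depend on
      \<open>l\<close> and disappears, so the bound becomes independent of \<open>Y\<close>.\<close>
    then show ?thesis by (rule geometric_bound) (use q(1) in simp)
  qed
  show ?thesis
  proof (intro exI[of _ "q ^ card S"] allI impI, elim conjE)
    fix Y assume Y: "finite Y" "Y \<subseteq> lin_span K S" "\<forall>y\<in>Y. absv y \<le> 1"
      "\<forall>y\<in>Y. \<forall>y'\<in>Y. absv (y - y') \<le> ?\<epsilon> \<longrightarrow> y = y'"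
    show "card Y \<le> q ^ card S"
      by (rule bd[OF Y(1,2)]) (rule Y(3)[rule_format], assumption, rule Y(4)[rule_format], assumption+)
  qed
qed

section \<open>The local field generated by the one-units of ideals\<close>

lemma K1_subfield: "is_subfield K1"
  unfolding K1_def by (rule is_subfield_hull)

lemmas K1_closed = subfield_closed[OF K1_subfield]

lemma K_subset_K1: "K \<subseteq> K1" and br_K1: "I \<in> fractional_ideals \<Longrightarrow> br I \<in> K1"
  unfolding K1_def by (auto intro: hull_inc)

lemma pistar_powi_split: "\<exists>c\<in>K. \<exists>i<d_inf. pistar powi n = c * pistar ^ i"
proof -
  define q i where "q = n div int d_inf" "i = nat (n mod int d_inf)"
  have "n = int d_inf * q + int i" using d_inf_pos by (simp add: q_i_def)
  then have "pistar powi n = (pistar ^ d_inf) powi q * pistar ^ i"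
    using pistar_nonzero by (simp only: power_int_add power_int_mult power_int_of_nat simp_thms)
  moreover have "(pistar ^ d_inf) powi q \<in> K" unfolding pistar by (intro K_closed unif_K)
  moreover have "i < d_inf" using d_inf_pos by (simp add: q_i_def nat_less_iff)
  ultimately show ?thesis by blast
qed

text \<open>\<open>br I\<close> is \<open>ideal_s1 I\<close> times a power of \<open>pistar\<close>,
  and up to factors from \<open>K\<close> only exponents below \<open>d_inf\<close> occur. The
  products of these powers with \<open>S\<close> span a field that contains all values of
  \<open>br\<close>.\<close>

lemma K1_span: "\<exists>S. finite S \<and> K1 \<subseteq> lin_span K S"
proof -
  obtain S D where SD: "spanning S D" using spanning_exists by blast
  note S = spanningD[OF SD]
  note KR = subfield_imp_subring[OF K_subfield]
  define S1 where "S1 = (\<lambda>(i, s). pistar ^ i * s) ` ({..<d_inf} \<times> S)"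
  have fin: "finite S1" using S(1) by (simp add: S1_def)
  note sp = lin_span_subspace[OF KR]
  have mem: "\<mu> * (pistar powi n * s) \<in> lin_span K S1" if "\<mu> \<in> K" "s \<in> S" for \<mu> n s
  proof -
    obtain c i where ci: "c \<in> K" "i < d_inf" "pistar powi n = c * pistar ^ i" using pistar_powi_split by blast
    have eq: "\<mu> * (pistar powi n * s) = (\<mu> * c) * (pistar ^ i * s)" unfolding ci(3) by (simp add: mult_ac)
    have "pistar ^ i * s \<in> lin_span K S1"
      using ci(2) that(2) by (intro lin_span_base[OF KR fin]) (auto simp: S1_def)
    moreover have "\<mu> * c \<in> K" using that(1) ci(1) by (rule K_closed(4))
    ultimately show ?thesis unfolding eq using subspace_scale[OF sp] by blast
  qed
  have kK: "\<mu> \<in> K" if "\<mu> \<in> k - {0}" for \<mu> using that k_subset_K by auto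
  obtain \<mu> s where "\<mu> \<in> k - {0}" "s \<in> S" "ideal_s1 A = \<mu> * s" using S(6)[OF A_frac] by blast
  then have one: "1 \<in> lin_span K S1" using mem[of \<mu> s 0] kK ideal_s1_A by simp
  have prod: "x * y \<in> lin_span K S1" if xy: "x \<in> S1" "y \<in> S1" for x y
  proof -
    obtain i s j s' where *: "x = pistar ^ i * s" "y = pistar ^ j * s'" "s \<in> S" "s' \<in> S" using xy by (auto simp: S1_def)
    obtain \<mu> s'' where mu: "\<mu> \<in> k - {0}" "s'' \<in> S" "s * s' = \<mu> * s''" using S(7)[OF *(3,4)] by blast
    have "x * y = pistar ^ (i + j) * (s * s')" using * by (simp add: power_add mult_ac)
    also have "\<dots> = \<mu> * (pistar powi (int (i + j)) * s'')" unfolding mu(3) power_int_of_nat by (simp add: mult_ac)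
    also have "\<dots> \<in> lin_span K S1" using mem kK mu by blast
    finally show ?thesis .
  qed
  have "is_subfield (lin_span K S1)" by (rule lin_span_subfield[OF K_subfield fin one prod])
  moreover have "K \<subseteq> lin_span K S1" using subspace_scale[OF sp _ one] by force
  moreover have "br I \<in> lin_span K S1" if I: "I \<in> fractional_ideals" for I
  proof -
    obtain \<mu> s where mu: "\<mu> \<in> k - {0}" "s \<in> S" "ideal_s1 I = \<mu> * s" using S(6)[OF I] by blast
    have "br I = pistar powi degk I * ideal_s1 I"
      using pistar_nonzero by (simp add: ideal_s1_def power_int_minus mult.assoc[symmetric])
    also have "\<dots> = \<mu> * (pistar powi degk I * s)" using mu(3) by (simp add: mult_ac)
    also have "\<dots> \<in> lin_span K S1" using mem kK mu by blast
    finally show ?thesis .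
  qed
  ultimately have "K1 \<subseteq> lin_span K S1" unfolding K1_def by (intro hull_minimal) auto
  then show ?thesis using fin by blast
qed

lemma K1_separated_bounded:
  "\<exists>Q. \<forall>Y. finite Y \<and> Y \<subseteq> K1 \<and> (\<forall>y\<in>Y. absv y \<le> 1) \<and>
    (\<forall>y\<in>Y. \<forall>y'\<in>Y. absv (y - y') \<le> absv unif \<longrightarrow> y = y') \<longrightarrow> card Y \<le> Q"
proof -
  obtain S where S: "finite S" "K1 \<subseteq> lin_span K S" using K1_span by blast
  obtain Q where Q: "\<forall>Y. finite Y \<and> Y \<subseteq> lin_span K S \<and> (\<forall>y\<in>Y. absv y \<le> 1) \<and>
    (\<forall>y\<in>Y. \<forall>y'\<in>Y. absv (y - y') \<le> absv unif \<longrightarrow> y = y') \<longrightarrow> card Y \<le> Q"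
    using span_separated_bounded[OF S(1)] by (elim exE)
  show ?thesis
  proof (intro exI[of _ Q] allI impI, elim conjE)
    fix Y assume Y: "finite Y" "Y \<subseteq> K1" "\<forall>y\<in>Y. absv y \<le> 1"
      "\<forall>y\<in>Y. \<forall>y'\<in>Y. absv (y - y') \<le> absv unif \<longrightarrow> y = y'"
    show "card Y \<le> Q" by (rule Q[rule_format], intro conjI Y subset_trans[OF Y(2) S(2)])
  qed
qed

text \<open>Elements with distinct absolute values above \<open>absv unif\<close> are at distance
  greater than \<open>absv unif\<close>, so only finitely many values lie strictly between
  \<open>absv unif\<close> and \<open>1\<close>. A uniformizer has the largest of them, or the value
  \<open>absv unif\<close> if there are none.\<close>

lemma K1_uniformizer:
  "\<exists>p\<in>K1. p \<noteq> 0 \<and> absv p < 1 \<and> (\<forall>y\<in>K1. absv y < 1 \<longrightarrow> absv y \<le> absv p)"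
proof -
  obtain Q where Q: "\<forall>Y. finite Y \<and> Y \<subseteq> K1 \<and> (\<forall>y\<in>Y. absv y \<le> 1) \<and>
    (\<forall>y\<in>Y. \<forall>y'\<in>Y. absv (y - y') \<le> absv unif \<longrightarrow> y = y') \<longrightarrow> card Y \<le> Q"
    using K1_separated_bounded by (elim exE)
  define X where "X = {absv y | y. y \<in> K1 \<and> absv unif < absv y \<and> absv y < 1}"
  have "finite X"
  proof (rule ccontr)
    assume "infinite X"
    then obtain Z where Z: "Z \<subseteq> X" "finite Z" "card Z = Suc Q" by (meson infinite_arbitrarily_large)
    have "\<forall>z\<in>Z. \<exists>y. y \<in> K1 \<and> absv unif < absv y \<and> absv y < 1 \<and> z = absv y" using Z(1) unfolding X_def by blast
    from bchoice[OF this] obtain g where g: "\<forall>z\<in>Z. g z \<in> K1 \<and> absv unif < absv (g z) \<and> absv (g z) < 1 \<and> z = absv (g z)" by (elim exE)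
    have gz: "absv (g z) = z" "absv unif < z" "z < 1" "g z \<in> K1" if "z \<in> Z" for z using bspec[OF g that] by simp_all
    have "inj_on g Z" using gz(1) by (metis inj_onI)
    have "card (g ` Z) \<le> Q"
    proof (rule Q[rule_format], intro conjI ballI impI)
      show "finite (g ` Z)" using Z(2) by simp
      show "g ` Z \<subseteq> K1" using gz(4) by blast
      show "absv y \<le> 1" if y: "y \<in> g ` Z" for y
      proof -
        obtain z where "z \<in> Z" "y = g z" using y by blast
        then show ?thesis using gz(1,3)[of z] by simp
      qed
      fix y y' assume "y \<in> g ` Z" "y' \<in> g ` Z" and le: "absv (y - y') \<le> absv unif"
      then obtain z z' where z: "z \<in> Z" "z' \<in> Z" "y = g z" "y' = g z'" by blast
      have "absv (- y') = absv y'" by (rule abs.N_uminus) simp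
      have "\<not> absv y' < absv y"
        using abs.N_add_lt[of y "- y'"] le gz(1,2)[OF z(1)] z(3) \<open>absv (- y') = absv y'\<close> by auto
      moreover have "\<not> absv y < absv y'"
        using abs.N_add_lt[of "- y'" y] le gz(1,2)[OF z(2)] z(4) \<open>absv (- y') = absv y'\<close> by auto
      ultimately have "z = z'" using gz(1)[OF z(1)] gz(1)[OF z(2)] z(3,4) by simp
      then show "y = y'" using z(3,4) by simp
    qed
    then show False using Z(3) \<open>inj_on g Z\<close> by (simp add: card_image)
  qed
  define M where "M = Max (insert (absv unif) X)"
  have "M \<in> insert (absv unif) X" unfolding M_def using \<open>finite X\<close> by (intro Max_in) auto
  then obtain p where p: "p \<in> K1" "absv p = M" "absv p < 1" "absv unif \<le> absv p"
    using abs_unif(2) unif_K K_subset_K1 by (auto simp: X_def)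
  have "absv y \<le> absv p" if y: "y \<in> K1" "absv y < 1" for y
  proof (cases "absv unif < absv y")
    case True
    then have "absv y \<in> X" using y by (auto simp: X_def)
    then show ?thesis using \<open>finite X\<close> unfolding p(2) M_def by (intro Max_ge) auto
  next
    case False
    then show ?thesis using p(4) by simp
  qed
  moreover have "p \<noteq> 0" using p(4) abs_unif(1) by auto
  ultimately show ?thesis using p by blast
qed

lemma K1_nonarch: "nonarch K1 absv"
  by unfold_locales (auto simp: K1_subfield abs_nonneg abs_eq_0 abs_mult abs_ultrametric)

lemma K1_unit_power: "\<exists>E>0. \<forall>u\<in>K1. absv u = 1 \<longrightarrow> absv (u ^ E - 1) < 1"
proof -
  interpret K1: nonarch K1 absv by (rule K1_nonarch)
  obtain Q where Q: "\<forall>Y. finite Y \<and> Y \<subseteq> K1 \<and> (\<forall>y\<in>Y. absv y \<le> 1) \<and>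
    (\<forall>y\<in>Y. \<forall>y'\<in>Y. absv (y - y') \<le> absv unif \<longrightarrow> y = y') \<longrightarrow> card Y \<le> Q"
    using K1_separated_bounded by (elim exE)
  have bd: "card Y \<le> Q" if Y: "finite Y" "Y \<subseteq> K1" "\<And>y. y \<in> Y \<Longrightarrow> absv y \<le> 1"
    "\<And>y y'. y \<in> Y \<Longrightarrow> y' \<in> Y \<Longrightarrow> absv (y - y') < 1 \<Longrightarrow> y = y'" for Y
  proof (rule Q[rule_format], intro conjI ballI impI)
    fix y y' assume "y \<in> Y" "y' \<in> Y" "absv (y - y') \<le> absv unif"
    then show "y = y'" using Y(4)[of y y'] abs_unif(2) by simp
  qed (use Y in auto)
  show ?thesis
  proof (intro exI[of _ "fact Q"] conjI ballI impI)
    show "absv (u ^ fact Q - 1) < 1" if "u \<in> K1" "absv u = 1" for u by (rule K1.unit_power_one[OF bd that])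
  qed simp
qed

text \<open>Division by a uniformizer \<open>p\<close> shows that the powers of the maximal ideal
  are balls, which turns the congruence at infinity into a condition on absolute values.\<close>

lemma ideal_power_M1:
  assumes p: "p \<in> K1" "p \<noteq> 0" "absv p < 1" "\<And>y. y \<in> K1 \<Longrightarrow> absv y < 1 \<Longrightarrow> absv y \<le> absv p"
  shows "ideal_power A1_inf M1_inf n = {x\<in>K1. absv x \<le> absv p ^ n}"
proof (induction n)
  case 0
  show ?case by (simp add: A1_inf_def)
next
  case (Suc n)
  have p0: "0 < absv p" using p(2) abs_nonneg[of p] abs_eq_0[of p] by linarith
  show ?case
  proof (intro equalityI subsetI)
    have "ideal_mult M1_inf {x\<in>K1. absv x \<le> absv p ^ n} \<subseteq> {x\<in>K1. absv x \<le> absv p ^ Suc n}"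
    proof (rule ideal_mult_subset)
      fix x y assume "x \<in> M1_inf" "y \<in> {x\<in>K1. absv x \<le> absv p ^ n}"
      then have "x \<in> K1" "absv x \<le> absv p" "y \<in> K1" "absv y \<le> absv p ^ n" using p(4) by (auto simp: M1_inf_def)
      then show "x * y \<in> {x\<in>K1. absv x \<le> absv p ^ Suc n}"
        using K1_closed(4) abs_nonneg by (auto simp: abs_mult intro!: mult_mono)
    next
      fix x y assume "x \<in> {x\<in>K1. absv x \<le> absv p ^ Suc n}" "y \<in> {x\<in>K1. absv x \<le> absv p ^ Suc n}"
      then show "x + y \<in> {x\<in>K1. absv x \<le> absv p ^ Suc n}"
        using K1_closed(6)[of x y] abs.N_add[of x y] by auto
    qed (use K1_closed(1) p0 in auto)
    then show "x \<in> {x\<in>K1. absv x \<le> absv p ^ Suc n}" if "x \<in> ideal_power A1_inf M1_inf (Suc n)" for x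
      using that Suc by auto
  next
    fix x assume x: "x \<in> {x\<in>K1. absv x \<le> absv p ^ Suc n}"
    have "absv (x / p) \<le> absv p ^ n" using x p0 by (simp add: abs.N_divide divide_le_eq mult.commute)
    moreover have "x / p \<in> K1" using x p(1) K1_closed(11) by auto
    moreover have "p \<in> M1_inf" using p by (simp add: M1_inf_def)
    ultimately have "p * (x / p) \<in> ideal_mult M1_inf (ideal_power A1_inf M1_inf n)"
      unfolding Suc by (intro ideal_multI) auto
    then show "x \<in> ideal_power A1_inf M1_inf (Suc n)" using p(2) by simp
  qed
qed

section \<open>Restriction to congruence classes\<close>

lemma vanishing_cong:
  assumes "\<And>I. I \<in> ideals \<Longrightarrow> b I = b' I" shows "vanishing b \<longleftrightarrow> vanishing b'"
proof -
  have "dsum b j d = dsum b' j d" for j d unfolding dsum_def using assms by (intro sum.cong) auto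
  then show ?thesis by (simp add: vanishing_def)
qed

lemma decaying_restrict:
  assumes "decaying b" shows "decaying (\<lambda>I. if P I then b I else 0)"
proof -
  have le: "absv ((if P I then b I else 0) * x) \<le> absv (b I * x)" for I x using abs_nonneg by simp
  obtain t where t: "t > 0" "\<And>s \<epsilon>. s \<in> S_inf \<Longrightarrow> t \<le> absv (fst s) \<Longrightarrow> 0 < \<epsilon> \<Longrightarrow>
    \<exists>N. \<forall>I\<in>ideals. N \<le> degk I \<longrightarrow> absv (b I * ideal_exp I (S_neg s)) < \<epsilon>"
    using assms unfolding decaying_def by blast
  show ?thesis unfolding decaying_def
  proof (intro exI[of _ t] conjI ballI allI impI t(1))
    fix s and \<epsilon> :: real assume "s \<in> S_inf" "t \<le> absv (fst s)" "0 < \<epsilon>"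
    then obtain N where N: "\<forall>I\<in>ideals. N \<le> degk I \<longrightarrow> absv (b I * ideal_exp I (S_neg s)) < \<epsilon>" using t(2) by blast
    show "\<exists>N. \<forall>I\<in>ideals. N \<le> degk I \<longrightarrow> absv ((if P I then b I else 0) * ideal_exp I (S_neg s)) < \<epsilon>"
      using N le order_le_less_trans by blast
  qed
qed

text \<open>Congruences modulo increasing powers are imposed one step at a time.\<close>

lemma vanishing_filtration:
  assumes van: "vanishing b" and P0: "\<And>I. I \<in> ideals \<Longrightarrow> P 0 I"
    and mono: "\<And>i I. I \<in> ideals \<Longrightarrow> P (Suc i) I \<Longrightarrow> P i I"
    and step: "\<And>i. vanishing (\<lambda>I. if P i I then b I else 0) \<Longrightarrow>
      vanishing (\<lambda>I. if P (Suc i) I then (if P i I then b I else 0) else 0)"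
  shows "vanishing (\<lambda>I. if P n I then b I else 0)"
proof (induction n)
  case 0
  show ?case using van P0 vanishing_cong[of b "\<lambda>I. if P 0 I then b I else 0"] by simp
next
  case (Suc n)
  show ?case
    using step[OF Suc] mono vanishing_cong[of "\<lambda>I. if P (Suc n) I then (if P n I then b I else 0) else 0"
        "\<lambda>I. if P (Suc n) I then b I else 0"] by auto
qed

text \<open>Here \<open>N\<close> is \<open>absv\<close> itself, and the restriction step is applied
  to \<open>br I - \<alpha>\<close> divided by \<open>p ^ i\<close>: the next congruence holds
  exactly when this quotient lies in the maximal ideal.\<close>

lemma vanishing_canonical:
  assumes \<alpha>: "\<alpha> \<in> A1_inf" and bA: "\<And>I. I \<in> ideals \<Longrightarrow> b I \<in> A" and dec: "decaying b" and van: "vanishing b"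
  shows "vanishing (\<lambda>I. if br I - \<alpha> \<in> ideal_power A1_inf M1_inf n then b I else 0)"
proof -
  obtain p where p: "p \<in> K1" "p \<noteq> 0" "absv p < 1" "\<And>y. y \<in> K1 \<Longrightarrow> absv y < 1 \<Longrightarrow> absv y \<le> absv p"
    using K1_uniformizer by blast
  obtain E where E: "0 < E" "\<And>u. u \<in> K1 \<Longrightarrow> absv u = 1 \<Longrightarrow> absv (u ^ E - 1) < 1" using K1_unit_power by blast
  have p0: "0 < absv p" using p(2) abs_nonneg[of p] abs_eq_0[of p] by linarith
  have \<alpha>': "\<alpha> \<in> K1" "absv \<alpha> \<le> 1" using \<alpha> by (auto simp: A1_inf_def)
  have bk: "br I - \<alpha> \<in> K1" if "I \<in> ideals" for I using br_K1[OF ideals_fractional[OF that]] \<alpha>'(1) by (rule K1_closed(3))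
  define P where "P i I \<longleftrightarrow> absv (br I - \<alpha>) \<le> absv p ^ i" for i I
  have "vanishing (\<lambda>I. if P n I then b I else 0)"
  proof (rule vanishing_filtration[OF van])
    show "P 0 I" if I: "I \<in> ideals" for I
      using abs.N_diff[of "br I" \<alpha>] abs_br[OF ideals_fractional[OF I]] \<alpha>'(2) by (simp add: P_def)
    show "P i I" if "P (Suc i) I" for i I
      using that order_trans[OF _ power_decreasing[of i "Suc i" "absv p"]] less_imp_le[OF p(3)] less_imp_le[OF p0]
      unfolding P_def by (meson le_add2 plus_1_eq_Suc lessI less_imp_le)
    fix i assume van_i: "vanishing (\<lambda>I. if P i I then b I else 0)"
    define y where "y I = (br I - \<alpha>) / p ^ i" for I
    have yP: "P (Suc i) I \<longleftrightarrow> absv (y I) < 1" if I: "I \<in> ideals" for I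
    proof -
      have yK: "y I \<in> K1" unfolding y_def using bk[OF I] p(1) K1_closed(9,11) by blast
      have "absv (y I) < 1 \<longleftrightarrow> absv (y I) \<le> absv p" using p(3,4) yK by force
      also have "\<dots> \<longleftrightarrow> P (Suc i) I" using p0 by (simp add: y_def P_def abs.N_divide abs.N_power divide_le_eq mult.commute)
      finally show ?thesis by simp
    qed
    have "vanishing (\<lambda>I. if absv (y I) < 1 then (if P i I then b I else 0) else 0)"
    proof (rule vanishing_restrict[where L = UNIV and E = E and \<rho> = "absv p"])
      show "nonarch UNIV absv" by (rule abs.nonarch_axioms)
      show "1 \<le> absv c * absv c" if "c \<in> A" "c \<noteq> 0" for c using abs_A_ge_1[OF that] by (metis mult_ge1_I)
      show "y I = pistar ^ d / p ^ i * ideal_s1 I + (- \<alpha> / p ^ i)" if "I \<in> ideals" "degk I = int d" for I d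
        using that(2) pistar_nonzero p(2) by (simp add: y_def ideal_s1_def power_int_minus field_simps)
      show "y I \<in> UNIV \<and> absv (y I) \<le> 1 \<and> (absv (y I) < 1 \<longrightarrow> absv (y I) \<le> absv p) \<and>
          (absv (y I) = 1 \<longrightarrow> absv (y I ^ E - 1) \<le> absv p)"
        if I: "I \<in> ideals" "(if P i I then b I else 0) \<noteq> 0" for I
      proof -
        have Pi: "P i I" using I(2) by (cases "P i I") auto
        have yK: "y I \<in> K1" unfolding y_def using bk[OF I(1)] p(1) K1_closed(9,11) by blast
        have "absv (y I) \<le> 1" using Pi p0 by (simp add: y_def P_def abs.N_divide abs.N_power divide_le_eq)
        moreover have "y I ^ E - 1 \<in> K1" using yK by (intro K1_closed)
        ultimately show ?thesis using p(4)[OF yK] p(4)[of "y I ^ E - 1"] E(2)[OF yK] by auto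
      qed
      show "(if P i I then b I else 0) \<in> A" if "I \<in> ideals" for I using bA[OF that] A_closed(1) by simp
    qed (use E p p0 dec van_i decaying_restrict in auto)
    then show "vanishing (\<lambda>I. if P (Suc i) I then (if P i I then b I else 0) else 0)"
      using yP vanishing_cong[of "\<lambda>I. if absv (y I) < 1 then (if P i I then b I else 0) else 0"
        "\<lambda>I. if P (Suc i) I then (if P i I then b I else 0) else 0"] by auto
  qed
  then show ?thesis
    using vanishing_cong[of "\<lambda>I. if P n I then b I else 0" "\<lambda>I. if br I - \<alpha> \<in> ideal_power A1_inf M1_inf n then b I else 0"]
      bk by (auto simp: ideal_power_M1[OF p] P_def)
qed

section \<open>Finite places\<close>

text \<open>Over the rational functions in \<open>t\<close> the field \<open>\<V>\<close> is
  contained in the span of the products of a spanning set of \<open>k\<close> with \<open>S\<close>,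
  so \<open>x_indep_bounded\<close> applies.\<close>

lemma V_x_indep_bounded:
  assumes x: "x \<in> \<V>" shows "\<exists>N. \<forall>Y. finite Y \<and> Y \<subseteq> \<V> \<and> x_indep Fr x Y \<longrightarrow> card Y \<le> N"
proof -
  obtain S D where SD: "spanning S D" using spanning_exists by blast
  note S = spanningD[OF SD]
  have VS: "\<V> \<subseteq> lin_span k S" by (rule V_subset_span[OF S(1,6,7)])
  obtain t B where B: "finite B" "B \<subseteq> k" "k \<subseteq> lin_span (ratfuns Fr t) B" by (rule k_span)
  note RR = subfield_imp_subring[OF ratfuns_subfield[OF F_subring, of t]]
  define B' where "B' = (\<lambda>(b, s). b * s) ` (B \<times> S)"
  have B': "finite B'" using B(1) S(1) by (simp add: B'_def)
  note sp = lin_span_subspace[OF RR, of B']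
  have sub: "lin_span k S \<subseteq> lin_span (ratfuns Fr t) B'"
  proof
    fix u assume "u \<in> lin_span k S"
    then obtain c where c: "\<forall>s\<in>S. c s \<in> k" "u = (\<Sum>s\<in>S. c s * s)" by (rule lin_spanE)
    have "c s * s \<in> lin_span (ratfuns Fr t) B'" if s: "s \<in> S" for s
    proof -
      have "c s \<in> lin_span (ratfuns Fr t) B" using c(1) s B(3) by blast
      then obtain q where q: "\<forall>b\<in>B. q b \<in> ratfuns Fr t" "c s = (\<Sum>b\<in>B. q b * b)" by (rule lin_spanE)
      have "c s * s = (\<Sum>b\<in>B. q b * (b * s))" unfolding q(2) by (simp add: sum_distrib_right mult.assoc)
      also have "\<dots> \<in> lin_span (ratfuns Fr t) B'"
      proof (rule subspace_sum[OF sp])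
        fix b assume b: "b \<in> B"
        have "b * s \<in> lin_span (ratfuns Fr t) B'" using b s by (intro lin_span_base[OF RR B']) (auto simp: B'_def)
        then show "q b * (b * s) \<in> lin_span (ratfuns Fr t) B'" by (rule subspace_scale[OF sp bspec[OF q(1) b]])
      qed
      finally show ?thesis .
    qed
    then show "u \<in> lin_span (ratfuns Fr t) B'" unfolding c(2) by (intro subspace_sum[OF sp])
  qed
  note spk = lin_span_subspace[OF k_subring, of S]
  have xs: "x * s \<in> lin_span k S" if s: "s \<in> S" for s
  proof -
    have "s * s' \<in> lin_span k S" if "s' \<in> S" for s'
    proof -
      obtain \<mu> s'' where "\<mu> \<in> k - {0}" "s'' \<in> S" "s * s' = \<mu> * s''" using S(7)[OF s \<open>s' \<in> S\<close>] by blast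
      then show ?thesis using subspace_scale[OF spk, of \<mu> s''] lin_span_base[OF k_subring S(1), of s''] by simp
    qed
    from lin_span_mult_closed[OF k_subring this subsetD[OF VS x]] have "s * x \<in> lin_span k S" .
    then show ?thesis by (simp add: mult.commute)
  qed
  have xB: "x * b \<in> lin_span (ratfuns Fr t) B'" if b': "b \<in> B'" for b
  proof -
    obtain b1 s where b: "b = b1 * s" "b1 \<in> B" "s \<in> S" using b' by (auto simp: B'_def)
    have "b1 * (x * s) \<in> lin_span k S" using subspace_scale[OF spk _ xs[OF b(3)]] b(2) B(2) by blast
    then have "b1 * (x * s) \<in> lin_span (ratfuns Fr t) B'" using sub by blast
    then show ?thesis using b(1) by (simp add: mult_ac)
  qed
  have "\<exists>N. \<forall>Y. finite Y \<and> Y \<subseteq> lin_span (ratfuns Fr t) B' \<and> x_indep Fr x Y \<longrightarrow> card Y \<le> N"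
    by (rule x_indep_bounded[OF F_subfield F_finite B' xB])
  then obtain N where
    N: "\<forall>Y. finite Y \<and> Y \<subseteq> lin_span (ratfuns Fr t) B' \<and> x_indep Fr x Y \<longrightarrow> card Y \<le> N" by (elim exE)
  show ?thesis
  proof (intro exI[of _ N] allI impI, elim conjE)
    fix Y assume Y: "finite Y" "Y \<subseteq> \<V>" "x_indep Fr x Y"
    show "card Y \<le> N" by (rule N[rule_format], intro conjI Y subset_trans[OF Y(2) subset_trans[OF VS sub]])
  qed
qed

text \<open>The integer \<open>e\<close> is the ramification index. Elements of value
  \<open>0\<close> at \<open>v\<close> have value \<open>0\<close> at \<open>w\<close>, so
  \<open>w\<close> is determined on \<open>k\<close> by its value at a uniformizer of
  \<open>v\<close>.\<close>

lemma finite_place_ramification: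
  assumes w: "w \<in> places \<V>" and v: "v \<in> places k" "local_ring \<V> w \<inter> k = local_ring k v"
  shows "\<exists>e>0. \<forall>x\<in>k. x \<noteq> 0 \<longrightarrow> w x = int e * v x"
proof -
  interpret w: place \<V> w using V_subfield w by unfold_locales
  interpret v: place k v by (rule placeI[OF v(1)])
  have le: "0 \<le> w x \<longleftrightarrow> 0 \<le> v x" if "x \<in> k" "x \<noteq> 0" for x
    using v(2) that k_subset_V unfolding local_ring_def by blast
  have zero: "w x = 0" if x: "x \<in> k" "x \<noteq> 0" "v x = 0" for x
  proof -
    have xV: "x \<in> \<V>" using x k_subset_V by auto
    have "0 \<le> w x" using le x by simp
    moreover have "0 \<le> w (inverse x)" using le[of "inverse x"] x v.v_inverse[OF x(1,2)] k_closed(10) by simp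
    ultimately show ?thesis using w.v_inverse[OF xV x(2)] by simp
  qed
  obtain t where t: "t \<in> k" "t \<noteq> 0" "v t = 1" by (rule v.uniformizer)
  have tV: "t \<in> \<V>" using t k_subset_V by auto
  have "\<not> 0 \<le> w (inverse t)" using le[of "inverse t"] t v.v_inverse[OF t(1,2)] k_closed(10) by simp
  then have pos: "0 < w t" using w.v_inverse[OF tV t(2)] by simp
  have "w x = w t * v x" if x: "x \<in> k" "x \<noteq> 0" for x
  proof -
    have tp: "t powi v x \<in> k" "t powi v x \<noteq> 0" using t k_closed(12) by auto
    have "v (x / t powi v x) = 0" using v.v_divide[OF x(1) tp(1) x(2) tp(2)] v.v_powi[OF t(1,2)] t(3) by simp
    moreover have "x / t powi v x \<in> k" using x tp k_closed(11) by auto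
    ultimately have "w (x / t powi v x) = 0" using zero x tp by simp
    moreover have "w (x / t powi v x) = w x - w (t powi v x)"
      using x tp k_subset_V by (intro w.v_divide) auto
    ultimately show ?thesis using w.v_powi[OF tV t(2)] by simp
  qed
  then show ?thesis using pos by (intro exI[of _ "nat (w t)"]) auto
qed

lemma vanishing_finite_place:
  assumes w: "finite_place w" and \<alpha>: "\<alpha> \<in> local_ring \<V> w"
    and bA: "\<And>I. I \<in> ideals \<Longrightarrow> b I \<in> A" and dec: "decaying b" and van: "vanishing b"
  shows "vanishing (\<lambda>I. if ideal_s1 I - \<alpha> \<in> place_power \<V> w n then b I else 0)"
proof -
  obtain v where wv: "w \<in> places \<V>" "v \<in> places k - {vinf}" "local_ring \<V> w \<inter> k = local_ring k v"
    using w unfolding finite_place_def by blast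
  interpret w: place \<V> w using V_subfield wv(1) by unfold_locales
  interpret v: place k v using wv(2) by (intro placeI) auto
  obtain e where e: "0 < e" "\<And>x. x \<in> k \<Longrightarrow> x \<noteq> 0 \<Longrightarrow> w x = int e * v x"
    using finite_place_ramification[of w v] wv by auto
  define r where "r = real (card Fr)"
  have r: "1 < r" using r_gt_1 by (simp add: r_def)
  \<comment> \<open>Division by \<open>e\<close> makes \<open>N\<close> equal to
    \<open>r powr (- v x)\<close> on nonzero elements of \<open>k\<close>, on the same scale as
    \<open>absv\<close>, so that the two can be compared through the product formula.\<close>
  define N where "N x = (if x = 0 then 0 else r powr (- real_of_int (w x) / real e))" for x
  have N_iff: "N x \<le> N y \<longleftrightarrow> w y \<le> w x" if "x \<noteq> 0" "y \<noteq> 0" for x y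
    using that r e(1) by (simp add: N_def divide_le_cancel)
  have N0: "N x = 0 \<longleftrightarrow> x = 0" for x using r by (simp add: N_def)
  have Nn: "0 \<le> N x" for x by (simp add: N_def)
  have non: "nonarch \<V> N"
  proof
    show "N (x * y) = N x * N y" if "x \<in> \<V>" "y \<in> \<V>" for x y
    proof (cases "x = 0 \<or> y = 0")
      case False
      then have "- real_of_int (w (x * y)) / real e = - real_of_int (w x) / real e + - real_of_int (w y) / real e"
        using that w.v_mult[of x y] by (simp add: add_divide_distrib diff_divide_distrib)
      moreover have "x \<noteq> 0" "y \<noteq> 0" "x * y \<noteq> 0" using False by auto
      ultimately show ?thesis unfolding N_def by (simp only: powr_add if_False)
    qed (auto simp: N_def)
    show "N (x + y) \<le> max (N x) (N y)" if xy: "x \<in> \<V>" "y \<in> \<V>" for x y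
    proof (cases "x = 0 \<or> y = 0 \<or> x + y = 0")
      case False
      then have "min (w x) (w y) \<le> w (x + y)" using xy by (intro w.v_add) auto
      then show ?thesis using False N_iff[of "x + y" x] N_iff[of "x + y" y] by (auto simp: min_def le_max_iff_disj split: if_splits)
    next
      case True
      have "N 0 = 0" by (simp add: N0)
      then show ?thesis using True Nn[of x] Nn[of y] by (auto simp: max_def)
    qed
  qed (use V_subfield Nn N0 in auto)
  interpret N: nonarch \<V> N by (rule non)
  have N_le_1: "N x \<le> 1 \<longleftrightarrow> x \<in> val_ge \<V> w 0" if "x \<in> \<V>" for x
    using N_iff[of x 1] that N.N_1 by (cases "x = 0") (auto simp: val_ge_def N0[of 0])
  \<comment> \<open>The value of \<open>N\<close> at a uniformizer of \<open>w\<close>, hence the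
    largest value below \<open>1\<close>.\<close>
  define \<rho> where "\<rho> = r powr (- 1 / real e)"
  have \<rho>: "0 < \<rho>" "\<rho> < 1" using r e(1) powr_less_mono[of "- 1 / real e" 0 r] by (auto simp: \<rho>_def)
  obtain p where p: "p \<in> \<V>" "p \<noteq> 0" "w p = 1" by (rule w.uniformizer)
  have Np: "N p = \<rho>" using p by (simp add: N_def \<rho>_def)
  have N_lt_1: "N x < 1 \<longleftrightarrow> x \<in> val_ge \<V> w 1" "N x < 1 \<Longrightarrow> N x \<le> \<rho>" if "x \<in> \<V>" for x
  proof -
    show 1: "N x < 1 \<longleftrightarrow> x \<in> val_ge \<V> w 1"
      using N_iff[of 1 x] that N.N_1 by (cases "x = 0") (auto simp: val_ge_def not_le[symmetric] N0[of 0])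
    show "N x \<le> \<rho>" if "N x < 1"
      using 1 that N_iff[of x p] p Np \<rho>(1) by (cases "x = 0") (auto simp: val_ge_def N0[of 0])
  qed
  \<comment> \<open>Finiteness of the residue field at \<open>w\<close>, which yields the uniform
    exponent \<open>E\<close>.\<close>
  have "\<exists>C. \<forall>Y. finite Y \<and> Y \<subseteq> val_ge \<V> w 0 \<and> incong (val_ge \<V> w 1) Y \<longrightarrow> card Y \<le> C"
  proof -
    obtain M where M: "\<forall>Y. finite Y \<and> Y \<subseteq> \<V> \<and> x_indep Fr p Y \<longrightarrow> card Y \<le> M" using V_x_indep_bounded[OF p(1)] by blast
    have FV: "Fr \<subseteq> \<V>" using F_subset k_subset_V by auto
    have "card Y \<le> card Fr ^ M" if Y: "finite Y" "Y \<subseteq> val_ge \<V> w 0" "incong (val_ge \<V> w 1) Y" for Y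
    proof (rule incong_multiples_bounded[OF F_subfield F_finite w.val_ge_subring _ _ p(2) _ Y(1,2)])
      show "Fr \<subseteq> val_ge \<V> w 0" using w.finite_field_val_ge[OF F_subfield F_finite FV] by blast
      show "p \<in> val_ge \<V> w 0" using p by (simp add: val_ge_def)
      show "incong ((*) p ` val_ge \<V> w 0) Y" using Y(3) w.val_ge_multiples[OF p(1,2), of 0] p(3) by simp
      show "card Y' \<le> M" if "finite Y'" "Y' \<subseteq> val_ge \<V> w 0" "x_indep Fr p Y'" for Y'
        using M that w.val_ge_subset[of 0] by blast
    qed
    then show ?thesis by blast
  qed
  then obtain C where C: "\<And>Y. finite Y \<Longrightarrow> Y \<subseteq> val_ge \<V> w 0 \<Longrightarrow> incong (val_ge \<V> w 1) Y \<Longrightarrow> card Y \<le> C" by blast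
  have bd: "card Y \<le> C" if Y: "finite Y" "Y \<subseteq> \<V>" "\<And>y. y \<in> Y \<Longrightarrow> N y \<le> 1"
    "\<And>y y'. y \<in> Y \<Longrightarrow> y' \<in> Y \<Longrightarrow> N (y - y') < 1 \<Longrightarrow> y = y'" for Y
  proof (rule C[OF Y(1)])
    show "Y \<subseteq> val_ge \<V> w 0" using N_le_1 Y(2,3) by blast
    show "incong (val_ge \<V> w 1) Y" unfolding incong_def
    proof (intro ballI impI)
      fix y y' assume yy: "y \<in> Y" "y' \<in> Y" "y - y' \<in> val_ge \<V> w 1"
      then have "y - y' \<in> \<V>" using Y(2) V_closed(3) by blast
      then show "y = y'" using N_lt_1(1) Y(4) yy by blast
    qed
  qed
  define E where "E = (fact C :: nat)"
  have E: "N (u ^ E - 1) < 1" if "u \<in> \<V>" "N u = 1" for u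
    unfolding E_def by (rule N.unit_power_one[OF bd that])
  \<comment> \<open>All finite places contribute nonnegatively to the product formula for
    \<open>c\<close>. Keeping only \<open>v\<close> among them gives
    \<open>v c * deg v \<le> - (d_inf * vinf c)\<close>, and \<open>deg v\<close> is at least
    \<open>1\<close>.\<close>
  have lower: "1 \<le> N c * absv c" if c: "c \<in> A" "c \<noteq> 0" for c
  proof -
    have ck: "c \<in> k" using c A_subset by auto
    let ?Z = "insert v (insert vinf {u\<in>places k. u c \<noteq> 0})"
    have Z: "finite ?Z" "?Z \<subseteq> places k" using finite_support[OF ck c(2)] wv(2) vinf_place by auto
    have "(\<Sum>u\<in>?Z. u c * int (deg u)) = 0" by (rule product_formula[OF ck c(2) Z]) auto
    moreover have "(\<Sum>u\<in>{v, vinf}. u c * int (deg u)) \<le> (\<Sum>u\<in>?Z. u c * int (deg u))"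
    proof (rule sum_mono2[OF Z(1)])
      fix u assume u: "u \<in> ?Z - {v, vinf}"
      then have "c \<in> val_ge k u 0" using c(1) Z(2) by (auto simp: A_def')
      then show "0 \<le> u c * int (deg u)" using c(2) by (auto simp: val_ge_def)
    qed auto
    ultimately have "v c * int (deg v) + vinf c * int d_inf \<le> 0" using wv(2) by (simp add: d_inf_eq)
    moreover have "0 \<le> v c" using c wv(2) by (auto simp: A_def' val_ge_def)
    then have "v c * 1 \<le> v c * int (deg v)" using deg_pos[of v] wv(2) by (intro mult_left_mono) auto
    ultimately have le: "v c \<le> - (int d_inf * vinf c)" by (simp add: mult.commute)
    have "- real_of_int (w c) / real e = - real_of_int (v c)" using e(1) e(2)[OF ck c(2)] by simp
    then have "N c = r powr (- real_of_int (v c))" using c(2) by (simp add: N_def)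
    moreover have "absv c = r powr real_of_int (- (int d_inf * vinf c))"
      using abs_k[of c] ck c(2) r powr_real_of_int'[of r "- (int d_inf * vinf c)"] by (simp add: r_def)
    ultimately have "N c * absv c = r powr (real_of_int (- (int d_inf * vinf c)) - real_of_int (v c))"
      by (simp only: powr_add[symmetric] diff_conv_add_uminus add.commute)
    moreover have "0 \<le> real_of_int (- (int d_inf * vinf c)) - real_of_int (v c)" using le by linarith
    ultimately show ?thesis using r by (simp only: ge_one_powr_ge_zero less_imp_le)
  qed
  have upper: "N c \<le> 1" if c: "c \<in> A" for c
  proof -
    have cV: "c \<in> \<V>" using c A_subset k_subset_V by auto
    have "c \<in> local_ring k v" using c wv(2) by (auto simp: A_def)
    then have "c \<in> local_ring \<V> w" using wv(3) by blast
    then show ?thesis using N_le_1[OF cV] by (simp add: local_ring_eq)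
  qed
  have sV: "ideal_s1 I \<in> \<V>" if "I \<in> ideals" for I by (rule ideal_s1_V[OF ideals_fractional[OF that]])
  \<comment> \<open>A power of \<open>ideal_s1 I\<close> lies in \<open>A\<close>, whose elements
    are integral at \<open>w\<close>.\<close>
  have s1: "N (ideal_s1 I) \<le> 1" if I: "I \<in> ideals" for I
  proof -
    obtain m where m: "0 < m" "ideal_s1 I ^ m \<in> A" using ideal_s1_power_in_A[OF I] by blast
    have "N (ideal_s1 I) ^ m \<le> 1 ^ m" using upper[OF m(2)] N.N_power[OF sV[OF I], of m] by simp
    then show ?thesis using m(1) Nn by (subst (asm) power_mono_iff) auto
  qed
  have \<alpha>': "\<alpha> \<in> \<V>" "\<alpha> \<in> val_ge \<V> w 0" using \<alpha> by (auto simp: local_ring_eq val_ge_def)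
  define P where "P i I \<longleftrightarrow> ideal_s1 I - \<alpha> \<in> place_power \<V> w i" for i I
  have "vanishing (\<lambda>I. if P n I then b I else 0)"
  proof (rule vanishing_filtration[OF van])
    show "P 0 I" if I: "I \<in> ideals" for I
      using N_le_1[OF sV[OF I]] s1[OF I] \<alpha>'(2) w.val_ge_diff by (simp add: P_def place_power_eq)
    show "P i I" if "P (Suc i) I" for i I
      using that w.val_ge_mono[of "int i" "int (Suc i)"] by (auto simp: P_def place_power_eq)
    fix i assume van_i: "vanishing (\<lambda>I. if P i I then b I else 0)"
    define y where "y I = (ideal_s1 I - \<alpha>) / p ^ i" for I
    have pi: "p ^ i \<in> \<V>" "p ^ i \<noteq> 0" "w (p ^ i) = int i" using p V_closed(9) w.v_power[OF p(1,2), of i] by auto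
    have yV: "y I \<in> \<V>" if "I \<in> ideals" for I unfolding y_def using sV[OF that] \<alpha>'(1) pi(1) V_closed(3,11) by blast
    have yge: "y I \<in> val_ge \<V> w m \<longleftrightarrow> ideal_s1 I - \<alpha> \<in> val_ge \<V> w (int i + m)" for I m
    proof -
      have "p ^ i * y I = ideal_s1 I - \<alpha>" using pi(2) by (simp add: y_def)
      then show ?thesis using w.val_ge_multiple[OF pi(1,2), of "y I" m] pi(3) by simp
    qed
    have yP: "P (Suc i) I \<longleftrightarrow> N (y I) < 1" if I: "I \<in> ideals" for I
      using N_lt_1(1)[OF yV[OF I]] yge[of I 1] by (simp add: P_def place_power_eq add.commute)
    have "vanishing (\<lambda>I. if N (y I) < 1 then (if P i I then b I else 0) else 0)"
    proof (rule vanishing_restrict[OF non order_refl lower, where E = E and \<rho> = \<rho>])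
      show "N c \<le> max 1 (absv c)" if "c \<in> A" for c using upper[OF that] by simp
      show "N (ideal_s1 I) \<le> max 1 (absv (ideal_s1 I))" if "I \<in> ideals" for I using s1[OF that] by simp
      show "y I = inverse (p ^ i) * ideal_s1 I + (- \<alpha> / p ^ i)" for I
        using p(2) by (simp add: y_def field_simps)
      show "y I \<in> \<V> \<and> N (y I) \<le> 1 \<and> (N (y I) < 1 \<longrightarrow> N (y I) \<le> \<rho>) \<and> (N (y I) = 1 \<longrightarrow> N (y I ^ E - 1) \<le> \<rho>)"
        if I: "I \<in> ideals" "(if P i I then b I else 0) \<noteq> 0" for I
      proof -
        have Pi: "P i I" using I(2) by (cases "P i I") auto
        then have "N (y I) \<le> 1" using N_le_1[OF yV[OF I(1)]] yge[of I 0] by (simp add: P_def place_power_eq)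
        moreover have "y I ^ E - 1 \<in> \<V>" using yV[OF I(1)] by (intro V_closed)
        ultimately show ?thesis using yV[OF I(1)] N_lt_1(2)[OF yV[OF I(1)]] N_lt_1(2)[of "y I ^ E - 1"] E[OF yV[OF I(1)]] by auto
      qed
      show "(if P i I then b I else 0) \<in> A" if "I \<in> ideals" for I using bA[OF that] A_closed(1) by simp
      show "0 < E" by (simp add: E_def)
    qed (use \<rho> dec van_i decaying_restrict in auto)
    then show "vanishing (\<lambda>I. if P (Suc i) I then (if P i I then b I else 0) else 0)"
      using yP vanishing_cong[of "\<lambda>I. if N (y I) < 1 then (if P i I then b I else 0) else 0"
        "\<lambda>I. if P (Suc i) I then (if P i I then b I else 0) else 0"] by auto
  qed
  then show ?thesis by (simp add: P_def)
qed

text \<open>In \<open>motivic_iff\<close> the conditions on coefficients and on decay pass to every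
  restriction, so only \<open>vanishing\<close> has to be preserved at each place. The restricted
  series is motivic again, which allows the next place to be imposed on it.\<close>

theorem motivic_partial_series:
  assumes W: "finite W" "\<And>w. w \<in> W \<Longrightarrow> finite_place w \<or> canonical_place w"
    and \<alpha>: "\<And>w. w \<in> W \<Longrightarrow> \<alpha> w \<in> local_ring_at w" and b: "motivic b"
  shows "motivic (partial_series W n \<alpha> b)"
  using W \<alpha>
proof (induction W rule: finite_induct)
  case empty
  have "partial_series {} n \<alpha> b = b" by (auto simp: partial_series_def ideal_cong_def)
  then show ?case using b by simp
next
  case (insert w W)
  define b' where "b' = partial_series W n \<alpha> b"
  have "motivic b'" unfolding b'_def using insert by blast
  then have b': "\<And>I. I \<in> ideals \<Longrightarrow> b' I \<in> A" "decaying b'" "vanishing b'" by (auto simp: motivic_iff)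
  define P where "P I \<longleftrightarrow> (if canonical_place w then br I - \<alpha> w \<in> ideal_power A1_inf M1_inf (n w)
     else ideal_s1 I - \<alpha> w \<in> place_power \<V> w (n w))" for I
  have eq: "partial_series (insert w W) n \<alpha> b = (\<lambda>I. if P I then b' I else 0)"
    by (rule ext) (simp add: partial_series_def ideal_cong_def b'_def P_def)
  have "vanishing (\<lambda>I. if P I then b' I else 0)"
  proof (cases "canonical_place w")
    case True
    have "\<alpha> w \<in> A1_inf" using insert.prems(2)[of w] True by (simp add: local_ring_at_def)
    from vanishing_canonical[OF this b', of "n w"] show ?thesis using True by (simp add: P_def)
  next
    case False
    then have "finite_place w" "\<alpha> w \<in> local_ring \<V> w"
      using insert.prems(1)[of w] insert.prems(2)[of w] by (auto simp: local_ring_at_def)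
    from vanishing_finite_place[OF this b', of "n w"] show ?thesis using False by (simp add: P_def)
  qed
  then show ?case unfolding eq motivic_iff using b' A_closed(1) decaying_restrict by auto
qed

end

theorem theorem4p4:
  fixes Fr k :: "'c::field set"
    and vinf :: "'c \<Rightarrow> int"
    and absv :: "'c \<Rightarrow> real"
    and unif pistar :: 'c
    and br :: "'c set \<Rightarrow> 'c"
    and b :: "'c set \<Rightarrow> 'c"
    and W :: "('c \<Rightarrow> int) set"
    and n :: "('c \<Rightarrow> int) \<Rightarrow> nat"
    and \<alpha> :: "('c \<Rightarrow> int) \<Rightarrow> 'c"
  assumes "goss_setting Fr k vinf absv unif pistar br"
    and "goss_data.motivic Fr k vinf absv pistar br b"
    and "finite W"
    and "\<And>w. w \<in> W \<Longrightarrow>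
      goss_data.finite_place Fr k vinf pistar br w \<or>
      goss_data.canonical_place Fr k vinf absv pistar br w"
    and "\<And>w. w \<in> W \<Longrightarrow> 0 < n w"
    and "\<And>w. w \<in> W \<Longrightarrow> \<alpha> w \<in> goss_data.local_ring_at Fr k vinf absv pistar br w"
  shows "goss_data.motivic Fr k vinf absv pistar br
    (goss_data.partial_series Fr k vinf absv pistar br W n \<alpha> b)"
  using goss_setting.motivic_partial_series[OF assms(1,3,4,6,2)] .

end
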